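(* Let $z_1<\dots<z_p$ be real numbers, $p\ge2$, and $\alpha_1,\dots,\alpha_p,\gamma$ complex numbers with positive real parts. Then, with the rows and columns indexed by $\mathcal Z_n^{p-1}$ in the same order, $$\det\Big[\int_{\mathbb U_{\mathbf l}}\Phi(t,z)\,\omega_{\mathbf m}(t,z)\Big]_{\mathbf l,\mathbf m\in\mathcal Z_n^{p-1}} =\prod_{s=0}^{n-1}\Big[\frac{\Gamma((s+1)\gamma)^{p-1}}{\Gamma(\gamma)^{p-1}}\frac{\Gamma(1+\alpha_p+s\gamma)\prod_{j=1}^{p-1}\Gamma(\alpha_j+s\gamma)}{\Gamma(1+\sum_{j=1}^p\alpha_j+(2n-2-s)\gamma)}\Big]^{\binom{p+n-s-3}{p-2}}$$ $$\times\exp\Big(i\pi\binom{p+n-2}{p-1}\sum_{s=1}^p(s-1)\alpha_s\Big)\prod_{1\le a<b\le p}(z_b-z_a)^{(\alpha_a+\alpha_b)\binom{p+n-2}{p-1}+2\gamma\binom{p+n-2}{p}}.$$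
   Context: For $t\in\mathbb R^n$, $$\Phi(t,z)=\prod_{s=1}^p\prod_{i=1}^n(t_i-z_s)^{\alpha_s}\prod_{1\le i<j\le n}(t_j-t_i)^{2\gamma},$$ where every power $x^{\alpha_s}$ and $x^{2\gamma}$ uses the branch with $-\pi/2<\arg x<3\pi/2$. $\mathcal Z_n^p=\{\mathbf l=(l_1,\dots,l_p)\in\mathbb Z^p: l_i\ge0,\ l_1+\dots+l_p=n\}$. Set $\mathbf l^s=l_1+\dots+l_s$ and $\mathbf l^0=0$, and $\Gamma_{\mathbf m,s}=\{\mathbf m^{s-1}+1,\dots,\mathbf m^s\}$. For $\mathbf m\in\mathcal Z_n^p$, $$\omega_{\mathbf m}=\Big(\sum_{\sigma\in S_n}\prod_{s=1}^p\frac{1}{m_s!}\prod_{j\in\Gamma_{\mathbf m,s}}\frac{1}{t_{\sigma_j}-z_s}\Big)dt_1\wedge\dots\wedge dt_n,$$ and $\mathbf m\in\mathcal Z_n^{p-1}$ is identified with $(\mathbf m,0)\in\mathcal Z_n^p$. For $\mathbf l\in\mathcal Z_n^{p-1}$, $$\mathbb U_{\mathbf l}=\{t\in\mathbb R^n: z_s\le t_{\mathbf l^{s-1}+1}\le\dots\le t_{\mathbf l^s}\le z_{s+1}\text{ for }s=1,\dots,p-1\},$$ with the standard orientation of $\mathbb R^n$. *)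

theory Defs
  imports "HOL-Analysis.Analysis"
begin

text \<open>Branch of the logarithm with argument in the open interval (-pi/2, 3pi/2).\<close>
definition br_log :: "complex \<Rightarrow> complex" where
  "br_log x = (if Im (Ln x) \<le> - pi / 2 then Ln x + 2 * pi * \<i> else Ln x)"

text \<open>Power x^a using that branch (value at x = 0 irrelevant; set to 0).\<close>
definition br_pow :: "complex \<Rightarrow> complex \<Rightarrow> complex" where
  "br_pow x a = (if x = 0 then 0 else exp (a * br_log x))"

definition Zset :: "nat \<Rightarrow> nat \<Rightarrow> (nat \<Rightarrow> nat) set" where
  "Zset n k = {l. (\<forall>i. i \<notin> {1..k} \<longrightarrow> l i = 0) \<and> (\<Sum>i=1..k. l i) = n}"

definition psum :: "(nat \<Rightarrow> nat) \<Rightarrow> nat \<Rightarrow> nat" where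
  "psum l s = (\<Sum>i=1..s. l i)"

definition Gam :: "(nat \<Rightarrow> nat) \<Rightarrow> nat \<Rightarrow> nat set" where
  "Gam m s = {psum m (s - 1) + 1 .. psum m s}"

definition Phi :: "nat \<Rightarrow> nat \<Rightarrow> (nat \<Rightarrow> real) \<Rightarrow> (nat \<Rightarrow> complex) \<Rightarrow> complex
    \<Rightarrow> (nat \<Rightarrow> real) \<Rightarrow> complex" where
  "Phi n p z \<alpha> \<gamma> t =
     (\<Prod>s=1..p. \<Prod>i=1..n. br_pow (complex_of_real (t i - z s)) (\<alpha> s)) *
     (\<Prod>i=1..n. \<Prod>j\<in>{i<..n}. br_pow (complex_of_real (t j - t i)) (2 * \<gamma>))"

text \<open>Coefficient of omega_m with respect to dt_1 \<and> ... \<and> dt_n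
  (m in Z_n^{p-1} is identified with (m,0) in Z_n^p).\<close>
definition omega :: "nat \<Rightarrow> nat \<Rightarrow> (nat \<Rightarrow> real) \<Rightarrow> (nat \<Rightarrow> nat) \<Rightarrow> (nat \<Rightarrow> real) \<Rightarrow> complex" where
  "omega n p z m t =
     (\<Sum>\<sigma> | \<sigma> permutes {1..n}.
        \<Prod>s=1..p. (1 / of_nat (fact (m s))) *
          (\<Prod>j\<in>Gam m s. 1 / complex_of_real (t (\<sigma> j) - z s)))"

definition Uset :: "nat \<Rightarrow> nat \<Rightarrow> (nat \<Rightarrow> real) \<Rightarrow> (nat \<Rightarrow> nat) \<Rightarrow> (nat \<Rightarrow> real) set" where
  "Uset n p z l = {t. \<forall>s\<in>{1..p-1}.
      (\<forall>j\<in>Gam l s. z s \<le> t j \<and> t j \<le> z (s + 1)) \<and>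
      (\<forall>j\<in>{psum l (s - 1) + 1 ..< psum l s}. t j \<le> t (j + 1))}"

abbreviation Rn :: "nat \<Rightarrow> (nat \<Rightarrow> real) measure" where
  "Rn n \<equiv> PiM {1..n} (\<lambda>_. lborel)"

text \<open>Determinant of a square matrix indexed by a finite set S (Leibniz formula);
  independent of the chosen ordering of S.\<close>
definition det_on :: "'i set \<Rightarrow> ('i \<Rightarrow> 'i \<Rightarrow> 'a::comm_ring_1) \<Rightarrow> 'a" where
  "det_on S M = (\<Sum>\<pi> | \<pi> permutes S. of_int (sign \<pi>) * (\<Prod>i\<in>S. M i (\<pi> i)))"

end

theory Submission
  imports Defs "HOL-Real_Asymp.Real_Asymp" "HOL-Library.Function_Algebras"
begin

text \<open>On \<open>\<U>\<^sub>l\<close> the phase of \<open>\<Phi>\<close> is constant, so each row reduces to an integral of the weight \<open>\<Psi>\<close> built from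
  powers of absolute values. Put \<open>c\<^sub>s = z\<^sub>p - z\<^sub>s\<close>, \<open>f\<^sub>s = 1 / (t - z\<^sub>s)\<close>, \<open>g\<^sub>s = c\<^sub>s f\<^sub>s\<close> and
  \<open>h\<^sub>s = (z\<^sub>p - t) f\<^sub>s = g\<^sub>s - 1\<close>. Replacing \<open>\<alpha>\<^sub>p\<close> by \<open>\<alpha>\<^sub>p + 1\<close> replaces symmetric products of the \<open>f\<^sub>s\<close> by symmetric
  products of the \<open>h\<^sub>s\<close>. With \<open>u\<^sub>s = g\<^sub>s - g\<^sub>1 = h\<^sub>s - h\<^sub>1\<close>, the products of \<open>h\<^sub>1\<close> and the \<open>u\<^sub>s\<close> are expressed through
  products of \<open>g\<^sub>1\<close> and the \<open>u\<^sub>s\<close> by the integration by parts that comes from differentiating \<open>(t\<^sub>i - z\<^sub>p) \<Psi>\<close>, and the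
  transition matrix is triangular in the number of factors with index 1. This gives the determinant for \<open>\<alpha>\<^sub>p + 1\<close> as an
  explicit multiple of the determinant for \<open>\<alpha>\<^sub>p\<close>.

  Iterating \<open>K\<close> times and letting \<open>K\<close> tend to infinity, the substitution \<open>t\<^sub>i = z\<^sub>s + c\<^sub>s y\<^sub>i / K\<close> makes the rescaled matrix
  converge to a diagonal one, whose entries are products of Laguerre limits \<open>L\<^sub>n(a)\<close> of Selberg's integral
  \<open>S\<^sub>n(a, b)\<close>. The case of two points expresses \<open>S\<^sub>n(a, b)\<close> through \<open>L\<^sub>n(a)\<close>; its symmetry in \<open>a\<close> and \<open>b\<close> determines
  the dependence of \<open>L\<^sub>n(a)\<close> on \<open>a\<close>, and the translation \<open>y\<^sub>i = y\<^sub>1 + w\<^sub>i\<close> yields \<open>L\<^sub>n(1) = L\<^sub>n\<^sub>-\<^sub>1(1 + 2\<gamma>) / n\<close>, which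
  fixes the constant by induction on \<open>n\<close>.\<close>

section \<open>Determinants indexed by a finite set\<close>

lemma det_on_cong:
  assumes "\<And>i j. i \<in> S \<Longrightarrow> j \<in> S \<Longrightarrow> M i j = N i j"
  shows "det_on S M = det_on S N"
  unfolding det_on_def
proof (intro sum.cong refl)
  fix \<pi> assume "\<pi> \<in> {\<pi>. \<pi> permutes S}"
  then have "(\<Prod>i\<in>S. M i (\<pi> i)) = (\<Prod>i\<in>S. N i (\<pi> i))"
    by (intro prod.cong refl assms) (auto simp: permutes_in_image)
  then show "of_int (sign \<pi>) * (\<Prod>i\<in>S. M i (\<pi> i)) = of_int (sign \<pi>) * (\<Prod>i\<in>S. N i (\<pi> i))" by simp
qed

lemma det_on_scale:
  "det_on S (\<lambda>i j. r i * M i j * c j) = (\<Prod>i\<in>S. r i) * (\<Prod>i\<in>S. c i) * det_on S M"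
proof -
  have "(\<Prod>i\<in>S. c (\<pi> i)) = (\<Prod>i\<in>S. c i)" if "\<pi> permutes S" for \<pi>
    using prod.permute[OF that, of c] by (simp add: o_def)
  then show ?thesis unfolding det_on_def
    by (simp add: prod.distrib sum_distrib_left mult_ac)
qed

lemma det_on_permute_rows:
  assumes "finite S" "\<tau> permutes S"
  shows "det_on S (\<lambda>i j. M (\<tau> i) j) = of_int (sign \<tau>) * det_on S M"
proof -
  have "det_on S (\<lambda>i j. M (\<tau> i) j)
      = (\<Sum>\<pi> | \<pi> permutes S. of_int (sign (\<pi> \<circ> \<tau>)) * (\<Prod>i\<in>S. M (\<tau> i) ((\<pi> \<circ> \<tau>) i)))"
    unfolding det_on_def by (rule sum_permutations_compose_right[OF assms(2)])
  also have "\<dots> = (\<Sum>\<pi> | \<pi> permutes S. of_int (sign \<tau>) * (of_int (sign \<pi>) * (\<Prod>i\<in>S. M i (\<pi> i))))"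
  proof (intro sum.cong refl)
    fix \<pi> assume "\<pi> \<in> {\<pi>. \<pi> permutes S}"
    then have pi_permutes: "\<pi> permutes S" by simp
    have "(\<Prod>i\<in>S. M (\<tau> i) ((\<pi> \<circ> \<tau>) i)) = (\<Prod>i\<in>S. M i (\<pi> i))"
      using prod.permute[OF assms(2), of "\<lambda>i. M i (\<pi> i)"] by (simp add: o_def)
    moreover have "sign (\<pi> \<circ> \<tau>) = sign \<pi> * sign \<tau>"
      using assms pi_permutes by (intro sign_compose permutes_imp_permutation) auto
    ultimately show "of_int (sign (\<pi> \<circ> \<tau>)) * (\<Prod>i\<in>S. M (\<tau> i) ((\<pi> \<circ> \<tau>) i))
        = of_int (sign \<tau>) * (of_int (sign \<pi>) * (\<Prod>i\<in>S. M i (\<pi> i)))" by simp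
  qed
  finally show ?thesis by (simp add: det_on_def sum_distrib_left)
qed

lemma det_on_equal_rows:
  fixes M :: "'i \<Rightarrow> 'i \<Rightarrow> 'a :: {idom, ring_char_0}"
  assumes "finite S" "a \<in> S" "b \<in> S" "a \<noteq> b" "\<And>j. j \<in> S \<Longrightarrow> M a j = M b j"
  shows "det_on S M = 0"
proof -
  let ?\<tau> = "Transposition.transpose a b"
  have tau_permutes: "?\<tau> permutes S" using assms by (simp add: permutes_swap_id)
  have "det_on S M = det_on S (\<lambda>i j. M (?\<tau> i) j)"
    by (rule det_on_cong) (auto simp: Transposition.transpose_def assms(5))
  also have "\<dots> = - det_on S M"
    using det_on_permute_rows[OF assms(1) tau_permutes, of M] assms(4) by (simp add: sign_swap_id)
  finally have "det_on S M + det_on S M = 0" by (metis add.right_inverse)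
  then have "2 * det_on S M = 0" unfolding mult_2 .
  then show ?thesis by simp
qed

lemma det_on_mult_eq_sum_PiE:
  assumes finite_S: "finite S"
  shows "det_on S (\<lambda>i j. \<Sum>k\<in>S. A i k * B k j)
    = (\<Sum>f\<in>PiE S (\<lambda>_. S). (\<Prod>i\<in>S. A i (f i)) * det_on S (\<lambda>i j. B (f i) j))"
proof -
  have "det_on S (\<lambda>i j. \<Sum>k\<in>S. A i k * B k j)
     = (\<Sum>\<pi> | \<pi> permutes S. of_int (sign \<pi>) * (\<Sum>f\<in>PiE S (\<lambda>_. S). \<Prod>i\<in>S. A i (f i) * B (f i) (\<pi> i)))"
    unfolding det_on_def by (simp add: prod_sum_PiE finite_S)
  then show ?thesis
    unfolding det_on_def sum_distrib_left by (subst (asm) sum.swap) (simp add: prod.distrib mult_ac)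
qed

lemma sum_PiE_inj_eq_sum_permutes:
  assumes finite_S: "finite S"
  shows "(\<Sum>f | f \<in> PiE S (\<lambda>_. S) \<and> inj_on f S. g f) = (\<Sum>\<pi> | \<pi> permutes S. g (restrict \<pi> S))"
proof (rule sum.reindex_bij_witness[where i="\<lambda>\<pi>. restrict \<pi> S" and j="\<lambda>f x. if x \<in> S then f x else x"])
  fix f assume f_inj: "f \<in> {f. f \<in> PiE S (\<lambda>_. S) \<and> inj_on f S}"
  show "restrict (\<lambda>x. if x \<in> S then f x else x) S = f"
    using f_inj by (auto simp: PiE_def extensional_def fun_eq_iff)
  then show "g (restrict (\<lambda>x. if x \<in> S then f x else x) S) = g f" by simp
  have "bij_betw f S S" using f_inj endo_inj_surj[OF finite_S, of f] by (auto simp: bij_betw_def)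
  then have "bij_betw (\<lambda>x. if x \<in> S then f x else x) S S" by (subst bij_betw_cong[where g=f]) auto
  then show "(\<lambda>x. if x \<in> S then f x else x) \<in> {\<pi>. \<pi> permutes S}" by (auto intro!: bij_imp_permutes)
next
  fix \<pi> assume "\<pi> \<in> {\<pi>. \<pi> permutes S}"
  then have pi_permutes: "\<pi> permutes S" by simp
  show "(\<lambda>x. if x \<in> S then restrict \<pi> S x else x) = \<pi>"
    using pi_permutes by (auto simp: fun_eq_iff permutes_def)
  show "restrict \<pi> S \<in> {f. f \<in> PiE S (\<lambda>_. S) \<and> inj_on f S}"
    using pi_permutes by (auto simp: permutes_in_image permutes_inj_on inj_on_restrict_eq)
qed

lemma det_on_mult:
  fixes A B :: "'i \<Rightarrow> 'i \<Rightarrow> 'a :: {idom, ring_char_0}"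
  assumes finite_S: "finite S"
  shows "det_on S (\<lambda>i j. \<Sum>k\<in>S. A i k * B k j) = det_on S A * det_on S B"
proof -
  define g where "g f = (\<Prod>i\<in>S. A i (f i)) * det_on S (\<lambda>i j. B (f i) j)" for f
  have g_restrict: "g (restrict \<pi> S) = g \<pi>" for \<pi>
    unfolding g_def by (intro arg_cong2[of _ _ _ _ "(*)"] det_on_cong prod.cong) auto
  have "det_on S (\<lambda>i j. \<Sum>k\<in>S. A i k * B k j) = (\<Sum>f\<in>PiE S (\<lambda>_. S). g f)"
    unfolding g_def by (rule det_on_mult_eq_sum_PiE[OF finite_S])
  also have "\<dots> = (\<Sum>f | f \<in> PiE S (\<lambda>_. S) \<and> inj_on f S. g f)"
  proof (rule sum.mono_neutral_right)
    show "\<forall>f\<in>PiE S (\<lambda>_. S) - {f. f \<in> PiE S (\<lambda>_. S) \<and> inj_on f S}. g f = 0"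
    proof
      fix f assume "f \<in> PiE S (\<lambda>_. S) - {f. f \<in> PiE S (\<lambda>_. S) \<and> inj_on f S}"
      then obtain a b where "a \<in> S" "b \<in> S" "a \<noteq> b" "f a = f b" by (auto simp: inj_on_def)
      then have "det_on S (\<lambda>i j. B (f i) j) = 0"
        by (intro det_on_equal_rows[OF finite_S, of a b]) auto
      then show "g f = 0" by (simp add: g_def)
    qed
  qed (auto simp: finite_S finite_PiE)
  also have "\<dots> = (\<Sum>\<pi> | \<pi> permutes S. g \<pi>)"
    by (simp add: sum_PiE_inj_eq_sum_permutes[OF finite_S] g_restrict)
  also have "\<dots> = (\<Sum>\<pi> | \<pi> permutes S. (\<Prod>i\<in>S. A i (\<pi> i)) * (of_int (sign \<pi>) * det_on S B))"
    unfolding g_def by (intro sum.cong refl) (simp add: det_on_permute_rows[OF finite_S])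
  also have "\<dots> = det_on S A * det_on S B"
    by (simp add: det_on_def[of S A] sum_distrib_left mult_ac)
  finally show ?thesis .
qed

lemma det_on_triangular:
  fixes rank :: "'i \<Rightarrow> nat"
  assumes finite_S: "finite S"
    and triangular: "\<And>i j. i \<in> S \<Longrightarrow> j \<in> S \<Longrightarrow> i \<noteq> j \<Longrightarrow> \<not> rank i < rank j \<Longrightarrow> M i j = 0"
  shows "det_on S M = (\<Prod>i\<in>S. M i i)"
proof -
  have vanish: "(\<Prod>i\<in>S. M i (\<pi> i)) = 0" if pi_permutes: "\<pi> permutes S" and "\<pi> \<noteq> id" for \<pi>
  proof (rule ccontr)
    assume nonzero: "(\<Prod>i\<in>S. M i (\<pi> i)) \<noteq> 0"
    have "rank i < rank (\<pi> i)" if "i \<in> S" "\<pi> i \<noteq> i" for i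
    proof -
      have "M i (\<pi> i) \<noteq> 0" using nonzero prod_zero[OF finite_S, of "\<lambda>i. M i (\<pi> i)"] that(1) by metis
      then show ?thesis using triangular[of i "\<pi> i"] that pi_permutes by (auto simp: permutes_in_image)
    qed
    moreover obtain a where "\<pi> a \<noteq> a" "a \<in> S"
      using \<open>\<pi> \<noteq> id\<close> pi_permutes by (metis eq_id_iff permutes_not_in)
    ultimately have "(\<Sum>i\<in>S. rank i) < (\<Sum>i\<in>S. rank (\<pi> i))"
      using finite_S by (intro sum_strict_mono_ex1) (auto, metis le_less)
    also have "(\<Sum>i\<in>S. rank (\<pi> i)) = (\<Sum>i\<in>S. rank i)"
      using sum.permute[OF pi_permutes, of rank] by (simp add: o_def)
    finally show False by simp
  qed
  have "det_on S M = (\<Sum>\<pi>\<in>{id}. of_int (sign \<pi>) * (\<Prod>i\<in>S. M i (\<pi> i)))"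
    unfolding det_on_def
    using vanish by (intro sum.mono_neutral_right) (auto simp: finite_S permutes_id finite_permutations)
  then show ?thesis by (simp add: sign_id)
qed

lemma det_on_diagonal:
  assumes "finite S"
  shows "det_on S (\<lambda>i j. if j = i then d i else 0) = (\<Prod>i\<in>S. d i)"
  using assms by (subst det_on_triangular[where rank="\<lambda>_. 0"]) auto

definition cscale :: "complex \<Rightarrow> ('r \<Rightarrow> complex) \<Rightarrow> 'r \<Rightarrow> complex" (infixr "*\<^sub>C" 75) where
  "c *\<^sub>C f = (\<lambda>x. c * f x)"

lemma cscale_apply: "(c *\<^sub>C f) x = c * f x"
  by (simp add: cscale_def)

lemma sum_fun_apply: "(\<Sum>i\<in>I. f i) x = (\<Sum>i\<in>I. f i x)"
  by (induction I rule: infinite_finite_induct) auto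

interpretation cfun: vector_space cscale
  by standard (auto simp: cscale_def fun_eq_iff algebra_simps)

lemma cfun_span_image_explicit:
  assumes "u \<in> cfun.span (v ` I)" "finite I"
  obtains c where "u = (\<Sum>i\<in>I. c i *\<^sub>C v i)"
proof -
  have "\<exists>c. u = (\<Sum>i\<in>I. c i *\<^sub>C v i)"
    using assms(1)
  proof (induction rule: cfun.span_induct_alt)
    case base
    show ?case by (rule exI[of _ "\<lambda>_. 0"]) simp
  next
    case (step a x y)
    then obtain j c where "j \<in> I" "x = v j" "y = (\<Sum>i\<in>I. c i *\<^sub>C v i)" by blast
    moreover have "(\<Sum>i\<in>I. (if i = j then a else 0) *\<^sub>C v i) = a *\<^sub>C v j"
      using \<open>j \<in> I\<close> assms(2) by (subst sum.remove[of _ j]) (auto intro: sum.neutral)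
    ultimately show ?case
      by (intro exI[of _ "\<lambda>i. (if i = j then a else 0) + c i"])
        (simp only: cfun.scale_left_distrib sum.distrib)
  qed
  then show ?thesis using that by blast
qed

lemma det_on_triangular_change_of_columns:
  fixes rank :: "'i \<Rightarrow> nat" and v v' :: "'i \<Rightarrow> 'i \<Rightarrow> complex"
  assumes finite_S: "finite S"
    and span: "\<And>m. m \<in> S \<Longrightarrow> v' m - d m *\<^sub>C v m \<in> cfun.span (v ` {m'\<in>S. rank m' < rank m})"
  shows "det_on S (\<lambda>l m. v' m l) = (\<Prod>m\<in>S. d m) * det_on S (\<lambda>l m. v m l)"
proof -
  have "\<exists>c. v' m - d m *\<^sub>C v m = (\<Sum>m'\<in>{m'\<in>S. rank m' < rank m}. c m' *\<^sub>C v m')" if "m \<in> S" for m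
    by (rule cfun_span_image_explicit[OF span[OF that]]) (use finite_S in auto)
  then obtain c where c: "\<And>m. m \<in> S \<Longrightarrow>
      v' m - d m *\<^sub>C v m = (\<Sum>m'\<in>{m'\<in>S. rank m' < rank m}. c m m' *\<^sub>C v m')"
    by metis
  define L where "L m' m = (if m' = m then d m else if rank m' < rank m then c m m' else 0)" for m' m
  have "v' m l = (\<Sum>m'\<in>S. v m' l * L m' m)" if "m \<in> S" for m l
  proof -
    have "(\<Sum>m'\<in>S. v m' l * L m' m) = v m l * L m m + (\<Sum>m'\<in>S - {m}. v m' l * L m' m)"
      using finite_S that by (simp add: sum.remove)
    also have "(\<Sum>m'\<in>S - {m}. v m' l * L m' m) = (\<Sum>m'\<in>{m'\<in>S. rank m' < rank m}. c m m' * v m' l)"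
      using finite_S by (intro sum.mono_neutral_cong_right) (auto simp: L_def)
    also have "\<dots> = v' m l - d m * v m l"
      using fun_cong[OF c[OF that], of l] by (simp add: sum_fun_apply cscale_apply)
    finally show ?thesis by (simp add: L_def[of m m] algebra_simps)
  qed
  then have "det_on S (\<lambda>l m. v' m l) = det_on S (\<lambda>l m. \<Sum>m'\<in>S. v m' l * L m' m)"
    by (intro det_on_cong) auto
  also have "\<dots> = det_on S (\<lambda>l m. v m l) * det_on S L"
    by (rule det_on_mult[OF finite_S])
  also have "det_on S L = (\<Prod>m\<in>S. L m m)"
    using finite_S by (rule det_on_triangular[where rank=rank]) (auto simp: L_def)
  finally show ?thesis by (simp add: L_def)
qed

lemma tendsto_det_on:
  fixes M :: "'k \<Rightarrow> 'i \<Rightarrow> 'i \<Rightarrow> 'a :: {comm_ring_1, real_normed_algebra_1}"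
  assumes "\<And>i j. i \<in> S \<Longrightarrow> j \<in> S \<Longrightarrow> ((\<lambda>k. M k i j) \<longlongrightarrow> N i j) F"
  shows "((\<lambda>k. det_on S (M k)) \<longlongrightarrow> det_on S N) F"
  unfolding det_on_def
  by (intro tendsto_sum tendsto_mult tendsto_const tendsto_prod assms) (auto simp: permutes_in_image)

section \<open>Permutations and pairs of indices\<close>

lemma permutes_restrict_id_fibre:
  assumes "finite A" "\<sigma> permutes A" "\<And>x. x \<in> A \<Longrightarrow> f (\<sigma> x) = f x"
  shows "restrict_id \<sigma> {x\<in>A. f x = v} permutes {x\<in>A. f x = v}"
proof (rule permutes_restrict_id)
  have "\<sigma> ` {x\<in>A. f x = v} \<subseteq> {x\<in>A. f x = v}" using assms(2,3) by (auto simp: permutes_in_image)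
  moreover have "inj_on \<sigma> {x\<in>A. f x = v}" using assms(2) by (rule permutes_inj_on)
  ultimately show "bij_betw \<sigma> {x\<in>A. f x = v} {x\<in>A. f x = v}"
    using endo_inj_surj[of "{x\<in>A. f x = v}" \<sigma>] assms(1) by (simp add: bij_betw_def)
qed

lemma permutes_glue_fibres:
  assumes "finite A" "\<And>x. x \<in> A \<Longrightarrow> \<tau> (f x) permutes {y\<in>A. f y = f x}"
  shows "(\<lambda>x. if x \<in> A then \<tau> (f x) x else x) permutes A"
    and "\<And>x. x \<in> A \<Longrightarrow> \<tau> (f x) x \<in> A \<and> f (\<tau> (f x) x) = f x"
proof -
  show in_fibre: "\<tau> (f x) x \<in> A \<and> f (\<tau> (f x) x) = f x" if "x \<in> A" for x
    using permutes_in_image[OF assms(2)[OF that], of x] that by simp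
  let ?g = "\<lambda>x. if x \<in> A then \<tau> (f x) x else x"
  have "inj_on ?g A"
  proof (rule inj_onI)
    fix x y assume xy: "x \<in> A" "y \<in> A" and "?g x = ?g y"
    then have glued_eq: "\<tau> (f x) x = \<tau> (f y) y" by simp
    then have "f x = f y" using in_fibre[OF xy(1)] in_fibre[OF xy(2)] by metis
    then show "x = y" using glued_eq permutes_inj[OF assms(2)[OF xy(1)]] by (simp add: inj_eq)
  qed
  moreover have "?g ` A \<subseteq> A" using in_fibre by auto
  ultimately show "?g permutes A"
    using endo_inj_surj[OF assms(1), of ?g] by (intro bij_imp_permutes) (auto simp: bij_betw_def)
qed

lemma card_permutes_preserving:
  assumes finite_A: "finite A" and finite_V_image: "finite V" "f ` A \<subseteq> V"
  shows "card {\<sigma>. \<sigma> permutes A \<and> (\<forall>x\<in>A. f (\<sigma> x) = f x)} = (\<Prod>v\<in>V. fact (card {x\<in>A. f x = v}))"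
proof -
  let ?F = "\<lambda>v. {x\<in>A. f x = v}"
  have "bij_betw (\<lambda>\<sigma>. \<lambda>v\<in>V. restrict_id \<sigma> (?F v)) {\<sigma>. \<sigma> permutes A \<and> (\<forall>x\<in>A. f (\<sigma> x) = f x)}
      (\<Pi>\<^sub>E v\<in>V. {\<tau>. \<tau> permutes ?F v})" (is "bij_betw ?to ?L ?R")
  proof (rule bij_betw_byWitness[where f'="\<lambda>\<tau> x. if x \<in> A then \<tau> (f x) x else x"])
    show "\<forall>\<sigma>\<in>?L. (\<lambda>x. if x \<in> A then ?to \<sigma> (f x) x else x) = \<sigma>"
      using finite_V_image(2) by (auto simp: fun_eq_iff permutes_def)
    show "?to ` ?L \<subseteq> ?R"
      using permutes_restrict_id_fibre[OF finite_A, of _ f] by auto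
    have tau_permutes: "\<tau> (f x) permutes ?F (f x)" if "\<tau> \<in> ?R" "x \<in> A" for \<tau> x
      using PiE_mem[OF that(1), of "f x"] finite_V_image(2) that(2) by auto
    show "(\<lambda>\<tau> x. if x \<in> A then \<tau> (f x) x else x) ` ?R \<subseteq> ?L"
      using permutes_glue_fibres[OF finite_A, of _ f] tau_permutes by auto
    show "\<forall>\<tau>\<in>?R. ?to (\<lambda>x. if x \<in> A then \<tau> (f x) x else x) = \<tau>"
    proof (intro ballI ext)
      fix \<tau> v x assume \<tau>R: "\<tau> \<in> ?R"
      show "?to (\<lambda>x. if x \<in> A then \<tau> (f x) x else x) v x = \<tau> v x"
      proof (cases "v \<in> V")
        case True
        then have "\<tau> v permutes ?F v" using PiE_mem[OF \<tau>R] by auto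
        then show ?thesis using True by (auto simp: restrict_id_def permutes_not_in)
      qed (use PiE_arb[OF \<tau>R] in simp)
    qed
  qed
  then have "card ?L = card ?R" by (rule bij_betw_same_card)
  also have "\<dots> = (\<Prod>v\<in>V. fact (card (?F v)))"
    using finite_A by (simp add: card_PiE[OF finite_V_image(1)] card_permutations)
  finally show ?thesis .
qed

definition less_pairs :: "'a :: linorder set \<Rightarrow> ('a \<times> 'a) set" where
  "less_pairs A = {(i, j). i \<in> A \<and> j \<in> A \<and> i < j}"

lemma finite_less_pairs [simp]: "finite A \<Longrightarrow> finite (less_pairs A)"
  by (rule finite_subset[of _ "A \<times> A"]) (auto simp: less_pairs_def)

lemma prod_less_pairs_nat:
  "(\<Prod>(i, j)\<in>less_pairs {1..n}. f i j) = (\<Prod>i=1..n. \<Prod>j\<in>{i<..n::nat}. f i j)"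
  "(\<Prod>(i, j)\<in>less_pairs {1..n}. f i j) = (\<Prod>j=1..n. \<Prod>i=1..<j. f i j)"
proof -
  have "less_pairs {1..n} = (SIGMA i:{1..n}. {i<..n})" by (auto simp: less_pairs_def)
  then show "(\<Prod>(i, j)\<in>less_pairs {1..n}. f i j) = (\<Prod>i=1..n. \<Prod>j\<in>{i<..n}. f i j)"
    by (simp add: prod.Sigma)
  have "(\<Prod>(i, j)\<in>less_pairs {1..n}. f i j) = (\<Prod>(j, i)\<in>(SIGMA j:{1..n}. {1..<j}). f i j)"
    by (rule prod.reindex_bij_witness[where i=prod.swap and j=prod.swap]) (auto simp: less_pairs_def)
  then show "(\<Prod>(i, j)\<in>less_pairs {1..n}. f i j) = (\<Prod>j=1..n. \<Prod>i=1..<j. f i j)"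
    by (simp add: prod.Sigma)
qed

lemma less_pairs_insert_image:
  "i \<notin> A \<Longrightarrow> less_pairs (insert i A) = less_pairs A \<union> (\<lambda>j. (min i j, max i j)) ` A"
  by (auto simp: less_pairs_def min_def max_def image_iff split: if_splits) (metis leD less_le_not_le neqE)+

lemma prod_less_pairs_insert:
  assumes "finite A" "i \<notin> A" and sym: "\<And>j. j \<in> A \<Longrightarrow> g (j, i) = g (i, j)"
  shows "(\<Prod>x\<in>less_pairs (insert i A). g x) = (\<Prod>j\<in>A. g (i, j)) * (\<Prod>x\<in>less_pairs A. g x)"
proof -
  let ?p = "\<lambda>j. (min i j, max i j)"
  have "inj_on ?p A" using assms(2) by (auto simp: inj_on_def min_def max_def split: if_splits)
  moreover have "g (?p j) = g (i, j)" if "j \<in> A" for j using sym[OF that] by (simp add: min_def max_def)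
  ultimately have "(\<Prod>x\<in>?p ` A. g x) = (\<Prod>j\<in>A. g (i, j))" by (simp add: prod.reindex)
  moreover have "less_pairs A \<inter> ?p ` A = {}" using assms(2)
    by (auto simp: less_pairs_def min_def max_def split: if_splits)
  ultimately show ?thesis
    unfolding less_pairs_insert_image[OF assms(2)] using assms(1)
    by (simp add: prod.union_disjoint mult.commute)
qed

lemma card_less_pairs: "finite A \<Longrightarrow> card (less_pairs A) = card A choose 2"
proof (induction A rule: finite_induct)
  case (insert i A)
  have "inj_on (\<lambda>j. (min i j, max i j)) A"
    using insert.hyps(2) by (auto simp: inj_on_def min_def max_def split: if_splits)
  moreover have "less_pairs A \<inter> (\<lambda>j. (min i j, max i j)) ` A = {}"
    using insert.hyps(2) by (auto simp: less_pairs_def min_def max_def split: if_splits)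
  ultimately have "card (less_pairs (insert i A)) = card (less_pairs A) + card A"
    unfolding less_pairs_insert_image[OF insert.hyps(2)] using insert.hyps(1)
    by (simp add: card_Un_disjoint card_image)
  then show ?case using insert by (simp add: numeral_2_eq_2)
qed (simp add: less_pairs_def)

lemma prod_less_pairs_reindex:
  fixes f :: "'a :: linorder \<Rightarrow> 'b :: linorder"
  assumes f_bij: "bij_betw f A B" and sym: "\<And>i j. g i j = g j i"
  shows "(\<Prod>(i, j)\<in>less_pairs A. g (f i) (f j)) = (\<Prod>(i, j)\<in>less_pairs B. g i j)"
proof -
  let ?f = "\<lambda>(i, j). (min (f i) (f j), max (f i) (f j))"
  let ?h = "\<lambda>(i, j). (min (inv_into A f i) (inv_into A f j), max (inv_into A f i) (inv_into A f j))"
  have inv: "inv_into A f (f i) = i" "f i \<in> B" if "i \<in> A" for i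
    using f_bij that by (auto simp: bij_betw_def inv_into_f_f)
  have inv': "f (inv_into A f i) = i" "inv_into A f i \<in> A" if "i \<in> B" for i
    using f_bij that by (auto simp: bij_betw_def f_inv_into_f inv_into_into)
  show ?thesis
  proof (rule prod.reindex_bij_witness[where i="?h" and j="?f"])
    fix x assume "x \<in> less_pairs A"
    then obtain i j where x: "x = (i, j)" "i \<in> A" "j \<in> A" "i < j" by (auto simp: less_pairs_def)
    then have "f i \<noteq> f j" using f_bij by (auto simp: bij_betw_def inj_on_def)
    then show "?h (?f x) = x" "?f x \<in> less_pairs B"
      "(case ?f x of (i, j) \<Rightarrow> g i j) = (case x of (i, j) \<Rightarrow> g (f i) (f j))"
      using x inv by (auto simp: less_pairs_def min_def max_def sym[of "f j"])
  next
    fix x assume "x \<in> less_pairs B"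
    then obtain i j where x: "x = (i, j)" "i \<in> B" "j \<in> B" "i < j" by (auto simp: less_pairs_def)
    then have "inv_into A f i \<noteq> inv_into A f j" using inv' by (metis less_irrefl)
    then show "?f (?h x) = x" "?h x \<in> less_pairs A"
      using x inv' by (auto simp: less_pairs_def min_def max_def)
  qed
qed

section \<open>Compositions\<close>

lemma Zset_component_le: "m \<in> Zset n q \<Longrightarrow> s \<in> {1..q} \<Longrightarrow> m s \<le> n"
  unfolding Zset_def using member_le_sum[of s "{1..q}" m] by auto

lemma Zset_outside: "m \<in> Zset n q \<Longrightarrow> s \<notin> {1..q} \<Longrightarrow> m s = 0"
  unfolding Zset_def by blast

lemma sum_Zset_eq: "m \<in> Zset n q \<Longrightarrow> (\<Sum>s=1..q. m s) = n"
  by (simp add: Zset_def)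

lemma ZsetI: "(\<And>s. s \<notin> {1..q} \<Longrightarrow> m s = 0) \<Longrightarrow> (\<Sum>s=1..q. m s) = n \<Longrightarrow> m \<in> Zset n q"
  unfolding Zset_def by blast

lemma finite_Zset [simp]: "finite (Zset n q)"
proof -
  have "Zset n q \<subseteq> {f. \<forall>x. (x \<in> {1..q} \<longrightarrow> f x \<in> {..n}) \<and> (x \<notin> {1..q} \<longrightarrow> f x = 0)}"
    using Zset_component_le Zset_outside by fastforce
  then show ?thesis
    using finite_set_of_finite_funs[of "{1..q}" "{..n}" "0::nat"]
    by (meson finite_subset finite_atLeastAtMost finite_atMost)
qed

lemma count_in_Zset:
  assumes "size M = n" "set_mset M \<subseteq> {1..q}"
  shows "count M \<in> Zset n q"
proof (rule ZsetI)
  have "(\<Sum>i=1..q. count M i) = (\<Sum>i\<in>set_mset M. count M i)"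
    using assms(2) by (intro sum.mono_neutral_right) (auto simp: count_eq_zero_iff)
  then show "(\<Sum>i=1..q. count M i) = n" using assms(1) by (simp add: size_multiset_overloaded_eq)
qed (use assms(2) in \<open>auto simp: count_eq_zero_iff\<close>)

lemma Zset_fun_upd:
  assumes "m \<in> Zset n q" "s \<in> {1..q}" "x + n = k + m s"
  shows "m(s := x) \<in> Zset k q"
proof (rule ZsetI)
  have "(\<Sum>j=1..q. (m(s := x)) j) + m s = (\<Sum>j=1..q. m j) + x"
    using assms(2) by (simp add: sum.remove[of _ s])
  then show "(\<Sum>j=1..q. (m(s := x)) j) = k" using assms(3) sum_Zset_eq[OF assms(1)] by simp
qed (use assms(2) Zset_outside[OF assms(1)] in auto)

lemma bij_betw_Zset_raise:
  assumes s_in: "s \<in> {1..q}" and i_less: "i < n"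
  shows "bij_betw (\<lambda>m. m(s := m s + Suc i)) (Zset (n - 1 - i) q) {m \<in> Zset n q. i < m s}"
proof (rule bij_betw_byWitness[where f'="\<lambda>m. m(s := m s - Suc i)"])
  show "(\<lambda>m. m(s := m s + Suc i)) ` Zset (n - 1 - i) q \<subseteq> {m \<in> Zset n q. i < m s}"
    using s_in i_less by (auto intro!: Zset_fun_upd[where n="n - 1 - i"])
  show "(\<lambda>m. m(s := m s - Suc i)) ` {m \<in> Zset n q. i < m s} \<subseteq> Zset (n - 1 - i) q"
    using s_in i_less by (auto intro!: Zset_fun_upd[where n=n])
qed (auto simp: fun_eq_iff)

lemma (in comm_monoid_set) Zset_raise:
  assumes s_in: "s \<in> {1..q}"
  shows "F (\<lambda>m. F (\<lambda>i. g i m) {..<m s}) (Zset n q)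
    = F (\<lambda>i. F (\<lambda>m. g i (m(s := m s + Suc i))) (Zset (n - 1 - i) q)) {..<n}"
proof -
  have "F (\<lambda>m. F (\<lambda>i. g i m) {..<m s}) (Zset n q) = F (\<lambda>m. F (\<lambda>i. g i m) {i \<in> {..<n}. i < m s}) (Zset n q)"
    using Zset_component_le[OF _ s_in, where n=n]
    by (intro cong refl arg_cong[of _ _ "F _"]) (auto simp: order.strict_trans2)
  also have "\<dots> = F (\<lambda>i. F (g i) {m \<in> Zset n q. i < m s}) {..<n}" by (rule swap_restrict) auto
  also have "\<dots> = F (\<lambda>i. F (\<lambda>m. g i (m(s := m s + Suc i))) (Zset (n - 1 - i) q)) {..<n}"
    by (intro cong refl reindex_bij_betw[symmetric] bij_betw_Zset_raise[OF s_in]) simp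
  finally show ?thesis .
qed

lemma card_Zset_Suc_Suc: "card (Zset (Suc n) (Suc q)) = card (Zset (Suc n) q) + card (Zset n (Suc q))"
proof -
  have "Zset (Suc n) (Suc q) = Zset (Suc n) q \<union> {m \<in> Zset (Suc n) (Suc q). 0 < m (Suc q)}"
    by (auto simp: Zset_def not_less_eq_eq le_Suc_eq)
  moreover have "Zset (Suc n) q \<inter> {m \<in> Zset (Suc n) (Suc q). 0 < m (Suc q)} = {}"
    by (auto simp: Zset_def)
  ultimately have "card (Zset (Suc n) (Suc q)) = card (Zset (Suc n) q)
      + card {m \<in> Zset (Suc n) (Suc q). 0 < m (Suc q)}"
    by (metis (no_types, lifting) card_Un_disjoint finite_Un finite_Zset)
  also have "card {m \<in> Zset (Suc n) (Suc q). 0 < m (Suc q)} = card (Zset n (Suc q))"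
    using bij_betw_same_card[OF bij_betw_Zset_raise[of "Suc q" "Suc q" 0 "Suc n"]] by simp
  finally show ?thesis .
qed

lemma Zset_0: "Zset 0 q = {\<lambda>_. 0}"
proof -
  have "m x = 0" if "m \<in> Zset 0 q" for m x
    using that Zset_component_le[OF that, of x] Zset_outside[OF that, of x] by (cases "x \<in> {1..q}") auto
  then show ?thesis by (auto simp: fun_eq_iff intro: ZsetI)
qed

lemma Zset_Suc_0: "Zset (Suc n) 0 = {}"
  by (auto simp: Zset_def)

lemma Zset_1: "Zset n 1 = {\<lambda>s. if s = 1 then n else 0}"
proof -
  have "m s = (if s = 1 then n else 0)" if "m \<in> Zset n 1" for m s
    using sum_Zset_eq[OF that] Zset_outside[OF that, of s] by auto
  moreover have "(\<lambda>s. if s = 1 then n else 0) \<in> Zset n 1" by (rule ZsetI) auto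
  ultimately show ?thesis by blast
qed

lemma card_Zset:
  assumes "q \<ge> 1"
  shows "card (Zset n q) = (n + q - 1) choose (q - 1)"
proof -
  have "card (Zset n (Suc r)) = (n + r) choose r" for r
  proof (induction r arbitrary: n)
    case 0
    show ?case by (induction n) (auto simp: card_Zset_Suc_Suc Zset_0 Zset_Suc_0)
  next
    case (Suc r)
    show ?case by (induction n) (auto simp: card_Zset_Suc_Suc[of _ "Suc r"] Zset_0 Suc)
  qed
  from this[of "q - 1"] show ?thesis using assms by simp
qed

lemma sum_choose_shift: "(\<Sum>j<n. (j + a) choose b) + (a choose Suc b) = (n + a) choose Suc b"
  by (induction n) auto

lemma sum_Zset_complement_choose:
  assumes "q \<ge> 1" "q \<le> Suc b"
  shows "(\<Sum>i<n. (n - 1 - i + q - 1) choose b) = (n + q - 1) choose Suc b"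
proof -
  have "(\<Sum>i<n. (n - 1 - i + q - 1) choose b) = (\<Sum>j<n. (j + (q - 1)) choose b)"
    using sum.nat_diff_reindex[of "\<lambda>j. (j + (q - 1)) choose b" n] assms(1) by simp
  then show ?thesis using sum_choose_shift[of "q - 1" b n] assms by (simp add: binomial_eq_0)
qed

lemma sum_Zset_component:
  assumes s_in: "s \<in> {1..q}"
  shows "(\<Sum>m\<in>Zset n q. m s) = (n + q - 1) choose q"
proof -
  have "(\<Sum>m\<in>Zset n q. m s) = (\<Sum>i<n. card (Zset (n - 1 - i) q))"
    using sum.Zset_raise[OF s_in, of "\<lambda>_ _. 1 :: nat" n] by simp
  then show ?thesis using s_in sum_Zset_complement_choose[of q "q - 1" n] by (simp add: card_Zset)
qed

lemma sum_Zset_component_mult: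
  assumes s_in: "s \<in> {1..q}" and r_in: "r \<in> {1..q}" "r \<noteq> s"
  shows "(\<Sum>m\<in>Zset n q. m r * m s) = (n + q - 1) choose Suc q"
proof -
  have "(\<Sum>m\<in>Zset n q. m r * m s) = (\<Sum>i<n. (n - 1 - i + q - 1) choose q)"
    using sum.Zset_raise[OF r_in(1), of "\<lambda>_ m. m s" n] r_in(2) by (simp add: sum_Zset_component[OF s_in])
  then show ?thesis using s_in sum_Zset_complement_choose[of q q n] by simp
qed

lemma sum_Zset_component_choose_2:
  assumes s_in: "s \<in> {1..q}"
  shows "(\<Sum>m\<in>Zset n q. m s choose 2) = (n + q - 1) choose Suc q"
proof -
  have "(k choose 2) = (\<Sum>i<k. k - Suc i)" for k
    using sum.nat_diff_reindex[of "\<lambda>j. j" k] sum_choose_shift[of 0 1 k] by (simp add: numeral_2_eq_2)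
  then have "(\<Sum>m\<in>Zset n q. m s choose 2) = (\<Sum>m\<in>Zset n q. \<Sum>i<m s. m s - Suc i)" by simp
  also have "\<dots> = (\<Sum>i<n. (n - 1 - i + q - 1) choose q)"
    unfolding sum.Zset_raise[OF s_in] by (simp add: sum_Zset_component[OF s_in])
  finally show ?thesis using s_in sum_Zset_complement_choose[of q q n] by simp
qed

lemma sum_card_Zset:
  assumes "q \<ge> 1"
  shows "(\<Sum>i<n. card (Zset (n - 1 - i) q)) = (n + q - 1) choose q"
  using assms sum_Zset_complement_choose[of q "q - 1" n] by (simp add: card_Zset)

lemma sum_card_Zset_weighted:
  assumes "q \<ge> 1"
  shows "(\<Sum>i<n. card (Zset (n - 1 - i) q) * (n - 1 - i)) = q * ((n + q - 1) choose Suc q)"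
proof -
  have "((k + q - 1) choose (q - 1)) * k = q * ((k + q - 1) choose q)" for k
    using binomial_absorb_comp[of "k + q - 1" "q - 1"] binomial_absorption[of "q - 1" "k + q - 1"] assms
    by (simp add: mult.commute)
  then have "(\<Sum>i<n. card (Zset (n - 1 - i) q) * (n - 1 - i)) = q * (\<Sum>i<n. (n - 1 - i + q - 1) choose q)"
    unfolding card_Zset[OF assms] sum_distrib_left by (intro sum.cong refl)
  then show ?thesis using assms sum_Zset_complement_choose[of q q n] by simp
qed

section \<open>The block of an index\<close>

definition block :: "(nat \<Rightarrow> nat) \<Rightarrow> nat \<Rightarrow> nat" where
  "block l i = (LEAST s. i \<le> psum l s)"

lemma psum_Suc: "psum l (Suc s) = psum l s + l (Suc s)"
  by (simp add: psum_def)

lemma psum_0 [simp]: "psum l 0 = 0"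
  by (simp add: psum_def)

lemma psum_mono: "a \<le> b \<Longrightarrow> psum l a \<le> psum l b"
  by (rule lift_Suc_mono_le[of "psum l"]) (simp add: psum_Suc)

lemma psum_Zset: "l \<in> Zset n q \<Longrightarrow> psum l q = n"
  by (simp add: Zset_def psum_def)

lemma block_eq_iff:
  assumes "i \<ge> 1" "i \<le> psum l q"
  shows "block l i = s \<longleftrightarrow> s \<ge> 1 \<and> i \<in> Gam l s"
proof -
  have le_block: "i \<le> psum l (block l i)" unfolding block_def using assms(2) by (rule LeastI)
  then have block_ge_1: "block l i \<ge> 1" using assms(1) by (cases "block l i") auto
  have "block l i \<le> s" if "i \<le> psum l s" for s
    unfolding block_def using that by (rule Least_le)
  moreover have "s \<le> block l i" if "i > psum l (s - 1)" for s
  proof (rule ccontr)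
    assume "\<not> s \<le> block l i"
    then have "psum l (block l i) \<le> psum l (s - 1)" by (intro psum_mono) auto
    then show False using le_block that by simp
  qed
  ultimately have "s = block l i" if "s \<ge> 1" "i \<in> Gam l s"
    using that by (intro antisym) (auto simp: Gam_def)
  moreover have "i \<in> Gam l (block l i)"
    using le_block block_ge_1 not_less_Least[of "block l i - 1" "\<lambda>s. i \<le> psum l s"]
    by (auto simp: Gam_def block_def)
  ultimately show ?thesis using block_ge_1 by auto
qed

context
  fixes l n q assumes l_Zset: "l \<in> Zset n q"
begin

lemma block_range: "i \<in> {1..n} \<Longrightarrow> block l i \<in> {1..q}"
proof -
  assume i_in: "i \<in> {1..n}"
  have "block l i \<ge> 1" using block_eq_iff[of i l q "block l i"] i_in psum_Zset[OF l_Zset] by auto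
  moreover have "block l i \<le> q" unfolding block_def using i_in psum_Zset[OF l_Zset] by (intro Least_le) auto
  ultimately show ?thesis by auto
qed

lemma Gam_eq_block: "s \<in> {1..q} \<Longrightarrow> Gam l s = {i \<in> {1..n}. block l i = s}"
proof -
  assume s_in: "s \<in> {1..q}"
  have "Gam l s \<subseteq> {1..n}" using psum_mono[of s q l] s_in psum_Zset[OF l_Zset] by (auto simp: Gam_def)
  then show ?thesis using block_eq_iff[of _ l q s] s_in psum_Zset[OF l_Zset] by auto
qed

lemma card_block_eq: "s \<in> {1..q} \<Longrightarrow> card {i \<in> {1..n}. block l i = s} = l s"
proof -
  assume s_in: "s \<in> {1..q}"
  have "psum l s = psum l (s - 1) + l s" using psum_Suc[of l "s - 1"] s_in by simp
  then have "card (Gam l s) = l s" by (simp add: Gam_def)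
  then show ?thesis using Gam_eq_block[OF s_in] by simp
qed

lemma block_mono: "i \<le> j \<Longrightarrow> i \<in> {1..n} \<Longrightarrow> j \<in> {1..n} \<Longrightarrow> block l i \<le> block l j"
  unfolding block_def using psum_Zset[OF l_Zset]
  by (intro Least_le) (auto intro: order_trans LeastI[of "\<lambda>s. j \<le> psum l s" q])

lemma prod_block:
  fixes g :: "nat \<Rightarrow> 'a :: comm_monoid_mult"
  shows "(\<Prod>i=1..n. g (block l i)) = (\<Prod>s=1..q. g s ^ l s)"
proof -
  have "(\<Prod>i=1..n. g (block l i)) = (\<Prod>s=1..q. \<Prod>i\<in>{i\<in>{1..n}. block l i = s}. g (block l i))"
    using block_range by (intro prod.group[symmetric]) auto
  then show ?thesis using card_block_eq by simp
qed

lemma less_pairs_block_fibre: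
  assumes "r \<in> {1..q}" "s \<in> {1..q}" "r \<le> s"
  shows "{(i, j) \<in> less_pairs {1..n}. block l i = r \<and> block l j = s}
    = (if r = s then less_pairs (Gam l s) else Gam l r \<times> Gam l s)"
proof -
  have "i < j" if "block l i = r" "block l j = s" "i \<in> {1..n}" "j \<in> {1..n}" "r < s" for i j
    using block_mono[of j i] that by (cases "i < j") auto
  then show ?thesis
    unfolding Gam_eq_block[OF assms(1)] Gam_eq_block[OF assms(2)] using assms(3) by (auto simp: less_pairs_def)
qed

lemma card_less_pairs_block_fibre:
  assumes "r \<in> {1..q}" "s \<in> {1..q}" "r \<le> s"
  shows "card {(i, j) \<in> less_pairs {1..n}. block l i = r \<and> block l j = s}
      = (if r = s then l s choose 2 else l r * l s)"
proof -
  have "card (Gam l s) = l s" "card (Gam l r) = l r"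
    unfolding Gam_eq_block[OF assms(1)] Gam_eq_block[OF assms(2)] by (rule card_block_eq assms)+
  then show ?thesis
    unfolding less_pairs_block_fibre[OF assms] by (simp add: Gam_def card_less_pairs card_cartesian_product)
qed

lemma prod_block_pairs:
  fixes G :: "nat \<Rightarrow> nat \<Rightarrow> 'a :: comm_monoid_mult"
  shows "(\<Prod>(i, j)\<in>less_pairs {1..n}. G (block l i) (block l j))
     = (\<Prod>s=1..q. G s s ^ (l s choose 2)) * (\<Prod>(r, s)\<in>less_pairs {1..q}. G r s ^ (l r * l s))"
proof -
  define B where "B x = (case x of (i, j) \<Rightarrow> (block l i, block l j))" for x
  define D where "D = (\<lambda>s. (s, s)) ` {1..q}"
  have "{x \<in> less_pairs {1..n}. B x = (r, s)} = {(i, j) \<in> less_pairs {1..n}. block l i = r \<and> block l j = s}"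
    for r s
    by (auto simp: B_def)
  note fibre_card = arg_cong[OF this, of card, THEN trans, OF card_less_pairs_block_fibre]
  have "(\<Prod>(i, j)\<in>less_pairs {1..n}. G (block l i) (block l j)) = (\<Prod>x\<in>less_pairs {1..n}. case_prod G (B x))"
    by (intro prod.cong) (auto simp: B_def)
  also have "\<dots> = (\<Prod>y\<in>D \<union> less_pairs {1..q}. \<Prod>x\<in>{x \<in> less_pairs {1..n}. B x = y}. case_prod G (B x))"
  proof (rule prod.group[symmetric])
    show "B ` less_pairs {1..n} \<subseteq> D \<union> less_pairs {1..q}"
    proof (rule image_subsetI)
      fix x assume "x \<in> less_pairs {1..n}"
      then obtain i j where x: "x = (i, j)" "i \<in> {1..n}" "j \<in> {1..n}" "i < j" by (auto simp: less_pairs_def)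
      then have "block l i \<le> block l j" "block l i \<in> {1..q}" "block l j \<in> {1..q}"
        using block_mono[of i j] block_range[of i] block_range[of j] by auto
      then show "B x \<in> D \<union> less_pairs {1..q}"
        by (cases "block l i = block l j") (auto simp: x(1) B_def D_def less_pairs_def)
    qed
  qed (auto simp: D_def)
  also have "\<dots> = (\<Prod>y\<in>D \<union> less_pairs {1..q}. case_prod G y ^ card {x \<in> less_pairs {1..n}. B x = y})"
    by (intro prod.cong refl) simp
  also have "\<dots> = (\<Prod>y\<in>D. case_prod G y ^ card {x \<in> less_pairs {1..n}. B x = y})
      * (\<Prod>y\<in>less_pairs {1..q}. case_prod G y ^ card {x \<in> less_pairs {1..n}. B x = y})"
    by (rule prod.union_disjoint) (simp_all add: D_def, auto simp: less_pairs_def)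
  also have "(\<Prod>y\<in>D. case_prod G y ^ card {x \<in> less_pairs {1..n}. B x = y}) = (\<Prod>s=1..q. G s s ^ (l s choose 2))"
    unfolding D_def by (subst prod.reindex) (auto simp: inj_on_def fibre_card[unfolded One_nat_def])
  also have "(\<Prod>y\<in>less_pairs {1..q}. case_prod G y ^ card {x \<in> less_pairs {1..n}. B x = y})
      = (\<Prod>(r, s)\<in>less_pairs {1..q}. G r s ^ (l r * l s))"
  proof (rule prod.cong[OF refl], clarify)
    fix r s assume "(r, s) \<in> less_pairs {1..q}"
    then have "r \<in> {1..q}" "s \<in> {1..q}" "r < s" by (auto simp: less_pairs_def)
    then show "G r s ^ card {x \<in> less_pairs {1..n}. B x = (r, s)} = G r s ^ (l r * l s)"
      by (subst fibre_card) auto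
  qed
  finally show ?thesis .
qed

lemma count_Abs_multiset_Zset: "count (Abs_multiset l) = l"
proof -
  have "{x. 0 < l x} \<subseteq> {1..q}" using Zset_outside[OF l_Zset] by force
  then show ?thesis by (intro count_Abs_multiset) (auto intro: finite_subset)
qed

lemma image_mset_block: "image_mset (block l) (mset_set {1..n}) = Abs_multiset l"
proof (rule multiset_eqI)
  fix s
  have "count (image_mset (block l) (mset_set {1..n})) s = card {i\<in>{1..n}. block l i = s}"
    by (simp add: count_image_mset vimage_def Int_def conj_commute)
  also have "\<dots> = l s"
  proof (cases "s \<in> {1..q}")
    case False
    then have "{i\<in>{1..n}. block l i = s} = {}" using block_range by auto
    then show ?thesis using Zset_outside[OF l_Zset False] by simp
  qed (rule card_block_eq)
  finally show "count (image_mset (block l) (mset_set {1..n})) s = count (Abs_multiset l) s"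
    by (simp add: count_Abs_multiset_Zset)
qed

lemma size_Abs_multiset_Zset: "size (Abs_multiset l) = n"
  by (simp add: image_mset_block[symmetric])

lemma set_mset_Abs_multiset_Zset: "set_mset (Abs_multiset l) \<subseteq> {1..q}"
  using block_range by (auto simp: image_mset_block[symmetric])

end

lemma prod_Zset_block:
  fixes g :: "nat \<Rightarrow> 'a :: comm_semiring_1"
  shows "(\<Prod>l\<in>Zset n q. \<Prod>i=1..n. g (block l i)) = (\<Prod>s=1..q. g s) ^ ((n + q - 1) choose q)"
proof -
  have "(\<Prod>l\<in>Zset n q. \<Prod>i=1..n. g (block l i)) = (\<Prod>l\<in>Zset n q. \<Prod>s=1..q. g s ^ l s)"
    by (intro prod.cong refl prod_block)
  also have "\<dots> = (\<Prod>s=1..q. g s ^ (\<Sum>l\<in>Zset n q. l s))" unfolding power_sum by (rule prod.swap)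
  finally show ?thesis by (simp add: sum_Zset_component prod_power_distrib)
qed

lemma prod_Zset_block_pairs:
  fixes G :: "nat \<Rightarrow> nat \<Rightarrow> 'a :: comm_semiring_1"
  shows "(\<Prod>l\<in>Zset n q. \<Prod>(i, j)\<in>less_pairs {1..n}. G (block l i) (block l j))
    = ((\<Prod>s=1..q. G s s) * (\<Prod>(r, s)\<in>less_pairs {1..q}. G r s)) ^ ((n + q - 1) choose Suc q)"
proof -
  let ?N = "(n + q - 1) choose Suc q"
  have "(\<Prod>l\<in>Zset n q. \<Prod>(i, j)\<in>less_pairs {1..n}. G (block l i) (block l j))
     = (\<Prod>l\<in>Zset n q. \<Prod>s=1..q. G s s ^ (l s choose 2))
       * (\<Prod>l\<in>Zset n q. \<Prod>x\<in>less_pairs {1..q}. case_prod G x ^ (l (fst x) * l (snd x)))"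
    unfolding prod.distrib[symmetric]
    by (intro prod.cong refl) (subst prod_block_pairs, auto simp: case_prod_unfold)
  also have "(\<Prod>l\<in>Zset n q. \<Prod>s=1..q. G s s ^ (l s choose 2)) = (\<Prod>s=1..q. G s s ^ ?N)"
    by (subst prod.swap) (simp add: power_sum[symmetric] sum_Zset_component_choose_2)
  also have "(\<Prod>l\<in>Zset n q. \<Prod>x\<in>less_pairs {1..q}. case_prod G x ^ (l (fst x) * l (snd x)))
      = (\<Prod>x\<in>less_pairs {1..q}. case_prod G x ^ ?N)"
  proof (subst prod.swap, rule prod.cong[OF refl])
    fix x assume "x \<in> less_pairs {1..q}"
    then show "(\<Prod>l\<in>Zset n q. case_prod G x ^ (l (fst x) * l (snd x))) = case_prod G x ^ ?N"
      by (auto simp: less_pairs_def power_sum[symmetric] sum_Zset_component_mult)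
  qed
  finally show ?thesis by (simp add: prod_power_distrib power_mult_distrib case_prod_unfold)
qed

section \<open>The recursion in the last exponent\<close>

text \<open>Letters name functions of one variable: \<open>LOne\<close> is the constant 1, and \<open>LF s\<close>, \<open>LG s\<close>, \<open>LH s\<close>, \<open>LU s\<close> are
  \<open>f\<^sub>s\<close>, \<open>g\<^sub>s\<close>, \<open>h\<^sub>s\<close>, \<open>u\<^sub>s\<close>. A multiset of \<open>n\<close> letters stands for the symmetrised product. Symmetrising the interaction
  \<open>2 \<gamma> (t\<^sub>i - z\<^sub>p) / (t\<^sub>i - t\<^sub>j)\<close> times the letter \<open>b\<close> at \<open>t\<^sub>j\<close> gives \<open>\<gamma>\<close> times the sum of \<open>c a(t\<^sub>i) a'(t\<^sub>j)\<close> over the triples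
  \<open>(a, a', c)\<close> of \<open>pair_expansion b\<close>; only the letters \<open>LOne\<close>, \<open>LG s\<close>, \<open>LU s\<close> occur there.\<close>

datatype letter = LOne | LF nat | LG nat | LH nat | LU nat

definition letters :: "nat \<Rightarrow> letter set" where
  "letters q = {LOne} \<union> LF ` {1..q} \<union> LG ` {1..q} \<union> LH ` {1..q} \<union> LU ` {1..q}"

definition expandable_letters :: "nat \<Rightarrow> letter set" where
  "expandable_letters q = {LOne} \<union> LG ` {1..q} \<union> LU ` {1..q}"

lemma expandable_letters_subset: "expandable_letters q \<subseteq> letters q"
  by (auto simp: letters_def expandable_letters_def)

primrec pair_expansion :: "letter \<Rightarrow> (letter \<times> letter \<times> complex) list" where
  "pair_expansion LOne = [(LOne, LOne, 1)]"
| "pair_expansion (LG s) = [(LOne, LG s, 1), (LG s, LOne, 1), (LG s, LG s, -1)]"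
| "pair_expansion (LU s) = [(LOne, LU s, 1), (LU s, LOne, 1), (LU s, LU s, -1), (LU s, LG 1, -1),
    (LG 1, LU s, -1)]"
| "pair_expansion (LF s) = []"
| "pair_expansion (LH s) = []"

lemma pair_expansion_letters:
  assumes "b \<in> expandable_letters q" "q \<ge> 1" "(a, a', c) \<in> set (pair_expansion b)"
  shows "a \<in> letters q" "a' \<in> letters q"
  using assms by (auto simp: letters_def expandable_letters_def)

definition pair_sum :: "(letter multiset \<Rightarrow> 'r \<Rightarrow> complex) \<Rightarrow> letter multiset \<Rightarrow> letter \<Rightarrow> 'r \<Rightarrow> complex" where
  "pair_sum V N b = (\<lambda>l. \<Sum>(a, a', c)\<leftarrow>pair_expansion b. c * V (add_mset a (add_mset a' N)) l)"

definition reduction_coeff :: "'a :: field \<Rightarrow> 'a \<Rightarrow> 'a \<Rightarrow> nat \<Rightarrow> nat \<Rightarrow> 'a" where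
  "reduction_coeff \<gamma> C T i j = (\<Prod>r=1..j. (C - of_nat r * \<gamma>) / (T - of_nat r * \<gamma>))
     * (\<Prod>s<i. (T - C - of_nat s * \<gamma>) / (T - of_nat (Suc j + s) * \<gamma>))"

lemma reduction_coeff_0_0 [simp]: "reduction_coeff \<gamma> C T 0 0 = 1"
  by (simp add: reduction_coeff_def)

lemma reduction_coeff_0_Suc:
  "reduction_coeff \<gamma> C T 0 (Suc j)
    = reduction_coeff \<gamma> C T 0 j * ((C - of_nat (Suc j) * \<gamma>) / (T - of_nat (Suc j) * \<gamma>))"
  by (simp add: reduction_coeff_def)

lemma reduction_coeff_Suc:
  fixes \<gamma> C T :: "'a :: field"
  assumes nonzero: "\<And>r. r \<in> {1..Suc (i + j)} \<Longrightarrow> T - of_nat r * \<gamma> \<noteq> 0"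
  shows "reduction_coeff \<gamma> C T (Suc i) j = reduction_coeff \<gamma> C T i j - reduction_coeff \<gamma> C T i (Suc j)"
proof -
  define d where "d r = T - of_nat r * \<gamma>" for r
  define P where "P = (\<Prod>r=1..j. (C - of_nat r * \<gamma>) / d r)"
  define N where "N = (\<Prod>s<i. T - C - of_nat s * \<gamma>)"
  define D where "D = (\<Prod>s<Suc i. d (Suc j + s))"
  have d_nonzero: "d r \<noteq> 0" if "r \<in> {1..Suc (i + j)}" for r using nonzero[OF that] by (simp add: d_def)
  then have d_nonzero: "d (Suc j + i) \<noteq> 0" "d (Suc j) \<noteq> 0" and D_nonzero: "D \<noteq> 0" by (auto simp: D_def)
  have drop_last: "(\<Prod>s<i. d (Suc j + s)) = D / d (Suc j + i)" using d_nonzero by (simp add: D_def)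
  have "D = d (Suc j) * (\<Prod>s<i. d (Suc (Suc j) + s))"
    unfolding D_def by (simp only: prod.lessThan_Suc_shift) simp
  then have drop_first: "(\<Prod>s<i. d (Suc (Suc j) + s)) = D / d (Suc j)" using d_nonzero by simp
  have coeffs: "reduction_coeff \<gamma> C T i j = P * (N / (D / d (Suc j + i)))"
    "reduction_coeff \<gamma> C T i (Suc j) = P * ((C - of_nat (Suc j) * \<gamma>) / d (Suc j)) * (N / (D / d (Suc j)))"
    "reduction_coeff \<gamma> C T (Suc i) j = P * (N * (T - C - of_nat i * \<gamma>) / D)"
    unfolding reduction_coeff_def prod_dividef N_def P_def drop_first[symmetric] drop_last[symmetric]
    by (simp_all add: d_def D_def prod_dividef)
  have split: "T - C - of_nat i * \<gamma> = d (Suc j + i) - (C - of_nat (Suc j) * \<gamma>)"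
    by (simp add: d_def algebra_simps)
  have "p * (x * (e - c) / y) = p * (x / (y / e)) - p * (c / g) * (x / (y / g))"
    if "y \<noteq> 0" "e \<noteq> 0" "g \<noteq> 0" for p x e c y g :: 'a
    using that by (simp add: field_simps)
  from this[OF D_nonzero d_nonzero] show ?thesis unfolding coeffs split .
qed

lemma span_sum_mset:
  "(\<And>s. s \<in># B \<Longrightarrow> f s \<in> cfun.span S) \<Longrightarrow> (\<lambda>x. \<Sum>s\<in>#B. f s x) \<in> cfun.span S"
proof (induction B)
  case empty
  show ?case using cfun.span_zero[of S] by (simp add: zero_fun_def)
next
  case (add s B)
  then show ?case using cfun.span_add[of "f s" S] by (simp add: plus_fun_def)
qed

lemma sum_mset_const_diff: "(\<Sum>x\<in>#M. c - f x) = of_nat (size M) * c - (\<Sum>x\<in>#M. f x)" for c :: "'a :: comm_ring_1"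
  by (induction M) (simp_all add: algebra_simps)

locale word_recursion =
  fixes V :: "letter multiset \<Rightarrow> (nat \<Rightarrow> nat) \<Rightarrow> complex" and n q :: nat and \<alpha> :: "nat \<Rightarrow> complex"
    and \<gamma> a A :: complex
  assumes q_ge_1: "q \<ge> 1"
    and A_eq: "A = a + (\<Sum>s=1..q. \<alpha> s)"
    and V_LU_LG: "\<And>N s. size N + 1 = n \<Longrightarrow> set_mset N \<subseteq> letters q \<Longrightarrow> s \<in> {1..q} \<Longrightarrow>
        V (add_mset (LU s) N) = V (add_mset (LG s) N) - V (add_mset (LG 1) N)"
    and V_LU_LH: "\<And>N s. size N + 1 = n \<Longrightarrow> set_mset N \<subseteq> letters q \<Longrightarrow> s \<in> {1..q} \<Longrightarrow>
        V (add_mset (LU s) N) = V (add_mset (LH s) N) - V (add_mset (LH 1) N)"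
    and V_LH_LG: "\<And>N. size N + 1 = n \<Longrightarrow> set_mset N \<subseteq> letters q \<Longrightarrow>
        V (add_mset (LH 1) N) = V (add_mset (LG 1) N) - V (add_mset LOne N)"
    and integration_by_parts: "\<And>N l. size N + 1 = n \<Longrightarrow> set_mset N \<subseteq> expandable_letters q \<Longrightarrow>
        A * V (add_mset LOne N) l - (\<Sum>s=1..q. \<alpha> s * V (add_mset (LG s) N) l)
        + \<gamma> * (\<Sum>b\<in>#N. pair_sum V (N - {#b#}) b l) = 0"
    and A_nonzero: "\<And>j::nat. A + of_nat j * \<gamma> \<noteq> 0"
begin

lemma LU_word_minus_word_in_span:
  assumes LU_eq_diff: "\<And>N s. size N + 1 = n \<Longrightarrow> set_mset N \<subseteq> letters q \<Longrightarrow> s \<in> {1..q} \<Longrightarrow>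
        V (add_mset (LU s) N) = V (add_mset (P s) N) - V (add_mset (P 1) N)"
    and P_letters: "P ` {1..q} \<subseteq> letters q"
    and "size M + size B = n" "set_mset M \<subseteq> {1..q}" "set_mset B \<subseteq> {1..q}"
  shows "V (image_mset P M + image_mset LU B) - V (image_mset P (M + B))
      \<in> cfun.span ((\<lambda>m. V (image_mset P (Abs_multiset m))) ` {m \<in> Zset n q. count M 1 < m 1})"
  using assms(3-5)
proof (induction B arbitrary: M)
  case empty
  show ?case using cfun.span_zero by (simp only: image_mset_empty add_0_right diff_self)
next
  case (add s B)
  let ?S = "\<lambda>M. (\<lambda>m. V (image_mset P (Abs_multiset m))) ` {m \<in> Zset n q. count M 1 < m 1}"
  let ?D = "\<lambda>r. V (image_mset P (add_mset r M) + image_mset LU B) - V (image_mset P (add_mset r M + B))"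
  have s_and_1_in: "s \<in> {1..q}" "1 \<in> {1..q}" using add.prems q_ge_1 by simp_all
  have "set_mset (image_mset P M + image_mset LU B) \<subseteq> letters q"
    using add.prems P_letters by (auto simp: letters_def)
  then have expand: "V (image_mset P M + image_mset LU (add_mset s B))
      = V (image_mset P (add_mset s M) + image_mset LU B) - V (image_mset P (add_mset 1 M) + image_mset LU B)"
    using LU_eq_diff[of "image_mset P M + image_mset LU B" s] add.prems s_and_1_in by simp
  have IH: "?D r \<in> cfun.span (?S M)" if "r \<in> {1..q}" for r
  proof -
    have "?D r \<in> cfun.span (?S (add_mset r M))" using add.prems that by (intro add.IH) auto
    moreover have "?S (add_mset r M) \<subseteq> ?S M" by auto
    ultimately show ?thesis using cfun.span_mono by blast
  qed
  have "count (add_mset 1 M + B) \<in> Zset n q"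
    using add.prems s_and_1_in by (intro count_in_Zset) auto
  then have "V (image_mset P (add_mset 1 M + B)) \<in> cfun.span (?S M)"
    by (intro cfun.span_base image_eqI[where x="count (add_mset 1 M + B)"]) (simp_all add: count_inverse)
  from cfun.span_diff[OF cfun.span_diff[OF IH[OF s_and_1_in(1)] IH[OF s_and_1_in(2)]] this]
  have "?D s - ?D 1 - V (image_mset P (add_mset 1 M + B)) \<in> cfun.span (?S M)" .
  moreover have "?D s - ?D 1 - V (image_mset P (add_mset 1 M + B))
      = V (image_mset P M + image_mset LU (add_mset s B)) - V (image_mset P (M + add_mset s B))"
    unfolding expand by (simp add: fun_eq_iff)
  ultimately show ?case by (simp only:)
qed

definition lead_word :: "letter \<Rightarrow> (nat \<Rightarrow> nat) \<Rightarrow> letter multiset" where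
  "lead_word c m = replicate_mset (m 1) c + image_mset LU (Abs_multiset (m(1 := 0)))"

lemma remove_lead:
  assumes "m \<in> Zset n q"
  shows "m(1 := 0) \<in> Zset (n - m 1) q" "m 1 \<le> n"
    "Abs_multiset m = replicate_mset (m 1) 1 + Abs_multiset (m(1 := 0))"
    "set_mset (Abs_multiset (m(1 := 0))) \<subseteq> {2..q}"
proof -
  show le: "m 1 \<le> n" using Zset_component_le[OF assms] q_ge_1 by simp
  then show Z: "m(1 := 0) \<in> Zset (n - m 1) q" using assms q_ge_1 by (intro Zset_fun_upd) auto
  show "Abs_multiset m = replicate_mset (m 1) 1 + Abs_multiset (m(1 := 0))"
    by (rule multiset_eqI)
      (simp only: count_union count_replicate_mset count_Abs_multiset_Zset[OF assms]
        count_Abs_multiset_Zset[OF Z], simp)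
  have "count (Abs_multiset (m(1 := 0))) 1 = 0" unfolding count_Abs_multiset_Zset[OF Z] by simp
  then have "1 \<notin># Abs_multiset (m(1 := 0))" unfolding count_eq_zero_iff .
  moreover have "{1..q} - {1} \<subseteq> {2..q}" by auto
  ultimately show "set_mset (Abs_multiset (m(1 := 0))) \<subseteq> {2..q}"
    using set_mset_Abs_multiset_Zset[OF Z] by blast
qed

lemma det_lead_word:
  assumes LU_eq_diff: "\<And>N s. size N + 1 = n \<Longrightarrow> set_mset N \<subseteq> letters q \<Longrightarrow> s \<in> {1..q} \<Longrightarrow>
        V (add_mset (LU s) N) = V (add_mset (P s) N) - V (add_mset (P 1) N)"
    and P_letters: "P ` {1..q} \<subseteq> letters q"
  shows "det_on (Zset n q) (\<lambda>l m. V (lead_word (P 1) m) l)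
       = det_on (Zset n q) (\<lambda>l m. V (image_mset P (Abs_multiset m)) l)"
proof -
  have "V (lead_word (P 1) m) - 1 *\<^sub>C V (image_mset P (Abs_multiset m))
      \<in> cfun.span ((\<lambda>m. V (image_mset P (Abs_multiset m))) ` {m' \<in> Zset n q. n - m' 1 < n - m 1})"
    if m_Zset: "m \<in> Zset n q" for m
  proof -
    note lead = remove_lead[OF m_Zset]
    have "V (image_mset P (replicate_mset (m 1) 1) + image_mset LU (Abs_multiset (m(1 := 0))))
        - V (image_mset P (replicate_mset (m 1) 1 + Abs_multiset (m(1 := 0))))
      \<in> cfun.span ((\<lambda>m. V (image_mset P (Abs_multiset m)))
          ` {m' \<in> Zset n q. count (replicate_mset (m 1) (1::nat)) 1 < m' 1})"
    proof (rule LU_word_minus_word_in_span[OF LU_eq_diff P_letters])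
      show "size (replicate_mset (m 1) (1::nat)) + size (Abs_multiset (m(1 := 0))) = n"
        using size_Abs_multiset_Zset[OF lead(1)] lead(2) by (simp only: size_replicate_mset)
      show "set_mset (replicate_mset (m 1) 1) \<subseteq> {1..q}" using q_ge_1 by auto
      show "set_mset (Abs_multiset (m(1 := 0))) \<subseteq> {1..q}" by (rule set_mset_Abs_multiset_Zset[OF lead(1)])
    qed
    moreover have "{m' \<in> Zset n q. m 1 < m' 1} = {m' \<in> Zset n q. n - m' 1 < n - m 1}"
      using remove_lead(2) lead(2)
      by (intro Collect_cong conj_cong refl) (meson diff_less_mono2 diff_le_mono2 leD leI less_le_trans)
    ultimately show ?thesis by (simp add: lead_word_def lead(3))
  qed
  from det_on_triangular_change_of_columns[OF finite_Zset this] show ?thesis by simp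
qed

definition mixed :: "nat \<Rightarrow> nat \<Rightarrow> nat multiset \<Rightarrow> (nat \<Rightarrow> nat) \<Rightarrow> complex" where
  "mixed j k B = V (replicate_mset j LOne + replicate_mset k (LG 1) + image_mset LU B)"

lemma sum_pair_sum_mixed:
  defines "N j k B \<equiv> replicate_mset j LOne + replicate_mset k (LG 1) + image_mset LU B"
  shows "(\<Sum>b\<in>#N j k B. pair_sum V (N j k B - {#b#}) b l)
      = of_nat j * mixed (Suc j) k B l + of_nat k * (2 * mixed (Suc j) k B l - mixed j (Suc k) B l)
       + of_nat (size B) * (2 * mixed (Suc j) k B l - 2 * mixed j (Suc k) B l)
       - (\<Sum>s\<in>#B. mixed j k (add_mset s B) l)"
proof -
  let ?N = "N j k B"
  have "pair_sum V (?N - {#LOne#}) LOne l = mixed (Suc j) k B l" if "j > 0"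
    using that by (cases j) (simp_all add: N_def mixed_def pair_sum_def)
  then have ones: "(\<Sum>b\<in>#replicate_mset j LOne. pair_sum V (?N - {#b#}) b l) = of_nat j * mixed (Suc j) k B l"
    by (cases "j = 0") auto
  have "pair_sum V (?N - {#LG 1#}) (LG 1) l = 2 * mixed (Suc j) k B l - mixed j (Suc k) B l" if "k > 0"
    using that by (cases k) (simp_all add: N_def mixed_def pair_sum_def add_mset_commute)
  then have sum_LG_pairs: "(\<Sum>b\<in>#replicate_mset k (LG 1). pair_sum V (?N - {#b#}) b l)
      = of_nat k * (2 * mixed (Suc j) k B l - mixed j (Suc k) B l)"
    by (cases "k = 0") auto
  have "pair_sum V (?N - {#LU s#}) (LU s) l
      = (2 * mixed (Suc j) k B l - 2 * mixed j (Suc k) B l) - mixed j k (add_mset s B) l" if s_mem: "s \<in># B"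
    for s
  proof -
    obtain B' where B': "B = add_mset s B'" using multi_member_split[OF s_mem] by blast
    have "?N - {#LU s#} = replicate_mset j LOne + replicate_mset k (LG 1) + image_mset LU B'"
      by (simp add: N_def B')
    then show ?thesis
      by (simp add: mixed_def pair_sum_def B' add_mset_commute[of "LU s" LOne]
        add_mset_commute[of "LU s" "LG _"])
  qed
  then have "(\<Sum>b\<in>#image_mset LU B. pair_sum V (?N - {#b#}) b l)
      = (\<Sum>s\<in>#B. (2 * mixed (Suc j) k B l - 2 * mixed j (Suc k) B l) - mixed j k (add_mset s B) l)"
    unfolding image_mset.compositionality o_def by (intro arg_cong[of _ _ sum_mset] image_mset_cong)
  also have "\<dots> = of_nat (size B) * (2 * mixed (Suc j) k B l - 2 * mixed j (Suc k) B l)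
      - (\<Sum>s\<in>#B. mixed j k (add_mset s B) l)"
    by (rule sum_mset_const_diff)
  finally show ?thesis
    using ones sum_LG_pairs unfolding N_def by (simp only: image_mset_union sum_mset.union add_diff_eq)
qed

lemma mixed_recursion:
  assumes size_eq: "Suc j + k + size B = n" and B_subset: "set_mset B \<subseteq> {2..q}"
  shows "(A + of_nat (2 * n - j - 2) * \<gamma>) * mixed (Suc j) k B l
     = ((\<Sum>s=1..q. \<alpha> s) + (2 * of_nat (size B) + of_nat k) * \<gamma>) * mixed j (Suc k) B l
       + (\<Sum>s=2..q. \<alpha> s * mixed j k (add_mset s B) l) + \<gamma> * (\<Sum>s\<in>#B. mixed j k (add_mset s B) l)"
proof -
  let ?N = "replicate_mset j LOne + replicate_mset k (LG 1) + image_mset LU B"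
  have size_N: "size ?N + 1 = n" using size_eq by simp
  have N_expandable: "set_mset ?N \<subseteq> expandable_letters q"
    using B_subset q_ge_1 by (force simp: expandable_letters_def split: if_splits)
  then have N_letters: "set_mset ?N \<subseteq> letters q" using expandable_letters_subset by blast
  have V_LG: "V (add_mset (LG s) ?N) l = mixed j k (add_mset s B) l + mixed j (Suc k) B l" if "s \<in> {1..q}" for s
    using fun_cong[OF V_LU_LG[OF size_N N_letters that], of l] by (simp add: mixed_def)
  have "mixed j k (add_mset 1 B) l = 0" using V_LG[of 1] q_ge_1 by (simp add: mixed_def)
  then have "(\<Sum>s=1..q. \<alpha> s * mixed j k (add_mset s B) l) = (\<Sum>s=2..q. \<alpha> s * mixed j k (add_mset s B) l)"
    using sum.atLeast_Suc_atMost[OF q_ge_1, of "\<lambda>s. \<alpha> s * mixed j k (add_mset s B) l"]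
    by (simp add: numeral_2_eq_2)
  moreover have "(\<Sum>s=1..q. \<alpha> s * V (add_mset (LG s) ?N) l)
      = (\<Sum>s=1..q. \<alpha> s * mixed j k (add_mset s B) l) + (\<Sum>s=1..q. \<alpha> s) * mixed j (Suc k) B l"
    unfolding sum_distrib_right sum.distrib[symmetric] by (intro sum.cong refl) (simp only: V_LG distrib_left)
  ultimately have sum_LG: "(\<Sum>s=1..q. \<alpha> s * V (add_mset (LG s) ?N) l)
      = (\<Sum>s=2..q. \<alpha> s * mixed j k (add_mset s B) l) + (\<Sum>s=1..q. \<alpha> s) * mixed j (Suc k) B l" by simp
  have V_LOne: "V (add_mset LOne ?N) l = mixed (Suc j) k B l" by (simp add: mixed_def)
  have count: "2 * n - j - 2 = j + 2 * k + 2 * size B" using size_eq by simp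
  show ?thesis
    using integration_by_parts[OF size_N N_expandable, of l]
    unfolding V_LOne sum_LG sum_pair_sum_mixed count by (simp add: algebra_simps)
qed

text \<open>Modulo words with fewer than \<open>\<kappa>\<close> leading letters, a word with \<open>i\<close> letters \<open>LH 1\<close>, \<open>j\<close> letters \<open>LOne\<close> and
  \<open>\<kappa> - i - j\<close> letters \<open>LG 1\<close> is \<open>lead_coeff_mod i j \<kappa>\<close> times the word with \<open>\<kappa>\<close> letters \<open>LG 1\<close>.\<close>

definition lead_coeff_mod :: "nat \<Rightarrow> nat \<Rightarrow> nat \<Rightarrow> complex" where
  "lead_coeff_mod i j \<kappa> = reduction_coeff \<gamma> ((\<Sum>s=1..q. \<alpha> s) + (2 * of_nat n - of_nat \<kappa>) * \<gamma>)
     (A + (2 * of_nat n - 1) * \<gamma>) i j"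

definition lower_span :: "nat \<Rightarrow> ((nat \<Rightarrow> nat) \<Rightarrow> complex) set" where
  "lower_span \<kappa> = cfun.span ((\<lambda>m. V (lead_word (LG 1) m)) ` {m \<in> Zset n q. m 1 < \<kappa>})"

lemma lead_coeff_mod_Suc:
  assumes "i + j < 2 * n - 1"
  shows "lead_coeff_mod (Suc i) j \<kappa> = lead_coeff_mod i j \<kappa> - lead_coeff_mod i (Suc j) \<kappa>"
  unfolding lead_coeff_mod_def
proof (rule reduction_coeff_Suc)
  fix r assume "r \<in> {1..Suc (i + j)}"
  then have "Suc r \<le> 2 * n" using assms by auto
  then have "of_nat (2 * n - 1 - r) = (2 * of_nat n - 1 - of_nat r :: complex)"
    by (simp add: of_nat_diff)
  then have "A + (2 * of_nat n - 1) * \<gamma> - of_nat r * \<gamma> = A + of_nat (2 * n - 1 - r) * \<gamma>"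
    by (simp only: left_diff_distrib) simp
  then show "A + (2 * of_nat n - 1) * \<gamma> - of_nat r * \<gamma> \<noteq> 0"
    using A_nonzero[of "2 * n - 1 - r"] by (simp only: not_False_eq_True)
qed

lemma lead_coeff_mod_diag:
  "lead_coeff_mod k 0 k = (\<Prod>s<k. (a + of_nat s * \<gamma>) / (A + (2 * of_nat n - 2 - of_nat s) * \<gamma>))"
proof -
  let ?T = "A + (2 * of_nat n - 1) * \<gamma>" and ?C = "(\<Sum>s=1..q. \<alpha> s) + (2 * of_nat n - of_nat k) * \<gamma>"
  have "(\<Prod>s<k. ?T - ?C - of_nat s * \<gamma>) = (\<Prod>s<k. a + of_nat (k - Suc s) * \<gamma>)"
    unfolding A_eq by (intro prod.cong refl) (auto simp: of_nat_diff algebra_simps)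
  also have "\<dots> = (\<Prod>s<k. a + of_nat s * \<gamma>)" by (rule prod.nat_diff_reindex)
  finally have numerators: "(\<Prod>s<k. ?T - ?C - of_nat s * \<gamma>) = (\<Prod>s<k. a + of_nat s * \<gamma>)" .
  have denominators: "?T - of_nat (Suc 0 + s) * \<gamma> = A + (2 * of_nat n - 2 - of_nat s) * \<gamma>" for s
    by (simp add: algebra_simps)
  show ?thesis
    unfolding lead_coeff_mod_def reduction_coeff_def prod_dividef numerators denominators by simp
qed

lemma mixed_in_lower_span:
  assumes "k + size B = n" "set_mset B \<subseteq> {2..q}" "k < \<kappa>"
  shows "mixed 0 k B \<in> lower_span \<kappa>"
proof -
  let ?m = "count (replicate_mset k 1 + B)"
  have "1 \<notin># B" using assms(2) by auto
  then have m_1: "?m 1 = k" and m_rest: "?m(1 := 0) = count B"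
    by (auto simp: fun_eq_iff count_eq_zero_iff)
  have "?m \<in> Zset n q"
    using assms q_ge_1 by (intro count_in_Zset) (auto split: if_splits)
  moreover have "mixed 0 k B = V (lead_word (LG 1) ?m)"
    unfolding lead_word_def m_1 m_rest mixed_def by (simp add: count_inverse)
  ultimately show ?thesis
    unfolding lower_span_def using m_1 assms(3) by (intro cfun.span_base image_eqI[where x="?m"]) simp_all
qed

definition mixed_tail :: "nat \<Rightarrow> nat \<Rightarrow> nat multiset \<Rightarrow> (nat \<Rightarrow> nat) \<Rightarrow> complex" where
  "mixed_tail j k B = (\<Sum>s=2..q. \<alpha> s *\<^sub>C mixed j k (add_mset s B))
      + \<gamma> *\<^sub>C (\<lambda>l. \<Sum>s\<in>#B. mixed j k (add_mset s B) l)"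

lemma mixed_Suc_minus_lead:
  assumes "Suc j + k + size B = n" "set_mset B \<subseteq> {2..q}"
  obtains x y where "mixed (Suc j) k B - lead_coeff_mod 0 (Suc j) (Suc j + k) *\<^sub>C mixed 0 (Suc j + k) B
    = x *\<^sub>C (mixed j (Suc k) B - lead_coeff_mod 0 j (Suc j + k) *\<^sub>C mixed 0 (Suc j + k) B)
    + y *\<^sub>C mixed_tail j k B"
proof
  let ?\<kappa> = "Suc j + k"
  define d where "d = A + of_nat (2 * n - j - 2) * \<gamma>"
  define c where "c = (\<Sum>s=1..q. \<alpha> s) + (2 * of_nat (size B) + of_nat k) * \<gamma>"
  have d_nonzero: "d \<noteq> 0" using A_nonzero by (simp add: d_def)
  have n_eq: "of_nat n = (1 + of_nat j + of_nat k + of_nat (size B) :: complex)"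
    "2 * n - j - 2 = j + 2 * k + 2 * size B"
    using arg_cong[OF assms(1), of "of_nat :: nat \<Rightarrow> complex"] assms(1) by (simp_all add: add_ac)
  have "lead_coeff_mod 0 (Suc j) ?\<kappa> = lead_coeff_mod 0 j ?\<kappa> * (c / d)"
    unfolding lead_coeff_mod_def reduction_coeff_0_Suc c_def d_def n_eq by (simp add: algebra_simps)
  moreover have "mixed (Suc j) k B l = (c * mixed j (Suc k) B l + mixed_tail j k B l) / d" for l
    using mixed_recursion[OF assms, of l] d_nonzero unfolding d_def[symmetric] c_def[symmetric]
    by (simp add: mixed_tail_def sum_fun_apply cscale_apply field_simps)
  ultimately show "mixed (Suc j) k B - lead_coeff_mod 0 (Suc j) ?\<kappa> *\<^sub>C mixed 0 ?\<kappa> B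
      = (c / d) *\<^sub>C (mixed j (Suc k) B - lead_coeff_mod 0 j ?\<kappa> *\<^sub>C mixed 0 ?\<kappa> B) + (1 / d) *\<^sub>C mixed_tail j k B"
    using d_nonzero by (simp add: fun_eq_iff cscale_apply field_simps)
qed

lemma mixed_mod_lower_span:
  assumes "j + k + size B = n" "set_mset B \<subseteq> {2..q}"
  shows "mixed j k B - lead_coeff_mod 0 j (j + k) *\<^sub>C mixed 0 (j + k) B \<in> lower_span (j + k)"
  using assms
proof (induction j arbitrary: k B)
  case 0
  show ?case
    by (simp only: lead_coeff_mod_def reduction_coeff_0_0 cfun.scale_one diff_self add_0_left lower_span_def
      cfun.span_zero)
next
  case (Suc j)
  let ?\<kappa> = "Suc j + k"
  obtain x y where mixed_minus_lead: "mixed (Suc j) k B - lead_coeff_mod 0 (Suc j) ?\<kappa> *\<^sub>C mixed 0 ?\<kappa> B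
      = x *\<^sub>C (mixed j (Suc k) B - lead_coeff_mod 0 j ?\<kappa> *\<^sub>C mixed 0 ?\<kappa> B) + y *\<^sub>C mixed_tail j k B"
    by (rule mixed_Suc_minus_lead[OF Suc.prems])
  have lower: "mixed j k (add_mset s B) \<in> lower_span ?\<kappa>" if "s \<in> {2..q}" for s
  proof -
    have "mixed j k (add_mset s B) - lead_coeff_mod 0 j (j + k) *\<^sub>C mixed 0 (j + k) (add_mset s B)
        \<in> lower_span (j + k)"
      using Suc.prems that by (intro Suc.IH) auto
    also have "lower_span (j + k) \<subseteq> lower_span ?\<kappa>" unfolding lower_span_def by (intro cfun.span_mono) auto
    finally have "mixed j k (add_mset s B) - lead_coeff_mod 0 j (j + k) *\<^sub>C mixed 0 (j + k) (add_mset s B)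
        \<in> lower_span ?\<kappa>" .
    moreover have "mixed 0 (j + k) (add_mset s B) \<in> lower_span ?\<kappa>"
      using Suc.prems that by (intro mixed_in_lower_span) auto
    ultimately have "(mixed j k (add_mset s B) - lead_coeff_mod 0 j (j + k) *\<^sub>C mixed 0 (j + k) (add_mset s B))
        + lead_coeff_mod 0 j (j + k) *\<^sub>C mixed 0 (j + k) (add_mset s B) \<in> lower_span ?\<kappa>"
      unfolding lower_span_def by (intro cfun.span_add cfun.span_scale)
    then show ?thesis by (simp only: diff_add_cancel)
  qed
  then have "mixed_tail j k B \<in> lower_span ?\<kappa>"
    unfolding mixed_tail_def lower_span_def using Suc.prems(2)
    by (intro cfun.span_add cfun.span_scale cfun.span_sum span_sum_mset) auto
  moreover have "mixed j (Suc k) B - lead_coeff_mod 0 j ?\<kappa> *\<^sub>C mixed 0 ?\<kappa> B \<in> lower_span ?\<kappa>"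
    using Suc.IH[of "Suc k" B] Suc.prems by (simp only: add_Suc add_Suc_right)
  ultimately show ?case
    unfolding mixed_minus_lead lower_span_def
    by (rule cfun.span_add[OF cfun.span_scale cfun.span_scale, rotated])
qed

lemma LH_mixed_mod_lower_span:
  assumes "i + j + k + size B = n" "set_mset B \<subseteq> {2..q}"
  shows "V (replicate_mset i (LH 1) + (replicate_mset j LOne + replicate_mset k (LG 1) + image_mset LU B))
       - lead_coeff_mod i j (i + j + k) *\<^sub>C mixed 0 (i + j + k) B \<in> lower_span (i + j + k)"
  using assms
proof (induction i arbitrary: j k)
  case 0
  then show ?case using mixed_mod_lower_span[of j k B] by (simp only: mixed_def replicate_mset_0 add_0_left)
next
  case (Suc i)
  let ?W = "\<lambda>i j k. replicate_mset i (LH 1)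
      + (replicate_mset j LOne + replicate_mset k (LG 1) + image_mset LU B)"
  let ?\<kappa> = "Suc i + j + k"
  have "size (?W i j k) + 1 = n" "set_mset (?W i j k) \<subseteq> letters q"
    using Suc.prems q_ge_1 by (simp, force simp: letters_def split: if_splits)
  then have "V (?W (Suc i) j k) = V (?W i j (Suc k)) - V (?W i (Suc j) k)"
    using V_LH_LG[of "?W i j k"] by simp
  moreover have "lead_coeff_mod (Suc i) j ?\<kappa> = lead_coeff_mod i j ?\<kappa> - lead_coeff_mod i (Suc j) ?\<kappa>"
    using Suc.prems by (intro lead_coeff_mod_Suc) simp
  ultimately have word_minus_lead: "V (?W (Suc i) j k) - lead_coeff_mod (Suc i) j ?\<kappa> *\<^sub>C mixed 0 ?\<kappa> B
      = (V (?W i j (Suc k)) - lead_coeff_mod i j ?\<kappa> *\<^sub>C mixed 0 ?\<kappa> B)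
       - (V (?W i (Suc j) k) - lead_coeff_mod i (Suc j) ?\<kappa> *\<^sub>C mixed 0 ?\<kappa> B)"
    by (simp add: cfun.scale_left_diff_distrib)
  have "V (?W i j (Suc k)) - lead_coeff_mod i j ?\<kappa> *\<^sub>C mixed 0 ?\<kappa> B \<in> lower_span ?\<kappa>"
    "V (?W i (Suc j) k) - lead_coeff_mod i (Suc j) ?\<kappa> *\<^sub>C mixed 0 ?\<kappa> B \<in> lower_span ?\<kappa>"
    using Suc.IH[of j "Suc k"] Suc.IH[of "Suc j" k] Suc.prems by (simp_all only: add_Suc add_Suc_right)
  then show ?case unfolding word_minus_lead lower_span_def by (rule cfun.span_diff)
qed

theorem det_shift:
  "det_on (Zset n q) (\<lambda>l m. V (image_mset LH (Abs_multiset m)) l)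
   = (\<Prod>m\<in>Zset n q. \<Prod>s<m 1. (a + of_nat s * \<gamma>) / (A + (2 * of_nat n - 2 - of_nat s) * \<gamma>))
     * det_on (Zset n q) (\<lambda>l m. V (image_mset LG (Abs_multiset m)) l)"
proof -
  have "V (lead_word (LH 1) m) - lead_coeff_mod (m 1) 0 (m 1) *\<^sub>C V (lead_word (LG 1) m)
      \<in> cfun.span ((\<lambda>m. V (lead_word (LG 1) m)) ` {m' \<in> Zset n q. m' 1 < m 1})" if m_Zset: "m \<in> Zset n q" for m
  proof -
    note lead = remove_lead[OF m_Zset]
    have "m 1 + 0 + 0 + size (Abs_multiset (m(1 := 0))) = n"
      unfolding size_Abs_multiset_Zset[OF lead(1)] using lead(2) by simp
    from LH_mixed_mod_lower_span[OF this lead(4)] show ?thesis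
      by (simp add: mixed_def lead_word_def lower_span_def)
  qed
  then have "det_on (Zset n q) (\<lambda>l m. V (lead_word (LH 1) m) l)
    = (\<Prod>m\<in>Zset n q. lead_coeff_mod (m 1) 0 (m 1)) * det_on (Zset n q) (\<lambda>l m. V (lead_word (LG 1) m) l)"
    by (rule det_on_triangular_change_of_columns[OF finite_Zset])
  moreover have "det_on (Zset n q) (\<lambda>l m. V (lead_word (LH 1) m) l)
      = det_on (Zset n q) (\<lambda>l m. V (image_mset LH (Abs_multiset m)) l)"
    by (rule det_lead_word[OF V_LU_LH]) (auto simp: letters_def)
  moreover have "det_on (Zset n q) (\<lambda>l m. V (lead_word (LG 1) m) l)
      = det_on (Zset n q) (\<lambda>l m. V (image_mset LG (Abs_multiset m)) l)"
    by (rule det_lead_word[OF V_LU_LG]) (auto simp: letters_def)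
  ultimately show ?thesis by (simp only: lead_coeff_mod_diag)
qed

end

section \<open>Integration over finite products of the real line\<close>

abbreviation lborel_on :: "nat set \<Rightarrow> (nat \<Rightarrow> real) measure" where
  "lborel_on J \<equiv> PiM J (\<lambda>_. lborel)"

interpretation lborel_product: product_sigma_finite "\<lambda>_::nat. lborel :: real measure" by standard

lemma measurable_component_lborel_on: "i \<in> J \<Longrightarrow> (\<lambda>t. t i) \<in> borel_measurable (lborel_on J)"
  using measurable_component_singleton[of i J "\<lambda>_. lborel :: real measure"] by simp

lemma measurable_affine_reindex:
  assumes "\<And>j. j \<in> J \<Longrightarrow> f j \<in> I"
  shows "(\<lambda>y. \<lambda>j\<in>J. d j + c j * y (f j)) \<in> measurable (lborel_on I) (lborel_on J)"
proof (rule measurable_restrict)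
  fix j assume "j \<in> J"
  note [measurable] = measurable_component_lborel_on[OF assms[OF this]]
  show "(\<lambda>y. d j + c j * y (f j)) \<in> measurable (lborel_on I) lborel" by measurable
qed

lemma emeasure_lborel_affine_vimage:
  fixes c d :: real
  assumes "c \<noteq> 0" "A \<in> sets lborel"
  shows "ennreal \<bar>c\<bar> * emeasure lborel ((\<lambda>x. d + c * x) -` A) = emeasure lborel A"
proof -
  have "emeasure lborel A = emeasure (density (distr lborel borel (\<lambda>x. d + c * x)) (\<lambda>_. \<bar>c\<bar>)) A"
    using lborel_real_affine[OF assms(1), of d] by simp
  also have "\<dots> = ennreal \<bar>c\<bar> * emeasure (distr lborel borel (\<lambda>x. d + c * x)) A"
    using assms(2) by (subst emeasure_density_const) auto
  also have "emeasure (distr lborel borel (\<lambda>x. d + c * x)) A = emeasure lborel ((\<lambda>x. d + c * x) -` A)"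
    using assms(2) by (subst emeasure_distr) auto
  finally show ?thesis by simp
qed

lemma lborel_on_affine_reindex:
  assumes f_bij: "bij_betw f J I" and finite_J: "finite J" and c_nonzero: "\<And>j. j \<in> J \<Longrightarrow> c j \<noteq> 0"
  shows "density (distr (lborel_on I) (lborel_on J) (\<lambda>y. \<lambda>j\<in>J. d j + c j * y (f j)))
           (\<lambda>_. \<Prod>j\<in>J. ennreal \<bar>c j\<bar>) = lborel_on J" (is "density (distr ?P ?Q ?T) ?c = _")
proof (rule lborel_product.PiM_eqI[OF finite_J])
  have finite_I: "finite I" using f_bij finite_J bij_betw_finite by blast
  have f_in: "f j \<in> I" if "j \<in> J" for j using f_bij that by (auto simp: bij_betw_def)
  show "sets (density (distr ?P ?Q ?T) ?c) = sets ?Q" by simp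
  fix A :: "nat \<Rightarrow> real set" assume A_sets: "\<And>i. i \<in> J \<Longrightarrow> A i \<in> sets lborel"
  let ?g = "inv_into J f"
  let ?B = "\<lambda>i. (\<lambda>x. d (?g i) + c (?g i) * x) -` A (?g i)"
  have inv: "?g (f j) = j" if "j \<in> J" for j using f_bij that by (simp add: bij_betw_def inv_into_f_f)
  have inv': "?g i \<in> J" "f (?g i) = i" if "i \<in> I" for i
    using f_bij that by (auto simp: bij_betw_def inv_into_into f_inv_into_f)
  have "d j + c j * y (f j) \<in> A j" if "j \<in> J" "\<forall>i\<in>I. y i \<in> ?B i" for y j
    using bspec[OF that(2) f_in[OF that(1)]] inv[OF that(1)] by simp
  moreover have "y i \<in> ?B i" if "i \<in> I" "\<forall>j\<in>J. d j + c j * y (f j) \<in> A j" for y i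
    using bspec[OF that(2) inv'(1)[OF that(1)]] inv'(2)[OF that(1)] by simp
  ultimately have vimage: "?T -` Pi\<^sub>E J A \<inter> space ?P = Pi\<^sub>E I ?B"
    by (auto simp: space_PiM PiE_iff)
  have "emeasure (density (distr ?P ?Q ?T) ?c) (Pi\<^sub>E J A) = (\<Prod>j\<in>J. ennreal \<bar>c j\<bar>) * emeasure ?P (Pi\<^sub>E I ?B)"
    using A_sets finite_J measurable_affine_reindex[OF f_in, where c=c and d=d]
    by (simp add: emeasure_density_const emeasure_distr vimage sets_PiM_I_finite)
  also have "emeasure ?P (Pi\<^sub>E I ?B) = (\<Prod>i\<in>I. emeasure lborel (?B i))"
  proof (rule lborel_product.emeasure_PiM[OF finite_I])
    fix i assume "i \<in> I"
    have "(\<lambda>x. d (?g i) + c (?g i) * x) \<in> borel_measurable borel" by measurable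
    from measurable_sets[OF this, of "A (?g i)"] A_sets[OF inv'(1)[OF \<open>i \<in> I\<close>]]
    show "?B i \<in> sets lborel" by simp
  qed
  also have "\<dots> = (\<Prod>j\<in>J. emeasure lborel ((\<lambda>x. d j + c j * x) -` A j))"
    using prod.reindex_bij_betw[OF f_bij, of "\<lambda>i. emeasure lborel (?B i)"] inv by simp
  also have "(\<Prod>j\<in>J. ennreal \<bar>c j\<bar>) * (\<Prod>j\<in>J. emeasure lborel ((\<lambda>x. d j + c j * x) -` A j))
      = (\<Prod>j\<in>J. emeasure lborel (A j))"
    unfolding prod.distrib[symmetric] by (intro prod.cong refl emeasure_lborel_affine_vimage c_nonzero A_sets)
  finally show "emeasure (density (distr ?P ?Q ?T) ?c) (Pi\<^sub>E J A) = (\<Prod>j\<in>J. emeasure lborel (A j))" .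
qed

lemma integral_lborel_on_affine_reindex:
  fixes g :: "(nat \<Rightarrow> real) \<Rightarrow> complex"
  assumes f_bij: "bij_betw f J I" and finite_J: "finite J" and c_nonzero: "\<And>j. j \<in> J \<Longrightarrow> c j \<noteq> 0"
    and g_measurable: "g \<in> borel_measurable (lborel_on J)"
  shows "(\<integral>x. g x \<partial>lborel_on J)
    = of_real (\<Prod>j\<in>J. \<bar>c j\<bar>) * (\<integral>y. g (\<lambda>j\<in>J. d j + c j * y (f j)) \<partial>lborel_on I)"
proof -
  let ?T = "\<lambda>y. \<lambda>j\<in>J. d j + c j * y (f j)"
  have T_measurable: "?T \<in> measurable (lborel_on I) (lborel_on J)"
    using f_bij by (intro measurable_affine_reindex) (auto simp: bij_betw_def)
  have "(\<Prod>j\<in>J. ennreal \<bar>c j\<bar>) = ennreal (\<Prod>j\<in>J. \<bar>c j\<bar>)" by (rule prod_ennreal) auto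
  then have "(\<integral>x. g x \<partial>lborel_on J)
      = (\<integral>x. g x \<partial>density (distr (lborel_on I) (lborel_on J) ?T) (\<lambda>_. ennreal (\<Prod>j\<in>J. \<bar>c j\<bar>)))"
    using lborel_on_affine_reindex[OF f_bij finite_J, of c d] c_nonzero by simp
  also have "\<dots> = (\<integral>x. (\<Prod>j\<in>J. \<bar>c j\<bar>) *\<^sub>R g x \<partial>distr (lborel_on I) (lborel_on J) ?T)"
    using g_measurable by (subst integral_density) (auto intro!: prod_nonneg)
  also have "\<dots> = of_real (\<Prod>j\<in>J. \<bar>c j\<bar>) * (\<integral>x. g x \<partial>distr (lborel_on I) (lborel_on J) ?T)"
    by (simp add: scaleR_conv_of_real)
  also have "(\<integral>x. g x \<partial>distr (lborel_on I) (lborel_on J) ?T) = (\<integral>y. g (?T y) \<partial>lborel_on I)"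
    using g_measurable T_measurable by (intro integral_distr) auto
  finally show ?thesis .
qed

lemma integrable_lborel_on_dominated:
  fixes f :: "(nat \<Rightarrow> real) \<Rightarrow> complex" and w :: "nat \<Rightarrow> real \<Rightarrow> real"
  assumes "finite J" "f \<in> borel_measurable (lborel_on J)" "\<And>i. i \<in> J \<Longrightarrow> integrable lborel (w i)"
    and "\<And>t. norm (f t) \<le> C * (\<Prod>i\<in>J. w i (t i))"
  shows "integrable (lborel_on J) f"
proof (rule Bochner_Integration.integrable_bound)
  show "integrable (lborel_on J) (\<lambda>t. C * (\<Prod>i\<in>J. w i (t i)))"
    using assms(1,3) by (intro integrable_mult_right lborel_product.product_integrable_prod)
  show "AE t in lborel_on J. norm (f t) \<le> norm (C * (\<Prod>i\<in>J. w i (t i)))"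
    by (rule AE_I2) (rule order_trans[OF assms(4)], simp)
qed (rule assms(2))

lemma integrable_lborel_on_insert:
  fixes f :: "(nat \<Rightarrow> real) \<Rightarrow> complex" and g :: "(nat \<Rightarrow> real) \<Rightarrow> real"
  assumes I_insert: "finite I" "i \<notin> I" and f_measurable: "f \<in> borel_measurable (lborel_on (insert i I))"
    and g_integrable: "integrable (lborel_on I) g"
    and bound: "\<And>x. (\<integral>\<^sup>+y. ennreal (norm (f (x(i := y)))) \<partial>lborel) \<le> ennreal (g x)"
  shows "integrable (lborel_on (insert i I)) f"
proof (rule integrableI_bounded[OF f_measurable])
  have "(\<integral>\<^sup>+t. ennreal (norm (f t)) \<partial>lborel_on (insert i I))
      = (\<integral>\<^sup>+x. \<integral>\<^sup>+y. ennreal (norm (f (x(i := y)))) \<partial>lborel \<partial>lborel_on I)"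
    using I_insert f_measurable by (intro lborel_product.product_nn_integral_insert) auto
  also have "\<dots> \<le> (\<integral>\<^sup>+x. ennreal (norm (g x)) \<partial>lborel_on I)"
    by (intro nn_integral_mono order_trans[OF bound]) (auto intro: ennreal_leI)
  also have "\<dots> < \<infinity>" using g_integrable unfolding integrable_iff_bounded by (rule conjunct2)
  finally show "(\<integral>\<^sup>+t. ennreal (norm (f t)) \<partial>lborel_on (insert i I)) < \<infinity>" .
qed

lemma integrable_lborel_on_union_product:
  fixes f g :: "(nat \<Rightarrow> real) \<Rightarrow> complex"
  assumes finite_disjoint: "finite I" "finite J" "I \<inter> J = {}"
    and f_integrable: "integrable (lborel_on I) f" and g_integrable: "integrable (lborel_on J) g"
  shows "integrable (lborel_on (I \<union> J)) (\<lambda>t. f (restrict t I) * g (restrict t J))" (is ?A)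
    and "(\<integral>t. f (restrict t I) * g (restrict t J) \<partial>lborel_on (I \<union> J)) = (\<integral>x. f x \<partial>lborel_on I)
        * (\<integral>y. g y \<partial>lborel_on J)" (is ?B)
proof -
  interpret I: finite_product_sigma_finite "\<lambda>_. lborel :: real measure" I by standard (rule finite_disjoint)
  interpret J: finite_product_sigma_finite "\<lambda>_. lborel :: real measure" J by standard (rule finite_disjoint)
  interpret P: pair_sigma_finite "lborel_on I" "lborel_on J" by standard
  have restrict_merge: "restrict (merge I J (x, y)) I = x" "restrict (merge I J (x, y)) J = y"
    if "x \<in> space (lborel_on I)" "y \<in> space (lborel_on J)" for x y
    using that finite_disjoint(3) by (auto simp: space_PiM PiE_def extensional_restrict)
  have [measurable]: "f \<in> borel_measurable (lborel_on I)" "g \<in> borel_measurable (lborel_on J)"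
    using f_integrable g_integrable by auto
  have meas: "(\<lambda>t. f (restrict t I) * g (restrict t J)) \<in> borel_measurable (lborel_on (I \<union> J))"
    using measurable_restrict_subset[of I "I \<union> J"] measurable_restrict_subset[of J "I \<union> J"] by measurable
  have "integrable (lborel_on I \<Otimes>\<^sub>M lborel_on J) (\<lambda>(x, y). f x * g y)"
    using f_integrable g_integrable by (intro P.Fubini_integrable) (auto simp: norm_mult)
  then have "integrable (lborel_on I \<Otimes>\<^sub>M lborel_on J) (\<lambda>p. f (restrict (merge I J p) I)
      * g (restrict (merge I J p) J))"
    by (subst Bochner_Integration.integrable_cong[OF refl, of _ _ "\<lambda>(x, y). f x * g y"])
      (auto simp: space_pair_measure restrict_merge)
  then have "integrable (distr (lborel_on I \<Otimes>\<^sub>M lborel_on J) (lborel_on (I \<union> J)) (merge I J))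
      (\<lambda>t. f (restrict t I) * g (restrict t J))"
    by (rule integrable_distr_eq[OF measurable_merge meas, THEN iffD2])
  then show A: ?A by (simp only: lborel_product.distr_merge[OF finite_disjoint(3,1,2)])
  have "(\<integral>t. f (restrict t I) * g (restrict t J) \<partial>lborel_on (I \<union> J))
      = (\<integral>x. \<integral>y. f (restrict (merge I J (x, y)) I)
      * g (restrict (merge I J (x, y)) J) \<partial>lborel_on J \<partial>lborel_on I)"
    by (rule lborel_product.product_integral_fold[OF finite_disjoint(3,1,2) A])
  also have "\<dots> = (\<integral>x. \<integral>y. f x * g y \<partial>lborel_on J \<partial>lborel_on I)"
    by (intro Bochner_Integration.integral_cong refl) (simp add: restrict_merge)
  finally show ?B by simp
qed

lemma integral_lborel_on_disjoint_product:
  fixes F :: "'k \<Rightarrow> (nat \<Rightarrow> real) \<Rightarrow> complex"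
  assumes "finite K" "disjoint_family_on A K" "\<And>k. k \<in> K \<Longrightarrow> finite (A k)"
    and "\<And>k. k \<in> K \<Longrightarrow> integrable (lborel_on (A k)) (F k)"
  shows "integrable (lborel_on (\<Union>k\<in>K. A k)) (\<lambda>t. \<Prod>k\<in>K. F k (restrict t (A k))) \<and>
    (\<integral>t. (\<Prod>k\<in>K. F k (restrict t (A k))) \<partial>lborel_on (\<Union>k\<in>K. A k)) = (\<Prod>k\<in>K. \<integral>y. F k y \<partial>lborel_on (A k))"
  using assms
proof (induction K rule: finite_induct)
  case empty
  have "integrable (lborel_on {}) (\<lambda>x. \<Prod>i\<in>({}::nat set). 1 :: complex)"
    by (rule lborel_product.product_integrable_prod) auto
  moreover have "(\<integral>x. (\<Prod>i\<in>({}::nat set). 1) \<partial>lborel_on {}) = (1 :: complex)"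
    using lborel_product.product_integral_prod[of "{}" "\<lambda>_ _. 1 :: complex"] by simp
  ultimately show ?case by simp
next
  case (insert k K)
  let ?U = "\<Union>k\<in>K. A k" and ?G = "\<lambda>t. \<Prod>k\<in>K. F k (restrict t (A k))"
  have "A k \<inter> A j = {}" if "j \<in> K" for j
    using disjoint_family_onD[OF insert.prems(1), of k j] that insert.hyps(2) by auto
  then have disj: "A k \<inter> ?U = {}" by auto
  have IH: "integrable (lborel_on ?U) ?G \<and> (\<integral>t. ?G t \<partial>lborel_on ?U) = (\<Prod>k\<in>K. \<integral>y. F k y \<partial>lborel_on (A k))"
    by (rule insert.IH) (use insert.prems in \<open>auto simp: disjoint_family_on_def\<close>)
  have fin: "finite (A k)" "finite ?U" and F_integrable: "integrable (lborel_on (A k)) (F k)"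
    using insert.prems insert.hyps(1) by auto
  have "?G (restrict t ?U) = ?G t" for t
    by (intro prod.cong refl arg_cong[of _ _ "F _"]) (auto simp: fun_eq_iff)
  then show ?case
    using integrable_lborel_on_union_product[OF fin disj F_integrable conjunct1[OF IH]] insert.hyps IH
    by (simp only: UN_insert prod.insert[OF insert.hyps])
qed

section \<open>Powers of the absolute value\<close>

definition abs_powr :: "real \<Rightarrow> complex \<Rightarrow> complex" where
  "abs_powr x a = complex_of_real \<bar>x\<bar> powr a"

lemma abs_powr_eq_exp: "abs_powr x a = (if x = 0 then 0 else exp (a * of_real (ln \<bar>x\<bar>)))"
  by (simp add: abs_powr_def powr_def Ln_of_real)

lemma abs_powr_0 [simp]: "abs_powr 0 a = 0"
  by (simp add: abs_powr_def)

lemma abs_powr_eq_0_iff [simp]: "abs_powr x a = 0 \<longleftrightarrow> x = 0"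
  by (simp add: abs_powr_def)

lemma abs_powr_1 [simp]: "abs_powr 1 a = 1"
  by (simp add: abs_powr_def)

lemma norm_abs_powr: "norm (abs_powr x a) = \<bar>x\<bar> powr Re a"
  by (simp add: abs_powr_eq_exp powr_def)

lemma abs_powr_minus [simp]: "abs_powr (- x) a = abs_powr x a"
  by (simp add: abs_powr_def)

lemma abs_powr_diff_commute: "abs_powr (x - y) a = abs_powr (y - x) a"
  using abs_powr_minus[of "x - y" a] by simp

lemma abs_powr_mult: "abs_powr (x * y) a = abs_powr x a * abs_powr y a"
  by (simp add: abs_powr_eq_exp abs_mult ln_mult distrib_left exp_add)

lemma abs_powr_divide: "abs_powr (x / y) a = abs_powr x a / abs_powr y a"
  by (simp add: abs_powr_eq_exp ln_div right_diff_distrib exp_diff)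

lemma abs_powr_add: "abs_powr x (a + b) = abs_powr x a * abs_powr x b"
  by (simp add: abs_powr_def powr_add)

lemma abs_powr_exponent_0: "x \<noteq> 0 \<Longrightarrow> abs_powr x 0 = 1"
  by (simp add: abs_powr_def)

lemma abs_powr_sum: "x \<noteq> 0 \<Longrightarrow> abs_powr x (\<Sum>i\<in>S. f i) = (\<Prod>i\<in>S. abs_powr x (f i))"
  by (induction S rule: infinite_finite_induct) (auto simp: abs_powr_add abs_powr_exponent_0)

lemma abs_powr_power: "x \<noteq> 0 \<Longrightarrow> abs_powr x a ^ k = abs_powr x (of_nat k * a)"
  by (simp add: abs_powr_eq_exp exp_of_nat_mult[symmetric] mult_ac)

lemma abs_powr_add_of_nat: "abs_powr x (a + of_nat k) = abs_powr x a * of_real (\<bar>x\<bar> ^ k)"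
proof (cases "x = 0")
  case False
  then have "abs_powr x (of_nat k) = abs_powr x 1 ^ k" by (simp add: abs_powr_power)
  also have "abs_powr x 1 = of_real \<bar>x\<bar>" by (simp add: abs_powr_def)
  finally show ?thesis by (simp add: abs_powr_add)
qed simp

lemma abs_powr_plus_1: "x \<ge> 0 \<Longrightarrow> abs_powr x (a + 1) = abs_powr x a * of_real x"
  using abs_powr_add_of_nat[of x a 1] by simp

lemma abs_powr_minus_1: "x \<ge> 0 \<Longrightarrow> abs_powr x (a - 1) = abs_powr x a / of_real x"
  using abs_powr_plus_1[of x "a - 1"] by (cases "x = 0") auto

lemma measurable_abs_powr [measurable]: "(\<lambda>x. abs_powr x a) \<in> borel_measurable borel"
  unfolding abs_powr_eq_exp by measurable

lemma isCont_abs_powr: "x \<noteq> 0 \<Longrightarrow> isCont (\<lambda>x. abs_powr x a) x"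
  unfolding abs_powr_def by (intro continuous_intros) (auto simp: complex_nonpos_Reals_iff)

lemma tendsto_abs_powr: "(f \<longlongrightarrow> x) F \<Longrightarrow> x \<noteq> 0 \<Longrightarrow> ((\<lambda>k. abs_powr (f k) a) \<longlongrightarrow> abs_powr x a) F"
  using isCont_tendsto_compose[OF isCont_abs_powr] by blast

lemma continuous_on_abs_powr:
  assumes "Re a > 0"
  shows "continuous_on S (\<lambda>x. abs_powr x a)"
proof (rule continuous_at_imp_continuous_on, rule ballI)
  fix x
  show "isCont (\<lambda>x. abs_powr x a) x"
  proof (cases "x = 0")
    case True
    have "((\<lambda>x::real. \<bar>x\<bar> powr Re a) \<longlongrightarrow> 0 powr Re a) (at 0)"
      using assms by (intro tendsto_powr2) (auto intro!: tendsto_eq_intros)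
    then have "((\<lambda>x. norm (abs_powr x a)) \<longlongrightarrow> 0) (at 0)" by (simp add: norm_abs_powr)
    then have "((\<lambda>x. abs_powr x a) \<longlongrightarrow> 0) (at 0)" by (rule tendsto_norm_zero_cancel)
    then show ?thesis using True by (simp add: isCont_def)
  qed (rule isCont_abs_powr)
qed

lemma has_real_derivative_ln_abs:
  assumes "x \<noteq> 0"
  shows "((\<lambda>x. ln \<bar>x\<bar>) has_real_derivative 1 / x) (at x)"
proof -
  have "((\<lambda>y. ln (y * sgn x)) has_real_derivative 1 / x) (at x)"
    using assms by (auto intro!: derivative_eq_intros simp: sgn_if field_simps)
  moreover have "\<forall>\<^sub>F y in nhds x. y \<in> {y. 0 < y * sgn x}"
    using assms by (intro eventually_nhds_in_open open_Collect_less continuous_intros) (auto simp: sgn_if)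
  then have "\<forall>\<^sub>F y in nhds x. ln (y * sgn x) = ln \<bar>y\<bar>"
    by eventually_elim (auto simp: sgn_if zero_less_mult_iff split: if_splits)
  ultimately show ?thesis by (simp add: DERIV_cong_ev)
qed

lemma has_vector_derivative_abs_powr:
  assumes "x \<noteq> c"
  shows "((\<lambda>x. abs_powr (x - c) a) has_vector_derivative a / of_real (x - c) * abs_powr (x - c) a) (at x)"
proof -
  have "((\<lambda>x. ln \<bar>x - c\<bar>) has_real_derivative 1 / (x - c)) (at x)"
    using DERIV_shift[of "\<lambda>x. ln \<bar>x\<bar>" "1 / (x - c)" x "- c"] has_real_derivative_ln_abs[of "x - c"] assms
    by simp
  then have "((\<lambda>x. a * of_real (ln \<bar>x - c\<bar>)) has_vector_derivative a * of_real (1 / (x - c))) (at x)"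
    by (intro has_vector_derivative_mult_right has_vector_derivative_of_real)
       (simp add: has_real_derivative_iff_has_vector_derivative)
  from field_vector_diff_chain_at[OF this DERIV_exp]
  have "((\<lambda>x. exp (a * of_real (ln \<bar>x - c\<bar>))) has_vector_derivative a * of_real (1 / (x - c))
      * exp (a * of_real (ln \<bar>x - c\<bar>))) (at x)"
    by (simp add: o_def)
  then have "((\<lambda>x. abs_powr (x - c) a) has_vector_derivative a * of_real (1 / (x - c))
      * exp (a * of_real (ln \<bar>x - c\<bar>))) (at x)"
    by (rule has_vector_derivative_transform_within_open[where S="- {c}"])
      (use assms in \<open>auto simp: abs_powr_eq_exp\<close>)
  then show ?thesis using assms by (simp add: abs_powr_eq_exp)
qed

lemma has_vector_derivative_prod_abs_powr:
  assumes "finite S" "\<And>k. k \<in> S \<Longrightarrow> x \<noteq> c k"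
  shows "((\<lambda>x. \<Prod>k\<in>S. abs_powr (x - c k) (a k)) has_vector_derivative
    (\<Prod>k\<in>S. abs_powr (x - c k) (a k)) * (\<Sum>k\<in>S. a k / of_real (x - c k))) (at x)"
  using assms
proof (induction S rule: finite_induct)
  case (insert k S)
  let ?P = "\<Prod>k\<in>S. abs_powr (x - c k) (a k)" and ?s = "\<Sum>k\<in>S. a k / of_real (x - c k)"
  have "((\<lambda>x. abs_powr (x - c k) (a k) * (\<Prod>k\<in>S. abs_powr (x - c k) (a k))) has_vector_derivative
      abs_powr (x - c k) (a k) * (?P * ?s) + a k / of_real (x - c k) * abs_powr (x - c k) (a k) * ?P) (at x)"
    using insert by (intro has_vector_derivative_mult has_vector_derivative_abs_powr) auto
  then show ?case using insert.hyps by (simp add: algebra_simps)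
qed simp

section \<open>Integrals in one variable\<close>

lemma set_integral_derivative_eq_0:
  fixes F f :: "real \<Rightarrow> complex"
  assumes "continuous_on {a..b} F" "\<And>x. x \<in> {a<..<b} \<Longrightarrow> (F has_vector_derivative f x) (at x)" "F a = 0" "F b = 0"
  shows "(LINT y:{a..b}|lborel. f y) = 0"
proof (cases "set_integrable lborel {a..b} f")
  case False
  then show ?thesis unfolding set_integrable_def set_lebesgue_integral_def by (rule not_integrable_integral_eq)
next
  case int: True
  show ?thesis
  proof (cases "a < b")
    case False
    then have "AE y in lborel. indicator {a..b} y *\<^sub>R f y = 0"
      using AE_lborel_singleton[of a] by (auto elim!: eventually_mono simp: indicator_def)
    then have "(\<integral>y. indicator {a..b} y *\<^sub>R f y \<partial>lborel) = (\<integral>y. 0 \<partial>(lborel :: real measure))"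
      using int by (intro integral_cong_AE) (auto simp: set_integrable_def)
    then show ?thesis by (simp add: set_lebesgue_integral_def)
  next
    case True
    have "(f has_integral (F b - F a)) {a..b}"
      using assms True by (intro fundamental_theorem_of_calculus_interior) auto
    then show ?thesis
      using set_borel_integral_eq_integral(2)[OF int] assms(3,4) by (simp add: integral_unique)
  qed
qed

lemma nn_integral_abs_powr_symmetric:
  fixes a L :: real
  assumes "a > 0" "L \<ge> 0"
  shows "(\<integral>\<^sup>+t. ennreal (indicator {-L..L} t * \<bar>t\<bar> powr (a - 1)) \<partial>lborel) \<le> ennreal (2 * (L powr a / a))"
proof -
  let ?g = "\<lambda>t. indicator {0..L} t * t powr (a - 1)"
  have "((\<lambda>t. if t \<in> {0..L} then t powr (a - 1) else 0) has_integral (L powr a / a)) UNIV"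
    unfolding has_integral_restrict_UNIV using has_integral_powr_from_0[of "a - 1" L] assms by simp
  then have "(?g has_integral (L powr a / a)) UNIV"
    by (rule has_integral_eq[rotated]) (auto simp: indicator_def)
  then have right: "(\<integral>\<^sup>+t. ennreal (?g t) \<partial>lborel) = ennreal (L powr a / a)"
    by (intro nn_integral_has_integral_lborel) auto
  then have left: "(\<integral>\<^sup>+t. ennreal (?g (- t)) \<partial>lborel) = ennreal (L powr a / a)"
    using nn_integral_real_affine[of "\<lambda>t. ennreal (?g t)" "-1" 0] by simp
  have "(\<integral>\<^sup>+t. ennreal (indicator {-L..L} t * \<bar>t\<bar> powr (a - 1)) \<partial>lborel)
      \<le> (\<integral>\<^sup>+t. ennreal (?g t) + ennreal (?g (- t)) \<partial>lborel)"
    by (rule nn_integral_mono) (auto simp: indicator_def abs_real_def)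
  also have "\<dots> = ennreal (L powr a / a) + ennreal (L powr a / a)"
    by (subst nn_integral_add) (auto simp: left right)
  also have "\<dots> = ennreal (2 * (L powr a / a))" using assms by (simp flip: ennreal_plus)
  finally show ?thesis .
qed

lemma nn_integral_abs_powr_le:
  fixes a c A B :: real
  assumes "a > 0" "c \<in> {A..B}"
  shows "(\<integral>\<^sup>+t. ennreal (indicator {A..B} t * \<bar>t - c\<bar> powr (a - 1)) \<partial>lborel)
      \<le> ennreal (2 * ((B - A) powr a / a))"
proof -
  let ?g = "\<lambda>t. indicator {-(B - A)..B - A} t * \<bar>t\<bar> powr (a - 1)"
  have "(\<integral>\<^sup>+t. ennreal (indicator {A..B} t * \<bar>t - c\<bar> powr (a - 1)) \<partial>lborel)
      \<le> (\<integral>\<^sup>+t. ennreal (?g (t - c)) \<partial>lborel)"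
    using assms by (intro nn_integral_mono) (auto simp: indicator_def)
  also have "\<dots> = (\<integral>\<^sup>+t. ennreal (?g t) \<partial>lborel)"
    using nn_integral_real_affine[of "\<lambda>t. ennreal (?g t)" 1 "- c"] by simp
  also have "\<dots> \<le> ennreal (2 * ((B - A) powr a / a))" using assms by (intro nn_integral_abs_powr_symmetric) auto
  finally show ?thesis .
qed

lemma set_integrable_abs_powr:
  fixes e c A B :: real
  assumes "e > - 1" "c \<in> {A..B}"
  shows "set_integrable lborel {A..B} (\<lambda>t. \<bar>t - c\<bar> powr e)"
  unfolding set_integrable_def
proof (rule integrableI_bounded)
  have "(\<integral>\<^sup>+t. ennreal (norm (indicator {A..B} t *\<^sub>R \<bar>t - c\<bar> powr e)) \<partial>lborel)
     = (\<integral>\<^sup>+t. ennreal (indicator {A..B} t * \<bar>t - c\<bar> powr (e + 1 - 1)) \<partial>lborel)" by simp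
  also have "\<dots> < \<infinity>" using nn_integral_abs_powr_le[of "e + 1" c A B] assms by (simp add: order_le_less_trans)
  finally show "(\<integral>\<^sup>+t. ennreal (norm (indicator {A..B} t *\<^sub>R \<bar>t - c\<bar> powr e)) \<partial>lborel) < \<infinity>" .
qed simp

lemma powr_le_powr_add_powr:
  fixes x :: real
  assumes "0 < d" "d \<le> x" "x \<le> L"
  shows "x powr e \<le> d powr e + L powr e"
proof (cases "e \<ge> 0")
  case True
  then have "x powr e \<le> L powr e" using assms by (intro powr_mono2) auto
  then show ?thesis by (simp add: add_increasing)
next
  case False
  then have "x powr e \<le> d powr e" using assms by (intro powr_mono2') auto
  then show ?thesis by (simp add: add_increasing2)
qed

lemma abs_powr_mult_abs_powr_le:
  fixes b c L :: real
  assumes "b \<noteq> c"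
  obtains C where "C \<ge> 0"
    "\<And>t. \<bar>t - b\<bar> \<le> L \<Longrightarrow> \<bar>t - c\<bar> \<le> L \<Longrightarrow> \<bar>t - b\<bar> powr e * \<bar>t - c\<bar> powr f \<le> C * (\<bar>t - b\<bar> powr e + \<bar>t - c\<bar> powr f)"
proof -
  define d where "d = \<bar>b - c\<bar> / 2"
  define C where "C = (d powr e + L powr e) + (d powr f + L powr f)"
  have d_pos: "d > 0" using assms by (simp add: d_def)
  have far: "\<bar>x\<bar> powr g * y \<le> C * (\<bar>x\<bar> powr g + y)"
    if "d \<le> \<bar>x\<bar>" "\<bar>x\<bar> \<le> L" "g = e \<or> g = f" "y \<ge> 0" for x g y :: real
  proof -
    have "\<bar>x\<bar> powr g \<le> d powr g + L powr g" using that d_pos by (intro powr_le_powr_add_powr) auto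
    also have "\<dots> \<le> C" using that(3) by (auto simp: C_def)
    finally have "\<bar>x\<bar> powr g * y \<le> C * y" using that(4) by (rule mult_right_mono)
    moreover have "0 \<le> C * \<bar>x\<bar> powr g" by (simp add: C_def)
    ultimately show ?thesis by (simp add: distrib_left)
  qed
  have "\<bar>t - b\<bar> powr e * \<bar>t - c\<bar> powr f \<le> C * (\<bar>t - b\<bar> powr e + \<bar>t - c\<bar> powr f)"
    if "\<bar>t - b\<bar> \<le> L" "\<bar>t - c\<bar> \<le> L" for t
  proof (cases "d \<le> \<bar>t - b\<bar>")
    case True
    then show ?thesis using that by (intro far) auto
  next
    case False
    then have "d \<le> \<bar>t - c\<bar>" by (simp add: d_def abs_real_def split: if_splits)
    then show ?thesis using far[of "t - c" f "\<bar>t - b\<bar> powr e"] that by (simp add: mult.commute add.commute)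
  qed
  then show ?thesis using that[of C] by (simp add: C_def)
qed

lemma prod_abs_powr_le_sum:
  fixes c :: "'k \<Rightarrow> real"
  assumes "finite K" "inj_on c K"
  shows "\<exists>C\<ge>0. \<forall>t. (\<forall>k\<in>K. \<bar>t - c k\<bar> \<le> L) \<longrightarrow> (\<Prod>k\<in>K. \<bar>t - c k\<bar> powr e k) \<le> C * (1 + (\<Sum>k\<in>K. \<bar>t - c k\<bar> powr e k))"
  using assms
proof (induction K rule: finite_induct)
  case (insert k K)
  let ?f = "\<lambda>k t. \<bar>t - c k\<bar> powr e k"
  obtain C where C: "C \<ge> 0" "\<And>t. (\<forall>j\<in>K. \<bar>t - c j\<bar> \<le> L) \<Longrightarrow> (\<Prod>j\<in>K. ?f j t) \<le> C * (1 + (\<Sum>j\<in>K. ?f j t))"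
    using insert by auto
  have "\<exists>D. D \<ge> 0 \<and> (\<forall>t. \<bar>t - c k\<bar> \<le> L \<longrightarrow> \<bar>t - c j\<bar> \<le> L \<longrightarrow> ?f k t * ?f j t \<le> D * (?f k t + ?f j t))" if "j \<in> K"
    for j
  proof -
    have "c k \<noteq> c j" using insert.prems insert.hyps(2) that by auto
    then show ?thesis by (rule abs_powr_mult_abs_powr_le[of "c k" "c j" L "e k" "e j"]) blast
  qed
  then obtain D where D: "\<And>j. j \<in> K \<Longrightarrow> D j \<ge> 0"
    "\<And>j t. j \<in> K \<Longrightarrow> \<bar>t - c k\<bar> \<le> L \<Longrightarrow> \<bar>t - c j\<bar> \<le> L \<Longrightarrow> ?f k t * ?f j t \<le> D j * (?f k t + ?f j t)"
    by metis
  define E where "E = (\<Sum>j\<in>K. D j)"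
  have D_le_E: "D j \<le> E" if "j \<in> K" for j
    unfolding E_def using insert.hyps(1) D(1) that by (intro member_le_sum) auto
  have E_nonneg: "E \<ge> 0" unfolding E_def using D(1) by (rule sum_nonneg)
  have "?f k t * (\<Prod>j\<in>K. ?f j t) \<le> C * (1 + E + E * card K) * (1 + (?f k t + (\<Sum>j\<in>K. ?f j t)))"
    if t_near: "\<forall>j\<in>insert k K. \<bar>t - c j\<bar> \<le> L" for t
  proof -
    have "?f k t * (\<Prod>j\<in>K. ?f j t) \<le> C * (?f k t + (\<Sum>j\<in>K. ?f k t * ?f j t))"
      using mult_left_mono[OF C(2)[of t], of "?f k t"] t_near by (simp add: algebra_simps sum_distrib_left)
    also have "(\<Sum>j\<in>K. ?f k t * ?f j t) \<le> (\<Sum>j\<in>K. E * (?f k t + ?f j t))"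
      using D(2) D_le_E t_near by (intro sum_mono) (meson insertCI mult_right_mono add_nonneg_nonneg order_trans
        powr_ge_zero)
    also have "\<dots> = E * card K * ?f k t + E * (\<Sum>j\<in>K. ?f j t)"
      by (simp add: sum.distrib distrib_left sum_distrib_left)
    also have "?f k t + \<dots> \<le> (1 + E + E * card K) * (1 + (?f k t + (\<Sum>j\<in>K. ?f j t)))"
      using E_nonneg by (simp add: algebra_simps sum_nonneg)
    finally show ?thesis using C(1) by (simp add: mult_left_mono mult.assoc)
  qed
  then show ?case using insert.hyps C(1) E_nonneg by (intro exI[of _ "C * (1 + E + E * card K)"]) simp
qed (auto intro: exI[of _ 1])

lemma set_integrable_prod_abs_powr:
  fixes c :: "'k \<Rightarrow> real"
  assumes K_inj: "finite K" "inj_on c K" and c_in: "\<And>k. k \<in> K \<Longrightarrow> c k \<in> {A..B}"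
    and e_greater: "\<And>k. k \<in> K \<Longrightarrow> e k > - 1"
  shows "set_integrable lborel {A..B} (\<lambda>t. \<Prod>k\<in>K. \<bar>t - c k\<bar> powr e k)"
proof -
  obtain C where C: "C \<ge> 0"
    "\<And>t. (\<forall>k\<in>K. \<bar>t - c k\<bar> \<le> B - A) \<Longrightarrow> (\<Prod>k\<in>K. \<bar>t - c k\<bar> powr e k) \<le> C * (1 + (\<Sum>k\<in>K. \<bar>t - c k\<bar> powr e k))"
    using prod_abs_powr_le_sum[OF K_inj, of "B - A" e] by blast
  have "set_integrable lborel {A..B} (\<lambda>t. \<Sum>k\<in>K. \<bar>t - c k\<bar> powr e k)"
    unfolding set_integrable_def scaleR_sum_right
    using set_integrable_abs_powr[OF e_greater c_in] by (intro Bochner_Integration.integrable_sum)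
      (auto simp: set_integrable_def)
  then have "set_integrable lborel {A..B} (\<lambda>t. C * (1 + (\<Sum>k\<in>K. \<bar>t - c k\<bar> powr e k)))"
    by (intro set_integrable_mult_right set_integral_add) (auto simp: set_integrable_def emeasure_lborel_Icc_eq)
  then show ?thesis
  proof (rule set_integrable_bound)
    show "AE t in lborel. t \<in> {A..B} \<longrightarrow> norm (\<Prod>k\<in>K. \<bar>t - c k\<bar> powr e k)
        \<le> norm (C * (1 + (\<Sum>k\<in>K. \<bar>t - c k\<bar> powr e k)))"
    proof (intro AE_I2 impI)
      fix t assume "t \<in> {A..B}"
      then have "(\<Prod>k\<in>K. \<bar>t - c k\<bar> powr e k) \<le> C * (1 + (\<Sum>k\<in>K. \<bar>t - c k\<bar> powr e k))"
        using c_in by (intro C(2)) (fastforce simp: abs_real_def)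
      then show "norm (\<Prod>k\<in>K. \<bar>t - c k\<bar> powr e k) \<le> norm (C * (1 + (\<Sum>k\<in>K. \<bar>t - c k\<bar> powr e k)))"
        using C(1) by (simp add: prod_nonneg sum_nonneg)
    qed
  qed (simp add: set_borel_measurable_def)
qed

definition gamma_majorant :: "real \<Rightarrow> real \<Rightarrow> real \<Rightarrow> real" where
  "gamma_majorant a Q y = indicator {0..} y * (y powr (a - 1) * (1 + y) powr Q * exp (- y))"

lemma gamma_majorant_nonneg: "gamma_majorant a Q y \<ge> 0"
  by (simp add: gamma_majorant_def)

lemma measurable_gamma_majorant [measurable]: "gamma_majorant a Q \<in> borel_measurable borel"
  unfolding gamma_majorant_def by measurable

lemma gamma_majorant_mult_powr: "y \<ge> 0 \<Longrightarrow> gamma_majorant a Q y * (1 + y) powr R = gamma_majorant a (Q + R) y"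
  by (simp add: gamma_majorant_def powr_add mult_ac)

lemma integrable_gamma_density:
  assumes "a > 0"
  shows "integrable lborel (gamma_majorant a 0)"
proof -
  have "((\<lambda>t. if t \<in> {0..} then t powr (a - 1) / exp t else 0) has_integral Gamma a) UNIV"
    unfolding has_integral_restrict_UNIV by (rule Gamma_integral_real[OF assms])
  then have "(gamma_majorant a 0 has_integral Gamma a) UNIV"
    by (rule has_integral_eq[rotated]) (auto simp: gamma_majorant_def indicator_def exp_minus field_simps)
  then have "(\<integral>\<^sup>+t. ennreal (gamma_majorant a 0 t) \<partial>lborel) = ennreal (Gamma a)"
    using gamma_majorant_nonneg by (intro nn_integral_has_integral_lborel) auto
  then show ?thesis using gamma_majorant_nonneg by (intro integrableI_bounded) auto
qed

lemma one_plus_powr_le: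
  fixes t Q :: real
  assumes "t \<ge> 0" "Q \<ge> 0"
  shows "(1 + t) powr Q \<le> 2 powr Q * (1 + t powr Q)"
proof (cases "t \<le> 1")
  case True
  have "(1 + t) powr Q \<le> 2 powr Q" using assms True by (intro powr_mono2) auto
  then show ?thesis by (simp add: distrib_left add_increasing2)
next
  case False
  have "(1 + t) powr Q \<le> (2 * t) powr Q" using assms False by (intro powr_mono2) auto
  also have "\<dots> = 2 powr Q * t powr Q" using False by (simp add: powr_mult)
  also have "\<dots> \<le> 2 powr Q * (1 + t powr Q)" by (intro mult_left_mono) auto
  finally show ?thesis .
qed

lemma integrable_gamma_majorant:
  assumes "a > 0" "Q \<ge> 0"
  shows "integrable lborel (gamma_majorant a Q)"
proof (rule Bochner_Integration.integrable_bound)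
  let ?g = "\<lambda>t. 2 powr Q * (gamma_majorant a 0 t + gamma_majorant (a + Q) 0 t)"
  show "integrable lborel ?g"
    using assms by (intro integrable_mult_right Bochner_Integration.integrable_add integrable_gamma_density)
      auto
  have "gamma_majorant a Q t \<le> ?g t" for t
  proof (cases "t \<ge> 0")
    case True
    have "t powr (a - 1) * (1 + t) powr Q * exp (- t) \<le> t powr (a - 1) * (2 powr Q * (1 + t powr Q))
        * exp (- t)"
      using one_plus_powr_le[OF True assms(2)] by (intro mult_right_mono mult_left_mono) auto
    also have "\<dots> = 2 powr Q * (t powr (a - 1) * exp (- t) + t powr (a - 1) * t powr Q * exp (- t))"
      by (simp add: algebra_simps)
    also have "t powr (a - 1) * t powr Q = t powr (a + Q - 1)" by (simp add: powr_add[symmetric] algebra_simps)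
    finally show ?thesis using True by (simp add: gamma_majorant_def)
  qed (simp add: gamma_majorant_def indicator_def)
  then show "AE t in lborel. norm (gamma_majorant a Q t) \<le> norm (?g t)"
    using gamma_majorant_nonneg by (intro AE_I2) (simp add: add_nonneg_nonneg)
qed simp

lemma set_integral_exp_half_line:
  assumes c_pos: "c > 0"
  shows "(LINT u:{0<..}|lborel. complex_of_real (exp (- c * u))) = of_real (1 / c)"
proof -
  have "((\<lambda>u. if u \<in> {0..} then exp (- c * u) else 0) has_integral exp (- c * 0) / c) UNIV"
    unfolding has_integral_restrict_UNIV using has_integral_exp_minus_to_infinity[OF c_pos, of 0] by simp
  then have "((\<lambda>u. if u \<in> {0..} then exp (- c * u) else 0) has_integral 1 / c) UNIV" by simp
  then have "((\<lambda>u. indicator {0..} u *\<^sub>R exp (- c * u)) has_integral 1 / c) UNIV"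
    by (rule has_integral_eq[rotated]) (auto simp: indicator_def)
  then have "(\<integral>\<^sup>+u. ennreal (indicator {0..} u *\<^sub>R exp (- c * u)) \<partial>lborel) = ennreal (1 / c)"
    by (intro nn_integral_has_integral_lborel) auto
  then have "(LINT u:{0..}|lborel. exp (- c * u)) = 1 / c"
    unfolding set_lebesgue_integral_def using c_pos by (subst integral_eq_nn_integral) auto
  then have "(LINT u:{0..}|lborel. complex_of_real (exp (- c * u))) = of_real (1 / c)"
    by (simp only: set_integral_complex_of_real)
  moreover have "(LINT u:{0<..}|lborel. complex_of_real (exp (- c * u)))
      = (LINT u:{0..}|lborel. complex_of_real (exp (- c * u)))"
    using AE_lborel_singleton[of 0]
    by (intro set_integral_cong_set) (auto simp: set_borel_measurable_def elim!: eventually_mono)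
  ultimately show ?thesis by simp
qed

lemma powr_times_power_tendsto_0:
  fixes a x :: real
  assumes "0 < x" "x < 1"
  shows "(\<lambda>k. real (Suc k) powr a * x ^ Suc k) \<longlonglongrightarrow> 0"
proof -
  define b where "b = - ln x"
  have b_pos: "b > 0" using assms by (simp add: b_def)
  have "(\<lambda>k. real (Suc k) powr a * exp (- b * real (Suc k))) \<longlonglongrightarrow> 0" using b_pos by real_asymp
  moreover have "exp (- b * real (Suc k)) = x ^ Suc k" for k
    using assms exp_of_nat_mult[of "Suc k" "ln x"] by (simp add: b_def mult.commute del: of_nat_Suc)
  ultimately show ?thesis by simp
qed

lemma one_minus_divide_power_le_exp:
  assumes "0 \<le> y" "y \<le> real K" "K > 0"
  shows "(1 - y / real K) ^ K \<le> exp (- y)"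
proof -
  have "(1 - y / real K) ^ K \<le> exp (- (y / real K)) ^ K"
    using assms exp_ge_add_one_self[of "- (y / real K)"] by (intro power_mono) (auto simp: divide_le_eq_1)
  also have "\<dots> = exp (- y)" using assms exp_of_nat_mult[of K "- (y / real K)"] by simp
  finally show ?thesis .
qed

lemma one_minus_divide_power_tendsto_exp: "(\<lambda>k. (1 - y / real (Suc k)) ^ Suc k) \<longlonglongrightarrow> exp (- y)"
  using LIMSEQ_Suc[OF tendsto_exp_limit_sequentially[of "- y"]] by simp

lemma Re_pos_not_nonpos_Ints: "Re x > 0 \<Longrightarrow> x \<notin> \<int>\<^sub>\<le>\<^sub>0"
  by (auto elim!: nonpos_Ints_cases)

lemma Gamma_nonzero_Re_pos: "Re x > 0 \<Longrightarrow> Gamma x \<noteq> 0"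
  using Re_pos_not_nonpos_Ints by (simp add: Gamma_eq_zero_iff)

lemma pochhammer_ratio_tendsto_Gamma_ratio:
  fixes x y :: complex
  assumes x_pos: "Re x > 0" and y_pos: "Re y > 0"
  shows "(\<lambda>k. pochhammer x (Suc k) / pochhammer y (Suc k) * abs_powr (real (Suc k)) (y - x))
      \<longlonglongrightarrow> Gamma y / Gamma x"
proof -
  have "(\<lambda>k. Gamma_series' y (Suc k) / Gamma_series' x (Suc k)) \<longlonglongrightarrow> Gamma y / Gamma x"
    using x_pos y_pos by (intro tendsto_divide LIMSEQ_Suc[OF Gamma_series'_LIMSEQ] Gamma_nonzero_Re_pos)
  moreover have "Gamma_series' y (Suc k) / Gamma_series' x (Suc k)
      = pochhammer x (Suc k) / pochhammer y (Suc k) * abs_powr (real (Suc k)) (y - x)" for k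
  proof -
    have "pochhammer x (Suc k) \<noteq> 0" "pochhammer y (Suc k) \<noteq> 0" using x_pos y_pos
      by (auto simp: pochhammer_eq_0_iff)
    moreover have "exp (y * of_real (ln (real (Suc k)))) / exp (x * of_real (ln (real (Suc k))))
        = abs_powr (real (Suc k)) (y - x)"
      by (simp add: abs_powr_eq_exp exp_diff[symmetric] left_diff_distrib del: of_nat_Suc)
    ultimately show ?thesis unfolding Gamma_series'_def
      by (simp add: divide_simps mult_ac del: of_nat_Suc pochhammer_Suc)
  qed
  ultimately show ?thesis by simp
qed

lemma br_pow_of_real: "br_pow (of_real x) a = abs_powr x a * (if x < 0 then exp (\<i> * pi * a) else 1)"
proof -
  consider "x = 0" | "x > 0" | "x < 0" by linarith
  then show ?thesis
  proof cases
    case 2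
    then have "br_log (of_real x) = of_real (ln x)" using pi_gt_zero by (simp add: br_log_def Ln_of_real not_le)
    then show ?thesis using 2 by (simp add: br_pow_def abs_powr_eq_exp)
  next
    case 3
    have Ln_eq: "Ln (of_real x) = of_real (ln (- x)) + \<i> * pi"
      using Ln_minus[of "of_real (- x)"] 3 Ln_of_real[of "- x"] by simp
    have "\<not> Im (Ln (of_real x)) \<le> - pi / 2" unfolding Ln_eq by simp (use pi_gt_zero in linarith)
    then have "br_log (of_real x) = of_real (ln (- x)) + \<i> * pi" unfolding br_log_def using Ln_eq by simp
    then show ?thesis using 3 by (simp add: br_pow_def abs_powr_eq_exp distrib_left exp_add mult_ac)
  qed (simp add: br_pow_def)
qed

section \<open>The weight and its integrability\<close>

definition vandermonde :: "nat set \<Rightarrow> complex \<Rightarrow> (nat \<Rightarrow> real) \<Rightarrow> complex" where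
  "vandermonde A \<gamma> t = (\<Prod>(i, j)\<in>less_pairs A. abs_powr (t j - t i) (2 * \<gamma>))"

lemma vandermonde_cong: "(\<And>i. i \<in> A \<Longrightarrow> t i = u i) \<Longrightarrow> vandermonde A \<gamma> t = vandermonde A \<gamma> u"
  unfolding vandermonde_def by (intro prod.cong refl) (auto simp: less_pairs_def)

lemma vandermonde_insert:
  assumes "finite A" "i \<notin> A"
  shows "vandermonde (insert i A) \<gamma> t = (\<Prod>j\<in>A. abs_powr (t i - t j) (2 * \<gamma>)) * vandermonde A \<gamma> t"
proof -
  have "(\<Prod>(i, j)\<in>less_pairs (insert i A). abs_powr (t j - t i) (2 * \<gamma>))
      = (\<Prod>j\<in>A. abs_powr (t j - t i) (2 * \<gamma>)) * (\<Prod>(i, j)\<in>less_pairs A. abs_powr (t j - t i) (2 * \<gamma>))"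
    by (subst prod_less_pairs_insert[OF assms])
      (simp only: prod.case, rule abs_powr_diff_commute, simp only: prod.case)
  also have "(\<Prod>j\<in>A. abs_powr (t j - t i) (2 * \<gamma>)) = (\<Prod>j\<in>A. abs_powr (t i - t j) (2 * \<gamma>))"
    by (intro prod.cong refl abs_powr_diff_commute)
  finally show ?thesis unfolding vandermonde_def .
qed

lemma vandermonde_reindex:
  "bij_betw f A B \<Longrightarrow> vandermonde A \<gamma> (\<lambda>i. t (f i)) = vandermonde B \<gamma> t"
  unfolding vandermonde_def
  by (rule prod_less_pairs_reindex[where g="\<lambda>i j. abs_powr (t j - t i) (2 * \<gamma>)"])
    (auto intro: abs_powr_diff_commute)

lemma measurable_vandermonde: "A \<subseteq> J \<Longrightarrow> vandermonde A \<gamma> \<in> borel_measurable (lborel_on J)"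
  unfolding vandermonde_def case_prod_unfold
proof (rule borel_measurable_prod)
  fix x assume "A \<subseteq> J" "x \<in> less_pairs A"
  then have [measurable]: "(\<lambda>t. t (fst x)) \<in> borel_measurable (lborel_on J)"
    "(\<lambda>t. t (snd x)) \<in> borel_measurable (lborel_on J)"
    by (auto simp: less_pairs_def intro!: measurable_component_lborel_on)
  show "(\<lambda>t. abs_powr (t (snd x) - t (fst x)) (2 * \<gamma>)) \<in> borel_measurable (lborel_on J)" by measurable
qed

lemma norm_abs_powr_diff_le:
  assumes "x \<in> {a..b}" "y \<in> {a..b}" "Re c \<ge> 0"
  shows "norm (abs_powr (x - y) c) \<le> (b - a) powr Re c"
  unfolding norm_abs_powr using assms by (intro powr_mono2) auto

lemma norm_vandermonde_le:
  assumes "\<And>i. i \<in> A \<Longrightarrow> t i \<in> {a..b}" "Re \<gamma> \<ge> 0"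
  shows "norm (vandermonde A \<gamma> t) \<le> ((b - a) powr (2 * Re \<gamma>)) ^ card (less_pairs A)"
proof -
  have "norm (vandermonde A \<gamma> t) = (\<Prod>(i, j)\<in>less_pairs A. norm (abs_powr (t j - t i) (2 * \<gamma>)))"
    by (simp add: vandermonde_def prod_norm[symmetric] case_prod_unfold)
  also have "\<dots> \<le> (\<Prod>x\<in>less_pairs A. (b - a) powr (2 * Re \<gamma>))"
    using norm_abs_powr_diff_le[OF assms(1) assms(1), of _ _ "2 * \<gamma>"] assms(2)
    by (intro prod_mono) (auto simp: less_pairs_def)
  finally show ?thesis by simp
qed

lemma pred_mono_on:
  assumes "finite A" "A \<subseteq> J"
  shows "Measurable.pred (lborel_on J) (\<lambda>t. mono_on A t)"
proof -
  have mono_on_iff: "mono_on A t \<longleftrightarrow> (\<forall>x\<in>less_pairs A. t (fst x) \<le> t (snd x))" for t :: "nat \<Rightarrow> real"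
    by (auto simp: less_pairs_def mono_on_def order_le_less)
  show ?thesis
    unfolding mono_on_iff
  proof (rule pred_intros_finite(3))
    fix x assume "x \<in> less_pairs A"
    then have "fst x \<in> J" "snd x \<in> J" using assms(2) by (auto simp: less_pairs_def)
    then show "Measurable.pred (lborel_on J) (\<lambda>t. t (fst x) \<le> t (snd x))"
      unfolding pred_def by (intro borel_measurable_le measurable_component_lborel_on)
  qed (use assms(1) in simp)
qed

definition point_weight :: "nat \<Rightarrow> (nat \<Rightarrow> real) \<Rightarrow> (nat \<Rightarrow> complex) \<Rightarrow> real \<Rightarrow> complex" where
  "point_weight p z \<alpha> t = (\<Prod>s=1..p. abs_powr (t - z s) (\<alpha> s))"

lemma measurable_point_weight [measurable]: "point_weight p z \<alpha> \<in> borel_measurable borel"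
  unfolding point_weight_def by measurable

lemma point_weight_remove:
  "s \<in> {1..p} \<Longrightarrow> point_weight p z \<alpha> t = abs_powr (t - z s) (\<alpha> s) * (\<Prod>r\<in>{1..p} - {s}. abs_powr (t - z r) (\<alpha> r))"
  unfolding point_weight_def by (intro prod.remove) auto

lemma point_weight_raise_last:
  assumes "p \<ge> 1" "t \<le> z p"
  shows "point_weight p z (\<alpha>(p := \<alpha> p + of_nat K)) t = point_weight p z \<alpha> t * of_real ((z p - t) ^ K)"
proof -
  have p_in: "p \<in> {1..p}" using assms(1) by simp
  have "(\<Prod>r\<in>{1..p} - {p}. abs_powr (t - z r) ((\<alpha>(p := \<alpha> p + of_nat K)) r))
      = (\<Prod>r\<in>{1..p} - {p}. abs_powr (t - z r) (\<alpha> r))"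
    by (intro prod.cong) auto
  then show ?thesis
    unfolding point_weight_remove[OF p_in] using assms(2) by (simp add: abs_powr_add_of_nat abs_if)
qed

definition abs_Phi :: "nat \<Rightarrow> nat \<Rightarrow> (nat \<Rightarrow> real) \<Rightarrow> (nat \<Rightarrow> complex) \<Rightarrow> complex \<Rightarrow> (nat \<Rightarrow> real) \<Rightarrow> complex" where
  "abs_Phi n p z \<alpha> \<gamma> t = (\<Prod>i=1..n. point_weight p z \<alpha> (t i)) * vandermonde {1..n} \<gamma> t"

lemma measurable_abs_Phi: "abs_Phi n p z \<alpha> \<gamma> \<in> borel_measurable (Rn n)"
proof -
  have "(\<lambda>t. point_weight p z \<alpha> (t i)) \<in> borel_measurable (Rn n)" if "i \<in> {1..n}" for i
    by (rule measurable_compose[OF measurable_component_lborel_on[OF that] measurable_point_weight])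
  then show ?thesis
    unfolding abs_Phi_def using measurable_vandermonde[of "{1..n}" "{1..n}"]
    by (intro borel_measurable_times borel_measurable_prod) auto
qed

lemma abs_Phi_raise_last:
  assumes "p \<ge> 1" "\<And>i. i \<in> {1..n} \<Longrightarrow> t i \<le> z p"
  shows "abs_Phi n p z (\<alpha>(p := \<alpha> p + of_nat K)) \<gamma> t = abs_Phi n p z \<alpha> \<gamma> t
      * (\<Prod>i=1..n. of_real ((z p - t i) ^ K))"
proof -
  have "(\<Prod>i=1..n. point_weight p z (\<alpha>(p := \<alpha> p + of_nat K)) (t i))
      = (\<Prod>i=1..n. point_weight p z \<alpha> (t i) * of_real ((z p - t i) ^ K))"
    using assms by (intro prod.cong refl point_weight_raise_last) auto
  then show ?thesis unfolding abs_Phi_def prod.distrib by (simp only: mult_ac)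
qed

lemma abs_Phi_remove:
  assumes "i \<in> {1..n}"
  shows "abs_Phi n p z \<alpha> \<gamma> t = point_weight p z \<alpha> (t i) * (\<Prod>k\<in>{1..n}-{i}. point_weight p z \<alpha> (t k))
     * (\<Prod>j\<in>{1..n}-{i}. abs_powr (t i - t j) (2 * \<gamma>)) * vandermonde ({1..n}-{i}) \<gamma> t"
proof -
  have "(\<Prod>i=1..n. point_weight p z \<alpha> (t i)) = point_weight p z \<alpha> (t i)
      * (\<Prod>k\<in>{1..n}-{i}. point_weight p z \<alpha> (t k))"
    using assms by (intro prod.remove) auto
  moreover have "vandermonde {1..n} \<gamma> t = (\<Prod>j\<in>{1..n}-{i}. abs_powr (t i - t j) (2 * \<gamma>))
      * vandermonde ({1..n}-{i}) \<gamma> t"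
    using vandermonde_insert[of "{1..n}-{i}" i \<gamma> t] assms by (simp add: insert_absorb)
  ultimately show ?thesis unfolding abs_Phi_def by (simp only: mult_ac)
qed

lemma abs_Phi_nonzeroD:
  assumes "abs_Phi n p z \<alpha> \<gamma> t \<noteq> 0" "i \<in> {1..n}"
  shows "s \<in> {1..p} \<Longrightarrow> t i \<noteq> z s" "j \<in> {1..n} \<Longrightarrow> i \<noteq> j \<Longrightarrow> t i \<noteq> t j"
  using assms(1) unfolding abs_Phi_remove[OF assms(2)] by (auto simp: point_weight_def)

text \<open>The condition on \<open>\<alpha> p\<close> is weaker than in the theorem because Selberg's integral \<open>selberg n a b \<gamma>\<close> is the
  case \<open>\<alpha> 2 = b - 1\<close>.\<close>

locale selberg_data =
  fixes n p :: nat and z :: "nat \<Rightarrow> real" and \<alpha> :: "nat \<Rightarrow> complex" and \<gamma> :: complex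
  assumes two_le_p: "p \<ge> 2"
    and z_less_Suc: "\<And>s. s \<in> {1..<p} \<Longrightarrow> z s < z (s + 1)"
    and Re_alpha_pos: "\<And>s. s \<in> {1..<p} \<Longrightarrow> Re (\<alpha> s) > 0"
    and Re_alpha_last: "Re (\<alpha> p) > - 1"
    and Re_gamma_pos: "Re \<gamma> > 0"
begin

lemma z_less: "1 \<le> i \<Longrightarrow> i < j \<Longrightarrow> j \<le> p \<Longrightarrow> z i < z j"
proof (induction j)
  case (Suc j)
  then show ?case using z_less_Suc[of j] by (cases "i = j") force+
qed simp

lemma z_le: "1 \<le> i \<Longrightarrow> i \<le> j \<Longrightarrow> j \<le> p \<Longrightarrow> z i \<le> z j"
  using z_less[of i j] by (cases "i = j") auto

lemma z_inj_on: "inj_on z {1..p}"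
proof (rule linorder_inj_onI)
  fix r s assume "r < s" "r \<in> {1..p}" "s \<in> {1..p}"
  then have "z r < z s" by (intro z_less) auto
  then show "z r \<noteq> z s" by simp
qed auto

lemma z_first_less_last: "z 1 < z p"
  using z_less[of 1 p] two_le_p by auto

lemma z_in_range: "s \<in> {1..p} \<Longrightarrow> z s \<in> {z 1..z p}"
  by (auto intro!: z_le)

lemma Re_alpha_greater: "s \<in> {1..p} \<Longrightarrow> Re (\<alpha> s) > - 1"
  using Re_alpha_pos[of s] Re_alpha_last by (cases "s = p") auto

lemma range_eq_insert_last: "{1..p} = insert p {1..p-1}" "p \<notin> {1..p-1}"
  using two_le_p by auto

lemma one_in_range: "1 \<in> {1..p-1}"
  using two_le_p by auto

abbreviation \<Psi> :: "(nat \<Rightarrow> real) \<Rightarrow> complex" where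
  "\<Psi> \<equiv> abs_Phi n p z \<alpha> \<gamma>"

definition chamber :: "(nat \<Rightarrow> nat) \<Rightarrow> (nat \<Rightarrow> real) set" where
  "chamber l = {t. (\<forall>i\<in>{1..n}. z (block l i) \<le> t i \<and> t i \<le> z (block l i + 1)) \<and> mono_on {1..n} t}"

lemma chamberD:
  assumes "t \<in> chamber l" "i \<in> {1..n}"
  shows "z (block l i) \<le> t i" "t i \<le> z (block l i + 1)" "j \<in> {1..n} \<Longrightarrow> i \<le> j \<Longrightarrow> t i \<le> t j"
  using assms mono_onD[of "{1..n}" t i j] unfolding chamber_def by auto

lemma chamber_range:
  assumes "l \<in> Zset n (p - 1)" "t \<in> chamber l" "i \<in> {1..n}"
  shows "t i \<in> {z 1..z p}"
proof -
  have "block l i \<in> {1..p-1}" by (rule block_range[OF assms(1,3)])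
  then have "z 1 \<le> z (block l i)" "z (block l i + 1) \<le> z p" using two_le_p by (auto intro!: z_le)
  then show ?thesis using chamberD(1,2)[OF assms(2,3)] by auto
qed

lemma Uset_subset_chamber:
  assumes l_Zset: "l \<in> Zset n (p - 1)" and t_Uset: "t \<in> Uset n p z l"
  shows "t \<in> chamber l"
proof -
  have bounds: "z (block l i) \<le> t i \<and> t i \<le> z (block l i + 1)" if i_in: "i \<in> {1..n}" for i
    using t_Uset block_range[OF l_Zset i_in] Gam_eq_block[OF l_Zset block_range[OF l_Zset i_in]] i_in
    unfolding Uset_def by auto
  have same_block: "t i \<le> t j" if "s \<in> {1..p-1}" "i \<in> Gam l s" "i \<le> j" "j \<in> Gam l s" for s i j
    using that(3,4)
  proof (induction j rule: dec_induct)
    case (step m)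
    have "m \<in> {psum l (s - 1) + 1..<psum l s}" using step that(2) by (auto simp: Gam_def)
    then have "t m \<le> t (m + 1)" using t_Uset that(1) unfolding Uset_def by blast
    moreover have "m \<in> Gam l s" using step that(2) by (auto simp: Gam_def)
    ultimately show ?case using step.IH by simp
  qed simp
  have "t i \<le> t j" if ij_ordered: "i \<in> {1..n}" "j \<in> {1..n}" "i \<le> j" for i j
  proof (cases "block l i = block l j")
    case True
    note block_in = block_range[OF l_Zset ij_ordered(1)]
    show ?thesis
      by (rule same_block[OF block_in]) (use Gam_eq_block[OF l_Zset block_in] True ij_ordered in auto)
  next
    case False
    then have "block l i < block l j" using block_mono[OF l_Zset, of i j] ij_ordered by simp
    then have "z (block l i + 1) \<le> z (block l j)" using block_range[OF l_Zset ij_ordered(2)]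
      by (intro z_le) auto
    then show ?thesis using bounds[OF ij_ordered(1)] bounds[OF ij_ordered(2)] by linarith
  qed
  then show ?thesis using bounds by (auto simp: chamber_def intro: mono_onI)
qed

lemma Uset_eq_chamber:
  assumes l_Zset: "l \<in> Zset n (p - 1)"
  shows "Uset n p z l = chamber l"
proof (intro equalityI subsetI)
  fix t assume t_chamber: "t \<in> chamber l"
  have Gam: "j \<in> {1..n}" "block l j = s" if "s \<in> {1..p - 1}" "j \<in> Gam l s" for s j
    using Gam_eq_block[OF l_Zset that(1)] that(2) by auto
  have "t j \<le> t (j + 1)" if "s \<in> {1..p - 1}" "j \<in> {psum l (s - 1) + 1..<psum l s}" for s j
    by (rule chamberD(3)[OF t_chamber Gam(1)[OF that(1)] Gam(1)[OF that(1)]])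
      (use that(2) in \<open>auto simp: Gam_def\<close>)
  moreover have "z s \<le> t j \<and> t j \<le> z (s + 1)" if "s \<in> {1..p - 1}" "j \<in> Gam l s" for s j
    using chamberD(1,2)[OF t_chamber Gam(1)[OF that]] Gam(2)[OF that] by simp
  ultimately show "t \<in> Uset n p z l" unfolding Uset_def by blast
qed (rule Uset_subset_chamber[OF l_Zset])

lemma pred_chamber [measurable]: "Measurable.pred (Rn n) (\<lambda>t. t \<in> chamber l)"
proof -
  have "Measurable.pred (Rn n) (\<lambda>t. \<forall>i\<in>{1..n}. z (block l i) \<le> t i \<and> t i \<le> z (block l i + 1))"
  proof (rule pred_intros_finite(3))
    fix i assume "i \<in> {1..n}"
    note [measurable] = measurable_component_lborel_on[OF this]
    show "Measurable.pred (Rn n) (\<lambda>t. z (block l i) \<le> t i \<and> t i \<le> z (block l i + 1))" by measurable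
  qed simp
  moreover have "Measurable.pred (Rn n) (\<lambda>t. mono_on {1..n} t)" by (rule pred_mono_on) auto
  ultimately show ?thesis unfolding chamber_def mem_Collect_eq by (rule pred_intros_logic(3))
qed

definition chamber_integral :: "(nat \<Rightarrow> nat) \<Rightarrow> ((nat \<Rightarrow> real) \<Rightarrow> complex) \<Rightarrow> complex" where
  "chamber_integral l f = (LINT t:chamber l|Rn n. \<Psi> t * f t)"

definition chamber_integrable :: "(nat \<Rightarrow> nat) \<Rightarrow> ((nat \<Rightarrow> real) \<Rightarrow> complex) \<Rightarrow> bool" where
  "chamber_integrable l f \<longleftrightarrow> set_integrable (Rn n) (chamber l) (\<lambda>t. \<Psi> t * f t)"

lemma chamber_integral_cong:
  assumes "\<And>t. t \<in> chamber l \<Longrightarrow> \<Psi> t \<noteq> 0 \<Longrightarrow> f t = g t"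
  shows "chamber_integral l f = chamber_integral l g"
  unfolding chamber_integral_def set_lebesgue_integral_def
  using assms by (intro Bochner_Integration.integral_cong refl) (auto simp: indicator_def)

lemma chamber_integral_cmult: "chamber_integral l (\<lambda>t. c * f t) = c * chamber_integral l f"
  unfolding chamber_integral_def by (simp add: mult.left_commute)

lemma chamber_integrable_cmult: "chamber_integrable l f \<Longrightarrow> chamber_integrable l (\<lambda>t. c * f t)"
  unfolding chamber_integrable_def by (simp add: mult.left_commute)

lemma chamber_integrable_add:
  "chamber_integrable l f \<Longrightarrow> chamber_integrable l g \<Longrightarrow> chamber_integrable l (\<lambda>t. f t + g t)"
  unfolding chamber_integrable_def distrib_left by (rule set_integral_add(1))

lemma chamber_integral_add:
  "chamber_integrable l f \<Longrightarrow> chamber_integrable l g \<Longrightarrow>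
    chamber_integral l (\<lambda>t. f t + g t) = chamber_integral l f + chamber_integral l g"
  unfolding chamber_integrable_def chamber_integral_def distrib_left by (rule set_integral_add(2))

lemma chamber_integrable_sum:
  "(\<And>i. i \<in> I \<Longrightarrow> chamber_integrable l (f i)) \<Longrightarrow> chamber_integrable l (\<lambda>t. \<Sum>i\<in>I. f i t)"
  unfolding chamber_integrable_def set_integrable_def sum_distrib_left scaleR_sum_right
  by (intro Bochner_Integration.integrable_sum)

lemma chamber_integral_sum:
  "(\<And>i. i \<in> I \<Longrightarrow> chamber_integrable l (f i)) \<Longrightarrow>
    chamber_integral l (\<lambda>t. \<Sum>i\<in>I. f i t) = (\<Sum>i\<in>I. chamber_integral l (f i))"
  unfolding chamber_integrable_def set_integrable_def chamber_integral_def set_lebesgue_integral_def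
    sum_distrib_left scaleR_sum_right
  by (intro Bochner_Integration.integral_sum)

definition admissible :: "(real \<Rightarrow> complex) \<Rightarrow> bool" where
  "admissible h \<longleftrightarrow> h \<in> borel_measurable borel
    \<and> set_integrable lborel {z 1..z p} (\<lambda>t. point_weight p z \<alpha> t * h t)"

lemma admissible_measurable: "admissible h \<Longrightarrow> h \<in> borel_measurable borel"
  by (simp add: admissible_def)

lemma admissible_add: "admissible f \<Longrightarrow> admissible g \<Longrightarrow> admissible (\<lambda>t. f t + g t)"
  unfolding admissible_def distrib_left by (auto intro: set_integral_add(1))

lemma admissible_mult_bounded:
  assumes f_admissible: "admissible f"
    and g_bounded: "g \<in> borel_measurable borel" "\<And>t. t \<in> {z 1..z p} \<Longrightarrow> norm (g t) \<le> B"
  shows "admissible (\<lambda>t. f t * g t)"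
proof -
  have [measurable]: "f \<in> borel_measurable borel" "g \<in> borel_measurable borel" using f_admissible g_bounded(1)
    by (simp_all add: admissible_def)
  have "set_integrable lborel {z 1..z p} (\<lambda>t. of_real B * (point_weight p z \<alpha> t * f t))"
    using f_admissible by (intro set_integrable_mult_right) (simp add: admissible_def)
  then have "set_integrable lborel {z 1..z p} (\<lambda>t. point_weight p z \<alpha> t * (f t * g t))"
  proof (rule set_integrable_bound)
    show "set_borel_measurable lborel {z 1..z p} (\<lambda>t. point_weight p z \<alpha> t * (f t * g t))"
      unfolding set_borel_measurable_def by measurable
    show "AE t in lborel. t \<in> {z 1..z p} \<longrightarrow> norm (point_weight p z \<alpha> t * (f t * g t))
        \<le> norm (of_real B * (point_weight p z \<alpha> t * f t))"
    proof (intro AE_I2 impI)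
      fix t assume "t \<in> {z 1..z p}"
      then have "norm (g t) * norm (point_weight p z \<alpha> t * f t) \<le> \<bar>B\<bar> * norm (point_weight p z \<alpha> t * f t)"
        using g_bounded(2)[of t] by (intro mult_right_mono) auto
      then show "norm (point_weight p z \<alpha> t * (f t * g t)) \<le> norm (of_real B * (point_weight p z \<alpha> t * f t))"
        by (simp add: norm_mult mult_ac)
    qed
  qed
  then show ?thesis by (simp add: admissible_def)
qed

lemma admissible_cmult: "admissible f \<Longrightarrow> admissible (\<lambda>t. c * f t)"
  using admissible_mult_bounded[of f "\<lambda>_. c" "norm c"] by (simp add: mult.commute)

lemma admissible_of_norm_eq_prod:
  assumes "h \<in> borel_measurable borel" "\<And>s. s \<in> {1..p} \<Longrightarrow> e s > - 1"
    and "\<And>t. norm (point_weight p z \<alpha> t * h t) = (\<Prod>s=1..p. \<bar>t - z s\<bar> powr e s)"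
  shows "admissible h"
proof -
  have [measurable]: "h \<in> borel_measurable borel" by (rule assms(1))
  have "set_integrable lborel {z 1..z p} (\<lambda>t. \<Prod>s=1..p. \<bar>t - z s\<bar> powr e s)"
    using assms(2) z_inj_on z_in_range by (intro set_integrable_prod_abs_powr) auto
  then have "set_integrable lborel {z 1..z p} (\<lambda>t. point_weight p z \<alpha> t * h t)"
    by (rule set_integrable_bound) (auto simp: set_borel_measurable_def assms(3) prod_nonneg)
  then show ?thesis by (simp add: admissible_def)
qed

lemma admissible_const: "admissible (\<lambda>t. c)"
proof -
  have "admissible (\<lambda>t. 1)"
    by (rule admissible_of_norm_eq_prod[of _ "\<lambda>s. Re (\<alpha> s)"])
      (use Re_alpha_greater in \<open>auto simp: point_weight_def norm_abs_powr prod_norm[symmetric]\<close>)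
  from admissible_cmult[OF this, of c] show ?thesis by simp
qed

lemma admissible_sum: "(\<And>i. i \<in> I \<Longrightarrow> admissible (f i)) \<Longrightarrow> admissible (\<lambda>t. \<Sum>i\<in>I. f i t)"
  by (induction I rule: infinite_finite_induct) (auto intro: admissible_add admissible_const)

lemma admissible_inverse:
  assumes s_in: "s \<in> {1..<p}"
  shows "admissible (\<lambda>t. 1 / of_real (t - z s))"
proof (rule admissible_of_norm_eq_prod)
  show "Re (\<alpha> r) - (if r = s then 1 else 0) > - 1" if "r \<in> {1..p}" for r
    using Re_alpha_greater[OF that] Re_alpha_pos[OF s_in] by simp
  fix t
  have s_in_all: "s \<in> {1..p}" using s_in by simp
  have "\<bar>x\<bar> powr e / \<bar>x\<bar> = \<bar>x\<bar> powr (e - 1)" for x e :: real by (cases "x = 0") (simp_all add: powr_diff)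
  moreover have "norm (point_weight p z \<alpha> t * (1 / of_real (t - z s)))
      = \<bar>t - z s\<bar> powr Re (\<alpha> s) / \<bar>t - z s\<bar> * (\<Prod>r\<in>{1..p} - {s}. \<bar>t - z r\<bar> powr Re (\<alpha> r))"
    unfolding point_weight_remove[OF s_in_all]
    by (simp add: norm_mult norm_divide norm_abs_powr prod_norm[symmetric] del: of_real_diff)
  ultimately have "norm (point_weight p z \<alpha> t * (1 / of_real (t - z s)))
      = \<bar>t - z s\<bar> powr (Re (\<alpha> s) - 1) * (\<Prod>r\<in>{1..p} - {s}. \<bar>t - z r\<bar> powr Re (\<alpha> r))"
    by (simp only:)
  also have "\<dots> = (\<Prod>r=1..p. \<bar>t - z r\<bar> powr (Re (\<alpha> r) - (if r = s then 1 else 0)))"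
    using s_in_all by (subst prod.remove[of _ s]) auto
  finally show "norm (point_weight p z \<alpha> t * (1 / of_real (t - z s)))
      = (\<Prod>r=1..p. \<bar>t - z r\<bar> powr (Re (\<alpha> r) - (if r = s then 1 else 0)))" .
qed measurable

definition admissible_majorant :: "(real \<Rightarrow> complex) \<Rightarrow> real \<Rightarrow> real" where
  "admissible_majorant h t = indicator {z 1..z p} t * norm (point_weight p z \<alpha> t * h t)"

lemma integrable_admissible_majorant: "admissible h \<Longrightarrow> integrable lborel (admissible_majorant h)"
  unfolding admissible_def set_integrable_def admissible_majorant_def
  using integrable_norm[of lborel "\<lambda>t. indicator {z 1..z p} t *\<^sub>R (point_weight p z \<alpha> t * h t)"] by simp

lemma admissible_majorant_nonneg: "admissible_majorant h t \<ge> 0"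
  by (simp add: admissible_majorant_def)

lemma chamber_integrable_prod:
  assumes l_Zset: "l \<in> Zset n (p - 1)" and h_admissible: "\<And>i. i \<in> {1..n} \<Longrightarrow> admissible (h i)"
  shows "chamber_integrable l (\<lambda>t. \<Prod>i=1..n. h i (t i))"
  unfolding chamber_integrable_def set_integrable_def
proof (rule integrable_lborel_on_dominated)
  let ?C = "((z p - z 1) powr (2 * Re \<gamma>)) ^ card (less_pairs {1..n})"
  have "(\<lambda>t. h i (t i)) \<in> borel_measurable (Rn n)" if "i \<in> {1..n}" for i
    by (rule measurable_compose[OF measurable_component_lborel_on[OF that] admissible_measurable])
      (rule h_admissible[OF that])
  then have [measurable]: "(\<lambda>t. \<Prod>i=1..n. h i (t i)) \<in> borel_measurable (Rn n)" by (rule borel_measurable_prod)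
  note [measurable] = measurable_abs_Phi
  show "(\<lambda>t. indicator (chamber l) t *\<^sub>R (\<Psi> t * (\<Prod>i=1..n. h i (t i)))) \<in> borel_measurable (Rn n)" by measurable
  fix t
  show "norm (indicator (chamber l) t *\<^sub>R (\<Psi> t * (\<Prod>i=1..n. h i (t i))))
      \<le> ?C * (\<Prod>i=1..n. admissible_majorant (h i) (t i))"
  proof (cases "t \<in> chamber l")
    case True
    then have range: "t i \<in> {z 1..z p}" if "i \<in> {1..n}" for i by (rule chamber_range[OF l_Zset _ that])
    have "norm (\<Psi> t * (\<Prod>i=1..n. h i (t i))) = norm (vandermonde {1..n} \<gamma> t)
        * (\<Prod>i=1..n. admissible_majorant (h i) (t i))"
      using range by (simp add: abs_Phi_def admissible_majorant_def norm_mult prod_norm[symmetric] prod.distrib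
        mult_ac)
    also have "\<dots> \<le> ?C * (\<Prod>i=1..n. admissible_majorant (h i) (t i))"
      using range Re_gamma_pos by (intro mult_right_mono norm_vandermonde_le prod_nonneg)
        (auto simp: admissible_majorant_nonneg)
    finally show ?thesis using True by simp
  qed (auto intro!: mult_nonneg_nonneg prod_nonneg simp: admissible_majorant_nonneg)
qed (use integrable_admissible_majorant[OF h_admissible] in auto)

lemma point_weight_mult_last_bounded:
  obtains B where "B \<ge> 0" "\<And>t. t \<in> {z 1..z p} \<Longrightarrow> norm (point_weight p z \<alpha> t * of_real (t - z p)) \<le> B"
proof
  define L where "L = z p - z 1"
  let ?e = "\<lambda>s. if s = p then Re (\<alpha> p) + 1 else Re (\<alpha> s)"
  show "norm (point_weight p z \<alpha> t * of_real (t - z p)) \<le> (\<Prod>s=1..p. L powr ?e s)" if t_in: "t \<in> {z 1..z p}"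
    for t
  proof -
    have "norm (point_weight p z \<alpha> t * of_real (t - z p)) = norm (point_weight p z (\<alpha>(p := \<alpha> p + of_nat 1)) t)"
      using t_in two_le_p by (subst point_weight_raise_last)
        (auto simp: norm_mult simp del: of_real_diff of_nat_1)
    also have "\<dots> = (\<Prod>s=1..p. \<bar>t - z s\<bar> powr ?e s)"
      unfolding point_weight_def prod_norm[symmetric] norm_abs_powr by (intro prod.cong refl) auto
    also have "\<dots> \<le> (\<Prod>s=1..p. L powr ?e s)"
    proof (intro prod_mono conjI powr_ge_zero powr_mono2)
      fix s assume s_in: "s \<in> {1..p}"
      show "?e s \<ge> 0" using s_in Re_alpha_pos[of s] Re_alpha_last by auto
      show "\<bar>t - z s\<bar> \<le> L" using t_in z_in_range[OF s_in] by (auto simp: L_def)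
    qed simp
    finally show ?thesis .
  qed
qed (simp add: prod_nonneg)

lemma norm_pole_integrand_le:
  assumes i_in: "i \<in> {1..n}" and j_in: "j \<in> {1..n} - {i}" and range: "\<And>k. k \<in> {1..n} \<Longrightarrow> t k \<in> {z 1..z p}"
    and B: "B \<ge> 0" "\<And>y. y \<in> {z 1..z p} \<Longrightarrow> norm (point_weight p z \<alpha> y * of_real (y - z p)) \<le> B"
  defines "I \<equiv> {1..n} - {i}" and "L \<equiv> (z p - z 1) powr (2 * Re \<gamma>)"
  shows "norm (\<Psi> t * ((\<Prod>k\<in>I. h k (t k)) * (of_real (t i - z p) / of_real (t i - t j))))
    \<le> B * L ^ card (I - {j}) * L ^ card (less_pairs I) * (\<Prod>k\<in>I. admissible_majorant (h k) (t k))
    * \<bar>t i - t j\<bar> powr (2 * Re \<gamma> - 1)"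
proof -
  let ?w = "point_weight p z \<alpha>"
  have rangeI: "t k \<in> {z 1..z p}" if "k \<in> I" for k using range that by (auto simp: I_def)
  have pole: "norm (abs_powr x (2 * \<gamma>) / of_real x) = \<bar>x\<bar> powr (2 * Re \<gamma> - 1)" for x
    by (cases "x = 0") (simp_all add: norm_divide norm_abs_powr powr_diff)
  have majorant: "(\<Prod>k\<in>I. norm (?w (t k) * h k (t k))) = (\<Prod>k\<in>I. admissible_majorant (h k) (t k))"
    using rangeI by (intro prod.cong) (auto simp: admissible_majorant_def)
  have "(\<Prod>j\<in>I. abs_powr (t i - t j) (2 * \<gamma>)) = abs_powr (t i - t j) (2 * \<gamma>)
      * (\<Prod>k\<in>I - {j}. abs_powr (t i - t k) (2 * \<gamma>))"
    using j_in by (intro prod.remove) (auto simp: I_def)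
  then have "\<Psi> t * ((\<Prod>k\<in>I. h k (t k)) * (of_real (t i - z p) / of_real (t i - t j)))
      = ?w (t i) * of_real (t i - z p) * (\<Prod>k\<in>I - {j}. abs_powr (t i - t k) (2 * \<gamma>)) * vandermonde I \<gamma> t
        * (\<Prod>k\<in>I. ?w (t k) * h k (t k)) * (abs_powr (t i - t j) (2 * \<gamma>) / of_real (t i - t j))"
    unfolding abs_Phi_remove[OF i_in] I_def[symmetric] prod.distrib
    by (simp only: times_divide_eq_right mult_ac)
  then have "norm (\<Psi> t * ((\<Prod>k\<in>I. h k (t k)) * (of_real (t i - z p) / of_real (t i - t j))))
      = norm (?w (t i) * of_real (t i - z p)) * (\<Prod>k\<in>I - {j}. norm (abs_powr (t i - t k) (2 * \<gamma>)))
       * norm (vandermonde I \<gamma> t) * (\<Prod>k\<in>I. admissible_majorant (h k) (t k)) * \<bar>t i - t j\<bar> powr (2 * Re \<gamma> - 1)"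
    unfolding majorant[symmetric] pole[symmetric] by (simp only: norm_mult prod_norm[symmetric])
  also have "\<dots> \<le> B * (\<Prod>k\<in>I - {j}. L) * L ^ card (less_pairs I) * (\<Prod>k\<in>I. admissible_majorant (h k) (t k))
      * \<bar>t i - t j\<bar> powr (2 * Re \<gamma> - 1)"
  proof (intro mult_right_mono mult_mono prod_mono conjI)
    show "norm (abs_powr (t i - t k) (2 * \<gamma>)) \<le> L" if "k \<in> I - {j}" for k
      using norm_abs_powr_diff_le[OF range[OF i_in] rangeI, of k "2 * \<gamma>"] that Re_gamma_pos by (simp add: L_def)
    show "norm (vandermonde I \<gamma> t) \<le> L ^ card (less_pairs I)"
      unfolding L_def using rangeI Re_gamma_pos by (intro norm_vandermonde_le) auto
  qed (use B range[OF i_in] in \<open>auto intro!: prod_nonneg simp: L_def admissible_majorant_nonneg\<close>)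
  finally show ?thesis by simp
qed

lemma norm_pole_section_le:
  fixes x :: "nat \<Rightarrow> real" and y :: real
  assumes l_Zset: "l \<in> Zset n (p - 1)" and i_in: "i \<in> {1..n}" and j_in: "j \<in> {1..n} - {i}"
    and B: "B \<ge> 0" "\<And>y. y \<in> {z 1..z p} \<Longrightarrow> norm (point_weight p z \<alpha> y * of_real (y - z p)) \<le> B"
  defines "I \<equiv> {1..n} - {i}" and "L \<equiv> (z p - z 1) powr (2 * Re \<gamma>)" and "t \<equiv> x(i := y)"
  shows "norm (indicator (chamber l) t
      *\<^sub>R (\<Psi> t * ((\<Prod>k\<in>I. h k (t k)) * (of_real (t i - z p) / of_real (t i - t j)))))
    \<le> B * L ^ card (I - {j}) * L ^ card (less_pairs I) * (\<Prod>k\<in>I. admissible_majorant (h k) (x k))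
      * (indicator {z 1..z p} y * \<bar>y - x j\<bar> powr (2 * Re \<gamma> - 1))"
proof (cases "t \<in> chamber l")
  case True
  have "(\<Prod>k\<in>I. admissible_majorant (h k) (t k)) = (\<Prod>k\<in>I. admissible_majorant (h k) (x k))"
    by (intro prod.cong) (auto simp: t_def I_def)
  moreover have "indicator {z 1..z p} y = (1 :: real)" using chamber_range[OF l_Zset True i_in]
    by (simp add: t_def)
  moreover have "t i - t j = y - x j" using j_in by (simp add: t_def)
  ultimately show ?thesis
    using norm_pole_integrand_le[where t=t and h=h, OF i_in j_in chamber_range[OF l_Zset True] B] True
    unfolding I_def[symmetric] L_def[symmetric] by (simp only: indicator_simps scaleR_one mult_1)
next
  case False
  have "B * L ^ card (I - {j}) * L ^ card (less_pairs I) * (\<Prod>k\<in>I. admissible_majorant (h k) (x k))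
      * (indicator {z 1..z p} y * \<bar>y - x j\<bar> powr (2 * Re \<gamma> - 1)) \<ge> 0"
    using B(1) by (intro mult_nonneg_nonneg prod_nonneg) (auto simp: L_def admissible_majorant_nonneg)
  then show ?thesis using False by simp
qed

lemma measurable_pole_integrand:
  assumes i_in: "i \<in> {1..n}" and j_in: "j \<in> {1..n}" and h_admissible: "\<And>k. k \<in> {1..n} - {i} \<Longrightarrow> admissible (h k)"
  shows "(\<lambda>t. indicator (chamber l) t
      *\<^sub>R (\<Psi> t * ((\<Prod>k\<in>{1..n}-{i}. h k (t k)) * (of_real (t i - z p) / of_real (t i - t j)))))
    \<in> borel_measurable (Rn n)"
proof -
  have "(\<lambda>t. h k (t k)) \<in> borel_measurable (Rn n)" if "k \<in> {1..n} - {i}" for k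
    using that
    by (intro measurable_compose[OF measurable_component_lborel_on admissible_measurable[OF h_admissible]]) auto
  then have [measurable]: "(\<lambda>t. \<Prod>k\<in>{1..n}-{i}. h k (t k)) \<in> borel_measurable (Rn n)"
    by (rule borel_measurable_prod)
  have [measurable]: "(\<lambda>t. t i) \<in> borel_measurable (Rn n)" "(\<lambda>t. t j) \<in> borel_measurable (Rn n)"
    using i_in j_in by (auto intro: measurable_component_lborel_on)
  note [measurable] = measurable_abs_Phi
  show ?thesis by measurable
qed

lemma chamber_integrable_pole:
  assumes l_Zset: "l \<in> Zset n (p - 1)" and i_in: "i \<in> {1..n}" and j_in: "j \<in> {1..n} - {i}"
    and h_admissible: "\<And>k. k \<in> {1..n} - {i} \<Longrightarrow> admissible (h k)"
  shows "chamber_integrable l (\<lambda>t. (\<Prod>k\<in>{1..n}-{i}. h k (t k)) * (of_real (t i - z p) / of_real (t i - t j)))"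
proof -
  define I where "I = {1..n} - {i}"
  have I_insert: "finite I" "i \<notin> I" "insert i I = {1..n}" using i_in by (auto simp: I_def)
  let ?f = "\<lambda>t. indicator (chamber l) t
      *\<^sub>R (\<Psi> t * ((\<Prod>k\<in>I. h k (t k)) * (of_real (t i - z p) / of_real (t i - t j))))"
  obtain B where B: "B \<ge> 0" "\<And>y. y \<in> {z 1..z p} \<Longrightarrow> norm (point_weight p z \<alpha> y * of_real (y - z p)) \<le> B"
    using point_weight_mult_last_bounded by blast
  define L where "L = (z p - z 1) powr (2 * Re \<gamma>)"
  define g where "g x = B * L ^ card (I - {j}) * L ^ card (less_pairs I)
      * (\<Prod>k\<in>I. admissible_majorant (h k) (x k))" for x
  define S where "S = 2 * (L / (2 * Re \<gamma>))"
  let ?e = "\<lambda>y c. indicator {z 1..z p} y * \<bar>y - c\<bar> powr (2 * Re \<gamma> - 1)"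
  have g_nonneg: "g x \<ge> 0" for x
    unfolding g_def using B(1) by (intro mult_nonneg_nonneg prod_nonneg)
      (auto simp: L_def admissible_majorant_nonneg)
  have bound: "norm (?f (x(i := y))) \<le> g x * ?e y (x j)" for x y
    unfolding g_def L_def I_def by (rule norm_pole_section_le[OF l_Zset i_in j_in B])
  have "integrable (lborel_on (insert i I)) ?f"
  proof (rule integrable_lborel_on_insert[OF I_insert(1,2)])
    show "integrable (lborel_on I) (\<lambda>x. g x * S)"
      unfolding g_def using I_insert(1) h_admissible integrable_admissible_majorant
      by (intro integrable_mult_left integrable_mult_right lborel_product.product_integrable_prod)
        (auto simp: I_def)
    show "?f \<in> borel_measurable (lborel_on (insert i I))"
      unfolding I_insert(3) unfolding I_def using j_in
      by (intro measurable_pole_integrand i_in h_admissible) auto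
    fix x
    have "(\<integral>\<^sup>+y. ennreal (norm (?f (x(i := y)))) \<partial>lborel)
        \<le> (\<integral>\<^sup>+y. ennreal (g x) * ennreal (?e y (x j)) \<partial>lborel)"
      using bound by (intro nn_integral_mono) (simp add: g_nonneg flip: ennreal_mult)
    also have "\<dots> = ennreal (g x) * (\<integral>\<^sup>+y. ennreal (?e y (x j)) \<partial>lborel)" by (intro nn_integral_cmult) simp
    also have "\<dots> \<le> ennreal (g x) * ennreal S"
    proof (cases "x j \<in> {z 1..z p}")
      case True
      then show ?thesis using nn_integral_abs_powr_le[of "2 * Re \<gamma>" "x j" "z 1" "z p"] Re_gamma_pos
        unfolding S_def L_def by (intro mult_left_mono) auto
    next
      case False
      then have "(\<Prod>k\<in>I. admissible_majorant (h k) (x k)) = 0"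
        using j_in I_insert(1) by (intro prod_zero bexI[of _ j]) (auto simp: admissible_majorant_def I_def)
      then show ?thesis by (simp add: g_def)
    qed
    also have "\<dots> = ennreal (g x * S)" using g_nonneg Re_gamma_pos by (intro ennreal_mult[symmetric])
      (auto simp: S_def L_def)
    finally show "(\<integral>\<^sup>+y. ennreal (norm (?f (x(i := y)))) \<partial>lborel) \<le> ennreal (g x * S)" .
  qed
  then show ?thesis unfolding chamber_integrable_def set_integrable_def I_insert(3) unfolding I_def .
qed

definition log_deriv_last :: "real \<Rightarrow> complex" where
  "log_deriv_last t = 1 + (\<Sum>s=1..p. \<alpha> s * (of_real (t - z p) / of_real (t - z s)))"

lemma admissible_log_deriv_last: "admissible log_deriv_last"
  unfolding log_deriv_last_def
proof (intro admissible_add admissible_const admissible_sum admissible_cmult)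
  fix s assume s_in: "s \<in> {1..p}"
  show "admissible (\<lambda>t. of_real (t - z p) / of_real (t - z s))"
  proof (cases "s = p")
    case True
    have "admissible (\<lambda>t. 1 * (of_real (t - z p) / of_real (t - z p)))"
      by (rule admissible_mult_bounded[OF admissible_const, of _ 1]) (auto simp: norm_divide)
    then show ?thesis using True by simp
  next
    case False
    then have "admissible (\<lambda>t. 1 / of_real (t - z s) * of_real (t - z p))"
      using s_in by (intro admissible_mult_bounded[OF admissible_inverse, of _ _ "z p - z 1"])
        (auto simp del: of_real_diff)
    then show ?thesis by simp
  qed
qed

lemma chamber_update_iff:
  assumes "x(i := y0) \<in> chamber l" "i \<in> {1..n}"
  shows "x(i := y) \<in> chamber l \<longleftrightarrow>
    (\<forall>c\<in>insert (z (block l i)) (x ` {1..<i}). c \<le> y) \<and> (\<forall>c\<in>insert (z (block l i + 1)) (x ` {i<..n}). y \<le> c)"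
    (is "_ \<longleftrightarrow> ?bounds")
proof
  assume y_chamber: "x(i := y) \<in> chamber l"
  have "x j \<le> y" if "j \<in> {1..<i}" for j using chamberD(3)[OF y_chamber, of j i] assms(2) that by simp
  moreover have "y \<le> x j" if "j \<in> {i<..n}" for j using chamberD(3)[OF y_chamber, of i j] assms(2) that by simp
  ultimately show ?bounds using chamberD(1,2)[OF y_chamber assms(2)] by auto
next
  assume bounds: ?bounds
  show "x(i := y) \<in> chamber l" unfolding chamber_def mem_Collect_eq
  proof (intro conjI ballI mono_onI)
    fix k assume k_in: "k \<in> {1..n}"
    show "z (block l k) \<le> (x(i := y)) k" "(x(i := y)) k \<le> z (block l k + 1)"
      using chamberD(1,2)[OF assms(1) k_in] bounds by (cases "k = i"; simp)+
  next
    fix j k assume "j \<in> {1..n}" "k \<in> {1..n}" "j \<le> k"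
    then show "(x(i := y)) j \<le> (x(i := y)) k"
      using chamberD(3)[OF assms(1), of j k] bounds by (cases "j = i"; cases "k = i") auto
  qed
qed

lemma chamber_section:
  assumes l_Zset: "l \<in> Zset n (p - 1)" and i_in: "i \<in> {1..n}" and x_chamber: "x(i := y0) \<in> chamber l"
  defines "singular \<equiv> z ` {1..p} \<union> x ` ({1..n} - {i})"
  obtains lo hi where "\<And>y. x(i := y) \<in> chamber l \<longleftrightarrow> y \<in> {lo..hi}"
    "lo \<in> singular" "hi \<in> singular" "singular \<inter> {lo<..<hi} = {}"
proof
  define s where "s = block l i"
  have s_in: "s \<in> {1..p - 1}" unfolding s_def by (rule block_range[OF l_Zset i_in])
  define L where "L = insert (z s) (x ` {1..<i})"
  define R where "R = insert (z (s + 1)) (x ` {i<..n})"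
  have fin: "finite L" "L \<noteq> {}" "finite R" "R \<noteq> {}" by (simp_all add: L_def R_def)
  show "x(i := y) \<in> chamber l \<longleftrightarrow> y \<in> {Max L..Min R}" for y
    unfolding chamber_update_iff[OF x_chamber i_in] s_def[symmetric] L_def[symmetric] R_def[symmetric]
    using fin by simp
  have "L \<union> R \<subseteq> singular" using s_in i_in by (auto simp: L_def R_def singular_def)
  moreover have "Max L \<in> L" "Min R \<in> R" using fin by simp_all
  ultimately show "Max L \<in> singular" "Min R \<in> singular" by blast+
  have "c \<le> Max L \<or> Min R \<le> c" if c_singular: "c \<in> singular" for c
  proof -
    have "(\<exists>r\<in>{1..p}. c = z r) \<or> c \<in> L \<union> R" using c_singular i_in by (force simp: singular_def L_def R_def)
    then show ?thesis
    proof (elim disjE bexE)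
      fix r assume r: "r \<in> {1..p}" "c = z r"
      have "z r \<le> z s" if "r \<le> s" using z_le[of r s] r s_in that by simp
      moreover have "z (s + 1) \<le> z r" if "\<not> r \<le> s" using z_le[of "s + 1" r] r s_in that by simp
      moreover have "z s \<le> Max L" "Min R \<le> z (s + 1)" using fin by (simp_all add: L_def R_def)
      ultimately show ?thesis using r(2) by (meson order_trans)
    qed (use fin in auto)
  qed
  then show "singular \<inter> {Max L<..<Min R} = {}" by force
qed

lemma section_integral_log_derivative:
  assumes l_Zset: "l \<in> Zset n (p - 1)" and i_in: "i \<in> {1..n}"
  defines "I \<equiv> {1..n} - {i}" and "\<alpha>' \<equiv> \<alpha>(p := \<alpha> p + 1)"
  shows "(LINT y:{y. x(i := y) \<in> chamber l}|lborel.
    point_weight p z \<alpha>' y * (\<Prod>j\<in>I. abs_powr (y - x j) (2 * \<gamma>)) *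
    ((\<Sum>s=1..p. \<alpha>' s / of_real (y - z s)) + (\<Sum>j\<in>I. 2 * \<gamma> / of_real (y - x j)))) = 0"
proof (cases "\<exists>y0. x(i := y0) \<in> chamber l")
  case True
  then obtain y0 where "x(i := y0) \<in> chamber l" by blast
  then obtain lo hi where lohi: "\<And>y. x(i := y) \<in> chamber l \<longleftrightarrow> y \<in> {lo..hi}"
    "lo \<in> z ` {1..p} \<union> x ` I" "hi \<in> z ` {1..p} \<union> x ` I" "(z ` {1..p} \<union> x ` I) \<inter> {lo<..<hi} = {}"
    by (rule chamber_section[OF l_Zset i_in, folded I_def]) (rule that)
  let ?G = "\<lambda>y. \<Prod>j\<in>I. abs_powr (y - x j) (2 * \<gamma>)"
  have vanish: "point_weight p z \<alpha>' c * ?G c = 0" if "c \<in> z ` {1..p} \<union> x ` I" for c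
    using that by (auto simp: point_weight_def I_def)
  have "Re (\<alpha>' s) > 0" if "s \<in> {1..p}" for s
    using that Re_alpha_pos[of s] Re_alpha_last by (auto simp: \<alpha>'_def)
  then have continuous: "continuous_on {lo..hi} (\<lambda>y. point_weight p z \<alpha>' y * ?G y)"
    unfolding point_weight_def using Re_gamma_pos
    by (intro continuous_on_mult continuous_on_prod continuous_on_compose2[OF continuous_on_abs_powr[of _ UNIV]]
      continuous_intros) auto
  have derivative: "((\<lambda>y. point_weight p z \<alpha>' y * ?G y) has_vector_derivative
      point_weight p z \<alpha>' y * ?G y * ((\<Sum>s=1..p. \<alpha>' s / of_real (y - z s)) + (\<Sum>j\<in>I. 2 * \<gamma> / of_real (y - x j))))
      (at y)"
    if y_in: "y \<in> {lo<..<hi}" for y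
  proof -
    have "y \<notin> z ` {1..p} \<union> x ` I" using lohi(4) y_in by blast
    then have "((\<lambda>y. point_weight p z \<alpha>' y * ?G y) has_vector_derivative
        point_weight p z \<alpha>' y * (?G y * (\<Sum>j\<in>I. 2 * \<gamma> / of_real (y - x j)))
        + point_weight p z \<alpha>' y * (\<Sum>s=1..p. \<alpha>' s / of_real (y - z s)) * ?G y) (at y)"
      unfolding point_weight_def
      by (intro has_vector_derivative_mult has_vector_derivative_prod_abs_powr) (auto simp: I_def)
    then show ?thesis by (simp only: ring_distribs mult_ac add_ac)
  qed
  have "{y. x(i := y) \<in> chamber l} = {lo..hi}" using lohi(1) by blast
  then show ?thesis
    by (simp only:)
      (rule set_integral_derivative_eq_0[OF continuous derivative vanish[OF lohi(2)] vanish[OF lohi(3)]])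
qed (simp add: set_lebesgue_integral_def)

lemma point_weight_mult_log_deriv_last:
  assumes "y \<le> z p"
  defines "\<alpha>' \<equiv> \<alpha>(p := \<alpha> p + 1)"
  shows "point_weight p z \<alpha> y * (log_deriv_last y + of_real (y - z p) * E)
    = - (point_weight p z \<alpha>' y * ((\<Sum>s=1..p. \<alpha>' s / of_real (y - z s)) + E))"
proof -
  have p_in: "p \<in> {1..p}" using two_le_p by simp
  define u :: complex where "u = of_real (y - z p)"
  have raise: "point_weight p z \<alpha>' y = - (point_weight p z \<alpha> y * u)"
    using point_weight_raise_last[of p y z \<alpha> 1] p_in assms(1) by (simp add: \<alpha>'_def u_def algebra_simps)
  show ?thesis
  proof (cases "y = z p")
    case True
    then have "point_weight p z \<alpha> y = 0" unfolding point_weight_remove[OF p_in] by simp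
    then show ?thesis by (simp add: raise)
  next
    case False
    then have u_nonzero: "u \<noteq> 0" by (simp add: u_def)
    have "(\<Sum>s=1..p. \<alpha>' s / of_real (y - z s))
        = (\<Sum>s=1..p. \<alpha> s / of_real (y - z s) + (if s = p then 1 / u else 0))"
      by (intro sum.cong refl) (auto simp: \<alpha>'_def u_def add_divide_distrib)
    then have "u * (\<Sum>s=1..p. \<alpha>' s / of_real (y - z s)) = log_deriv_last y"
      unfolding log_deriv_last_def u_def[symmetric] using p_in u_nonzero
      by (simp add: sum.distrib distrib_left sum_distrib_left mult_ac del: of_real_diff)
    then show ?thesis unfolding raise by (simp add: distrib_left mult.assoc del: of_real_diff flip: u_def)
  qed
qed

lemma abs_Phi_mult_log_derivative:
  assumes i_in: "i \<in> {1..n}" and y_le_last: "y \<le> z p"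
  defines "I \<equiv> {1..n} - {i}" and "\<alpha>' \<equiv> \<alpha>(p := \<alpha> p + 1)"
  shows "\<Psi> (x(i := y)) * ((\<Prod>k\<in>I. h k (x k)) *
      (log_deriv_last y + 2 * \<gamma> * (\<Sum>j\<in>I. of_real (y - z p) / of_real (y - x j))))
    = - ((\<Prod>k\<in>I. point_weight p z \<alpha> (x k) * h k (x k)) * vandermonde I \<gamma> x) *
      (point_weight p z \<alpha>' y * (\<Prod>j\<in>I. abs_powr (y - x j) (2 * \<gamma>)) *
       ((\<Sum>s=1..p. \<alpha>' s / of_real (y - z s)) + (\<Sum>j\<in>I. 2 * \<gamma> / of_real (y - x j))))"
proof -
  let ?E = "\<Sum>j\<in>I. 2 * \<gamma> / of_real (y - x j)" and ?S = "\<Sum>s=1..p. \<alpha>' s / of_real (y - z s)"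
  let ?G = "\<Prod>j\<in>I. abs_powr (y - x j) (2 * \<gamma>)" and ?W = "\<Prod>k\<in>I. point_weight p z \<alpha> (x k)"
  have off_i: "(x(i := y)) k = x k" if "k \<in> I" for k using that by (simp add: I_def)
  have "vandermonde I \<gamma> (x(i := y)) = vandermonde I \<gamma> x" by (rule vandermonde_cong) (rule off_i)
  then have "\<Psi> (x(i := y)) = point_weight p z \<alpha> y * ?W * ?G * vandermonde I \<gamma> x"
    unfolding abs_Phi_remove[OF i_in] I_def[symmetric] using off_i by simp
  moreover have "2 * \<gamma> * (\<Sum>j\<in>I. of_real (y - z p) / of_real (y - x j)) = of_real (y - z p) * ?E"
    by (simp add: sum_distrib_left mult_ac del: of_real_diff)
  moreover have "(\<Prod>k\<in>I. point_weight p z \<alpha> (x k) * h k (x k)) = ?W * (\<Prod>k\<in>I. h k (x k))" by (rule prod.distrib)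
  ultimately show ?thesis
    using point_weight_mult_log_deriv_last[OF y_le_last, of ?E] unfolding \<alpha>'_def[symmetric]
    by algebra
qed

lemma section_integral_by_parts:
  fixes h :: "nat \<Rightarrow> real \<Rightarrow> complex"
  assumes l_Zset: "l \<in> Zset n (p - 1)" and i_in: "i \<in> {1..n}"
  defines "I \<equiv> {1..n} - {i}"
  defines "f \<equiv> \<lambda>t. (\<Prod>k\<in>I. h k (t k)) *
    (log_deriv_last (t i) + 2 * \<gamma> * (\<Sum>j\<in>I. of_real (t i - z p) / of_real (t i - t j)))"
  shows "(\<integral>y. indicator (chamber l) (x(i := y)) *\<^sub>R (\<Psi> (x(i := y)) * f (x(i := y))) \<partial>lborel) = 0"
proof -
  let ?c = "- ((\<Prod>k\<in>I. point_weight p z \<alpha> (x k) * h k (x k)) * vandermonde I \<gamma> x)"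
  let ?d = "\<lambda>y. point_weight p z (\<alpha>(p := \<alpha> p + 1)) y * (\<Prod>j\<in>I. abs_powr (y - x j) (2 * \<gamma>)) *
    ((\<Sum>s=1..p. (\<alpha>(p := \<alpha> p + 1)) s / of_real (y - z s)) + (\<Sum>j\<in>I. 2 * \<gamma> / of_real (y - x j)))"
  have "indicator (chamber l) (x(i := y)) *\<^sub>R (\<Psi> (x(i := y)) * f (x(i := y)))
      = ?c * (indicator {y. x(i := y) \<in> chamber l} y *\<^sub>R ?d y)" for y
  proof (cases "x(i := y) \<in> chamber l")
    case True
    have "f (x(i := y)) = (\<Prod>k\<in>I. h k (x k)) *
        (log_deriv_last y + 2 * \<gamma> * (\<Sum>j\<in>I. of_real (y - z p) / of_real (y - x j)))"
      unfolding f_def I_def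
      by (intro arg_cong2[of _ _ _ _ "(*)"] arg_cong2[of _ _ _ _ "(+)"] prod.cong sum.cong refl) auto
    then show ?thesis
      using abs_Phi_mult_log_derivative[OF i_in, of y x h] chamber_range[OF l_Zset True i_in] True
      unfolding I_def by simp
  qed simp
  then have "(\<integral>y. indicator (chamber l) (x(i := y)) *\<^sub>R (\<Psi> (x(i := y)) * f (x(i := y))) \<partial>lborel)
      = ?c * (LINT y:{y. x(i := y) \<in> chamber l}|lborel. ?d y)"
    unfolding set_lebesgue_integral_def by (simp only: integral_mult_right_zero)
  then show ?thesis
    using section_integral_log_derivative[OF l_Zset i_in, of x] unfolding I_def by (simp only: mult_zero_right)
qed

theorem chamber_integral_by_parts:
  assumes l_Zset: "l \<in> Zset n (p - 1)" and i_in: "i \<in> {1..n}"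
    and h_admissible: "\<And>k. k \<in> {1..n} - {i} \<Longrightarrow> admissible (h k)"
  shows "chamber_integral l (\<lambda>t. (\<Prod>k\<in>{1..n}-{i}. h k (t k)) *
    (log_deriv_last (t i) + 2 * \<gamma> * (\<Sum>j\<in>{1..n}-{i}. of_real (t i - z p) / of_real (t i - t j)))) = 0"
    (is "chamber_integral l ?f = 0")
proof -
  define I where "I = {1..n} - {i}"
  have I_insert: "finite I" "i \<notin> I" "insert i I = {1..n}" using i_in by (auto simp: I_def)
  have "?f t = (\<Prod>k=1..n. (h(i := log_deriv_last)) k (t k))
      + (\<Sum>j\<in>I. 2 * \<gamma> * ((\<Prod>k\<in>I. h k (t k)) * (of_real (t i - z p) / of_real (t i - t j))))" for t
  proof -
    have "(\<Prod>k=1..n. (h(i := log_deriv_last)) k (t k)) = log_deriv_last (t i)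
        * (\<Prod>k\<in>I. (h(i := log_deriv_last)) k (t k))"
      using prod.insert[OF I_insert(1,2), of "\<lambda>k. (h(i := log_deriv_last)) k (t k)"] unfolding I_insert(3)
      by simp
    also have "(\<Prod>k\<in>I. (h(i := log_deriv_last)) k (t k)) = (\<Prod>k\<in>I. h k (t k))"
      using I_insert(2) by (intro prod.cong) auto
    finally show ?thesis unfolding I_def[symmetric]
      by (simp add: distrib_left sum_distrib_left mult_ac del: of_real_diff)
  qed
  moreover have "chamber_integrable l (\<lambda>t. (\<Prod>k=1..n. (h(i := log_deriv_last)) k (t k))
      + (\<Sum>j\<in>I. 2 * \<gamma> * ((\<Prod>k\<in>I. h k (t k)) * (of_real (t i - z p) / of_real (t i - t j)))))"
    unfolding I_def
    by (intro chamber_integrable_add chamber_integrable_sum chamber_integrable_cmult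
        chamber_integrable_prod[OF l_Zset] chamber_integrable_pole[OF l_Zset i_in] h_admissible)
      (auto simp: admissible_log_deriv_last h_admissible)
  ultimately have "integrable (lborel_on (insert i I)) (\<lambda>t. indicator (chamber l) t *\<^sub>R (\<Psi> t * ?f t))"
    unfolding I_insert(3) by (simp only: chamber_integrable_def set_integrable_def)
  from lborel_product.product_integral_insert[OF I_insert(1,2) this] show ?thesis
    unfolding chamber_integral_def set_lebesgue_integral_def I_insert(3)
      section_integral_by_parts[OF l_Zset i_in] by simp
qed

end

section \<open>Symmetrised integrals\<close>

definition symmetrize :: "nat \<Rightarrow> (nat \<Rightarrow> real \<Rightarrow> complex) \<Rightarrow> (nat \<Rightarrow> real) \<Rightarrow> complex" where
  "symmetrize n h t = (\<Sum>\<sigma> | \<sigma> permutes {1..n}. \<Prod>j=1..n. h j (t (\<sigma> j)))"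

lemma symmetrize_permute:
  assumes pi_permutes: "\<pi> permutes {1..n}" and h_eq: "\<And>j. j \<in> {1..n} \<Longrightarrow> h j = h' (\<pi> j)"
  shows "symmetrize n h t = symmetrize n h' t"
proof -
  have "symmetrize n h' t = (\<Sum>\<sigma> | \<sigma> permutes {1..n}. \<Prod>j=1..n. h' j (t ((\<sigma> \<circ> inv \<pi>) j)))"
    unfolding symmetrize_def by (rule sum_permutations_compose_right[OF permutes_inv[OF pi_permutes]])
  also have "\<dots> = (\<Sum>\<sigma> | \<sigma> permutes {1..n}. \<Prod>j=1..n. h j (t (\<sigma> j)))"
  proof (rule sum.cong[OF refl])
    fix \<sigma>
    have "(\<Prod>j=1..n. h' j (t ((\<sigma> \<circ> inv \<pi>) j))) = (\<Prod>j=1..n. h' (\<pi> j) (t ((\<sigma> \<circ> inv \<pi>) (\<pi> j))))"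
      using prod.permute[OF pi_permutes, of "\<lambda>j. h' j (t ((\<sigma> \<circ> inv \<pi>) j))"] by (simp add: o_def)
    also have "\<dots> = (\<Prod>j=1..n. h j (t (\<sigma> j)))"
      using permutes_inverses[OF pi_permutes] by (intro prod.cong refl) (simp add: h_eq)
    finally show "(\<Prod>j=1..n. h' j (t ((\<sigma> \<circ> inv \<pi>) j))) = (\<Prod>j=1..n. h j (t (\<sigma> j)))" .
  qed
  finally show ?thesis by (simp add: symmetrize_def)
qed

lemma symmetrize_cmult:
  "symmetrize n (\<lambda>j u. c j * h j u) t = (\<Prod>j=1..n. c j) * symmetrize n h t"
  unfolding symmetrize_def prod.distrib by (rule sum_distrib_left[symmetric])

lemma symmetrize_mult_prod:
  "symmetrize n (\<lambda>j u. g u * h j u) t = (\<Prod>i=1..n. g (t i)) * symmetrize n h t"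
  unfolding symmetrize_def prod.distrib sum_distrib_left
proof (rule sum.cong[OF refl])
  fix \<sigma> assume "\<sigma> \<in> {\<sigma>. \<sigma> permutes {1..n}}"
  then have "(\<Prod>j=1..n. g (t (\<sigma> j))) = (\<Prod>i=1..n. g (t i))"
    using prod.permute[of \<sigma> "{1..n}" "\<lambda>i. g (t i)"] by (simp add: o_def)
  then show "(\<Prod>j=1..n. g (t (\<sigma> j))) * (\<Prod>j=1..n. h j (t (\<sigma> j))) = (\<Prod>i=1..n. g (t i)) * (\<Prod>j=1..n. h j (t (\<sigma> j)))"
    by (simp only:)
qed

lemma prod_fun_upd_first:
  fixes n :: nat and h :: "nat \<Rightarrow> 'a \<Rightarrow> 'b :: comm_monoid_mult"
  assumes "n \<ge> 1"
  shows "(\<Prod>j=1..n. (h(1 := f)) j (u j)) = f (u 1) * (\<Prod>j=2..n. h j (u j))"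
proof -
  have "{1..n} = insert 1 {2..n}" using assms by auto
  then have "(\<Prod>j=1..n. (h(1 := f)) j (u j)) = f (u 1) * (\<Prod>j=2..n. (h(1 := f)) j (u j))" by simp
  also have "(\<Prod>j=2..n. (h(1 := f)) j (u j)) = (\<Prod>j=2..n. h j (u j))" by (intro prod.cong refl) auto
  finally show ?thesis .
qed

lemma prod_fun_upd_first_and:
  fixes n r :: nat and h :: "nat \<Rightarrow> 'a \<Rightarrow> 'b :: comm_monoid_mult"
  assumes r_in: "r \<in> {2..n}"
  shows "(\<Prod>j=1..n. (h(1 := f, r := g)) j (u j)) = f (u 1) * g (u r) * (\<Prod>j\<in>{2..n} - {r}. h j (u j))"
proof -
  have "(\<Prod>j=2..n. (h(r := g)) j (u j)) = g (u r) * (\<Prod>j\<in>{2..n} - {r}. (h(r := g)) j (u j))"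
    using r_in by (subst prod.remove[of _ r]) auto
  also have "(\<Prod>j\<in>{2..n} - {r}. (h(r := g)) j (u j)) = (\<Prod>j\<in>{2..n} - {r}. h j (u j))"
    by (intro prod.cong refl) auto
  finally have "(\<Prod>j=1..n. ((h(r := g))(1 := f)) j (u j)) = f (u 1) * (g (u r) * (\<Prod>j\<in>{2..n} - {r}. h j (u j)))"
    using r_in by (subst prod_fun_upd_first) auto
  moreover have "h(1 := f, r := g) = (h(r := g))(1 := f)" using r_in by (intro fun_upd_twist) auto
  ultimately show ?thesis by (simp only: mult.assoc)
qed

lemma bij_betw_permutes_remove_first:
  fixes n :: nat
  assumes "\<sigma> permutes {1..n}" "n \<ge> 1"
  shows "bij_betw \<sigma> {2..n} ({1..n} - {\<sigma> 1})"
proof -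
  have "bij_betw \<sigma> ({1..n} - {1}) ({1..n} - {\<sigma> 1})"
    using permutes_imp_bij[OF assms(1)] permutes_in_image[OF assms(1), of 1] assms(2)
    by (intro bij_betw_DiffI) auto
  moreover have "{1..n} - {1} = {2..n}" by auto
  ultimately show ?thesis by (simp only:)
qed

lemma (in comm_monoid_set) permutes_remove_first:
  fixes n :: nat
  assumes "\<sigma> permutes {1..n}" "n \<ge> 1"
  shows "F (\<lambda>k. g (inv \<sigma> k) k) ({1..n} - {\<sigma> 1}) = F (\<lambda>j. g j (\<sigma> j)) {2..n}"
  using reindex_bij_betw[OF bij_betw_permutes_remove_first[OF assms], of "\<lambda>k. g (inv \<sigma> k) k"]
    permutes_inverses[OF assms(1)] by simp

lemma exists_image_mset_mset_set:
  assumes "finite A" "card A = size N"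
  shows "\<exists>w. image_mset w (mset_set A) = N"
  using assms
proof (induction A arbitrary: N rule: finite_induct)
  case (insert a A)
  then obtain b N' where N: "N = add_mset b N'" by (cases N) auto
  then obtain w where w: "image_mset w (mset_set A) = N'" using insert by auto
  have "image_mset (w(a := b)) (mset_set A) = N'"
    unfolding w[symmetric] using insert.hyps by (intro image_mset_cong) auto
  then show ?case
    by (intro exI[of _ "w(a := b)"])
      (simp only: mset_set.insert[OF insert.hyps] image_mset_add_mset N fun_upd_same)
qed auto

lemma image_mset_fun_upd_insert:
  assumes "finite A" "a \<notin> A"
  shows "image_mset (w(a := b)) (mset_set (insert a A)) = add_mset b (image_mset w (mset_set A))"
proof -
  have "image_mset (w(a := b)) (mset_set A) = image_mset w (mset_set A)"
    using assms by (intro image_mset_cong) auto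
  then show ?thesis by (simp only: mset_set.insert[OF assms] image_mset_add_mset fun_upd_same)
qed

lemma image_mset_fun_upd_mem:
  assumes "finite A" "r \<in> A"
  shows "image_mset (w(r := b)) (mset_set A) = add_mset b (image_mset w (mset_set A) - {#w r#})"
proof -
  have A_eq: "A = insert r (A - {r})" using assms(2) by blast
  have "image_mset w (mset_set A) = add_mset (w r) (image_mset w (mset_set (A - {r})))"
    using assms(1) by (subst A_eq) (simp add: mset_set.insert_remove)
  moreover have "image_mset (w(r := b)) (mset_set A) = add_mset b (image_mset w (mset_set (A - {r})))"
    using image_mset_fun_upd_insert[of "A - {r}" r w b] assms(1) A_eq by simp
  ultimately show ?thesis by simp
qed

context selberg_data
begin

lemma chamber_integral_sum_list:
  "(\<And>x. x \<in> set xs \<Longrightarrow> chamber_integrable l (f x)) \<Longrightarrow>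
    chamber_integral l (\<lambda>t. \<Sum>x\<leftarrow>xs. f x t) = (\<Sum>x\<leftarrow>xs. chamber_integral l (f x))"
  using chamber_integral_sum[of "{..<length xs}" l "\<lambda>i. f (xs ! i)"]
  by (simp add: sum_list_sum_nth atLeast0LessThan)

primrec letter_fun :: "letter \<Rightarrow> real \<Rightarrow> complex" where
  "letter_fun LOne = (\<lambda>t. 1)"
| "letter_fun (LF s) = (\<lambda>t. 1 / of_real (t - z s))"
| "letter_fun (LG s) = (\<lambda>t. of_real (z p - z s) / of_real (t - z s))"
| "letter_fun (LH s) = (\<lambda>t. of_real (z p - t) / of_real (t - z s))"
| "letter_fun (LU s) = (\<lambda>t. of_real (z p - z s) / of_real (t - z s) - of_real (z p - z 1) / of_real (t - z 1))"

lemma letter_fun_LU: "letter_fun (LU s) = (\<lambda>t. letter_fun (LG s) t - letter_fun (LG 1) t)"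
  by (simp del: of_real_diff)

lemma letter_fun_LH: "t \<noteq> z s \<Longrightarrow> letter_fun (LH s) t = letter_fun (LG s) t - 1"
  by (simp add: field_simps)

lemma admissible_letter_fun:
  assumes "b \<in> letters (p - 1)"
  shows "admissible (letter_fun b)"
proof -
  have LF_admissible: "admissible (letter_fun (LF s))" if "s \<in> {1..p-1}" for s
    using admissible_inverse[of s] that two_le_p by auto
  have LG_admissible: "admissible (letter_fun (LG s))" if "s \<in> {1..p-1}" for s
    using admissible_cmult[OF LF_admissible[OF that], of "of_real (z p - z s)"] by simp
  have LH_admissible: "admissible (letter_fun (LH s))" if "s \<in> {1..p-1}" for s
    using admissible_mult_bounded[OF LF_admissible[OF that], of "\<lambda>t. of_real (z p - t)" "z p - z 1"]
    by (simp del: of_real_diff)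
  have LU_admissible: "admissible (letter_fun (LU s))" if "s \<in> {1..p-1}" for s
    using admissible_add[OF LG_admissible[OF that] admissible_cmult[OF LG_admissible, of 1 "-1"]] that
    by (simp del: of_real_diff)
  show ?thesis using assms LF_admissible LG_admissible LH_admissible LU_admissible admissible_const
    unfolding letters_def by auto
qed

definition sym_integral :: "(nat \<Rightarrow> nat) \<Rightarrow> (nat \<Rightarrow> real \<Rightarrow> complex) \<Rightarrow> complex" where
  "sym_integral l h = chamber_integral l (symmetrize n h)"

text \<open>Only words \<open>M\<close> of \<open>n\<close> letters matter: for other \<open>M\<close> no \<open>w\<close> exists.\<close>

definition word_integral :: "letter multiset \<Rightarrow> (nat \<Rightarrow> nat) \<Rightarrow> complex" where
  "word_integral M l = (if l \<in> Zset n (p - 1)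
     then sym_integral l (\<lambda>j. letter_fun ((SOME w. image_mset w (mset_set {1..n}) = M) j)) else 0)"

lemma word_integral_image_mset:
  assumes "l \<in> Zset n (p - 1)"
  shows "word_integral (image_mset w (mset_set {1..n})) l = sym_integral l (\<lambda>j. letter_fun (w j))"
proof -
  define w' where "w' = (SOME w'. image_mset w' (mset_set {1..n}) = image_mset w (mset_set {1..n}))"
  have "image_mset w' (mset_set {1..n}) = image_mset w (mset_set {1..n})"
    unfolding w'_def by (rule someI[of _ w]) simp
  then obtain \<pi> where \<pi>: "\<pi> permutes {1..n}" "\<forall>j\<in>{1..n}. w' j = w (\<pi> j)"
    using image_mset_eq_implies_permutes[of "{1..n}" w' w] by auto
  have "symmetrize n (\<lambda>j. letter_fun (w' j)) = symmetrize n (\<lambda>j. letter_fun (w j))"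
    using \<pi> by (intro ext symmetrize_permute[OF \<pi>(1)]) auto
  then show ?thesis unfolding word_integral_def w'_def[symmetric] if_P[OF assms] sym_integral_def
    by (simp only:)
qed

lemma word_integral_image_Abs_multiset:
  assumes "m \<in> Zset n (p - 1)" "l \<in> Zset n (p - 1)"
  shows "word_integral (image_mset P (Abs_multiset m)) l = sym_integral l (\<lambda>j. letter_fun (P (block m j)))"
  unfolding image_mset_block[OF assms(1), symmetric] image_mset.compositionality
    word_integral_image_mset[OF assms(2)] o_def ..

lemma chamber_integrable_prod_permuted:
  assumes l_Zset: "l \<in> Zset n (p - 1)" and h_admissible: "\<And>j. j \<in> {1..n} \<Longrightarrow> admissible (h j)"
    and sigma_permutes: "\<sigma> permutes {1..n}"
  shows "chamber_integrable l (\<lambda>t. \<Prod>j=1..n. h j (t (\<sigma> j)))"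
proof -
  have "(\<Prod>j=1..n. h j (t (\<sigma> j))) = (\<Prod>i=1..n. h (inv \<sigma> i) (t i))" for t
    using prod.permute[OF sigma_permutes, of "\<lambda>i. h (inv \<sigma> i) (t i)"] permutes_inverses[OF sigma_permutes]
    by (simp add: o_def)
  then show ?thesis
    using chamber_integrable_prod[OF l_Zset, of "\<lambda>i. h (inv \<sigma> i)"] h_admissible
      permutes_in_image[OF permutes_inv[OF sigma_permutes]]
    by (simp only:)
qed

lemma chamber_integrable_symmetrize:
  "l \<in> Zset n (p - 1) \<Longrightarrow> (\<And>j. j \<in> {1..n} \<Longrightarrow> admissible (h j)) \<Longrightarrow> chamber_integrable l (symmetrize n h)"
  unfolding symmetrize_def by (intro chamber_integrable_sum chamber_integrable_prod_permuted) auto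

lemma sym_integral_linear_combination:
  assumes l_Zset: "l \<in> Zset n (p - 1)" and n_ge_1: "n \<ge> 1" and h_admissible: "\<And>j. j \<in> {2..n} \<Longrightarrow> admissible (h j)"
    and g_admissible: "\<And>i. i \<in> I \<Longrightarrow> admissible (g i)"
    and f_eq: "\<And>t. (\<forall>s\<in>{1..p}. t \<noteq> z s) \<Longrightarrow> f t = (\<Sum>i\<in>I. c i * g i t)"
  shows "sym_integral l (h(1 := f)) = (\<Sum>i\<in>I. c i * sym_integral l (h(1 := g i)))"
proof -
  have "symmetrize n (h(1 := f)) t = (\<Sum>i\<in>I. c i * symmetrize n (h(1 := g i)) t)" if nonzero: "\<Psi> t \<noteq> 0" for t
  proof -
    have "f (t (\<sigma> 1)) = (\<Sum>i\<in>I. c i * g i (t (\<sigma> 1)))" if "\<sigma> permutes {1..n}" for \<sigma>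
      using abs_Phi_nonzeroD(1)[OF nonzero] permutes_in_image[OF that, of 1] n_ge_1 by (intro f_eq) auto
    then have "symmetrize n (h(1 := f)) t
        = (\<Sum>\<sigma> | \<sigma> permutes {1..n}. \<Sum>i\<in>I. c i * (g i (t (\<sigma> 1)) * (\<Prod>j=2..n. h j (t (\<sigma> j)))))"
      unfolding symmetrize_def prod_fun_upd_first[OF n_ge_1, where u="\<lambda>j. t (_ j)"]
      by (intro sum.cong refl) (simp add: sum_distrib_right mult.assoc)
    also have "\<dots> = (\<Sum>i\<in>I. c i * symmetrize n (h(1 := g i)) t)"
      unfolding symmetrize_def prod_fun_upd_first[OF n_ge_1, where u="\<lambda>j. t (_ j)"]
      by (subst sum.swap) (simp add: sum_distrib_left)
    finally show ?thesis .
  qed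
  then have "sym_integral l (h(1 := f)) = chamber_integral l (\<lambda>t. \<Sum>i\<in>I. c i * symmetrize n (h(1 := g i)) t)"
    unfolding sym_integral_def by (intro chamber_integral_cong)
  also have "\<dots> = (\<Sum>i\<in>I. chamber_integral l (\<lambda>t. c i * symmetrize n (h(1 := g i)) t))"
    by (intro chamber_integral_sum chamber_integrable_cmult chamber_integrable_symmetrize[OF l_Zset])
      (auto simp: g_admissible h_admissible)
  finally show ?thesis by (simp only: chamber_integral_cmult sym_integral_def)
qed

section \<open>Symmetrisation of the integration by parts\<close>

definition pole_product :: "(nat \<Rightarrow> real \<Rightarrow> complex) \<Rightarrow> nat \<Rightarrow> (nat \<Rightarrow> real) \<Rightarrow> complex" where
  "pole_product h r u = (\<Prod>j=2..n. h j (u j)) * (of_real (u 1 - z p) / of_real (u 1 - u r))"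

lemma pole_product_add_transpose:
  assumes r_in: "r \<in> {2..n}"
  shows "pole_product h r u + pole_product h r (u \<circ> Transposition.transpose 1 r)
    = (of_real (u 1 - z p) * h r (u r) - of_real (u r - z p) * h r (u 1)) / of_real (u 1 - u r)
      * (\<Prod>j\<in>{2..n} - {r}. h j (u j))"
proof -
  let ?R = "\<Prod>j\<in>{2..n} - {r}. h j (u j)" and ?v = "u \<circ> Transposition.transpose 1 r"
  have split: "(\<Prod>j=2..n. h j (v j)) = h r (v r) * (\<Prod>j\<in>{2..n} - {r}. h j (v j))" for v
    using r_in by (intro prod.remove) auto
  have "(\<Prod>j\<in>{2..n} - {r}. h j (?v j)) = ?R"
    by (intro prod.cong refl) (auto simp: Transposition.transpose_def)
  then have "pole_product h r ?v = h r (u 1) * ?R * (of_real (u r - z p) / of_real (u r - u 1))"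
    unfolding pole_product_def split by (simp add: o_def del: of_real_diff)
  moreover have "pole_product h r u = h r (u r) * ?R * (of_real (u 1 - z p) / of_real (u 1 - u r))"
    unfolding pole_product_def split ..
  moreover have "a * b * (c / of_real (u r - u 1)) = - (c * a / of_real (u 1 - u r) * b)" for a b c :: complex
    by (cases "u 1 = u r") (simp_all add: field_simps)
  ultimately show ?thesis
    by (simp add: diff_divide_distrib left_diff_distrib right_diff_distrib mult_ac del: of_real_diff)
qed

lemma letter_fun_pair_LG:
  assumes "u \<noteq> v" "u \<noteq> z s" "v \<noteq> z s"
  shows "(of_real (u - z p) * letter_fun (LG s) v - of_real (v - z p) * letter_fun (LG s) u) / of_real (u - v)
    = letter_fun (LG s) v + letter_fun (LG s) u - letter_fun (LG s) u * letter_fun (LG s) v"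
proof -
  have identity: "((a - e) * ((e - c) / (b - c)) - (b - e) * ((e - c) / (a - c))) / (a - b)
      = (e - c) / (b - c) + (e - c) / (a - c) - (e - c) / (a - c) * ((e - c) / (b - c))"
    if "a \<noteq> b" "a \<noteq> c" "b \<noteq> c" for a b c e :: complex
  proof -
    have "a - b \<noteq> 0" "a - c \<noteq> 0" "b - c \<noteq> 0" using that by auto
    then show ?thesis by (simp add: divide_simps) (simp add: algebra_simps)
  qed
  show ?thesis using identity[of "of_real u" "of_real v" "of_real (z s)" "of_real (z p)"] assms by simp
qed

lemma letter_fun_pair_expansion:
  assumes b_expandable: "b \<in> expandable_letters (p - 1)" and u_neq_v: "u \<noteq> v"
    and off: "\<And>s. s \<in> {1..p} \<Longrightarrow> u \<noteq> z s \<and> v \<noteq> z s"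
  shows "(of_real (u - z p) * letter_fun b v - of_real (v - z p) * letter_fun b u) / of_real (u - v)
     = (\<Sum>(a, a', c)\<leftarrow>pair_expansion b. c * (letter_fun a u * letter_fun a' v))"
proof -
  let ?E = "\<lambda>b. (of_real (u - z p) * letter_fun b v - of_real (v - z p) * letter_fun b u) / of_real (u - v)"
  note pair_LG = letter_fun_pair_LG[OF u_neq_v]
  have off': "u \<noteq> z s" "v \<noteq> z s" if "s \<in> {1..p-1}" for s
  proof -
    have "s \<in> {1..p}" using that by auto
    then show "u \<noteq> z s" "v \<noteq> z s" using off by blast+
  qed
  consider "b = LOne" | s where "b = LG s" "s \<in> {1..p-1}" | s where "b = LU s" "s \<in> {1..p-1}"
    using b_expandable unfolding expandable_letters_def by auto
  then show ?thesis
  proof cases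
    case 1
    then show ?thesis using u_neq_v by (simp add: divide_simps)
  next
    case (2 s)
    then show ?thesis using pair_LG[OF off'[OF 2(2)]] by (simp del: letter_fun.simps(3) add: algebra_simps)
  next
    case (3 s)
    have "?E (LU s) = ?E (LG s) - ?E (LG 1)"
      unfolding letter_fun_LU diff_divide_distrib[symmetric] by (simp only: algebra_simps)
    also have "\<dots> = (letter_fun (LG s) v + letter_fun (LG s) u - letter_fun (LG s) u * letter_fun (LG s) v)
        - (letter_fun (LG 1) v + letter_fun (LG 1) u - letter_fun (LG 1) u * letter_fun (LG 1) v)"
      unfolding pair_LG[OF off'[OF 3(2)]] pair_LG[OF off'[OF one_in_range]] ..
    also have "\<dots> = (\<Sum>(a, a', c)\<leftarrow>pair_expansion (LU s). c * (letter_fun a u * letter_fun a' v))"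
      by (simp del: letter_fun.simps add: letter_fun_LU letter_fun.simps(1) algebra_simps)
    finally show ?thesis unfolding 3 .
  qed
qed

lemma sum_pole_product_permuted:
  assumes r_in: "r \<in> {2..n}" and w_expandable: "w r \<in> expandable_letters (p - 1)" and nonzero: "\<Psi> t \<noteq> 0"
  defines "h \<equiv> \<lambda>j. letter_fun (w j)"
  shows "2 * (\<Sum>\<sigma> | \<sigma> permutes {1..n}. pole_product h r (t \<circ> \<sigma>))
    = (\<Sum>(a, a', c)\<leftarrow>pair_expansion (w r). c * symmetrize n (h(1 := letter_fun a, r := letter_fun a')) t)"
proof -
  let ?S = "{\<sigma>. \<sigma> permutes {1..n}}" and ?\<tau> = "Transposition.transpose 1 r"
  let ?R = "\<lambda>\<sigma>. \<Prod>j\<in>{2..n} - {r}. h j (t (\<sigma> j))"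
  have pair: "pole_product h r (t \<circ> \<sigma>) + pole_product h r (t \<circ> (\<sigma> \<circ> ?\<tau>))
      = (\<Sum>(a, a', c)\<leftarrow>pair_expansion (w r). c * (letter_fun a (t (\<sigma> 1)) * letter_fun a' (t (\<sigma> r)))) * ?R \<sigma>"
    if sigma_permutes: "\<sigma> permutes {1..n}" for \<sigma>
  proof -
    have mem: "\<sigma> 1 \<in> {1..n}" "\<sigma> r \<in> {1..n}" using permutes_in_image[OF sigma_permutes] r_in by auto
    have "\<sigma> 1 \<noteq> \<sigma> r" using r_in inj_eq[OF permutes_inj[OF sigma_permutes], of 1 r] by simp
    then have distinct: "t (\<sigma> 1) \<noteq> t (\<sigma> r)" using abs_Phi_nonzeroD(2)[OF nonzero mem] by simp
    have off: "t (\<sigma> 1) \<noteq> z s \<and> t (\<sigma> r) \<noteq> z s" if "s \<in> {1..p}" for s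
      using abs_Phi_nonzeroD(1)[OF nonzero _ that] mem by blast
    have "(of_real (t (\<sigma> 1) - z p) * h r (t (\<sigma> r)) - of_real (t (\<sigma> r) - z p) * h r (t (\<sigma> 1)))
        / of_real (t (\<sigma> 1) - t (\<sigma> r))
        = (\<Sum>(a, a', c)\<leftarrow>pair_expansion (w r). c * (letter_fun a (t (\<sigma> 1)) * letter_fun a' (t (\<sigma> r))))"
      unfolding h_def by (rule letter_fun_pair_expansion[OF w_expandable distinct off])
    then show ?thesis
      using pole_product_add_transpose[OF r_in, of h "t \<circ> \<sigma>"] by (simp only: comp_assoc o_apply)
  qed
  have "?\<tau> permutes {1..n}" using r_in by (intro permutes_swap_id) auto
  then have "2 * (\<Sum>\<sigma>\<in>?S. pole_product h r (t \<circ> \<sigma>))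
      = (\<Sum>\<sigma>\<in>?S. pole_product h r (t \<circ> \<sigma>) + pole_product h r (t \<circ> (\<sigma> \<circ> ?\<tau>)))"
    using sum_permutations_compose_right[of ?\<tau> "{1..n}" "\<lambda>\<sigma>. pole_product h r (t \<circ> \<sigma>)"]
    by (simp add: sum.distrib)
  also have "\<dots> = (\<Sum>\<sigma>\<in>?S. (\<Sum>(a, a', c)\<leftarrow>pair_expansion (w r).
      c * (letter_fun a (t (\<sigma> 1)) * letter_fun a' (t (\<sigma> r)))) * ?R \<sigma>)"
    using pair by (intro sum.cong refl) simp
  also have "\<dots> = (\<Sum>(a, a', c)\<leftarrow>xs. c * symmetrize n (h(1 := letter_fun a, r := letter_fun a')) t)"
    if "xs = pair_expansion (w r)" for xs
    unfolding that[symmetric] symmetrize_def prod_fun_upd_first_and[OF r_in, where u="\<lambda>j. t (_ j)"]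
    by (induction xs) (auto simp: sum.distrib distrib_right sum_distrib_left mult.assoc)
  finally show ?thesis by simp
qed

lemma chamber_integral_sum_pole_product:
  assumes l_Zset: "l \<in> Zset n (p - 1)" and r_in: "r \<in> {2..n}"
    and w_expandable: "\<And>j. j \<in> {2..n} \<Longrightarrow> w j \<in> expandable_letters (p - 1)"
  defines "N \<equiv> image_mset w (mset_set {2..n})"
  shows "2 * chamber_integral l (\<lambda>t. \<Sum>\<sigma> | \<sigma> permutes {1..n}. pole_product (\<lambda>j. letter_fun (w j)) r (t \<circ> \<sigma>))
    = pair_sum word_integral (N - {#w r#}) (w r) l"
proof -
  let ?g = "\<lambda>a a'. (\<lambda>j. letter_fun (w j))(1 := letter_fun a, r := letter_fun a')"
  have integrable: "chamber_integrable l (symmetrize n (?g a a'))" if "(a, a', c) \<in> set (pair_expansion (w r))"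
    for a a' c
  proof (rule chamber_integrable_symmetrize[OF l_Zset])
    fix j assume "j \<in> {1..n}"
    moreover have "p - 1 \<ge> 1" using two_le_p by simp
    ultimately show "admissible (?g a a' j)"
      using pair_expansion_letters[OF w_expandable[OF r_in] _ that]
        subsetD[OF expandable_letters_subset w_expandable, of j]
      by (auto intro!: admissible_letter_fun)
  qed
  have word: "sym_integral l (?g a a') = word_integral (add_mset a (add_mset a' (N - {#w r#}))) l" for a a'
  proof -
    have "{1..n} = insert 1 {2..n}" using r_in by auto
    then have "image_mset (w(1 := a, r := a')) (mset_set {1..n}) = add_mset a (add_mset a' (N - {#w r#}))"
      using r_in image_mset_fun_upd_insert[of "{2..n}" 1 "w(r := a')" a]
        image_mset_fun_upd_mem[of "{2..n}" r w a']
      by (simp add: N_def fun_upd_twist del: mset_set.insert)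
    moreover have "?g a a' = (\<lambda>j. letter_fun ((w(1 := a, r := a')) j))" by auto
    ultimately show ?thesis using word_integral_image_mset[OF l_Zset, of "w(1 := a, r := a')"] by (simp only:)
  qed
  have "2 * chamber_integral l (\<lambda>t. \<Sum>\<sigma> | \<sigma> permutes {1..n}. pole_product (\<lambda>j. letter_fun (w j)) r (t \<circ> \<sigma>))
      = chamber_integral l (\<lambda>t. \<Sum>x\<leftarrow>pair_expansion (w r).
          snd (snd x) * symmetrize n (?g (fst x) (fst (snd x))) t)"
    unfolding chamber_integral_cmult[symmetric]
    by (intro chamber_integral_cong, subst sum_pole_product_permuted[where w=w, OF r_in w_expandable[OF r_in]])
      (simp_all only: case_prod_unfold not_False_eq_True)
  also have "\<dots> = (\<Sum>x\<leftarrow>pair_expansion (w r).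
      chamber_integral l (\<lambda>t. snd (snd x) * symmetrize n (?g (fst x) (fst (snd x))) t))"
    by (intro chamber_integral_sum_list chamber_integrable_cmult) (use integrable in auto)
  finally show ?thesis
    unfolding pair_sum_def word[symmetric] chamber_integral_cmult sym_integral_def case_prod_unfold .
qed

lemma admissible_inv_permuted:
  assumes sigma_permutes: "\<sigma> permutes {1..n}" and n_ge_1: "n \<ge> 1"
    and h_admissible: "\<And>j. j \<in> {2..n} \<Longrightarrow> admissible (h j)"
    and k_in: "k \<in> {1..n} - {\<sigma> 1}"
  shows "admissible (h (inv \<sigma> k))"
proof -
  obtain j where "j \<in> {2..n}" "k = \<sigma> j"
    using k_in bij_betw_imp_surj_on[OF bij_betw_permutes_remove_first[OF sigma_permutes n_ge_1]] by blast
  then show ?thesis using h_admissible permutes_inverses[OF sigma_permutes] by simp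
qed

lemma chamber_integrable_pole_product:
  assumes l_Zset: "l \<in> Zset n (p - 1)" and sigma_permutes: "\<sigma> permutes {1..n}" and n_ge_1: "n \<ge> 1"
    and h_admissible: "\<And>j. j \<in> {2..n} \<Longrightarrow> admissible (h j)" and r_in: "r \<in> {2..n}"
  shows "chamber_integrable l (\<lambda>t. pole_product h r (t \<circ> \<sigma>))"
proof -
  have first: "\<sigma> 1 \<in> {1..n}" using permutes_in_image[OF sigma_permutes] n_ge_1 by auto
  have "\<sigma> r \<in> {1..n} - {\<sigma> 1}" using bij_betw_permutes_remove_first[OF sigma_permutes n_ge_1] r_in
    unfolding bij_betw_def by blast
  then have "chamber_integrable l (\<lambda>t. (\<Prod>k\<in>{1..n}-{\<sigma> 1}. h (inv \<sigma> k) (t k))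
      * (of_real (t (\<sigma> 1) - z p) / of_real (t (\<sigma> 1) - t (\<sigma> r))))"
    by (rule chamber_integrable_pole[OF l_Zset first])
      (rule admissible_inv_permuted[OF sigma_permutes n_ge_1 h_admissible])
  then show ?thesis
    unfolding prod.permutes_remove_first[OF sigma_permutes n_ge_1, of "\<lambda>j k. h j (_ k)"]
      pole_product_def o_def .
qed

lemma chamber_integral_by_parts_permuted:
  assumes l_Zset: "l \<in> Zset n (p - 1)" and sigma_permutes: "\<sigma> permutes {1..n}" and n_ge_1: "n \<ge> 1"
    and h_admissible: "\<And>j. j \<in> {2..n} \<Longrightarrow> admissible (h j)"
  shows "chamber_integral l (\<lambda>t. \<Prod>j=1..n. (h(1 := log_deriv_last)) j (t (\<sigma> j)))
    + 2 * \<gamma> * (\<Sum>r=2..n. chamber_integral l (\<lambda>t. pole_product h r (t \<circ> \<sigma>))) = 0"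
proof -
  have first: "\<sigma> 1 \<in> {1..n}" using permutes_in_image[OF sigma_permutes] n_ge_1 by auto
  have poles: "chamber_integrable l (\<lambda>t. pole_product h r (t \<circ> \<sigma>))" if "r \<in> {2..n}" for r
    by (rule chamber_integrable_pole_product[OF l_Zset sigma_permutes n_ge_1 h_admissible that])
  have "chamber_integral l (\<lambda>t. (\<Prod>k\<in>{1..n}-{\<sigma> 1}. h (inv \<sigma> k) (t k)) * (log_deriv_last (t (\<sigma> 1))
      + 2 * \<gamma> * (\<Sum>j\<in>{1..n}-{\<sigma> 1}. of_real (t (\<sigma> 1) - z p) / of_real (t (\<sigma> 1) - t j)))) = 0"
    by (rule chamber_integral_by_parts[OF l_Zset first])
      (rule admissible_inv_permuted[OF sigma_permutes n_ge_1 h_admissible])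
  then have "0 = chamber_integral l (\<lambda>t. (\<Prod>j=1..n. (h(1 := log_deriv_last)) j (t (\<sigma> j)))
      + (\<Sum>r=2..n. 2 * \<gamma> * pole_product h r (t \<circ> \<sigma>)))"
    unfolding prod.permutes_remove_first[OF sigma_permutes n_ge_1, of "\<lambda>j k. h j (_ k)"]
      sum.permutes_remove_first[OF sigma_permutes n_ge_1,
        of "\<lambda>_ k. of_real (_ (\<sigma> 1) - z p) / of_real (_ (\<sigma> 1) - _ k)"]
      prod_fun_upd_first[OF n_ge_1, where u="\<lambda>j. _ (\<sigma> j)"] pole_product_def o_def
    by (simp add: algebra_simps sum_distrib_left del: of_real_diff)
  also have "\<dots> = chamber_integral l (\<lambda>t. \<Prod>j=1..n. (h(1 := log_deriv_last)) j (t (\<sigma> j)))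
      + chamber_integral l (\<lambda>t. \<Sum>r=2..n. 2 * \<gamma> * pole_product h r (t \<circ> \<sigma>))"
    by (intro chamber_integral_add chamber_integrable_prod_permuted[OF l_Zset _ sigma_permutes]
      chamber_integrable_sum chamber_integrable_cmult poles)
      (auto simp: admissible_log_deriv_last h_admissible)
  also have "chamber_integral l (\<lambda>t. \<Sum>r=2..n. 2 * \<gamma> * pole_product h r (t \<circ> \<sigma>))
      = (\<Sum>r=2..n. chamber_integral l (\<lambda>t. 2 * \<gamma> * pole_product h r (t \<circ> \<sigma>)))"
    by (intro chamber_integral_sum chamber_integrable_cmult poles)
  finally show ?thesis by (simp only: chamber_integral_cmult sum_distrib_left[symmetric])
qed

lemma sym_integral_by_parts:
  assumes l_Zset: "l \<in> Zset n (p - 1)" and n_ge_1: "n \<ge> 1"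
    and w_expandable: "\<And>j. j \<in> {2..n} \<Longrightarrow> w j \<in> expandable_letters (p - 1)"
  defines "N \<equiv> image_mset w (mset_set {2..n})"
  shows "sym_integral l ((\<lambda>j. letter_fun (w j))(1 := log_deriv_last))
    + \<gamma> * (\<Sum>b\<in>#N. pair_sum word_integral (N - {#b#}) b l) = 0"
proof -
  define h where "h = (\<lambda>j. letter_fun (w j))"
  let ?S = "{\<sigma>. \<sigma> permutes {1..n}}"
  let ?J = "\<lambda>\<sigma>. chamber_integral l (\<lambda>t. \<Prod>j=1..n. (h(1 := log_deriv_last)) j (t (\<sigma> j)))"
  let ?K = "\<lambda>r \<sigma>. chamber_integral l (\<lambda>t. pole_product h r (t \<circ> \<sigma>))"
  have h_admissible: "admissible (h j)" if "j \<in> {2..n}" for j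
    unfolding h_def using w_expandable[OF that] expandable_letters_subset by (intro admissible_letter_fun) auto
  have "(\<Sum>\<sigma>\<in>?S. ?J \<sigma> + 2 * \<gamma> * (\<Sum>r=2..n. ?K r \<sigma>)) = 0"
    using chamber_integral_by_parts_permuted[OF l_Zset _ n_ge_1 h_admissible] by (intro sum.neutral) auto
  then have "(\<Sum>\<sigma>\<in>?S. ?J \<sigma>) + 2 * \<gamma> * (\<Sum>r=2..n. \<Sum>\<sigma>\<in>?S. ?K r \<sigma>) = 0"
    unfolding sum.distrib sum_distrib_left[symmetric] by (subst sum.swap)
  moreover have "(\<Sum>\<sigma>\<in>?S. ?J \<sigma>) = sym_integral l (h(1 := log_deriv_last))"
    unfolding sym_integral_def symmetrize_def
    by (intro chamber_integral_sum[symmetric] chamber_integrable_prod_permuted[OF l_Zset])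
      (auto simp: admissible_log_deriv_last h_admissible)
  moreover have "2 * (\<Sum>\<sigma>\<in>?S. ?K r \<sigma>) = pair_sum word_integral (N - {#w r#}) (w r) l" if r_in: "r \<in> {2..n}" for r
  proof -
    have "(\<Sum>\<sigma>\<in>?S. ?K r \<sigma>) = chamber_integral l (\<lambda>t. \<Sum>\<sigma>\<in>?S. pole_product h r (t \<circ> \<sigma>))"
      using chamber_integrable_pole_product[OF l_Zset _ n_ge_1 h_admissible r_in]
      by (intro chamber_integral_sum[symmetric]) auto
    then show ?thesis using chamber_integral_sum_pole_product[OF l_Zset r_in w_expandable] unfolding N_def h_def
      by simp
  qed
  then have "2 * (\<Sum>r=2..n. \<Sum>\<sigma>\<in>?S. ?K r \<sigma>) = (\<Sum>r=2..n. pair_sum word_integral (N - {#w r#}) (w r) l)"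
    unfolding sum_distrib_left by (intro sum.cong refl)
  moreover have "(\<Sum>r=2..n. pair_sum word_integral (N - {#w r#}) (w r) l)
      = (\<Sum>b\<in>#N. pair_sum word_integral (N - {#b#}) b l)"
    unfolding N_def sum_unfold_sum_mset image_mset.compositionality o_def ..
  moreover have "2 * \<gamma> * x = \<gamma> * (2 * x)" for x by simp
  ultimately show ?thesis unfolding h_def by (simp only:)
qed

lemma log_deriv_last_eq:
  assumes "\<forall>s\<in>{1..p}. t \<noteq> z s"
  shows "log_deriv_last t = 1 + (\<Sum>s=1..p. \<alpha> s) - (\<Sum>s=1..p-1. \<alpha> s * letter_fun (LG s) t)"
proof -
  have "\<alpha> s * (of_real (t - z p) / of_real (t - z s)) = \<alpha> s - \<alpha> s * letter_fun (LG s) t" if "s \<in> {1..p}" for s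
  proof -
    have "of_real (t - z s) \<noteq> (0::complex)" using assms that by auto
    then show ?thesis by (simp add: field_simps)
  qed
  then have "log_deriv_last t = 1 + (\<Sum>s=1..p. \<alpha> s) - (\<Sum>s=1..p. \<alpha> s * letter_fun (LG s) t)"
    unfolding log_deriv_last_def by (simp add: sum_subtractf del: letter_fun.simps)
  moreover note range_eq_insert_last
  moreover have "letter_fun (LG p) t = 0" by simp
  ultimately show ?thesis using two_le_p by simp
qed

lemma word_integral_add_mset:
  assumes "l \<in> Zset n (p - 1)" "n \<ge> 1"
  shows "word_integral (add_mset a (image_mset w (mset_set {2..n}))) l
      = sym_integral l ((\<lambda>j. letter_fun (w j))(1 := letter_fun a))"
proof -
  have "{1..n} = insert 1 {2..n}" using assms(2) by auto
  then have "image_mset (w(1 := a)) (mset_set {1..n}) = add_mset a (image_mset w (mset_set {2..n}))"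
    using image_mset_fun_upd_insert[of "{2..n}" 1 w a] by (simp only:) simp
  moreover have "(\<lambda>j. letter_fun (w j))(1 := letter_fun a) = (\<lambda>j. letter_fun ((w(1 := a)) j))" by auto
  ultimately show ?thesis using word_integral_image_mset[OF assms(1), of "w(1 := a)"] by (simp only:)
qed

lemma word_integral_diff:
  assumes N_letters: "size N + 1 = n" "set_mset N \<subseteq> letters (p - 1)"
    and ab_letters: "a \<in> letters (p - 1)" "b \<in> letters (p - 1)"
    and letter_fun_c: "\<And>t. (\<forall>s\<in>{1..p}. t \<noteq> z s) \<Longrightarrow> letter_fun c t = letter_fun a t - letter_fun b t"
  shows "word_integral (add_mset c N) = word_integral (add_mset a N) - word_integral (add_mset b N)"
proof (rule ext)
  fix l
  show "word_integral (add_mset c N) l = (word_integral (add_mset a N) - word_integral (add_mset b N)) l"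
  proof (cases "l \<in> Zset n (p - 1)")
    case l_Zset: True
    obtain w where w: "image_mset w (mset_set {2..n}) = N"
      using exists_image_mset_mset_set[of "{2..n}" N] N_letters(1) by auto
    have n_ge_1: "n \<ge> 1" using N_letters by auto
    let ?h = "\<lambda>j. letter_fun (w j)"
    have "sym_integral l (?h(1 := letter_fun c))
        = (\<Sum>i\<in>{True, False}. (if i then 1 else -1) * sym_integral l (?h(1 := letter_fun (if i then a else b))))"
    proof (rule sym_integral_linear_combination[OF l_Zset n_ge_1])
      show "admissible (?h j)" if "j \<in> {2..n}" for j
        using that N_letters(2) unfolding w[symmetric] by (intro admissible_letter_fun) auto
    qed (use ab_letters letter_fun_c in \<open>auto intro: admissible_letter_fun\<close>)
    then show ?thesis unfolding w[symmetric] minus_apply word_integral_add_mset[OF l_Zset n_ge_1] by simp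
  qed (simp add: word_integral_def)
qed

lemma one_plus_sum_alpha_nonzero: "1 + (\<Sum>s=1..p. \<alpha> s) + of_nat j * \<gamma> \<noteq> 0"
proof -
  have "{1..p} = insert p {1..<p}" using two_le_p by auto
  then have "Re (1 + (\<Sum>s=1..p. \<alpha> s) + of_nat j * \<gamma>) = 1 + Re (\<alpha> p) + (\<Sum>s\<in>{1..<p}. Re (\<alpha> s)) + of_nat j * Re \<gamma>"
    by simp
  moreover have "(\<Sum>s\<in>{1..<p}. Re (\<alpha> s)) \<ge> 0" using Re_alpha_pos by (intro sum_nonneg) (auto intro: less_imp_le)
  moreover have "of_nat j * Re \<gamma> \<ge> 0" using Re_gamma_pos by simp
  ultimately have "Re (1 + (\<Sum>s=1..p. \<alpha> s) + of_nat j * \<gamma>) > 0" using Re_alpha_last by linarith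
  then show ?thesis by (metis less_irrefl zero_complex.sel(1))
qed

lemma word_integral_by_parts:
  assumes N_expandable: "size N + 1 = n" "set_mset N \<subseteq> expandable_letters (p - 1)"
  shows "(1 + (\<Sum>s=1..p. \<alpha> s)) * word_integral (add_mset LOne N) l
      - (\<Sum>s=1..p-1. \<alpha> s * word_integral (add_mset (LG s) N) l)
      + \<gamma> * (\<Sum>b\<in>#N. pair_sum word_integral (N - {#b#}) b l) = 0"
proof (cases "l \<in> Zset n (p - 1)")
  case False
  then have "word_integral M l = 0" for M by (simp add: word_integral_def)
  then show ?thesis by (simp add: pair_sum_def case_prod_unfold)
next
  case l_Zset: True
  obtain w where w: "image_mset w (mset_set {2..n}) = N"
    using exists_image_mset_mset_set[of "{2..n}" N] N_expandable(1) by auto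
  have n_ge_1: "n \<ge> 1" using N_expandable by auto
  define A where "A = 1 + (\<Sum>s=1..p. \<alpha> s)"
  let ?h = "\<lambda>j. letter_fun (w j)"
  let ?b = "\<lambda>s. if s = 0 then LOne else LG s" and ?c = "\<lambda>s. if s = 0 then A else - \<alpha> s"
  have split: "(\<Sum>s=0..p-1. ?c s * f (?b s)) = A * f LOne - (\<Sum>s=1..p-1. \<alpha> s * f (LG s))"
    for f :: "letter \<Rightarrow> complex"
    by (simp add: sum.atLeast_Suc_atMost sum_negf)
  have w_letters: "w j \<in> expandable_letters (p - 1)" if "j \<in> {2..n}" for j
    using that N_expandable(2) unfolding w[symmetric] by auto
  have "sym_integral l (?h(1 := log_deriv_last))
      = (\<Sum>s=0..p-1. ?c s * sym_integral l (?h(1 := letter_fun (?b s))))"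
  proof (rule sym_integral_linear_combination[OF l_Zset n_ge_1])
    show "admissible (?h j)" if "j \<in> {2..n}" for j
      using w_letters[OF that] expandable_letters_subset by (intro admissible_letter_fun) auto
    show "admissible (letter_fun (?b s))" if "s \<in> {0..p-1}" for s
      using that by (intro admissible_letter_fun) (auto simp: letters_def)
    show "log_deriv_last t = (\<Sum>s=0..p-1. ?c s * letter_fun (?b s) t)" if "\<forall>s\<in>{1..p}. t \<noteq> z s" for t
      unfolding log_deriv_last_eq[OF that] split[of "\<lambda>b. letter_fun b t"] unfolding A_def
      by (simp del: letter_fun.simps(3))
  qed
  also have "\<dots> = A * word_integral (add_mset LOne N) l - (\<Sum>s=1..p-1. \<alpha> s * word_integral (add_mset (LG s) N) l)"
    unfolding w[symmetric] word_integral_add_mset[OF l_Zset n_ge_1] by (rule split)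
  finally show ?thesis using sym_integral_by_parts[where w=w, OF l_Zset n_ge_1 w_letters] unfolding w A_def by simp
qed

lemma word_recursion_word_integral:
  "word_recursion word_integral n (p - 1) \<alpha> \<gamma> (1 + \<alpha> p) (1 + (\<Sum>s=1..p. \<alpha> s))"
proof
  show "1 \<le> p - 1" using two_le_p by simp
  show "1 + (\<Sum>s=1..p. \<alpha> s) = 1 + \<alpha> p + (\<Sum>s=1..p-1. \<alpha> s)"
    using range_eq_insert_last by simp
  have letters: "LG s \<in> letters (p - 1)" "LH s \<in> letters (p - 1)" if "s \<in> {1..p-1}" for s
    using that by (auto simp: letters_def)
  have LOne: "LOne \<in> letters (p - 1)" by (simp add: letters_def)
  have off: "t \<noteq> z s" if "\<forall>s\<in>{1..p}. t \<noteq> z s" "s \<in> {1..p-1}" for s t using that by auto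
  fix N :: "letter multiset" assume N_letters: "size N + 1 = n" "set_mset N \<subseteq> letters (p - 1)"
  show "word_integral (add_mset (LH 1) N) = word_integral (add_mset (LG 1) N) - word_integral (add_mset LOne N)"
    by (rule word_integral_diff[OF N_letters letters(1)[OF one_in_range] LOne])
       (simp only: letter_fun_LH[OF off[OF _ one_in_range]] letter_fun.simps(1))
  fix s assume s_in: "s \<in> {1..p-1}"
  show "word_integral (add_mset (LU s) N) = word_integral (add_mset (LG s) N)
      - word_integral (add_mset (LG 1) N)"
    by (rule word_integral_diff[OF N_letters letters(1)[OF s_in] letters(1)[OF one_in_range]]) (simp only: letter_fun_LU)
  show "word_integral (add_mset (LU s) N) = word_integral (add_mset (LH s) N)
      - word_integral (add_mset (LH 1) N)"
    by (rule word_integral_diff[OF N_letters letters(2)[OF s_in] letters(2)[OF one_in_range]])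
       (simp only: letter_fun_LU letter_fun_LH[OF off[OF _ s_in]] letter_fun_LH[OF off[OF _ one_in_range]] diff_diff_eq2
         diff_add_cancel)
qed (use word_integral_by_parts one_plus_sum_alpha_nonzero in auto)

section \<open>The determinant under \<open>\<alpha>\<^sub>p \<mapsto> \<alpha>\<^sub>p + 1\<close>\<close>

definition matrix_entry :: "(nat \<Rightarrow> nat) \<Rightarrow> (nat \<Rightarrow> nat) \<Rightarrow> complex" where
  "matrix_entry l m = chamber_integral l (omega n p z m)"

definition inv_fact_prod :: "(nat \<Rightarrow> nat) \<Rightarrow> complex" where
  "inv_fact_prod m = (\<Prod>s=1..p. 1 / of_nat (fact (m s)))"

lemma omega_eq_symmetrize:
  assumes m_Zset: "m \<in> Zset n (p - 1)"
  shows "omega n p z m t = inv_fact_prod m * symmetrize n (\<lambda>j. letter_fun (LF (block m j))) t"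
proof -
  have "Gam m p = {}"
    using psum_Suc[of m "p - 1"] Zset_outside[OF m_Zset, of p] two_le_p by (simp add: Gam_def)
  moreover note range_eq_insert_last
  ultimately have "(\<Prod>s=1..p. \<Prod>j\<in>Gam m s. 1 / complex_of_real (t (\<sigma> j) - z s))
      = (\<Prod>s=1..p-1. \<Prod>j\<in>Gam m s. 1 / complex_of_real (t (\<sigma> j) - z s))" for \<sigma> by simp
  also have "\<dots> \<sigma> = (\<Prod>s=1..p-1. \<Prod>j\<in>{j\<in>{1..n}. block m j = s}. letter_fun (LF (block m j)) (t (\<sigma> j)))" for \<sigma>
    by (intro prod.cong refl) (auto simp: Gam_eq_block[OF m_Zset])
  also have "\<dots> \<sigma> = (\<Prod>j=1..n. letter_fun (LF (block m j)) (t (\<sigma> j)))" for \<sigma>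
    using block_range[OF m_Zset] by (intro prod.group) auto
  finally show ?thesis
    unfolding omega_def symmetrize_def inv_fact_prod_def prod.distrib sum_distrib_left by (simp only:)
qed

lemma matrix_entry_eq_word_integral:
  assumes "m \<in> Zset n (p - 1)" "l \<in> Zset n (p - 1)"
  shows "matrix_entry l m = inv_fact_prod m * word_integral (image_mset LF (Abs_multiset m)) l"
  unfolding matrix_entry_def word_integral_image_Abs_multiset[OF assms] sym_integral_def
    chamber_integral_cmult[symmetric]
  by (intro chamber_integral_cong omega_eq_symmetrize assms)

lemma word_integral_LG:
  assumes m_Zset: "m \<in> Zset n (p - 1)" and l_Zset: "l \<in> Zset n (p - 1)"
  shows "word_integral (image_mset LG (Abs_multiset m)) l
    = (\<Prod>s=1..p-1. of_real (z p - z s) ^ m s) * word_integral (image_mset LF (Abs_multiset m)) l"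
proof -
  have "letter_fun (LG (block m j)) = (\<lambda>u. of_real (z p - z (block m j)) * letter_fun (LF (block m j)) u)" for j
    by simp
  then have "symmetrize n (\<lambda>j. letter_fun (LG (block m j))) t
      = (\<Prod>s=1..p-1. of_real (z p - z s) ^ m s) * symmetrize n (\<lambda>j. letter_fun (LF (block m j))) t" for t
    using symmetrize_cmult[of n "\<lambda>j. of_real (z p - z (block m j))" "\<lambda>j. letter_fun (LF (block m j))" t]
    unfolding prod_block[OF m_Zset, of "\<lambda>s. of_real (z p - z s)"] by (simp only:)
  then show ?thesis
    unfolding word_integral_image_Abs_multiset[OF m_Zset l_Zset] sym_integral_def
      chamber_integral_cmult[symmetric]
    by (intro chamber_integral_cong)
qed

lemma selberg_data_raise: "selberg_data p z (\<alpha>(p := \<alpha> p + of_nat K)) \<gamma>"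
  using two_le_p z_less_Suc Re_alpha_pos Re_alpha_last Re_gamma_pos by unfold_locales auto

lemma matrix_entry_shift_eq_word_integral:
  assumes l_Zset: "l \<in> Zset n (p - 1)" and m_Zset: "m \<in> Zset n (p - 1)"
  shows "selberg_data.matrix_entry n p z (\<alpha>(p := \<alpha> p + 1)) \<gamma> l m
    = inv_fact_prod m * word_integral (image_mset LH (Abs_multiset m)) l"
proof -
  interpret shifted: selberg_data n p z "\<alpha>(p := \<alpha> p + 1)" \<gamma> using selberg_data_raise[of 1] by simp
  let ?F = "\<lambda>j. letter_fun (LF (block m j))" and ?H = "\<lambda>j. letter_fun (LH (block m j))"
  have "?H = (\<lambda>j u. of_real (z p - u) * ?F j u)" by simp
  then have symmetrize_LH: "symmetrize n ?H t = (\<Prod>i=1..n. of_real (z p - t i)) * symmetrize n ?F t" for t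
    using symmetrize_mult_prod[of n "\<lambda>u. of_real (z p - u)" ?F t] by (simp only:)
  have "abs_Phi n p z (\<alpha>(p := \<alpha> p + 1)) \<gamma> t * omega n p z m t
      = \<Psi> t * (inv_fact_prod m * symmetrize n ?H t)" if t_chamber: "t \<in> chamber l" for t
    using abs_Phi_raise_last[of p n t z \<alpha> 1 \<gamma>] chamber_range[OF l_Zset t_chamber] two_le_p
    unfolding symmetrize_LH omega_eq_symmetrize[OF m_Zset] by (simp add: mult_ac del: letter_fun.simps)
  then have "shifted.matrix_entry l m = chamber_integral l (\<lambda>t. inv_fact_prod m * symmetrize n ?H t)"
    unfolding shifted.matrix_entry_def shifted.chamber_integral_def chamber_integral_def
      set_lebesgue_integral_def
    by (intro Bochner_Integration.integral_cong refl) (auto simp: indicator_def)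
  then show ?thesis
    unfolding word_integral_image_Abs_multiset[OF m_Zset l_Zset] sym_integral_def chamber_integral_cmult .
qed

theorem det_matrix_entry_shift:
  "det_on (Zset n (p - 1)) (selberg_data.matrix_entry n p z (\<alpha>(p := \<alpha> p + 1)) \<gamma>)
    = (\<Prod>m\<in>Zset n (p - 1). \<Prod>s<m 1. (1 + \<alpha> p + of_nat s * \<gamma>)
    / (1 + (\<Sum>s=1..p. \<alpha> s) + (2 * of_nat n - 2 - of_nat s) * \<gamma>))
      * (\<Prod>m\<in>Zset n (p - 1). \<Prod>s=1..p-1. of_real (z p - z s) ^ m s) * det_on (Zset n (p - 1)) matrix_entry"
proof -
  let ?Z = "Zset n (p - 1)" and ?W = "\<lambda>P. det_on (Zset n (p - 1))
      (\<lambda>l m. word_integral (image_mset P (Abs_multiset m)) l)"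
  have scale: "det_on ?Z (\<lambda>l m. c m * M l m) = (\<Prod>m\<in>?Z. c m) * det_on ?Z M" for c :: "(nat \<Rightarrow> nat) \<Rightarrow> complex"
    and M
    using det_on_scale[of ?Z "\<lambda>_. 1" M c] by (simp add: mult_ac)
  have "det_on ?Z (selberg_data.matrix_entry n p z (\<alpha>(p := \<alpha> p + 1)) \<gamma>) = (\<Prod>m\<in>?Z. inv_fact_prod m) * ?W LH"
    unfolding scale[symmetric] by (intro det_on_cong matrix_entry_shift_eq_word_integral)
  also have "?W LH = (\<Prod>m\<in>?Z. \<Prod>s<m 1. (1 + \<alpha> p + of_nat s * \<gamma>)
      / (1 + (\<Sum>s=1..p. \<alpha> s) + (2 * of_nat n - 2 - of_nat s) * \<gamma>)) * ?W LG"
    by (rule word_recursion.det_shift[OF word_recursion_word_integral])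
  also have "?W LG = (\<Prod>m\<in>?Z. \<Prod>s=1..p-1. of_real (z p - z s) ^ m s) * ?W LF"
    unfolding scale[symmetric] by (intro det_on_cong word_integral_LG)
  also have "(\<Prod>m\<in>?Z. inv_fact_prod m) * (a * (b * ?W LF)) = a * b * ((\<Prod>m\<in>?Z. inv_fact_prod m) * ?W LF)" for a b
    by (simp only: mult_ac)
  also have "(\<Prod>m\<in>?Z. inv_fact_prod m) * ?W LF = det_on ?Z matrix_entry"
    unfolding scale[symmetric] by (intro det_on_cong matrix_entry_eq_word_integral[symmetric])
  finally show ?thesis .
qed

end

section \<open>Integrals over ordered points\<close>

definition ordered_in :: "nat set \<Rightarrow> real set \<Rightarrow> (nat \<Rightarrow> real) set" where
  "ordered_in A S = {t. (\<forall>i\<in>A. t i \<in> S) \<and> mono_on A t}"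

definition ordered_integrand ::
    "nat set \<Rightarrow> real set \<Rightarrow> (real \<Rightarrow> complex) \<Rightarrow> complex \<Rightarrow> (nat \<Rightarrow> real) \<Rightarrow> complex" where
  "ordered_integrand A S w \<gamma> t = indicator (ordered_in A S) t *\<^sub>R ((\<Prod>i\<in>A. w (t i)) * vandermonde A \<gamma> t)"

definition ordered_integral :: "nat set \<Rightarrow> real set \<Rightarrow> (real \<Rightarrow> complex) \<Rightarrow> complex \<Rightarrow> complex" where
  "ordered_integral A S w \<gamma> = (\<integral>t. ordered_integrand A S w \<gamma> t \<partial>lborel_on A)"

lemma ordered_integrand_cong:
  assumes "\<And>i. i \<in> A \<Longrightarrow> t i = u i"
  shows "ordered_integrand A S w \<gamma> t = ordered_integrand A S w \<gamma> u"
proof -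
  have "t \<in> ordered_in A S \<longleftrightarrow> u \<in> ordered_in A S"
    using assms by (auto simp: ordered_in_def mono_on_def)
  moreover have "(\<Prod>i\<in>A. w (t i)) = (\<Prod>i\<in>A. w (u i))" using assms by (intro prod.cong) auto
  moreover have "vandermonde A \<gamma> t = vandermonde A \<gamma> u" by (rule vandermonde_cong[OF assms])
  ultimately show ?thesis by (simp add: ordered_integrand_def indicator_def)
qed

lemma ordered_integral_cong:
  assumes "\<And>y. y \<in> S \<Longrightarrow> w y = w' y"
  shows "ordered_integral A S w \<gamma> = ordered_integral A S w' \<gamma>"
proof -
  have "ordered_integrand A S w \<gamma> t = ordered_integrand A S w' \<gamma> t" for t
    using assms by (cases "t \<in> ordered_in A S") (auto simp: ordered_integrand_def ordered_in_def
      intro!: prod.cong)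
  then show ?thesis by (simp add: ordered_integral_def)
qed

lemma ordered_integral_empty: "ordered_integral {} S w \<gamma> = 1"
  using lborel_product.product_integral_prod[of "{}" "\<lambda>_ _. 1 :: complex"]
  by (simp add: ordered_integral_def ordered_integrand_def ordered_in_def vandermonde_def less_pairs_def)

lemma measurable_ordered_integrand:
  assumes "finite A" "S \<in> sets borel" "w \<in> borel_measurable borel"
  shows "ordered_integrand A S w \<gamma> \<in> borel_measurable (lborel_on A)"
proof -
  have component: "(\<lambda>t. t i) \<in> borel_measurable (lborel_on A)" if "i \<in> A" for i
    by (rule measurable_component_lborel_on[OF that])
  have "Measurable.pred (lborel_on A) (\<lambda>t. \<forall>i\<in>A. t i \<in> S)"
  proof (rule pred_intros_finite(3)[OF assms(1)])
    fix i assume "i \<in> A"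
    note [measurable] = component[OF this] assms(2)
    show "Measurable.pred (lborel_on A) (\<lambda>t. t i \<in> S)" by measurable
  qed
  then have [measurable]: "Measurable.pred (lborel_on A) (\<lambda>t. t \<in> ordered_in A S)"
    unfolding ordered_in_def mem_Collect_eq by (intro pred_intros_logic pred_mono_on assms(1) order_refl)
  have [measurable]: "(\<lambda>t. \<Prod>i\<in>A. w (t i)) \<in> borel_measurable (lborel_on A)"
    by (rule borel_measurable_prod) (rule measurable_compose[OF component assms(3)])
  have [measurable]: "vandermonde A \<gamma> \<in> borel_measurable (lborel_on A)"
    by (rule measurable_vandermonde[OF order_refl])
  show ?thesis unfolding ordered_integrand_def by measurable
qed

lemma vandermonde_affine:
  assumes "\<bar>c\<bar> = 1"
  shows "vandermonde A \<gamma> (\<lambda>i. d + c * t i) = vandermonde A \<gamma> t"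
proof -
  have "abs_powr ((d + c * x) - (d + c * x')) a = abs_powr (x - x') a" for x x' a
    using assms by (simp add: abs_powr_def right_diff_distrib[symmetric] abs_mult)
  then show ?thesis by (simp only: vandermonde_def)
qed

lemma mono_on_affine_iff:
  fixes c d :: real and t :: "nat \<Rightarrow> real" and f :: "'a :: linorder \<Rightarrow> nat"
  assumes abs_c: "\<bar>c\<bar> = 1"
    and mono: "\<And>i j. i \<in> A \<Longrightarrow> j \<in> A \<Longrightarrow> i < j \<Longrightarrow> c * real (f i) < c * real (f j)"
  shows "mono_on A (\<lambda>j. d + c * t (f j)) \<longleftrightarrow> mono_on (f ` A) t"
proof -
  have le_iff: "i \<le> j \<longleftrightarrow> c * real (f i) \<le> c * real (f j)" if "i \<in> A" "j \<in> A" for i j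
    using mono[of i j] mono[of j i] that by (cases i j rule: linorder_cases) auto
  consider "c = 1" | "c = -1" using abs_c by linarith
  then show ?thesis by cases (use le_iff in \<open>auto simp: mono_on_def\<close>)
qed

lemma ordered_integral_affine:
  fixes c d :: real
  assumes f_bij: "bij_betw f A B" and finite_A: "finite A" and abs_c: "\<bar>c\<bar> = 1"
    and mono: "\<And>i j. i \<in> A \<Longrightarrow> j \<in> A \<Longrightarrow> i < j \<Longrightarrow> c * real (f i) < c * real (f j)"
    and S_borel: "S \<in> sets borel" and w_measurable: "w \<in> borel_measurable borel"
  shows "ordered_integral A S w \<gamma> = ordered_integral B {y. d + c * y \<in> S} (\<lambda>y. w (d + c * y)) \<gamma>"
proof -
  have B_eq: "B = f ` A" using f_bij by (simp add: bij_betw_def)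
  have integrand: "ordered_integrand A S w \<gamma> (\<lambda>j\<in>A. d + c * y (f j))
      = ordered_integrand B {y. d + c * y \<in> S} (\<lambda>y. w (d + c * y)) \<gamma> y" for y
  proof -
    have "mono_on A (\<lambda>j. d + c * y (f j)) \<longleftrightarrow> mono_on B y"
      unfolding B_eq by (rule mono_on_affine_iff[OF abs_c mono])
    then have "(\<lambda>j. d + c * y (f j)) \<in> ordered_in A S \<longleftrightarrow> y \<in> ordered_in B {y. d + c * y \<in> S}"
      by (auto simp: ordered_in_def B_eq)
    moreover have "(\<Prod>i\<in>A. w (d + c * y (f i))) = (\<Prod>i\<in>B. w (d + c * y i))"
      by (rule prod.reindex_bij_betw[OF f_bij])
    moreover have "vandermonde A \<gamma> (\<lambda>j. d + c * y (f j)) = vandermonde B \<gamma> y"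
      unfolding vandermonde_affine[OF abs_c, where t="\<lambda>j. y (f j)"] by (rule vandermonde_reindex[OF f_bij])
    ultimately have "ordered_integrand A S w \<gamma> (\<lambda>j. d + c * y (f j))
        = ordered_integrand B {y. d + c * y \<in> S} (\<lambda>y. w (d + c * y)) \<gamma> y"
      by (simp add: ordered_integrand_def indicator_def)
    then show ?thesis
      by (subst ordered_integrand_cong[of A _ "\<lambda>j. d + c * y (f j)"]) auto
  qed
  have "c \<noteq> 0" using abs_c by auto
  then show ?thesis
    using integral_lborel_on_affine_reindex[OF f_bij finite_A _
      measurable_ordered_integrand[OF finite_A S_borel w_measurable], where c="\<lambda>_. c" and d="\<lambda>_. d"] abs_c
    unfolding ordered_integral_def by (simp add: integrand)
qed

lemma ordered_integral_shift_index:
  assumes "S \<in> sets borel" "w \<in> borel_measurable borel"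
  shows "ordered_integral {a + 1..a + k} S w \<gamma> = ordered_integral {1..k} S w \<gamma>"
proof -
  have "bij_betw (\<lambda>j. a + j) {1..k} {a + 1..a + k}"
    by (rule bij_betw_byWitness[where f'="\<lambda>i. i - a"]) auto
  from ordered_integral_affine[OF this, of 1 S w \<gamma> 0] assms show ?thesis by simp
qed

lemma ordered_integrand_insert_least:
  assumes finite_A: "finite A" and i_less: "\<And>j. j \<in> A \<Longrightarrow> i < j"
  shows "ordered_integrand (insert i A) S w \<gamma> t = (indicator S (t i) *\<^sub>R w (t i))
    * ordered_integrand A (S \<inter> {t i..}) (\<lambda>y. w y * abs_powr (y - t i) (2 * \<gamma>)) \<gamma> t"
proof -
  have i_notin: "i \<notin> A" using i_less by blast
  have "t \<in> ordered_in (insert i A) S \<longleftrightarrow> t i \<in> S \<and> t \<in> ordered_in A (S \<inter> {t i..})"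
    using i_less i_notin by (fastforce simp: ordered_in_def mono_on_def)
  moreover have "vandermonde (insert i A) \<gamma> t = (\<Prod>j\<in>A. abs_powr (t j - t i) (2 * \<gamma>)) * vandermonde A \<gamma> t"
    unfolding vandermonde_insert[OF finite_A i_notin] abs_powr_diff_commute[of "t i"] ..
  ultimately show ?thesis
    using finite_A i_notin by (simp add: ordered_integrand_def indicator_def prod.distrib mult_ac)
qed

lemma ordered_integral_insert_least:
  assumes finite_A: "finite A" and i_less: "\<And>j. j \<in> A \<Longrightarrow> i < j"
    and int: "integrable (lborel_on (insert i A)) (ordered_integrand (insert i A) S w \<gamma>)"
    and inner: "\<And>u. u \<in> S \<Longrightarrow> ordered_integral A (S \<inter> {u..}) (\<lambda>y. w y * abs_powr (y - u) (2 * \<gamma>)) \<gamma> = g u"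
    and meas [measurable]: "S \<in> sets borel" "w \<in> borel_measurable borel" "g \<in> borel_measurable borel"
  shows "ordered_integral (insert i A) S w \<gamma> = (LINT u:S|lborel. w u * g u)"
proof -
  have i_notin: "i \<notin> A" using i_less by blast
  let ?h = "\<lambda>u. ordered_integrand A (S \<inter> {u..}) (\<lambda>y. w y * abs_powr (y - u) (2 * \<gamma>)) \<gamma>"
  let ?f = "ordered_integrand (insert i A) S w \<gamma>"
  have split: "?f (merge {i} A (x, y)) = (indicator S (x i) *\<^sub>R w (x i)) * ?h (x i) y" for x y
  proof -
    have "?f t = (indicator S (t i) *\<^sub>R w (t i)) * ?h (t i) t" for t
      by (rule ordered_integrand_insert_least[OF finite_A]) (rule i_less)
    moreover have "merge {i} A (x, y) i = x i" by (simp add: merge_def)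
    moreover have "?h (x i) (merge {i} A (x, y)) = ?h (x i) y"
      using i_notin by (intro ordered_integrand_cong) (auto simp: merge_def)
    ultimately show ?thesis by (simp only:)
  qed
  have "ordered_integral (insert i A) S w \<gamma> = (\<integral>x. \<integral>y. ?f (merge {i} A (x, y)) \<partial>lborel_on A \<partial>lborel_on {i})"
    unfolding ordered_integral_def using lborel_product.product_integral_fold[of "{i}" A ?f] finite_A i_notin
      int by simp
  also have "\<dots> = (\<integral>x. indicator S (x i) *\<^sub>R (w (x i) * g (x i)) \<partial>lborel_on {i})"
    unfolding split by (intro Bochner_Integration.integral_cong refl)
      (simp add: inner flip: ordered_integral_def split: split_indicator)
  also have "\<dots> = (\<integral>u. indicator S u *\<^sub>R (w u * g u) \<partial>lborel)"
    by (rule lborel_product.product_integral_singleton) measurable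
  finally show ?thesis by (simp only: set_lebesgue_integral_def)
qed

lemma norm_prod_less_pairs_le:
  fixes b :: "nat \<Rightarrow> nat \<Rightarrow> complex" and y :: "nat \<Rightarrow> real"
  assumes finite_A: "finite A" and y_nonneg: "\<And>i. i \<in> A \<Longrightarrow> y i \<ge> 0" and g_nonneg: "g \<ge> 0" and M_nonneg: "M \<ge> 0"
    and norm_b_le: "\<And>i j. (i, j) \<in> less_pairs A \<Longrightarrow> norm (b i j) \<le> M * ((1 + y i) * (1 + y j)) powr g"
  shows "norm (\<Prod>(i, j)\<in>less_pairs A. b i j)
     \<le> M ^ card (less_pairs A) * (\<Prod>k\<in>A. (1 + y k) powr (g * card (less_pairs A)))"
proof -
  define P where "P = (\<Prod>k\<in>A. 1 + y k)"
  have factor: "norm (b i j) \<le> M * P powr g" if ij_pair: "(i, j) \<in> less_pairs A" for i j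
  proof -
    have mem: "i \<in> A" "j \<in> A" "i \<noteq> j" using ij_pair by (auto simp: less_pairs_def)
    have "1 \<le> (\<Prod>k\<in>A - {i} - {j}. 1 + y k)" by (rule prod_ge_1) (use y_nonneg in auto)
    then have "(1 + y i) * (1 + y j) \<le> (1 + y i) * (1 + y j) * (\<Prod>k\<in>A - {i} - {j}. 1 + y k)"
      using y_nonneg[OF mem(1)] y_nonneg[OF mem(2)] mult_left_mono[of 1 _ "(1 + y i) * (1 + y j)"] by simp
    also have "\<dots> = P"
      unfolding P_def using finite_A mem
      by (simp add: prod.remove[of A i] prod.remove[of "A - {i}" j] mult.assoc)
    finally have "((1 + y i) * (1 + y j)) powr g \<le> P powr g"
      using y_nonneg[OF mem(1)] y_nonneg[OF mem(2)] g_nonneg by (intro powr_mono2) auto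
    then show ?thesis using norm_b_le[OF ij_pair] M_nonneg by (meson mult_left_mono order_trans)
  qed
  have "norm (\<Prod>(i, j)\<in>less_pairs A. b i j) \<le> (\<Prod>x\<in>less_pairs A. M * P powr g)"
    unfolding case_prod_unfold prod_norm[symmetric] using factor by (intro prod_mono) auto
  also have "\<dots> = M ^ card (less_pairs A) * (P powr g) ^ card (less_pairs A)" by (simp add: power_mult_distrib)
  also have "(P powr g) ^ card (less_pairs A) = P powr (g * card (less_pairs A))"
  proof -
    have "P \<ge> 1" unfolding P_def by (rule prod_ge_1) (use y_nonneg in auto)
    then show ?thesis by (simp add: powr_power mult.commute)
  qed
  also have "\<dots> = (\<Prod>k\<in>A. (1 + y k) powr (g * card (less_pairs A)))" unfolding P_def by (rule prod_powr_distrib)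
  finally show ?thesis .
qed

lemma norm_abs_powr_diff_le_mult:
  assumes "x \<ge> 0" "y \<ge> 0" "Re a \<ge> 0"
  shows "norm (abs_powr (y - x) a) \<le> ((1 + x) * (1 + y)) powr Re a"
proof -
  have "\<bar>y - x\<bar> \<le> x + y" using assms by auto
  also have "\<dots> \<le> (1 + x) * (1 + y)" using assms by (simp add: algebra_simps)
  finally show ?thesis unfolding norm_abs_powr using assms by (simp add: powr_mono2)
qed

lemma integrable_ordered_integrand:
  assumes finite_A: "finite A" and a_pos: "a > 0" and gamma_nonneg: "Re \<gamma> \<ge> 0"
    and S_borel: "S \<in> sets borel" "S \<subseteq> {0..}"
    and w_bounded: "w \<in> borel_measurable borel" "\<And>y. y \<in> S \<Longrightarrow> norm (w y) \<le> gamma_majorant a 0 y"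
  shows "integrable (lborel_on A) (ordered_integrand A S w \<gamma>)"
proof (rule integrable_lborel_on_dominated[OF finite_A])
  show "ordered_integrand A S w \<gamma> \<in> borel_measurable (lborel_on A)"
    by (rule measurable_ordered_integrand[OF finite_A S_borel(1) w_bounded(1)])
  let ?Q = "2 * Re \<gamma> * card (less_pairs A)"
  show "integrable lborel (gamma_majorant a ?Q)" using a_pos gamma_nonneg
    by (intro integrable_gamma_majorant) auto
  show "norm (ordered_integrand A S w \<gamma> t) \<le> 1 * (\<Prod>i\<in>A. gamma_majorant a ?Q (t i))" for t
  proof (cases "t \<in> ordered_in A S")
    case True
    then have t_in_S: "t i \<in> S" "t i \<ge> 0" if "i \<in> A" for i using that S_borel(2) by (auto simp: ordered_in_def)
    have pairs: "norm (vandermonde A \<gamma> t) \<le> (\<Prod>i\<in>A. (1 + t i) powr ?Q)"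
      unfolding vandermonde_def
      using norm_prod_less_pairs_le[of A t "2 * Re \<gamma>" 1 "\<lambda>i j. abs_powr (t j - t i) (2 * \<gamma>)"]
        norm_abs_powr_diff_le_mult[of "t _" "t _" "2 * \<gamma>"] finite_A t_in_S gamma_nonneg
          by (simp add: less_pairs_def)
    have "norm ((\<Prod>i\<in>A. w (t i)) * vandermonde A \<gamma> t) \<le> (\<Prod>i\<in>A. gamma_majorant a 0 (t i))
        * (\<Prod>i\<in>A. (1 + t i) powr ?Q)"
      unfolding norm_mult prod_norm[symmetric] using t_in_S w_bounded(2) pairs
      by (intro mult_mono prod_mono conjI prod_nonneg) (auto simp: gamma_majorant_nonneg)
    also have "\<dots> = (\<Prod>i\<in>A. gamma_majorant a ?Q (t i))"
      unfolding prod.distrib[symmetric] using t_in_S(2) gamma_majorant_mult_powr[of _ a 0]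
      by (intro prod.cong) auto
    finally show ?thesis using True by (simp add: ordered_integrand_def)
  qed (auto simp: ordered_integrand_def gamma_majorant_nonneg intro!: prod_nonneg)
qed

definition laguerre_weight :: "complex \<Rightarrow> real \<Rightarrow> complex" where
  "laguerre_weight a y = abs_powr y (a - 1) * of_real (exp (- y))"

definition laguerre_selberg :: "nat \<Rightarrow> complex \<Rightarrow> complex \<Rightarrow> complex" where
  "laguerre_selberg n a \<gamma> = ordered_integral {1..n} {0..} (laguerre_weight a) \<gamma>"

lemma measurable_laguerre_weight [measurable]: "laguerre_weight a \<in> borel_measurable borel"
  unfolding laguerre_weight_def by measurable

lemma integrable_laguerre_integrand:
  assumes "finite A" "Re a > 0" "Re \<gamma> \<ge> 0"
  shows "integrable (lborel_on A) (ordered_integrand A {0..} (laguerre_weight a) \<gamma>)"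
  by (rule integrable_ordered_integrand[of A "Re a"])
    (use assms in \<open>auto simp: laguerre_weight_def gamma_majorant_def norm_mult norm_abs_powr\<close>)

lemma integral_prod_laguerre_integrand:
  assumes l_Zset: "l \<in> Zset n q" and a_pos: "\<And>s. s \<in> {1..q} \<Longrightarrow> Re (a s) > 0" and gamma_nonneg: "Re \<gamma> \<ge> 0"
  shows "(\<integral>t. (\<Prod>s=1..q. ordered_integrand (Gam l s) {0..} (laguerre_weight (a s)) \<gamma> t) \<partial>Rn n)
    = (\<Prod>s=1..q. laguerre_selberg (l s) (a s) \<gamma>)"
proof -
  let ?F = "\<lambda>s. ordered_integrand (Gam l s) {0..} (laguerre_weight (a s)) \<gamma>"
  have union: "(\<Union>s\<in>{1..q}. Gam l s) = {1..n}" using Gam_eq_block[OF l_Zset] block_range[OF l_Zset] by auto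
  have disjoint: "disjoint_family_on (Gam l) {1..q}"
    using Gam_eq_block[OF l_Zset] by (auto simp: disjoint_family_on_def)
  have "(\<integral>t. (\<Prod>s=1..q. ?F s (restrict t (Gam l s))) \<partial>lborel_on (\<Union>s\<in>{1..q}. Gam l s))
      = (\<Prod>s=1..q. \<integral>y. ?F s y \<partial>lborel_on (Gam l s))"
    by (rule conjunct2[OF integral_lborel_on_disjoint_product[OF _ disjoint]])
      (use a_pos gamma_nonneg in \<open>auto simp: Gam_def intro!: integrable_laguerre_integrand\<close>)
  moreover have "?F s (restrict t (Gam l s)) = ?F s t" for s t by (rule ordered_integrand_cong) simp
  moreover have "(\<integral>y. ?F s y \<partial>lborel_on (Gam l s)) = laguerre_selberg (l s) (a s) \<gamma>" if "s \<in> {1..q}" for s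
  proof -
    have "Gam l s = {psum l (s - 1) + 1..psum l (s - 1) + l s}"
      using that psum_Suc[of l "s - 1"] by (simp add: Gam_def)
    then show ?thesis
      unfolding laguerre_selberg_def
      using ordered_integral_shift_index[of "{0..}" "laguerre_weight (a s)" "psum l (s - 1)" "l s" \<gamma>]
      by (simp add: ordered_integral_def)
  qed
  ultimately show ?thesis unfolding union by simp
qed

section \<open>The limit \<open>\<alpha>\<^sub>p \<rightarrow> \<infinity>\<close>\<close>

lemma prod_less_pairs_block:
  fixes g :: "nat \<Rightarrow> nat \<Rightarrow> 'a :: comm_monoid_mult"
  assumes l_Zset: "l \<in> Zset n q"
  shows "(\<Prod>s=1..q. \<Prod>(i, j)\<in>less_pairs (Gam l s). g i j)
    = (\<Prod>(i, j)\<in>less_pairs {1..n}. if block l i = block l j then g i j else 1)"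
proof -
  let ?T = "{x \<in> less_pairs {1..n}. block l (fst x) = block l (snd x)}"
  have "less_pairs (Gam l s) = {x \<in> ?T. block l (fst x) = s}" if "s \<in> {1..q}" for s
    unfolding Gam_eq_block[OF l_Zset that] by (auto simp: less_pairs_def)
  then have "(\<Prod>s=1..q. \<Prod>(i, j)\<in>less_pairs (Gam l s). g i j)
      = (\<Prod>s=1..q. \<Prod>(i, j)\<in>{x \<in> ?T. block l (fst x) = s}. g i j)"
    by (intro prod.cong refl) (simp only:)
  also have "\<dots> = (\<Prod>(i, j)\<in>?T. g i j)"
  proof (rule prod.group)
    show "(\<lambda>x. block l (fst x)) ` ?T \<subseteq> {1..q}"
    proof (rule image_subsetI)
      fix x assume "x \<in> ?T"
      then have "fst x \<in> {1..n}" by (auto simp: less_pairs_def)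
      then show "block l (fst x) \<in> {1..q}" by (rule block_range[OF l_Zset])
    qed
  qed simp_all
  finally show ?thesis by (simp add: prod.inter_filter case_prod_unfold)
qed

context selberg_data
begin

definition dist_last :: "nat \<Rightarrow> real" where
  "dist_last s = z p - z s"

lemma dist_last_pos: "s \<in> {1..p-1} \<Longrightarrow> dist_last s > 0"
  using z_less[of s p] by (auto simp: dist_last_def)

lemma dist_last_le: "s \<in> {1..p-1} \<Longrightarrow> dist_last s \<le> z p - z 1"
  using z_le[of 1 s] by (auto simp: dist_last_def)

definition sep :: real where
  "sep = Min ((\<lambda>s. z (s + 1) - z s) ` {1..<p}) / 2"

lemma sep_pos: "sep > 0"
proof -
  have "Min ((\<lambda>s. z (s + 1) - z s) ` {1..<p}) \<in> (\<lambda>s. z (s + 1) - z s) ` {1..<p}"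
    using two_le_p by (intro Min_in) auto
  then show ?thesis using z_less_Suc by (auto simp: sep_def)
qed

lemma two_sep_le:
  assumes "1 \<le> r" "r < s" "s \<le> p"
  shows "2 * sep \<le> z s - z r"
proof -
  have "2 * sep \<le> z (r + 1) - z r" using assms by (auto simp: sep_def intro!: Min_le)
  then show ?thesis using z_le[of "r + 1" s] assms by simp
qed

definition near_ratio :: real where
  "near_ratio = sep / (z p - z 1)"

lemma near_ratio_pos: "near_ratio > 0"
  using sep_pos z_first_less_last by (simp add: near_ratio_def)

lemma near_ratio_le_half: "near_ratio \<le> 1 / 2"
  using two_sep_le[of 1 p] two_le_p z_first_less_last by (simp add: near_ratio_def field_simps)

lemma near_ratio_mult_dist_last_le:
  assumes "s \<in> {1..p-1}"
  shows "near_ratio * dist_last s \<le> sep"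
proof -
  have "near_ratio * dist_last s \<le> near_ratio * (z p - z 1)"
    using dist_last_le[OF assms] near_ratio_pos by (intro mult_left_mono) auto
  then show ?thesis using z_first_less_last by (simp add: near_ratio_def)
qed

lemma near_singularity_distance:
  assumes s_in: "s \<in> {1..p-1}" and t_in: "t \<in> {z s..z s + near_ratio * dist_last s}"
    and r_in: "r \<in> {1..p} - {s}"
  shows "sep \<le> \<bar>t - z r\<bar>" "\<bar>t - z r\<bar> \<le> z p - z 1"
proof -
  have t_le: "t \<le> z s + sep" using t_in near_ratio_mult_dist_last_le[OF s_in] by simp
  show "sep \<le> \<bar>t - z r\<bar>"
  proof (cases "r < s")
    case True
    then have "2 * sep \<le> z s - z r" using r_in s_in by (intro two_sep_le) auto
    then show ?thesis using t_in sep_pos by simp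
  next
    case False
    then have "2 * sep \<le> z r - z s" using r_in s_in by (intro two_sep_le) auto
    then show ?thesis using t_le sep_pos by simp
  qed
  have "z s \<in> {z 1..z p}" "z r \<in> {z 1..z p}" using s_in r_in by (intro z_in_range; auto)+
  moreover have "2 * sep \<le> z p - z s" using s_in two_le_p by (intro two_sep_le) auto
  ultimately show "\<bar>t - z r\<bar> \<le> z p - z 1" using t_in t_le sep_pos by auto
qed

subsection \<open>Rescaling\<close>

definition near_points :: "(nat \<Rightarrow> nat) \<Rightarrow> (nat \<Rightarrow> real) set" where
  "near_points l = {t. \<forall>i\<in>{1..n}. t i \<le> z (block l i) + near_ratio * dist_last (block l i)}"

definition scale_exponent :: "(nat \<Rightarrow> nat) \<Rightarrow> complex" where
  "scale_exponent l = (\<Sum>i=1..n. \<alpha> (block l i))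
    + (\<Sum>(i, j)\<in>less_pairs {1..n}. if block l i = block l j then 2 * \<gamma> else 0)"

lemma abs_powr_scale_exponent:
  assumes "x \<noteq> 0"
  shows "abs_powr x (scale_exponent l) = (\<Prod>i=1..n. abs_powr x (\<alpha> (block l i)))
    * (\<Prod>(i, j)\<in>less_pairs {1..n}. if block l i = block l j then abs_powr x (2 * \<gamma>) else 1)"
  using assms unfolding scale_exponent_def abs_powr_add abs_powr_sum[OF assms] case_prod_unfold
  by (intro arg_cong2[of _ _ _ _ "(*)"] prod.cong refl) (auto simp: abs_powr_exponent_0)

definition scaled_integrand :: "(nat \<Rightarrow> nat) \<Rightarrow> (nat \<Rightarrow> nat) \<Rightarrow> nat \<Rightarrow> (nat \<Rightarrow> real) \<Rightarrow> complex" where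
  "scaled_integrand l \<tau> K t = abs_powr (real K) (scale_exponent l) * (\<Psi> t *
     (\<Prod>i=1..n. of_real (((z p - t i) / dist_last (block l i)) ^ K) * (1 / of_real (t i - z (\<tau> i)))))"

definition rescale_point :: "(nat \<Rightarrow> nat) \<Rightarrow> nat \<Rightarrow> nat \<Rightarrow> real \<Rightarrow> real" where
  "rescale_point l K i y = z (block l i) + dist_last (block l i) / real K * y"

definition rescale :: "(nat \<Rightarrow> nat) \<Rightarrow> nat \<Rightarrow> (nat \<Rightarrow> real) \<Rightarrow> nat \<Rightarrow> real" where
  "rescale l K y = (\<lambda>i\<in>{1..n}. rescale_point l K i (y i))"

definition block_domain :: "(nat \<Rightarrow> nat) \<Rightarrow> (nat \<Rightarrow> real) set" where
  "block_domain l = {y. \<forall>s\<in>{1..p-1}. y \<in> ordered_in (Gam l s) {0..}}"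

definition rescaled_domain :: "(nat \<Rightarrow> nat) \<Rightarrow> nat \<Rightarrow> (nat \<Rightarrow> real) set" where
  "rescaled_domain l K = {y \<in> block_domain l. \<forall>i\<in>{1..n}. y i \<le> near_ratio * real K}"

definition point_factor :: "(nat \<Rightarrow> nat) \<Rightarrow> (nat \<Rightarrow> nat) \<Rightarrow> nat \<Rightarrow> nat \<Rightarrow> real \<Rightarrow> complex" where
  "point_factor l \<tau> K i y = of_real (dist_last (block l i))
      * abs_powr (dist_last (block l i) * y) (\<alpha> (block l i))
     * (\<Prod>r\<in>{1..p}-{block l i}. abs_powr (rescale_point l K i y - z r) (\<alpha> r)) * of_real ((1 - y / real K) ^ K)
     * (1 / (of_real (real K) * of_real (rescale_point l K i y - z (\<tau> i))))"

definition pair_factor :: "(nat \<Rightarrow> nat) \<Rightarrow> nat \<Rightarrow> (nat \<Rightarrow> real) \<Rightarrow> nat \<Rightarrow> nat \<Rightarrow> complex" where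
  "pair_factor l K y i j = (if block l i = block l j then abs_powr (dist_last (block l i) * (y j - y i)) (2 * \<gamma>)
     else abs_powr (rescale_point l K j (y j) - rescale_point l K i (y i)) (2 * \<gamma>))"

definition rescaled_integrand :: "(nat \<Rightarrow> nat) \<Rightarrow> (nat \<Rightarrow> nat) \<Rightarrow> nat \<Rightarrow> (nat \<Rightarrow> real) \<Rightarrow> complex" where
  "rescaled_integrand l \<tau> K y = indicator (rescaled_domain l K) y *\<^sub>R
     ((\<Prod>i=1..n. point_factor l \<tau> K i (y i)) * (\<Prod>(i, j)\<in>less_pairs {1..n}. pair_factor l K y i j))"

definition point_const :: "nat \<Rightarrow> complex" where
  "point_const s = abs_powr (dist_last s) (\<alpha> s) * (\<Prod>r\<in>{1..p}-{s}. abs_powr (z s - z r) (\<alpha> r))"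

definition pair_const :: "nat \<Rightarrow> nat \<Rightarrow> complex" where
  "pair_const r s = abs_powr (if r = s then dist_last r else z s - z r) (2 * \<gamma>)"

definition block_const :: "(nat \<Rightarrow> nat) \<Rightarrow> complex" where
  "block_const l = (\<Prod>i=1..n. point_const (block l i))
      * (\<Prod>(i, j)\<in>less_pairs {1..n}. pair_const (block l i) (block l j))"

context
  fixes l :: "nat \<Rightarrow> nat"
  assumes l_Zset: "l \<in> Zset n (p - 1)"
begin

lemma block_in: "i \<in> {1..n} \<Longrightarrow> block l i \<in> {1..p-1}"
  by (rule block_range[OF l_Zset])

lemma dist_block_pos: "i \<in> {1..n} \<Longrightarrow> dist_last (block l i) > 0"
  by (rule dist_last_pos[OF block_in])

lemma block_domain_iff:
  "y \<in> block_domain l \<longleftrightarrow> (\<forall>i\<in>{1..n}. 0 \<le> y i)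
    \<and> (\<forall>i\<in>{1..n}. \<forall>j\<in>{1..n}. block l i = block l j \<longrightarrow> i \<le> j \<longrightarrow> y i \<le> y j)"
proof -
  have "y \<in> block_domain l \<longleftrightarrow> (\<forall>s\<in>{1..p-1}. (\<forall>i\<in>{1..n}. block l i = s \<longrightarrow> 0 \<le> y i)
      \<and> (\<forall>i\<in>{1..n}. \<forall>j\<in>{1..n}. block l i = s \<longrightarrow> block l j = s \<longrightarrow> i \<le> j \<longrightarrow> y i \<le> y j))"
    unfolding block_domain_def ordered_in_def using Gam_eq_block[OF l_Zset] by (auto simp: mono_on_def)
  then show ?thesis using block_in by (simp only:) blast
qed

lemma fraction_bounds:
  assumes "t \<in> chamber l" "i \<in> {1..n}"
  shows "0 \<le> (z p - t i) / dist_last (block l i)" "(z p - t i) / dist_last (block l i) \<le> 1"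
proof -
  show "0 \<le> (z p - t i) / dist_last (block l i)"
    using chamber_range[OF l_Zset assms] dist_block_pos[OF assms(2)] by simp
  show "(z p - t i) / dist_last (block l i) \<le> 1"
    using chamberD(1)[OF assms] dist_block_pos[OF assms(2)] by (simp add: dist_last_def)
qed

lemma measurable_scaled_integrand: "scaled_integrand l \<tau> K \<in> borel_measurable (Rn n)"
proof -
  have "(\<lambda>t. of_real (((z p - t i) / dist_last (block l i)) ^ K) * (1 / of_real (t i - z (\<tau> i))) :: complex)
      \<in> borel_measurable (Rn n)" if "i \<in> {1..n}" for i
  proof -
    note [measurable] = measurable_component_lborel_on[OF that]
    show ?thesis by measurable
  qed
  then show ?thesis
    unfolding scaled_integrand_def
    by (intro borel_measurable_times borel_measurable_const measurable_abs_Phi borel_measurable_prod) auto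
qed

lemma pred_near_points [measurable]: "Measurable.pred (Rn n) (\<lambda>t. t \<in> near_points l)"
  unfolding near_points_def mem_Collect_eq
proof (rule pred_intros_finite(3))
  fix i assume "i \<in> {1..n}"
  note [measurable] = measurable_component_lborel_on[OF this]
  show "Measurable.pred (Rn n) (\<lambda>t. t i \<le> z (block l i) + near_ratio * dist_last (block l i))" by measurable
qed simp

lemma norm_scaled_integrand:
  assumes t_chamber: "t \<in> chamber l"
  shows "norm (scaled_integrand l \<tau> K t) = real K powr Re (scale_exponent l)
    * (\<Prod>i=1..n. ((z p - t i) / dist_last (block l i)) ^ K)
    * norm (\<Psi> t * (\<Prod>i=1..n. 1 / of_real (t i - z (\<tau> i))))"
proof -
  have "norm (of_real (\<Prod>i=1..n. ((z p - t i) / dist_last (block l i)) ^ K) :: complex)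
      = (\<Prod>i=1..n. ((z p - t i) / dist_last (block l i)) ^ K)"
    unfolding norm_of_real using fraction_bounds(1)[OF t_chamber]
    by (intro abs_of_nonneg prod_nonneg zero_le_power)
  then show ?thesis
    unfolding scaled_integrand_def prod.distrib norm_mult by (simp add: norm_abs_powr)
qed

lemma norm_scaled_integrand_le:
  assumes t_chamber: "t \<in> chamber l"
  shows "norm (scaled_integrand l \<tau> K t)
    \<le> real K powr Re (scale_exponent l) * 1 * norm (\<Psi> t * (\<Prod>i=1..n. 1 / of_real (t i - z (\<tau> i))))"
  unfolding norm_scaled_integrand[OF t_chamber] using fraction_bounds[OF t_chamber]
  by (intro mult_right_mono mult_left_mono prod_le_1) (auto intro: power_le_one)

lemma norm_scaled_integrand_far_le:
  assumes t_far: "t \<in> chamber l" "t \<notin> near_points l"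
  shows "norm (scaled_integrand l \<tau> K t)
    \<le> real K powr Re (scale_exponent l) * (1 - near_ratio) ^ K
    * norm (\<Psi> t * (\<Prod>i=1..n. 1 / of_real (t i - z (\<tau> i))))"
  unfolding norm_scaled_integrand[OF t_far(1)]
proof (intro mult_right_mono mult_left_mono)
  let ?f = "\<lambda>i. (z p - t i) / dist_last (block l i)"
  note fraction = fraction_bounds[OF t_far(1)]
  obtain k where k: "k \<in> {1..n}" "t k > z (block l k) + near_ratio * dist_last (block l k)"
    using t_far(2) by (auto simp: near_points_def not_le)
  have "z p - t k \<le> (1 - near_ratio) * dist_last (block l k)"
    using k(2) by (simp add: dist_last_def algebra_simps)
  then have far: "?f k \<le> 1 - near_ratio" using dist_block_pos[OF k(1)] by (simp add: pos_divide_le_eq)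
  have "(\<Prod>i=1..n. ?f i ^ K) = ?f k ^ K * (\<Prod>i\<in>{1..n}-{k}. ?f i ^ K)" using k(1) by (intro prod.remove) auto
  also have "\<dots> \<le> (1 - near_ratio) ^ K * 1"
    using fraction k(1) far near_ratio_le_half
    by (intro mult_mono power_mono prod_le_1 prod_nonneg) (auto intro: power_le_one)
  finally show "(\<Prod>i=1..n. ?f i ^ K) \<le> (1 - near_ratio) ^ K" by simp
qed auto

lemma chamber_integrable_poles:
  assumes "\<And>i. i \<in> {1..n} \<Longrightarrow> \<tau> i \<in> {1..p-1}"
  shows "chamber_integrable l (\<lambda>t. \<Prod>i=1..n. 1 / of_real (t i - z (\<tau> i)))"
proof (rule chamber_integrable_prod[OF l_Zset])
  fix i assume "i \<in> {1..n}"
  then have "\<tau> i \<in> {1..<p}" using assms[of i] two_le_p by auto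
  then show "admissible (\<lambda>t. 1 / of_real (t - z (\<tau> i)))" by (rule admissible_inverse)
qed

lemma set_integrable_scaled_integrand:
  assumes "\<And>i. i \<in> {1..n} \<Longrightarrow> \<tau> i \<in> {1..p-1}"
  shows "set_integrable (Rn n) (chamber l) (scaled_integrand l \<tau> K)"
proof -
  let ?g = "\<lambda>t. of_real (real K powr Re (scale_exponent l)) * (\<Psi> t * (\<Prod>i=1..n. 1 / of_real (t i - z (\<tau> i))))"
  have "set_integrable (Rn n) (chamber l) ?g"
    using chamber_integrable_poles[OF assms] unfolding chamber_integrable_def
    by (rule set_integrable_mult_right)
  then show ?thesis
  proof (rule set_integrable_bound)
    note [measurable] = measurable_scaled_integrand
    show "set_borel_measurable (Rn n) (chamber l) (scaled_integrand l \<tau> K)"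
      unfolding set_borel_measurable_def by measurable
    have "norm (scaled_integrand l \<tau> K t) \<le> norm (?g t)" if "t \<in> chamber l" for t
      using norm_scaled_integrand_le[OF that, where K=K] by (simp add: norm_mult)
    then show "AE t in Rn n. t \<in> chamber l \<longrightarrow> norm (scaled_integrand l \<tau> K t) \<le> norm (?g t)" by simp
  qed
qed

lemma far_integral_tendsto_0:
  assumes "\<And>i. i \<in> {1..n} \<Longrightarrow> \<tau> i \<in> {1..p-1}"
  shows "(\<lambda>k. LINT t:chamber l - near_points l|Rn n. scaled_integrand l \<tau> (Suc k) t) \<longlonglongrightarrow> 0"
proof -
  define g where "g t = indicator (chamber l) t *\<^sub>R (\<Psi> t * (\<Prod>i=1..n. 1 / of_real (t i - z (\<tau> i))))" for t
  define C where "C k = real (Suc k) powr Re (scale_exponent l) * (1 - near_ratio) ^ Suc k" for k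
  have C_nonneg: "C k \<ge> 0" for k using near_ratio_le_half by (simp add: C_def)
  have norm_g_integrable: "integrable (Rn n) (\<lambda>t. norm (g t))"
    using chamber_integrable_poles[OF assms] unfolding chamber_integrable_def set_integrable_def g_def
    by (rule integrable_norm)
  have bound: "norm (LINT t:chamber l - near_points l|Rn n. scaled_integrand l \<tau> (Suc k) t)
      \<le> C k * (\<integral>t. norm (g t) \<partial>Rn n)" for k
  proof -
    have "norm (LINT t:chamber l - near_points l|Rn n. scaled_integrand l \<tau> (Suc k) t)
        \<le> (\<integral>t. C k * norm (g t) \<partial>Rn n)"
      unfolding set_lebesgue_integral_def
    proof (rule order_trans[OF integral_norm_bound integral_mono'])
      show "norm (indicator (chamber l - near_points l) t *\<^sub>R scaled_integrand l \<tau> (Suc k) t)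
          \<le> C k * norm (g t)" for t
        using norm_scaled_integrand_far_le[where t=t and K="Suc k"] C_nonneg[of k]
        by (cases "t \<in> chamber l - near_points l") (simp_all add: C_def g_def)
    qed (use norm_g_integrable C_nonneg in auto)
    then show ?thesis by simp
  qed
  have "C \<longlonglongrightarrow> 0"
    unfolding C_def using near_ratio_pos near_ratio_le_half by (intro powr_times_power_tendsto_0) auto
  then have "(\<lambda>k. C k * (\<integral>t. norm (g t) \<partial>Rn n)) \<longlonglongrightarrow> 0" by (rule tendsto_mult_left_zero)
  then show ?thesis by (rule Lim_null_comparison[OF always_eventually[OF allI[OF bound]]])
qed

lemma rescale_point_bounds_iff:
  assumes "K > 0" "i \<in> {1..n}"
  shows "z (block l i) \<le> rescale_point l K i y \<longleftrightarrow> 0 \<le> y"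
    and "rescale_point l K i y \<le> z (block l i) + near_ratio * dist_last (block l i) \<longleftrightarrow> y \<le> near_ratio * real K"
  using dist_block_pos[OF assms(2)] assms(1)
  by (auto simp: rescale_point_def zero_le_mult_iff field_simps)

lemma rescale_point_le_iff:
  assumes "K > 0" "i \<in> {1..n}" "block l i = block l j"
  shows "rescale_point l K i x \<le> rescale_point l K j y \<longleftrightarrow> x \<le> y"
  using dist_block_pos[OF assms(2)] assms(1,3)
  by (simp add: rescale_point_def field_simps)

lemma rescaled_domainD:
  assumes "y \<in> rescaled_domain l K" "i \<in> {1..n}"
  shows "0 \<le> y i" "y i \<le> near_ratio * real K"
  using assms by (auto simp: rescaled_domain_def block_domain_iff)

lemma rescale_in_chamber:
  assumes K_pos: "K > 0" and y_domain: "y \<in> rescaled_domain l K"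
  shows "rescale l K y \<in> chamber l"
proof -
  have lower: "z (block l i) \<le> rescale l K y i" if "i \<in> {1..n}" for i
    using rescale_point_bounds_iff(1)[OF K_pos that] rescaled_domainD(1)[OF y_domain that] that
    by (simp add: rescale_def)
  have upper: "rescale l K y i \<le> z s" if i_in: "i \<in> {1..n}" and s_above: "block l i < s" "s \<le> p" for i s
  proof -
    have "rescale l K y i \<le> z (block l i) + near_ratio * dist_last (block l i)"
      using rescale_point_bounds_iff(2)[OF K_pos i_in] rescaled_domainD(2)[OF y_domain i_in] i_in
      by (simp add: rescale_def)
    moreover have "2 * sep \<le> z s - z (block l i)" using block_in[OF i_in] s_above
      by (intro two_sep_le) auto
    ultimately show ?thesis using near_ratio_mult_dist_last_le[OF block_in[OF i_in]] sep_pos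
      by linarith
  qed
  have "rescale l K y i \<le> rescale l K y j" if ij_ordered: "i \<in> {1..n}" "j \<in> {1..n}" "i \<le> j" for i j
  proof (cases "block l i = block l j")
    case True
    then have "y i \<le> y j" using y_domain ij_ordered unfolding rescaled_domain_def
      by (auto simp: block_domain_iff)
    then show ?thesis using rescale_point_le_iff[OF K_pos ij_ordered(1) True] ij_ordered
      by (simp add: rescale_def)
  next
    case False
    then have "block l i < block l j" using block_mono[OF l_Zset ij_ordered(3,1,2)] by simp
    then have "rescale l K y i \<le> z (block l j)" using block_in[OF ij_ordered(2)]
      by (intro upper[OF ij_ordered(1)]) auto
    then show ?thesis using lower[OF ij_ordered(2)] by simp
  qed
  moreover have "rescale l K y i \<le> z (block l i + 1)" if "i \<in> {1..n}" for i
    using block_in[OF that] by (intro upper[OF that]) auto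
  ultimately show ?thesis using lower unfolding chamber_def mem_Collect_eq by (blast intro: mono_onI)
qed

lemma rescale_near_chamber_iff:
  assumes K_pos: "K > 0"
  shows "rescale l K y \<in> chamber l \<inter> near_points l \<longleftrightarrow> y \<in> rescaled_domain l K"
proof
  assume y_domain: "rescale l K y \<in> chamber l \<inter> near_points l"
  have rescale: "rescale l K y i = rescale_point l K i (y i)" if "i \<in> {1..n}" for i
    using that by (simp add: rescale_def)
  have "0 \<le> y i" if "i \<in> {1..n}" for i
    using chamberD(1)[of "rescale l K y" l i] y_domain that rescale_point_bounds_iff(1)[OF K_pos that]
    by (simp add: rescale)
  moreover have "y i \<le> near_ratio * real K" if "i \<in> {1..n}" for i
  proof -
    have "rescale l K y i \<le> z (block l i) + near_ratio * dist_last (block l i)"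
      using y_domain that unfolding near_points_def by blast
    then show ?thesis using rescale_point_bounds_iff(2)[OF K_pos that] by (simp only: rescale[OF that])
  qed
  moreover have "y i \<le> y j" if "i \<in> {1..n}" "j \<in> {1..n}" "block l i = block l j" "i \<le> j" for i j
    using chamberD(3)[of "rescale l K y" l i j] y_domain that rescale_point_le_iff[OF K_pos that(1,3)]
    by (simp add: rescale)
  ultimately show "y \<in> rescaled_domain l K" unfolding rescaled_domain_def by (simp add: block_domain_iff)
next
  assume y_domain: "y \<in> rescaled_domain l K"
  then have "rescale l K y \<in> near_points l"
    using rescale_point_bounds_iff(2)[OF K_pos] rescaled_domainD(2)[OF y_domain]
    by (simp add: near_points_def rescale_def)
  then show "rescale l K y \<in> chamber l \<inter> near_points l" using rescale_in_chamber[OF K_pos y_domain] by blast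
qed

lemma scaled_point_factor:
  fixes y :: real
  assumes K_pos: "K > 0" and i_in: "i \<in> {1..n}"
  defines "d \<equiv> dist_last (block l i)" and "a \<equiv> \<alpha> (block l i)" and "x \<equiv> rescale_point l K i y"
  shows "of_real (d / real K) * (abs_powr (real K) a * point_weight p z \<alpha> x)
      * (of_real (((z p - x) / d) ^ K) * (1 / of_real (x - z (\<tau> i))))
    = point_factor l \<tau> K i y"
proof -
  have block_in_all: "block l i \<in> {1..p}" using block_in[OF i_in] by auto
  have d_pos: "d > 0" unfolding d_def by (rule dist_block_pos[OF i_in])
  have "x - z (block l i) = d * y / real K" by (simp add: x_def rescale_point_def d_def)
  then have "abs_powr (real K) a * abs_powr (x - z (block l i)) a = abs_powr (d * y) a"
    using K_pos by (simp add: abs_powr_divide)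
  then have weight: "abs_powr (real K) a * point_weight p z \<alpha> x
      = abs_powr (d * y) a * (\<Prod>r\<in>{1..p}-{block l i}. abs_powr (x - z r) (\<alpha> r))"
    unfolding point_weight_remove[OF block_in_all] a_def[symmetric] by (simp only: mult.assoc[symmetric])
  have fraction: "(z p - x) / d = 1 - y / real K"
    using d_pos K_pos by (simp add: x_def rescale_point_def d_def dist_last_def field_simps)
  show ?thesis
    unfolding weight fraction unfolding point_factor_def d_def[symmetric] a_def[symmetric] x_def[symmetric]
    by simp
qed

lemma scaled_pair_factor:
  assumes K_pos: "K > 0"
  shows "(if block l i = block l j then abs_powr (real K) (2 * \<gamma>) else 1)
      * abs_powr (rescale_point l K j (y j) - rescale_point l K i (y i)) (2 * \<gamma>) = pair_factor l K y i j"
proof (cases "block l i = block l j")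
  case True
  then have "rescale_point l K j (y j) - rescale_point l K i (y i) = dist_last (block l i) * (y j - y i)
      / real K"
    by (simp add: rescale_point_def right_diff_distrib diff_divide_distrib)
  then show ?thesis using True K_pos by (simp add: pair_factor_def abs_powr_divide)
qed (simp add: pair_factor_def)

lemma scaled_integrand_rescale:
  assumes K_pos: "K > 0"
  shows "of_real (\<Prod>i=1..n. \<bar>dist_last (block l i) / real K\<bar>) * scaled_integrand l \<tau> K (rescale l K y)
    = (\<Prod>i=1..n. point_factor l \<tau> K i (y i)) * (\<Prod>(i, j)\<in>less_pairs {1..n}. pair_factor l K y i j)"
proof -
  let ?x = "\<lambda>i. rescale_point l K i (y i)" and ?k = "abs_powr (real K)"
  have rescale: "rescale l K y i = ?x i" if "i \<in> {1..n}" for i using that by (simp add: rescale_def)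
  have "of_real (\<Prod>i=1..n. \<bar>dist_last (block l i) / real K\<bar>)
      = (\<Prod>i=1..n. of_real (dist_last (block l i) / real K) :: complex)"
    unfolding of_real_prod using dist_block_pos
    by (intro prod.cong refl) (auto simp: less_imp_le)
  moreover have "vandermonde {1..n} \<gamma> (rescale l K y)
      = (\<Prod>(i, j)\<in>less_pairs {1..n}. abs_powr (?x j - ?x i) (2 * \<gamma>))"
    using vandermonde_cong[of "{1..n}" "rescale l K y" ?x \<gamma>] rescale by (simp add: vandermonde_def)
  moreover have "(\<Prod>i=1..n. point_weight p z \<alpha> (rescale l K y i)) = (\<Prod>i=1..n. point_weight p z \<alpha> (?x i))"
    by (intro prod.cong refl) (simp only: rescale)
  moreover have "(\<Prod>i=1..n. of_real (((z p - rescale l K y i) / dist_last (block l i)) ^ K)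
      * (1 / of_real (rescale l K y i - z (\<tau> i))))
      = (\<Prod>i=1..n. of_real (((z p - ?x i) / dist_last (block l i)) ^ K)
      * (1 / of_real (?x i - z (\<tau> i))) :: complex)"
    by (intro prod.cong refl) (simp only: rescale)
  moreover have "?k (scale_exponent l) = (\<Prod>i=1..n. ?k (\<alpha> (block l i)))
      * (\<Prod>(i, j)\<in>less_pairs {1..n}. if block l i = block l j then ?k (2 * \<gamma>) else 1)"
    using K_pos by (intro abs_powr_scale_exponent) simp
  moreover have "(\<Prod>i=1..n. point_factor l \<tau> K i (y i))
      = (\<Prod>i=1..n. of_real (dist_last (block l i) / real K) * (?k (\<alpha> (block l i)) * point_weight p z \<alpha> (?x i))
        * (of_real (((z p - ?x i) / dist_last (block l i)) ^ K) * (1 / of_real (?x i - z (\<tau> i)))))"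
    by (intro prod.cong refl scaled_point_factor[OF K_pos, symmetric])
  ultimately show ?thesis
    unfolding scaled_integrand_def abs_Phi_def scaled_pair_factor[OF K_pos, symmetric] case_prod_unfold
      prod.distrib
    by (simp only: mult_ac)
qed

lemma near_integral_eq:
  assumes K_pos: "K > 0"
  shows "rescaled_integrand l \<tau> K \<in> borel_measurable (Rn n)"
    and "(LINT t:chamber l \<inter> near_points l|Rn n. scaled_integrand l \<tau> K t)
        = (\<integral>y. rescaled_integrand l \<tau> K y \<partial>Rn n)"
proof -
  let ?g = "\<lambda>t. indicator (chamber l \<inter> near_points l) t *\<^sub>R scaled_integrand l \<tau> K t"
  let ?J = "of_real (\<Prod>i=1..n. \<bar>dist_last (block l i) / real K\<bar>) :: complex"
  note [measurable] = measurable_scaled_integrand pred_near_points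
  have g_measurable: "?g \<in> borel_measurable (Rn n)" by measurable
  have rescaled_eq: "rescaled_integrand l \<tau> K y = ?J * ?g (rescale l K y)" for y
    using rescale_near_chamber_iff[OF K_pos, of y] scaled_integrand_rescale[OF K_pos, where \<tau>=\<tau> and y=y]
    by (simp add: rescaled_integrand_def indicator_def del: of_real_prod)
  have rescale: "rescale l K = (\<lambda>y. \<lambda>i\<in>{1..n}. z (block l i) + dist_last (block l i) / real K * y i)"
    by (simp add: rescale_def rescale_point_def fun_eq_iff)
  have "rescale l K \<in> measurable (Rn n) (Rn n)" unfolding rescale by (rule measurable_affine_reindex)
  from measurable_compose[OF this g_measurable] show "rescaled_integrand l \<tau> K \<in> borel_measurable (Rn n)"
    unfolding rescaled_eq[abs_def] by (intro borel_measurable_times borel_measurable_const)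
  have "(\<integral>t. ?g t \<partial>Rn n) = ?J * (\<integral>y. ?g (rescale l K y) \<partial>Rn n)"
    unfolding rescale
    by (rule integral_lborel_on_affine_reindex[OF bij_betw_id[unfolded id_def] _ _ g_measurable])
      (use dist_block_pos K_pos in fastforce)+
  then show "(LINT t:chamber l \<inter> near_points l|Rn n. scaled_integrand l \<tau> K t)
      = (\<integral>y. rescaled_integrand l \<tau> K y \<partial>Rn n)"
    unfolding set_lebesgue_integral_def rescaled_eq by (simp only: integral_mult_right_zero)
qed

subsection \<open>Pointwise limit\<close>

lemma rescale_point_tendsto: "(\<lambda>k. rescale_point l (Suc k) i y) \<longlonglongrightarrow> z (block l i)"
proof -
  have "(\<lambda>k. z (block l i) + dist_last (block l i) * (1 / real (Suc k)) * y)
      \<longlonglongrightarrow> z (block l i) + dist_last (block l i) * 0 * y"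
    by (intro tendsto_intros LIMSEQ_Suc[OF lim_1_over_n])
  then show ?thesis by (simp add: rescale_point_def)
qed

lemma z_block_neq:
  assumes "i \<in> {1..n}" "r \<in> {1..p}" "r \<noteq> block l i"
  shows "z (block l i) - z r \<noteq> 0"
proof -
  have "block l i \<in> {1..p}" using block_in[OF assms(1)] by auto
  then show ?thesis using inj_onD[OF z_inj_on, of "block l i" r] assms(2,3) by auto
qed

lemma pole_factor_tendsto:
  assumes i_in: "i \<in> {1..n}" and tau_in: "\<tau> i \<in> {1..p-1}"
  shows "(\<lambda>k. 1 / (of_real (real (Suc k)) * of_real (rescale_point l (Suc k) i y - z (\<tau> i))) :: complex)
    \<longlonglongrightarrow> (if \<tau> i = block l i then 1 / of_real (dist_last (block l i) * y) else 0)"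
proof (cases "\<tau> i = block l i")
  case True
  have "real (Suc k) * (rescale_point l (Suc k) i y - z (\<tau> i)) = dist_last (block l i) * y" for k
    unfolding True rescale_point_def by (simp del: of_nat_Suc)
  then have "of_real (real (Suc k)) * of_real (rescale_point l (Suc k) i y - z (\<tau> i))
      = (of_real (dist_last (block l i) * y) :: complex)" for k
    by (metis of_real_mult)
  then show ?thesis using True by (simp del: of_nat_Suc)
next
  case False
  have "z (block l i) - z (\<tau> i) \<noteq> 0" using tau_in False by (intro z_block_neq[OF i_in]) auto
  then have "(\<lambda>k. of_real (1 / real (Suc k)) * (1 / of_real (rescale_point l (Suc k) i y - z (\<tau> i))) :: complex)
      \<longlonglongrightarrow> of_real 0 * (1 / of_real (z (block l i) - z (\<tau> i)))"
    by (intro tendsto_intros LIMSEQ_Suc[OF lim_1_over_n] rescale_point_tendsto) auto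
  then show ?thesis using False by simp
qed

lemma point_factor_tendsto:
  assumes i_in: "i \<in> {1..n}" and tau_in: "\<tau> i \<in> {1..p-1}" and y_nonneg: "y \<ge> 0"
  shows "(\<lambda>k. point_factor l \<tau> (Suc k) i y)
    \<longlonglongrightarrow> (if \<tau> i = block l i then point_const (block l i) * laguerre_weight (\<alpha> (block l i)) y else 0)"
proof -
  define d where "d = dist_last (block l i)"
  define a where "a = \<alpha> (block l i)"
  define R where "R = (\<Prod>r\<in>{1..p}-{block l i}. abs_powr (z (block l i) - z r) (\<alpha> r))"
  have d_pos: "d > 0" unfolding d_def by (rule dist_block_pos[OF i_in])
  have "(\<lambda>k. abs_powr (rescale_point l (Suc k) i y - z r) (\<alpha> r)) \<longlonglongrightarrow> abs_powr (z (block l i) - z r) (\<alpha> r)"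
    if "r \<in> {1..p} - {block l i}" for r
    using that by (intro tendsto_abs_powr z_block_neq[OF i_in] tendsto_intros rescale_point_tendsto) auto
  then have "(\<lambda>k. point_factor l \<tau> (Suc k) i y) \<longlonglongrightarrow> of_real d * abs_powr (d * y) a * R * of_real (exp (- y))
      * (if \<tau> i = block l i then 1 / of_real (d * y) else 0)"
    unfolding point_factor_def R_def d_def a_def
    by (intro tendsto_mult tendsto_const tendsto_prod tendsto_of_real one_minus_divide_power_tendsto_exp
        pole_factor_tendsto[where \<tau>=\<tau>, OF i_in tau_in])
  moreover have const: "point_const (block l i) = abs_powr d a * R"
    unfolding point_const_def d_def a_def R_def ..
  moreover have "of_real d * abs_powr (d * y) a * R * of_real (exp (- y))
      * (if \<tau> i = block l i then 1 / of_real (d * y) else 0)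
      = (if \<tau> i = block l i then point_const (block l i) * laguerre_weight a y else 0)"
    using d_pos abs_powr_minus_1[OF y_nonneg, of a]
    by (simp add: abs_powr_mult const laguerre_weight_def)
  ultimately show ?thesis unfolding a_def by (simp only:)
qed

lemma pair_factor_tendsto:
  assumes "i \<in> {1..n}" "j \<in> {1..n}"
  shows "(\<lambda>k. pair_factor l (Suc k) y i j) \<longlonglongrightarrow> pair_const (block l i) (block l j)
    * (if block l i = block l j then abs_powr (y j - y i) (2 * \<gamma>) else 1)"
proof (cases "block l i = block l j")
  case False
  have "block l i \<in> {1..p}" using block_in[OF assms(1)] by auto
  from z_block_neq[OF assms(2) this] False
  have "(\<lambda>k. abs_powr (rescale_point l (Suc k) j (y j) - rescale_point l (Suc k) i (y i)) (2 * \<gamma>))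
      \<longlonglongrightarrow> abs_powr (z (block l j) - z (block l i)) (2 * \<gamma>)"
    by (intro tendsto_abs_powr tendsto_intros rescale_point_tendsto) auto
  then show ?thesis using False by (simp add: pair_factor_def pair_const_def)
qed (simp add: pair_factor_def pair_const_def abs_powr_mult)

lemma prod_laguerre_integrand:
  "(\<Prod>s=1..p-1. ordered_integrand (Gam l s) {0..} (laguerre_weight (\<alpha> s)) \<gamma> y)
    = indicator (block_domain l) y *\<^sub>R ((\<Prod>i=1..n. laguerre_weight (\<alpha> (block l i)) (y i))
      * (\<Prod>(i, j)\<in>less_pairs {1..n}. if block l i = block l j then abs_powr (y j - y i) (2 * \<gamma>) else 1))"
proof (cases "y \<in> block_domain l")
  case True
  have "(\<Prod>s=1..p-1. \<Prod>i\<in>Gam l s. laguerre_weight (\<alpha> s) (y i))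
      = (\<Prod>s=1..p-1. \<Prod>i\<in>{i\<in>{1..n}. block l i = s}. laguerre_weight (\<alpha> (block l i)) (y i))"
    by (intro prod.cong refl) (auto simp: Gam_eq_block[OF l_Zset])
  also have "\<dots> = (\<Prod>i=1..n. laguerre_weight (\<alpha> (block l i)) (y i))"
    using block_in by (intro prod.group) auto
  finally have weights: "(\<Prod>s=1..p-1. \<Prod>i\<in>Gam l s. laguerre_weight (\<alpha> s) (y i)) = \<dots>" .
  have "(\<Prod>s=1..p-1. ordered_integrand (Gam l s) {0..} (laguerre_weight (\<alpha> s)) \<gamma> y)
      = (\<Prod>s=1..p-1. (\<Prod>i\<in>Gam l s. laguerre_weight (\<alpha> s) (y i)) * vandermonde (Gam l s) \<gamma> y)"
    using True by (intro prod.cong refl) (auto simp: ordered_integrand_def block_domain_def)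
  then show ?thesis
    using True prod_less_pairs_block[OF l_Zset, of "\<lambda>i j. abs_powr (y j - y i) (2 * \<gamma>)"]
    unfolding prod.distrib weights vandermonde_def by simp
next
  case False
  then obtain s where "s \<in> {1..p-1}" "y \<notin> ordered_in (Gam l s) {0..}" by (auto simp: block_domain_def)
  then have "(\<Prod>s=1..p-1. ordered_integrand (Gam l s) {0..} (laguerre_weight (\<alpha> s)) \<gamma> y) = 0"
    by (intro prod_zero bexI[of _ s]) (auto simp: ordered_integrand_def)
  then show ?thesis using False by simp
qed

definition limit_integrand :: "(nat \<Rightarrow> nat) \<Rightarrow> (nat \<Rightarrow> real) \<Rightarrow> complex" where
  "limit_integrand \<tau> y = (if \<forall>i\<in>{1..n}. \<tau> i = block l i
     then block_const l * (\<Prod>s=1..p-1. ordered_integrand (Gam l s) {0..} (laguerre_weight (\<alpha> s)) \<gamma> y) else 0)"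

lemma eventually_rescaled_domain:
  assumes "y \<in> block_domain l"
  shows "\<forall>\<^sub>F k in sequentially. y \<in> rescaled_domain l (Suc k)"
proof -
  have "\<forall>\<^sub>F k in sequentially. y i \<le> near_ratio * real (Suc k)" for i
  proof -
    have "\<forall>\<^sub>F k in sequentially. y i / near_ratio \<le> real (Suc k)"
      using filterlim_compose[OF filterlim_real_sequentially filterlim_Suc]
      by (simp only: filterlim_at_top o_def)
    then show ?thesis using near_ratio_pos by (simp add: pos_divide_le_eq mult.commute)
  qed
  then have "\<forall>\<^sub>F k in sequentially. \<forall>i\<in>{1..n}. y i \<le> near_ratio * real (Suc k)"
    by (intro eventually_ball_finite) auto
  then show ?thesis using assms by (simp add: rescaled_domain_def)
qed

lemma rescaled_integrand_tendsto:
  assumes tau_in: "\<And>i. i \<in> {1..n} \<Longrightarrow> \<tau> i \<in> {1..p-1}"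
  shows "(\<lambda>k. rescaled_integrand l \<tau> (Suc k) y) \<longlonglongrightarrow> limit_integrand \<tau> y"
proof (cases "y \<in> block_domain l")
  case False
  then have "rescaled_integrand l \<tau> K y = 0" for K by (simp add: rescaled_integrand_def rescaled_domain_def)
  moreover have "limit_integrand \<tau> y = 0"
    unfolding limit_integrand_def prod_laguerre_integrand using False by simp
  ultimately show ?thesis by simp
next
  case True
  let ?w = "\<lambda>i. if \<tau> i = block l i then point_const (block l i) * laguerre_weight (\<alpha> (block l i)) (y i) else 0"
  let ?v = "\<lambda>i j. pair_const (block l i) (block l j)
      * (if block l i = block l j then abs_powr (y j - y i) (2 * \<gamma>) else 1)"
  have "y i \<ge> 0" if "i \<in> {1..n}" for i using True that by (simp add: block_domain_iff)
  then have "(\<lambda>k. (\<Prod>i=1..n. point_factor l \<tau> (Suc k) i (y i))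
      * (\<Prod>(i, j)\<in>less_pairs {1..n}. pair_factor l (Suc k) y i j))
      \<longlonglongrightarrow> (\<Prod>i=1..n. ?w i) * (\<Prod>(i, j)\<in>less_pairs {1..n}. ?v i j)"
    unfolding case_prod_unfold
    by (intro tendsto_mult tendsto_prod point_factor_tendsto pair_factor_tendsto tau_in)
      (auto simp: less_pairs_def)
  moreover have "\<forall>\<^sub>F k in sequentially. rescaled_integrand l \<tau> (Suc k) y
      = (\<Prod>i=1..n. point_factor l \<tau> (Suc k) i (y i)) * (\<Prod>(i, j)\<in>less_pairs {1..n}. pair_factor l (Suc k) y i j)"
    using eventually_rescaled_domain[OF True] by eventually_elim (simp add: rescaled_integrand_def)
  moreover have "(\<Prod>i=1..n. ?w i) * (\<Prod>(i, j)\<in>less_pairs {1..n}. ?v i j) = limit_integrand \<tau> y"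
  proof (cases "\<forall>i\<in>{1..n}. \<tau> i = block l i")
    case False
    then have "(\<Prod>i=1..n. ?w i) = 0" by (intro prod_zero) auto
    then show ?thesis unfolding limit_integrand_def if_not_P[OF False] by (simp only: mult_zero_left)
  next
    case eq: True
    then have "(\<Prod>i=1..n. ?w i) = (\<Prod>i=1..n. point_const (block l i) * laguerre_weight (\<alpha> (block l i)) (y i))"
      by (intro prod.cong refl) auto
    then show ?thesis
      unfolding limit_integrand_def if_P[OF eq] prod_laguerre_integrand block_const_def
      using True by (simp add: case_prod_unfold prod.distrib mult_ac)
  qed
  ultimately show ?thesis by (simp add: tendsto_cong)
qed

subsection \<open>Domination\<close>

definition point_bound :: "nat \<Rightarrow> real" where
  "point_bound s = dist_last s * dist_last s powr Re (\<alpha> s)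
     * (\<Prod>r\<in>{1..p}-{s}. sep powr Re (\<alpha> r) + (z p - z 1) powr Re (\<alpha> r)) * (1 / dist_last s + 1 / sep)"

lemma point_bound_nonneg: "s \<in> {1..p-1} \<Longrightarrow> point_bound s \<ge> 0"
  unfolding point_bound_def using dist_last_pos[of s] sep_pos
  by (intro mult_nonneg_nonneg prod_nonneg add_nonneg_nonneg) (auto intro: less_imp_le)

lemma norm_pole_factor_le:
  assumes K_pos: "K > 0" and i_in: "i \<in> {1..n}" and tau_in: "\<tau> i \<in> {1..p-1}"
    and y_range: "0 < y" "y \<le> near_ratio * real K"
  defines "d \<equiv> dist_last (block l i)"
  shows "norm (1 / (of_real (real K) * of_real (rescale_point l K i y - z (\<tau> i))) :: complex)
      \<le> (1 / d + 1 / sep) * ((1 + y) / y)"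
proof -
  have d_pos: "d > 0" unfolding d_def by (rule dist_block_pos[OF i_in])
  have "norm (1 / (of_real (real K) * of_real (rescale_point l K i y - z (\<tau> i))) :: complex)
      = 1 / (real K * \<bar>rescale_point l K i y - z (\<tau> i)\<bar>)"
    unfolding norm_divide norm_mult norm_of_real using K_pos by simp
  also have "\<dots> \<le> 1 / (d * y) + 1 / sep"
  proof (cases "\<tau> i = block l i")
    case True
    have "real K * \<bar>rescale_point l K i y - z (\<tau> i)\<bar> = d * y"
      unfolding True rescale_point_def d_def[symmetric] using K_pos d_pos y_range by (simp add: abs_mult)
    then show ?thesis using sep_pos by simp
  next
    case False
    have "sep \<le> \<bar>rescale_point l K i y - z (\<tau> i)\<bar>"
      using rescale_point_bounds_iff[OF K_pos i_in, of y] y_range tau_in False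
      by (intro near_singularity_distance(1)[OF block_in[OF i_in]]) auto
    then have "1 * sep \<le> real K * \<bar>rescale_point l K i y - z (\<tau> i)\<bar>" using K_pos sep_pos
      by (intro mult_mono) auto
    then have "1 / (real K * \<bar>rescale_point l K i y - z (\<tau> i)\<bar>) \<le> 1 / sep"
      using sep_pos by (intro divide_left_mono) (auto intro: mult_pos_pos)
    then show ?thesis using d_pos y_range by (simp add: add_increasing)
  qed
  also have "\<dots> \<le> 1 / (d * y) + 1 / d + 1 / (sep * y) + 1 / sep" using d_pos y_range sep_pos by simp
  also have "\<dots> = (1 / d + 1 / sep) * ((1 + y) / y)" using d_pos y_range sep_pos by (simp add: field_simps)
  finally show ?thesis .
qed

lemma norm_point_factor_le:
  assumes K_pos: "K > 0" and i_in: "i \<in> {1..n}" and tau_in: "\<tau> i \<in> {1..p-1}"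
    and y_range: "0 \<le> y" "y \<le> near_ratio * real K"
  shows "norm (point_factor l \<tau> K i y) \<le> point_bound (block l i) * gamma_majorant (Re (\<alpha> (block l i))) 1 y"
proof (cases "y = 0")
  case True
  then show ?thesis using point_bound_nonneg[OF block_in[OF i_in]]
    by (simp add: point_factor_def gamma_majorant_def)
next
  case False
  define d where "d = dist_last (block l i)"
  define a where "a = Re (\<alpha> (block l i))"
  let ?x = "rescale_point l K i y"
  have y_pos: "0 < y" using y_range False by simp
  have d_pos: "d > 0" unfolding d_def by (rule dist_block_pos[OF i_in])
  have "?x \<in> {z (block l i)..z (block l i) + near_ratio * dist_last (block l i)}"
    using rescale_point_bounds_iff[OF K_pos i_in, of y] y_range by simp
  note away = near_singularity_distance[OF block_in[OF i_in] this]
  have far: "norm (\<Prod>r\<in>{1..p}-{block l i}. abs_powr (?x - z r) (\<alpha> r))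
      \<le> (\<Prod>r\<in>{1..p}-{block l i}. sep powr Re (\<alpha> r) + (z p - z 1) powr Re (\<alpha> r))"
    unfolding prod_norm[symmetric] norm_abs_powr using away sep_pos
    by (intro prod_mono conjI powr_le_powr_add_powr) auto
  have "near_ratio * real K \<le> 1 * real K" using near_ratio_le_half by (intro mult_right_mono) auto
  then have y_le_K: "y \<le> real K" using y_range(2) by simp
  then have exp: "norm (of_real ((1 - y / real K) ^ K) :: complex) \<le> exp (- y)"
    unfolding norm_of_real using one_minus_divide_power_le_exp[OF y_range(1) y_le_K] K_pos
    by (subst abs_of_nonneg) auto
  have "norm (point_factor l \<tau> K i y) \<le> d * (d powr a * y powr a)
      * (\<Prod>r\<in>{1..p}-{block l i}. sep powr Re (\<alpha> r) + (z p - z 1) powr Re (\<alpha> r)) * exp (- y)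
      * ((1 / d + 1 / sep) * ((1 + y) / y))"
    unfolding point_factor_def norm_mult[of "_ * _ * _ * _"] norm_mult[of "_ * _ * _"] norm_mult[of "_ * _"]
      norm_mult[of "of_real d" for d] d_def[symmetric] a_def[symmetric]
    using d_pos y_pos far exp norm_pole_factor_le[where \<tau>=\<tau>, OF K_pos i_in tau_in y_pos y_range(2)]
    by (intro mult_mono mult_nonneg_nonneg prod_nonneg)
      (auto simp: d_def a_def norm_abs_powr powr_mult abs_mult)
  also have "\<dots> = point_bound (block l i) * (y powr a / y * (1 + y) * exp (- y))"
    unfolding point_bound_def d_def[symmetric] a_def[symmetric] by simp
  also have "y powr a / y * (1 + y) * exp (- y) = gamma_majorant a 1 y"
    using y_pos by (simp add: gamma_majorant_def powr_diff)
  finally show ?thesis unfolding a_def .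
qed

lemma norm_pair_factor_le:
  assumes K_pos: "K > 0" and y_domain: "y \<in> rescaled_domain l K" and ij_in: "i \<in> {1..n}" "j \<in> {1..n}"
  shows "norm (pair_factor l K y i j) \<le> (z p - z 1) powr (2 * Re \<gamma>) * ((1 + y i) * (1 + y j)) powr (2 * Re \<gamma>)"
proof (cases "block l i = block l j")
  case True
  note dist_bounds = dist_block_pos[OF ij_in(1)] dist_last_le[OF block_in[OF ij_in(1)]]
  have "norm (pair_factor l K y i j) = dist_last (block l i) powr (2 * Re \<gamma>)
      * norm (abs_powr (y j - y i) (2 * \<gamma>))"
    using True dist_bounds by (simp add: pair_factor_def abs_powr_mult norm_mult norm_abs_powr)
  also have "\<dots> \<le> (z p - z 1) powr (2 * Re \<gamma>) * ((1 + y i) * (1 + y j)) powr (2 * Re \<gamma>)"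
    using dist_bounds Re_gamma_pos norm_abs_powr_diff_le_mult[OF rescaled_domainD(1)[OF y_domain ij_in(1)]
      rescaled_domainD(1)[OF y_domain ij_in(2)], of "2 * \<gamma>"]
    by (intro mult_mono powr_mono2) auto
  finally show ?thesis .
next
  case False
  have range: "rescale_point l K i (y i) \<in> {z 1..z p}" if "i \<in> {1..n}" for i
    using chamber_range[OF l_Zset rescale_in_chamber[OF K_pos y_domain] that] that by (simp add: rescale_def)
  have "1 * 1 \<le> (1 + y i) * (1 + y j)"
    using rescaled_domainD(1)[OF y_domain ij_in(1)] rescaled_domainD(1)[OF y_domain ij_in(2)]
    by (intro mult_mono) auto
  then have "1 \<le> ((1 + y i) * (1 + y j)) powr (2 * Re \<gamma>)" using Re_gamma_pos by (intro ge_one_powr_ge_zero) auto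
  then have "(z p - z 1) powr (2 * Re \<gamma>) * 1 \<le> (z p - z 1) powr (2 * Re \<gamma>)
      * ((1 + y i) * (1 + y j)) powr (2 * Re \<gamma>)"
    by (intro mult_left_mono) auto
  moreover have "norm (pair_factor l K y i j) \<le> (z p - z 1) powr (2 * Re \<gamma>)"
    using False norm_abs_powr_diff_le[OF range[OF ij_in(2)] range[OF ij_in(1)], of "2 * \<gamma>"] Re_gamma_pos
    by (simp add: pair_factor_def)
  ultimately show ?thesis by simp
qed

lemma norm_rescaled_integrand_le:
  assumes K_pos: "K > 0" and tau_in: "\<And>i. i \<in> {1..n} \<Longrightarrow> \<tau> i \<in> {1..p-1}"
  defines "M \<equiv> (z p - z 1) powr (2 * Re \<gamma>)" and "N \<equiv> card (less_pairs {1..n})"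
  shows "norm (rescaled_integrand l \<tau> K y) \<le> (\<Prod>i=1..n. point_bound (block l i)) * M ^ N
    * (\<Prod>i=1..n. gamma_majorant (Re (\<alpha> (block l i))) (1 + 2 * Re \<gamma> * N) (y i))"
proof (cases "y \<in> rescaled_domain l K")
  case False
  then show ?thesis using point_bound_nonneg[OF block_in]
    by (auto simp: rescaled_integrand_def gamma_majorant_nonneg M_def intro!: mult_nonneg_nonneg prod_nonneg)
next
  case True
  note y_bounds = rescaled_domainD[OF True]
  have "norm (\<Prod>i=1..n. point_factor l \<tau> K i (y i))
      \<le> (\<Prod>i=1..n. point_bound (block l i) * gamma_majorant (Re (\<alpha> (block l i))) 1 (y i))"
    unfolding prod_norm[symmetric] using y_bounds tau_in
    by (intro prod_mono conjI norm_ge_zero norm_point_factor_le[OF K_pos]) auto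
  moreover have "norm (\<Prod>(i, j)\<in>less_pairs {1..n}. pair_factor l K y i j)
      \<le> M ^ N * (\<Prod>k=1..n. (1 + y k) powr (2 * Re \<gamma> * N))"
    unfolding N_def using y_bounds Re_gamma_pos norm_pair_factor_le[OF K_pos True]
    by (intro norm_prod_less_pairs_le) (auto simp: M_def less_pairs_def)
  ultimately have "norm (rescaled_integrand l \<tau> K y)
      \<le> (\<Prod>i=1..n. point_bound (block l i) * gamma_majorant (Re (\<alpha> (block l i))) 1 (y i))
      * (M ^ N * (\<Prod>k=1..n. (1 + y k) powr (2 * Re \<gamma> * N)))"
    using True point_bound_nonneg[OF block_in]
    by (auto simp: rescaled_integrand_def norm_mult intro!: mult_mono prod_nonneg mult_nonneg_nonneg
      gamma_majorant_nonneg)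
  also have "\<dots> = (\<Prod>i=1..n. point_bound (block l i)) * M ^ N
      * (\<Prod>i=1..n. gamma_majorant (Re (\<alpha> (block l i))) 1 (y i) * (1 + y i) powr (2 * Re \<gamma> * N))"
    unfolding prod.distrib by (simp only: mult_ac)
  also have "(\<Prod>i=1..n. gamma_majorant (Re (\<alpha> (block l i))) 1 (y i) * (1 + y i) powr (2 * Re \<gamma> * N))
      = (\<Prod>i=1..n. gamma_majorant (Re (\<alpha> (block l i))) (1 + 2 * Re \<gamma> * N) (y i))"
    by (intro prod.cong refl gamma_majorant_mult_powr y_bounds)
  finally show ?thesis .
qed

lemma near_integral_tendsto:
  assumes tau_in: "\<And>i. i \<in> {1..n} \<Longrightarrow> \<tau> i \<in> {1..p-1}"
  shows "(\<lambda>k. LINT t:chamber l \<inter> near_points l|Rn n. scaled_integrand l \<tau> (Suc k) t)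
    \<longlonglongrightarrow> (\<integral>y. limit_integrand \<tau> y \<partial>Rn n)"
  unfolding near_integral_eq(2)[OF zero_less_Suc]
proof (rule integral_dominated_convergence)
  let ?N = "card (less_pairs {1..n})"
  let ?C = "(\<Prod>i=1..n. point_bound (block l i)) * ((z p - z 1) powr (2 * Re \<gamma>)) ^ ?N"
  let ?w = "\<lambda>y. ?C * (\<Prod>i=1..n. gamma_majorant (Re (\<alpha> (block l i))) (1 + 2 * Re \<gamma> * ?N) (y i))"
  show meas: "rescaled_integrand l \<tau> (Suc k) \<in> borel_measurable (Rn n)" for k by (rule near_integral_eq(1)) simp
  show "limit_integrand \<tau> \<in> borel_measurable (Rn n)"
    by (rule borel_measurable_LIMSEQ_metric[OF meas]) (rule rescaled_integrand_tendsto[OF tau_in])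
  have "Re (\<alpha> (block l i)) > 0" if "i \<in> {1..n}" for i
    using block_in[OF that] two_le_p by (intro Re_alpha_pos) auto
  then show "integrable (Rn n) ?w" using Re_gamma_pos
    by (intro integrable_mult_right lborel_product.product_integrable_prod integrable_gamma_majorant) auto
  show "AE y in Rn n. (\<lambda>k. rescaled_integrand l \<tau> (Suc k) y) \<longlonglongrightarrow> limit_integrand \<tau> y"
    by (rule AE_I2) (rule rescaled_integrand_tendsto[OF tau_in])
  show "AE y in Rn n. norm (rescaled_integrand l \<tau> (Suc k) y) \<le> ?w y" for k
    by (rule AE_I2) (rule norm_rescaled_integrand_le[OF zero_less_Suc tau_in])
qed

lemma integral_limit_integrand:
  "(\<integral>y. limit_integrand \<tau> y \<partial>Rn n)
    = (if \<forall>i\<in>{1..n}. \<tau> i = block l i then block_const l * (\<Prod>s=1..p-1. laguerre_selberg (l s) (\<alpha> s) \<gamma>) else 0)"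
proof (cases "\<forall>i\<in>{1..n}. \<tau> i = block l i")
  case True
  have "Re (\<alpha> s) > 0" if "s \<in> {1..p-1}" for s using that two_le_p by (intro Re_alpha_pos) auto
  then show ?thesis
    unfolding limit_integrand_def if_P[OF True] integral_mult_right_zero
    using integral_prod_laguerre_integrand[OF l_Zset, of \<alpha> \<gamma>] Re_gamma_pos by simp
qed (simp only: limit_integrand_def if_False integral_zero)

lemma scaled_integral_tendsto:
  assumes tau_in: "\<And>i. i \<in> {1..n} \<Longrightarrow> \<tau> i \<in> {1..p-1}"
  shows "(\<lambda>k. LINT t:chamber l|Rn n. scaled_integrand l \<tau> (Suc k) t)
    \<longlonglongrightarrow> (if \<forall>i\<in>{1..n}. \<tau> i = block l i then block_const l * (\<Prod>s=1..p-1. laguerre_selberg (l s) (\<alpha> s) \<gamma>) else 0)"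
proof -
  let ?f = "\<lambda>k. scaled_integrand l \<tau> (Suc k)"
  have split: "(LINT t:chamber l|Rn n. ?f k t)
      = (LINT t:chamber l \<inter> near_points l|Rn n. ?f k t) + (LINT t:chamber l - near_points l|Rn n. ?f k t)" for k
  proof -
    note [measurable] = pred_near_points measurable_scaled_integrand
    have integrable_on: "set_integrable (Rn n) S (?f k)"
      if [measurable]: "Measurable.pred (Rn n) (\<lambda>t. t \<in> S)" and "S \<subseteq> chamber l" for S
      unfolding set_integrable_def
    proof (rule Bochner_Integration.integrable_bound)
      show "integrable (Rn n) (\<lambda>t. indicator (chamber l) t *\<^sub>R ?f k t)"
        using set_integrable_scaled_integrand[OF tau_in] by (simp only: set_integrable_def)
      show "(\<lambda>t. indicator S t *\<^sub>R ?f k t) \<in> borel_measurable (Rn n)" by measurable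
      show "AE t in Rn n. norm (indicator S t *\<^sub>R ?f k t) \<le> norm (indicator (chamber l) t *\<^sub>R ?f k t)"
        using that(2) by (auto simp: indicator_def)
    qed
    have "Measurable.pred (Rn n) (\<lambda>t. t \<in> chamber l \<inter> near_points l)"
      "Measurable.pred (Rn n) (\<lambda>t. t \<in> chamber l - near_points l)"
      by measurable
    from this[THEN integrable_on] show ?thesis
      using set_integral_Un[of "chamber l \<inter> near_points l" "chamber l - near_points l" "Rn n" "?f k"]
      by (auto simp: Int_Diff_Un Int_Diff_disjoint)
  qed
  show ?thesis
    unfolding split integral_limit_integrand[symmetric]
    using tendsto_add[OF near_integral_tendsto[OF tau_in] far_integral_tendsto_0[OF tau_in]] by simp
qed

end

subsection \<open>The determinant\<close>

abbreviation raised :: "nat \<Rightarrow> nat \<Rightarrow> complex" where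
  "raised K \<equiv> \<alpha>(p := \<alpha> p + of_nat K)"

abbreviation (input) point_count :: nat where
  "point_count \<equiv> (n + (p - 1) - 1) choose (p - 1)"

abbreviation (input) pair_count :: nat where
  "pair_count \<equiv> (n + (p - 1) - 1) choose Suc (p - 1)"

definition row_scale :: "nat \<Rightarrow> (nat \<Rightarrow> nat) \<Rightarrow> complex" where
  "row_scale K l = abs_powr (real K) (scale_exponent l) * (\<Prod>i=1..n. 1 / of_real (dist_last (block l i) ^ K))"

definition diag_limit :: "(nat \<Rightarrow> nat) \<Rightarrow> complex" where
  "diag_limit l = block_const l * (\<Prod>s=1..p-1. laguerre_selberg (l s) (\<alpha> s) \<gamma>)"

lemma row_scale_mult_integrand:
  assumes l_Zset: "l \<in> Zset n (p - 1)" and m_Zset: "m \<in> Zset n (p - 1)" and t_chamber: "t \<in> chamber l"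
  shows "row_scale K l * (abs_Phi n p z (raised K) \<gamma> t * omega n p z m t)
    = (\<Sum>\<sigma> | \<sigma> permutes {1..n}. inv_fact_prod m * scaled_integrand l (\<lambda>i. block m (inv \<sigma> i)) K t)"
proof -
  have poles: "(\<Prod>j=1..n. letter_fun (LF (block m j)) (t (\<sigma> j)))
      = (\<Prod>i=1..n. 1 / of_real (t i - z (block m (inv \<sigma> i))))"
    if sigma_permutes: "\<sigma> permutes {1..n}" for \<sigma>
    using prod.permute[OF sigma_permutes, of "\<lambda>i. letter_fun (LF (block m (inv \<sigma> i))) (t i)"]
      permutes_inverses[OF sigma_permutes] by (simp add: o_def)
  have "(\<Prod>i=1..n. of_real (((z p - t i) / dist_last (block l i)) ^ K)
      * (1 / of_real (t i - z (\<tau> i))) :: complex)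
      = (\<Prod>i=1..n. of_real ((z p - t i) ^ K)) * (\<Prod>i=1..n. 1 / of_real (dist_last (block l i) ^ K))
        * (\<Prod>i=1..n. 1 / of_real (t i - z (\<tau> i)))" for \<tau>
    unfolding prod.distrib[symmetric] by (intro prod.cong refl) (simp add: power_divide)
  then have scaled: "scaled_integrand l \<tau> K t
      = row_scale K l * (\<Psi> t * (\<Prod>i=1..n. of_real ((z p - t i) ^ K))) * (\<Prod>i=1..n. 1 / of_real (t i - z (\<tau> i)))"
    for \<tau>
    unfolding scaled_integrand_def row_scale_def by (simp only: mult_ac)
  have "abs_Phi n p z (raised K) \<gamma> t = \<Psi> t * (\<Prod>i=1..n. of_real ((z p - t i) ^ K))"
    using chamber_range[OF l_Zset t_chamber] two_le_p by (intro abs_Phi_raise_last) auto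
  moreover have "omega n p z m t
      = inv_fact_prod m * (\<Sum>\<sigma> | \<sigma> permutes {1..n}. \<Prod>i=1..n. 1 / of_real (t i - z (block m (inv \<sigma> i))))"
    unfolding omega_eq_symmetrize[OF m_Zset] symmetrize_def using poles
    by (intro arg_cong2[of _ _ _ _ "(*)"] sum.cong refl) simp
  ultimately show ?thesis unfolding scaled by (simp only: sum_distrib_left mult_ac)
qed

lemma row_scale_mult_matrix_entry:
  assumes l_Zset: "l \<in> Zset n (p - 1)" and m_Zset: "m \<in> Zset n (p - 1)"
  shows "row_scale K l * selberg_data.matrix_entry n p z (raised K) \<gamma> l m
    = (\<Sum>\<sigma> | \<sigma> permutes {1..n}. inv_fact_prod m
    * (LINT t:chamber l|Rn n. scaled_integrand l (\<lambda>i. block m (inv \<sigma> i)) K t))"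
proof -
  interpret raised: selberg_data n p z "raised K" \<gamma> by (rule selberg_data_raise)
  let ?S = "{\<sigma>. \<sigma> permutes {1..n}}"
  let ?f = "\<lambda>\<sigma> t. indicator (chamber l) t *\<^sub>R scaled_integrand l (\<lambda>i. block m (inv \<sigma> i)) K t"
  have "row_scale K l * raised.matrix_entry l m
      = (\<integral>t. row_scale K l * (indicator (chamber l) t
      *\<^sub>R (abs_Phi n p z (raised K) \<gamma> t * omega n p z m t)) \<partial>Rn n)"
    unfolding raised.matrix_entry_def raised.chamber_integral_def set_lebesgue_integral_def
    by (rule integral_mult_right_zero[symmetric])
  also have "\<dots> = (\<integral>t. (\<Sum>\<sigma>\<in>?S. inv_fact_prod m * ?f \<sigma> t) \<partial>Rn n)"
  proof (rule Bochner_Integration.integral_cong[OF refl])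
    fix t
    show "row_scale K l * (indicator (chamber l) t *\<^sub>R (abs_Phi n p z (raised K) \<gamma> t * omega n p z m t))
        = (\<Sum>\<sigma>\<in>?S. inv_fact_prod m * ?f \<sigma> t)"
      using row_scale_mult_integrand[OF l_Zset m_Zset, of t K] by (cases "t \<in> chamber l") simp_all
  qed
  also have "\<dots> = (\<Sum>\<sigma>\<in>?S. \<integral>t. inv_fact_prod m * ?f \<sigma> t \<partial>Rn n)"
  proof (intro Bochner_Integration.integral_sum integrable_mult_right)
    fix \<sigma> assume "\<sigma> \<in> ?S"
    then have range: "block m (inv \<sigma> i) \<in> {1..p-1}" if "i \<in> {1..n}" for i
      using permutes_in_image[OF permutes_inv[of \<sigma> "{1..n}"]] that by (intro block_range[OF m_Zset]) auto
    have "set_integrable (Rn n) (chamber l) (scaled_integrand l (\<lambda>i. block m (inv \<sigma> i)) K)"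
      by (rule set_integrable_scaled_integrand[OF l_Zset]) (rule range)
    then show "integrable (Rn n) (?f \<sigma>)" by (simp only: set_integrable_def)
  qed
  finally show ?thesis by (simp only: integral_mult_right_zero set_lebesgue_integral_def)
qed

lemma sum_permutes_block_eq:
  assumes l_Zset: "l \<in> Zset n (p - 1)" and m_Zset: "m \<in> Zset n (p - 1)"
  shows "(\<Sum>\<sigma> | \<sigma> permutes {1..n}. inv_fact_prod m * (if \<forall>i\<in>{1..n}. block m (\<sigma> i) = block l i then x else 0))
    = (if m = l then x else 0)"
proof (cases "m = l")
  case False
  have "\<not> (\<forall>i\<in>{1..n}. block m (\<sigma> i) = block l i)" if sigma_permutes: "\<sigma> permutes {1..n}" for \<sigma>
  proof
    assume "\<forall>i\<in>{1..n}. block m (\<sigma> i) = block l i"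
    then have "Abs_multiset l = image_mset (\<lambda>i. block m (\<sigma> i)) (mset_set {1..n})"
      unfolding image_mset_block[OF l_Zset, symmetric] by (intro image_mset_cong) auto
    also have "\<dots> = image_mset (block m) (image_mset \<sigma> (mset_set {1..n}))"
      by (simp add: image_mset.compositionality o_def)
    also have "\<dots> = Abs_multiset m" unfolding permutes_image_mset[OF sigma_permutes]
      by (rule image_mset_block[OF m_Zset])
    finally show False using count_Abs_multiset_Zset[OF l_Zset] count_Abs_multiset_Zset[OF m_Zset] False
      by metis
  qed
  then show ?thesis using False by (intro trans[OF sum.neutral]) auto
next
  case True
  have inv_fact: "inv_fact_prod l = 1 / of_nat (\<Prod>s=1..p-1. fact (l s))"
    using range_eq_insert_last Zset_outside[OF l_Zset, of p] two_le_p by (simp add: inv_fact_prod_def prod_dividef)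
  let ?P = "\<lambda>\<sigma>. \<forall>i\<in>{1..n}. block l (\<sigma> i) = block l i"
  have card: "card {\<sigma>. \<sigma> permutes {1..n} \<and> ?P \<sigma>} = (\<Prod>s=1..p-1. fact (l s))"
    using card_permutes_preserving[of "{1..n}" "{1..p-1}" "block l"] block_range[OF l_Zset]
      card_block_eq[OF l_Zset] by (simp add: image_subset_iff)
  have "(\<Sum>\<sigma> | \<sigma> permutes {1..n}. if ?P \<sigma> then x else 0) = (\<Sum>\<sigma>\<in>{\<sigma> \<in> {\<sigma>. \<sigma> permutes {1..n}}. ?P \<sigma>}. x)"
    by (rule sum.inter_filter[symmetric]) (simp add: finite_permutations)
  also have "\<dots> = of_nat (\<Prod>s=1..p-1. fact (l s)) * x" unfolding card[symmetric] by simp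
  moreover have "of_nat (\<Prod>s=1..p-1. fact (l s)) \<noteq> (0::complex)" by simp
  ultimately show ?thesis using True inv_fact by (simp only: sum_distrib_left[symmetric] if_True) simp
qed

lemma row_scale_mult_matrix_entry_tendsto:
  assumes l_Zset: "l \<in> Zset n (p - 1)" and m_Zset: "m \<in> Zset n (p - 1)"
  shows "(\<lambda>k. row_scale (Suc k) l * selberg_data.matrix_entry n p z (raised (Suc k)) \<gamma> l m)
    \<longlonglongrightarrow> (if m = l then diag_limit l else 0)"
proof -
  let ?c = "\<lambda>\<sigma>. if \<forall>i\<in>{1..n}. block m (\<sigma> i) = block l i then diag_limit l else 0"
  have "(\<lambda>k. row_scale (Suc k) l * selberg_data.matrix_entry n p z (raised (Suc k)) \<gamma> l m)
      \<longlonglongrightarrow> (\<Sum>\<sigma> | \<sigma> permutes {1..n}. inv_fact_prod m * ?c (inv \<sigma>))"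
    unfolding row_scale_mult_matrix_entry[OF l_Zset m_Zset] diag_limit_def
  proof (intro tendsto_sum tendsto_mult tendsto_const scaled_integral_tendsto[OF l_Zset])
    fix \<sigma> i assume "\<sigma> \<in> {\<sigma>. \<sigma> permutes {1..n}}" "i \<in> {1..n}"
    then show "block m (inv \<sigma> i) \<in> {1..p-1}"
      using permutes_in_image[OF permutes_inv[of \<sigma> "{1..n}"]] by (intro block_range[OF m_Zset]) auto
  qed
  also have "(\<Sum>\<sigma> | \<sigma> permutes {1..n}. inv_fact_prod m * ?c (inv \<sigma>))
      = (\<Sum>\<sigma> | \<sigma> permutes {1..n}. inv_fact_prod m * ?c \<sigma>)"
    by (rule sum_permutations_inverse[symmetric])
  also have "\<dots> = (if m = l then diag_limit l else 0)" by (rule sum_permutes_block_eq[OF l_Zset m_Zset])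
  finally show ?thesis .
qed

lemma det_raised_tendsto:
  "(\<lambda>k. (\<Prod>l\<in>Zset n (p - 1). row_scale (Suc k) l)
      * det_on (Zset n (p - 1)) (selberg_data.matrix_entry n p z (raised (Suc k)) \<gamma>))
    \<longlonglongrightarrow> (\<Prod>l\<in>Zset n (p - 1). diag_limit l)"
proof -
  let ?Z = "Zset n (p - 1)"
  have "(\<lambda>k. det_on ?Z (\<lambda>l m. row_scale (Suc k) l * selberg_data.matrix_entry n p z (raised (Suc k)) \<gamma> l m))
      \<longlonglongrightarrow> det_on ?Z (\<lambda>l m. if m = l then diag_limit l else 0)"
    by (intro tendsto_det_on row_scale_mult_matrix_entry_tendsto)
  moreover have "det_on ?Z (\<lambda>l m. r l * M l m) = (\<Prod>l\<in>?Z. r l) * det_on ?Z M" for r :: "(nat \<Rightarrow> nat) \<Rightarrow> complex"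
    and M
    using det_on_scale[of ?Z r M "\<lambda>_. 1"] by simp
  ultimately show ?thesis by (simp only: det_on_diagonal finite_Zset)
qed

definition gamma_arg_num :: "nat \<Rightarrow> complex" where
  "gamma_arg_num s = 1 + \<alpha> p + of_nat s * \<gamma>"

definition gamma_arg_den :: "nat \<Rightarrow> complex" where
  "gamma_arg_den s = 1 + (\<Sum>s=1..p. \<alpha> s) + (2 * of_nat n - 2 - of_nat s) * \<gamma>"

definition scale_prod :: complex where
  "scale_prod = (\<Prod>s=1..p-1. of_real (dist_last s)) ^ point_count"

lemma det_raised:
  "det_on (Zset n (p - 1)) (selberg_data.matrix_entry n p z (raised K) \<gamma>)
    = (\<Prod>m\<in>Zset n (p - 1). \<Prod>s<m 1. pochhammer (gamma_arg_num s) K / pochhammer (gamma_arg_den s) K)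
      * scale_prod ^ K * det_on (Zset n (p - 1)) matrix_entry"
proof (induction K)
  case (Suc K)
  interpret raised: selberg_data n p z "raised K" \<gamma> by (rule selberg_data_raise)
  let ?Z = "Zset n (p - 1)"
  have raise: "(raised K)(p := (raised K) p + 1) = raised (Suc K)" by (auto simp: fun_eq_iff)
  have "{1..p} = insert p {1..<p}" using two_le_p by auto
  then have "(\<Sum>s=1..p. (raised K) s) = (\<Sum>s=1..p. \<alpha> s) + of_nat K" by simp
  then have den: "1 + (\<Sum>s=1..p. (raised K) s) + (2 * of_nat n - 2 - of_nat s) * \<gamma> = gamma_arg_den s + of_nat K"
    for s
    by (simp add: gamma_arg_den_def algebra_simps)
  have num: "1 + (raised K) p + of_nat s * \<gamma> = gamma_arg_num s + of_nat K" for s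
    by (simp add: gamma_arg_num_def)
  have scale: "(\<Prod>m\<in>?Z. \<Prod>s=1..p-1. of_real (z p - z s) ^ m s) = scale_prod"
    unfolding scale_prod_def dist_last_def prod_Zset_block[symmetric]
    by (intro prod.cong refl prod_block[symmetric])
  have "det_on ?Z (selberg_data.matrix_entry n p z (raised (Suc K)) \<gamma>)
      = (\<Prod>m\<in>?Z. \<Prod>s<m 1. (gamma_arg_num s + of_nat K) / (gamma_arg_den s + of_nat K)) * scale_prod
      * det_on ?Z raised.matrix_entry"
    using raised.det_matrix_entry_shift unfolding raise num den scale .
  then show ?case
    unfolding Suc.IH pochhammer_Suc times_divide_times_eq[symmetric] prod.distrib power_Suc
    by (simp only: mult_ac)
qed simp

definition total_scale_exponent :: complex where
  "total_scale_exponent = of_nat point_count * (\<Sum>s=1..p-1. \<alpha> s) + of_nat (pair_count * (p - 1)) * (2 * \<gamma>)"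

lemma prod_row_scale:
  assumes K_pos: "K > 0"
  shows "(\<Prod>l\<in>Zset n (p - 1). row_scale K l) = abs_powr (real K) total_scale_exponent / scale_prod ^ K"
proof -
  let ?Z = "Zset n (p - 1)" and ?k = "abs_powr (real K)"
  have real_K_nonzero: "real K \<noteq> 0" using K_pos by simp
  let ?G = "\<lambda>r s. if r = s then ?k (2 * \<gamma>) else 1"
  have "(\<Prod>l\<in>?Z. \<Prod>(i, j)\<in>less_pairs {1..n}. ?G (block l i) (block l j))
      = ((\<Prod>s=1..p-1. ?G s s) * (\<Prod>(r, s)\<in>less_pairs {1..p-1}. ?G r s)) ^ pair_count"
    by (rule prod_Zset_block_pairs)
  also have "(\<Prod>(r, s)\<in>less_pairs {1..p-1}. ?G r s) = 1" by (intro prod.neutral) (auto simp: less_pairs_def)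
  finally have pairs: "(\<Prod>l\<in>?Z. \<Prod>(i, j)\<in>less_pairs {1..n}. ?G (block l i) (block l j))
      = ?k (of_nat (pair_count * (p - 1)) * (2 * \<gamma>))"
    by (simp add: abs_powr_power[OF real_K_nonzero] mult_ac flip: power_mult)
  have "(\<Prod>l\<in>?Z. \<Prod>i=1..n. ?k (\<alpha> (block l i))) = ?k (of_nat point_count * (\<Sum>s=1..p-1. \<alpha> s))"
    unfolding prod_Zset_block[of "\<lambda>s. ?k (\<alpha> s)"]
    by (simp only: abs_powr_sum[OF real_K_nonzero, symmetric] abs_powr_power[OF real_K_nonzero])
  moreover have "(\<Prod>l\<in>?Z. \<Prod>i=1..n. 1 / of_real (dist_last (block l i) ^ K)) = 1 / scale_prod ^ K"
    unfolding prod_Zset_block[of "\<lambda>s. 1 / of_real (dist_last s ^ K)"]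
    by (simp add: scale_prod_def prod_dividef prod_power_distrib power_divide power_commutes flip: power_mult
      add: mult.commute)
  ultimately show ?thesis
    unfolding row_scale_def abs_powr_scale_exponent[OF real_K_nonzero] prod.distrib pairs
      total_scale_exponent_def
    by (simp add: abs_powr_add)
qed

lemma scale_prod_nonzero: "scale_prod \<noteq> 0"
proof -
  have "dist_last s \<noteq> 0" if "s \<in> {1..p-1}" for s using dist_last_pos[OF that] by simp
  then show ?thesis by (auto simp: scale_prod_def)
qed

lemma sum_alpha_split: "(\<Sum>s=1..p. \<alpha> s) = (\<Sum>s=1..p-1. \<alpha> s) + \<alpha> p"
  using range_eq_insert_last by simp

lemma Re_gamma_arg_num: "Re (gamma_arg_num s) > 0"
  using Re_alpha_last Re_gamma_pos by (simp add: gamma_arg_num_def add_pos_nonneg)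

lemma Re_gamma_arg_den:
  assumes "s < n"
  shows "Re (gamma_arg_den s) > 0"
proof -
  have "Re (\<Sum>s=1..p-1. \<alpha> s) \<ge> 0"
    unfolding Re_sum using Re_alpha_pos two_le_p by (intro sum_nonneg) (auto intro!: less_imp_le)
  moreover have "2 * of_nat n - 2 - of_nat s = (of_nat (2 * n - 2 - s) :: complex)"
    using assms by (simp add: of_nat_diff)
  moreover have "Re (of_nat (2 * n - 2 - s) * \<gamma>) \<ge> 0" using Re_gamma_pos by simp
  ultimately show ?thesis using Re_alpha_last unfolding gamma_arg_den_def sum_alpha_split by simp
qed

lemma sum_gamma_arg_diff:
  "(\<Sum>m\<in>Zset n (p - 1). \<Sum>i<m 1. gamma_arg_den i - gamma_arg_num i) = total_scale_exponent"
proof -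
  let ?c = "\<lambda>i. card (Zset (n - 1 - i) (p - 1))"
  have p_minus_1: "p - 1 \<ge> 1" "1 \<in> {1..p-1}" using two_le_p by auto
  have "(\<Sum>m\<in>Zset n (p - 1). \<Sum>i<m 1. gamma_arg_den i - gamma_arg_num i)
      = (\<Sum>i<n. of_nat (?c i) * (gamma_arg_den i - gamma_arg_num i))"
    using sum.Zset_raise[OF p_minus_1(2), of "\<lambda>i _. gamma_arg_den i - gamma_arg_num i" n] by simp
  also have "\<dots> = (\<Sum>i<n. of_nat (?c i) * (\<Sum>s=1..p-1. \<alpha> s) + of_nat (?c i * (n - 1 - i)) * (2 * \<gamma>))"
  proof (rule sum.cong[OF refl])
    fix i assume "i \<in> {..<n}"
    then have "of_nat n = (of_nat (n - 1 - i) + 1 + of_nat i :: complex)" by (simp add: of_nat_diff)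
    then have "gamma_arg_den i - gamma_arg_num i = (\<Sum>s=1..p-1. \<alpha> s) + of_nat (n - 1 - i) * (2 * \<gamma>)"
      unfolding gamma_arg_num_def gamma_arg_den_def sum_alpha_split by (simp only:) (simp add: algebra_simps)
    then show "of_nat (?c i) * (gamma_arg_den i - gamma_arg_num i) = of_nat (?c i) * (\<Sum>s=1..p-1. \<alpha> s)
        + of_nat (?c i * (n - 1 - i)) * (2 * \<gamma>)"
      by (simp only: of_nat_mult distrib_left mult.assoc)
  qed
  also have "\<dots> = of_nat (\<Sum>i<n. ?c i) * (\<Sum>s=1..p-1. \<alpha> s) + of_nat (\<Sum>i<n. ?c i * (n - 1 - i)) * (2 * \<gamma>)"
    unfolding sum.distrib sum_distrib_right[symmetric] of_nat_sum ..
  finally show ?thesis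
    unfolding total_scale_exponent_def sum_card_Zset[OF p_minus_1(1)] sum_card_Zset_weighted[OF p_minus_1(1)]
    by (simp only: mult.commute)
qed

theorem det_matrix_entry:
  "det_on (Zset n (p - 1)) matrix_entry = (\<Prod>l\<in>Zset n (p - 1). diag_limit l)
    * (\<Prod>i<n. (Gamma (gamma_arg_num i) / Gamma (gamma_arg_den i)) ^ card (Zset (n - 1 - i) (p - 1)))"
proof -
  let ?Z = "Zset n (p - 1)" and ?D = "det_on (Zset n (p - 1)) matrix_entry"
  let ?G = "\<Prod>m\<in>Zset n (p - 1). \<Prod>s<m 1. Gamma (gamma_arg_den s) / Gamma (gamma_arg_num s)"
  let ?H = "\<Prod>m\<in>Zset n (p - 1). \<Prod>s<m 1. Gamma (gamma_arg_num s) / Gamma (gamma_arg_den s)"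
  have less_n: "s < n" if "m \<in> ?Z" "s \<in> {..<m 1}" for m s
    using Zset_component_le[OF that(1) one_in_range] that(2) by simp
  define P where "P k = (\<Prod>m\<in>?Z. \<Prod>s<m 1. pochhammer (gamma_arg_num s) (Suc k)
      / pochhammer (gamma_arg_den s) (Suc k)
      * abs_powr (real (Suc k)) (gamma_arg_den s - gamma_arg_num s))" for k
  have "(\<lambda>k. P k * ?D) \<longlonglongrightarrow> ?G * ?D"
    unfolding P_def
    by (intro tendsto_mult tendsto_prod tendsto_const pochhammer_ratio_tendsto_Gamma_ratio Re_gamma_arg_num
      Re_gamma_arg_den less_n)
  moreover have "(\<Prod>l\<in>?Z. row_scale (Suc k) l) * det_on ?Z (selberg_data.matrix_entry n p z (raised (Suc k)) \<gamma>)
      = P k * ?D" for k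
  proof -
    have real_K_nonzero: "real (Suc k) \<noteq> 0" by simp
    have "P k = (\<Prod>m\<in>?Z. \<Prod>s<m 1. pochhammer (gamma_arg_num s) (Suc k) / pochhammer (gamma_arg_den s) (Suc k))
        * abs_powr (real (Suc k)) total_scale_exponent"
      unfolding P_def prod.distrib sum_gamma_arg_diff[symmetric] abs_powr_sum[OF real_K_nonzero] ..
    then show ?thesis
      unfolding det_raised prod_row_scale[OF zero_less_Suc] using scale_prod_nonzero
      by (simp add: mult_ac del: of_nat_Suc pochhammer_Suc)
  qed
  ultimately have limit: "?G * ?D = (\<Prod>l\<in>?Z. diag_limit l)"
    using det_raised_tendsto LIMSEQ_unique by (simp only:)
  have "?H * ?G = 1"
    unfolding prod.distrib[symmetric]
    using Gamma_nonzero_Re_pos[OF Re_gamma_arg_num] Gamma_nonzero_Re_pos[OF Re_gamma_arg_den[OF less_n]]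
    by (intro prod.neutral ballI) simp
  then have "?D = ?H * ?G * ?D" by simp
  also have "\<dots> = (\<Prod>l\<in>?Z. diag_limit l) * ?H" unfolding mult.assoc limit by (rule mult.commute)
  finally show ?thesis
    using prod.Zset_raise[OF one_in_range, of "\<lambda>i _. Gamma (gamma_arg_num i) / Gamma (gamma_arg_den i)" n]
    by (simp only: prod_constant)
qed

end

section \<open>Selberg's integral and its Laguerre limit\<close>

definition selberg :: "nat \<Rightarrow> complex \<Rightarrow> complex \<Rightarrow> complex \<Rightarrow> complex" where
  "selberg n a b \<gamma> = ordered_integral {1..n} {0..1} (\<lambda>t. abs_powr t (a - 1) * abs_powr (t - 1) (b - 1)) \<gamma>"

lemma selberg_commute: "selberg n a b \<gamma> = selberg n b a \<gamma>"
proof -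
  have bij: "bij_betw (\<lambda>j. n + 1 - j) {1..n} {1..n}"
    by (rule bij_betw_byWitness[where f'="\<lambda>j. n + 1 - j"]) auto
  have "selberg n a b \<gamma> = ordered_integral {1..n} {y. 1 + - 1 * y \<in> {0..1}}
      (\<lambda>y. abs_powr (1 + - 1 * y) (a - 1) * abs_powr (1 + - 1 * y - 1) (b - 1)) \<gamma>"
    unfolding selberg_def by (rule ordered_integral_affine[OF bij]) auto
  also have "{y. 1 + - 1 * y \<in> {0..1}} = {0..1 :: real}" by auto
  also have "(\<lambda>y. abs_powr (1 + - 1 * y) (a - 1) * abs_powr (1 + - 1 * y - 1) (b - 1))
      = (\<lambda>y. abs_powr y (b - 1) * abs_powr (y - 1) (a - 1))"
    by (simp add: abs_powr_diff_commute[of 1] mult.commute)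
  finally show ?thesis by (simp only: selberg_def)
qed

context selberg_data
begin

lemma omega_unit_interval:
  assumes p_eq_2: "p = 2" and z_1: "z 1 = 0" and l_Zset: "l \<in> Zset n 1"
  shows "omega n p z l t = (\<Prod>i=1..n. 1 / of_real (t i))"
proof -
  have l_Zset_minus_1: "l \<in> Zset n (p - 1)" using l_Zset p_eq_2 by simp
  have block: "block l i = 1" if "i \<in> {1..n}" for i using block_range[OF l_Zset that] by simp
  have "symmetrize n (\<lambda>j. letter_fun (LF (block l j))) t = symmetrize n (\<lambda>j u. 1 / of_real u * 1) t"
    unfolding symmetrize_def using block z_1 by (intro sum.cong prod.cong refl) simp
  also have "\<dots> = (\<Prod>i=1..n. 1 / of_real (t i)) * of_nat (fact n)"
    unfolding symmetrize_mult_prod using card_permutations[of "{1..n}" n] by (simp add: symmetrize_def)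
  finally have "symmetrize n (\<lambda>j. letter_fun (LF (block l j))) t = \<dots>" .
  moreover have "l 1 = n" "l 2 = 0" using l_Zset unfolding Zset_1 by auto
  then have "inv_fact_prod l = 1 / of_nat (fact n)"
    unfolding inv_fact_prod_def unfolding p_eq_2 by (simp add: numeral_2_eq_2)
  ultimately show ?thesis unfolding omega_eq_symmetrize[OF l_Zset_minus_1] by simp
qed

lemma matrix_entry_unit_interval:
  assumes p_eq_2: "p = 2" and z_unit: "z 1 = 0" "z 2 = 1" and l_Zset: "l \<in> Zset n 1"
  shows "matrix_entry l l = selberg n (\<alpha> 1) (\<alpha> 2 + 1) \<gamma>"
proof -
  let ?w = "\<lambda>t. abs_powr t (\<alpha> 1 - 1) * abs_powr (t - 1) (\<alpha> 2)"
  have block: "block l i = 1" if "i \<in> {1..n}" for i using block_range[OF l_Zset that] by simp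
  have chamber: "chamber l = ordered_in {1..n} {0..1}"
    unfolding chamber_def ordered_in_def using block z_unit by (auto simp: numeral_2_eq_2)
  have "point_weight p z \<alpha> x * (1 / of_real x) = ?w x" if "x \<in> {0..1}" for x
  proof -
    have "point_weight p z \<alpha> x = abs_powr x (\<alpha> 1) * abs_powr (x - 1) (\<alpha> 2)"
      unfolding point_weight_def p_eq_2 using z_unit by (simp add: numeral_2_eq_2)
    then show ?thesis using abs_powr_minus_1[of x "\<alpha> 1"] that by simp
  qed
  then have "(\<Prod>i=1..n. point_weight p z \<alpha> (t i)) * (\<Prod>i=1..n. 1 / of_real (t i)) = (\<Prod>i=1..n. ?w (t i))"
    if "t \<in> ordered_in {1..n} {0..1}" for t
    unfolding prod.distrib[symmetric] using that by (intro prod.cong refl) (auto simp: ordered_in_def)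
  then have "\<Psi> t * omega n p z l t = (\<Prod>i=1..n. ?w (t i)) * vandermonde {1..n} \<gamma> t"
    if "t \<in> ordered_in {1..n} {0..1}" for t
    using that unfolding omega_unit_interval[OF p_eq_2 z_unit(1) l_Zset] abs_Phi_def by (simp only: mult_ac)
  then have "indicator (ordered_in {1..n} {0..1}) t *\<^sub>R (\<Psi> t * omega n p z l t)
      = ordered_integrand {1..n} {0..1} ?w \<gamma> t" for t
    by (cases "t \<in> ordered_in {1..n} {0..1}") (simp_all add: ordered_integrand_def)
  then show ?thesis
    unfolding matrix_entry_def chamber_integral_def set_lebesgue_integral_def selberg_def ordered_integral_def
      chamber by simp
qed

lemma diag_limit_unit_interval:
  assumes p_eq_2: "p = 2" and z_unit: "z 1 = 0" "z 2 = 1" and l_Zset: "l \<in> Zset n 1"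
  shows "diag_limit l = laguerre_selberg n (\<alpha> 1) \<gamma>"
proof -
  have block: "block l i = 1" if "i \<in> {1..n}" for i using block_range[OF l_Zset that] by simp
  have "{1..2} - {1} = {2::nat}" by auto
  then have "point_const 1 = 1" "pair_const 1 1 = 1"
    unfolding point_const_def pair_const_def dist_last_def
    unfolding p_eq_2 using z_unit abs_powr_minus[of 1] by (simp_all del: One_nat_def)
  then have "block_const l = 1"
    unfolding block_const_def using block by (auto simp: less_pairs_def intro!: prod.neutral)
  moreover have "l 1 = n" using l_Zset unfolding Zset_1 by auto
  ultimately show ?thesis unfolding diag_limit_def using p_eq_2 by simp
qed

end

lemma selberg_eq_laguerre_selberg:
  assumes a_pos: "Re a > 0" and b_pos: "Re b > 0" and gamma_pos: "Re \<gamma> > 0"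
  shows "selberg n a b \<gamma> = laguerre_selberg n a \<gamma>
    * (\<Prod>i<n. Gamma (b + of_nat i * \<gamma>) / Gamma (a + b + (2 * of_nat n - 2 - of_nat i) * \<gamma>))"
proof -
  define z :: "nat \<Rightarrow> real" where "z s = (if s = 1 then 0 else 1)" for s
  define \<alpha> where "\<alpha> s = (if s = 1 then a else b - 1)" for s :: nat
  interpret selberg_data n 2 z \<alpha> \<gamma> by standard (use a_pos b_pos gamma_pos in \<open>auto simp: z_def \<alpha>_def\<close>)
  define l :: "nat \<Rightarrow> nat" where "l = (\<lambda>s. if s = 1 then n else 0)"
  have Zset_eq: "Zset n (2 - 1) = {l}" using Zset_1[of n] by (simp add: l_def)
  have z_unit: "z 1 = 0" "z 2 = 1" and alpha_eq: "\<alpha> 1 = a" "\<alpha> 2 = b - 1" by (simp_all add: z_def \<alpha>_def)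
  have l_Zset: "l \<in> Zset n 1" using Zset_eq by simp
  have "det_on {l} matrix_entry = matrix_entry l l" by (simp add: det_on_def)
  then have "selberg n a b \<gamma> = det_on (Zset n (2 - 1)) matrix_entry"
    unfolding Zset_eq using matrix_entry_unit_interval[OF refl z_unit l_Zset] alpha_eq by simp
  also have "\<dots> = laguerre_selberg n a \<gamma>
      * (\<Prod>i<n. (Gamma (gamma_arg_num i) / Gamma (gamma_arg_den i)) ^ card (Zset (n - 1 - i) (2 - 1)))"
    unfolding det_matrix_entry unfolding Zset_eq using diag_limit_unit_interval[OF refl z_unit l_Zset] alpha_eq
    by simp
  also have "gamma_arg_num = (\<lambda>i. b + of_nat i * \<gamma>)" by (simp add: gamma_arg_num_def alpha_eq fun_eq_iff)
  also have "gamma_arg_den = (\<lambda>i. a + b + (2 * of_nat n - 2 - of_nat i) * \<gamma>)"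
    unfolding gamma_arg_den_def using alpha_eq by (simp add: numeral_2_eq_2 fun_eq_iff)
  finally show ?thesis by (simp add: Zset_1[unfolded One_nat_def])
qed

lemma ordered_integral_cmult: "ordered_integral A S (\<lambda>y. c * w y) \<gamma> = c ^ card A * ordered_integral A S w \<gamma>"
proof -
  have "ordered_integrand A S (\<lambda>y. c * w y) \<gamma> t = c ^ card A * ordered_integrand A S w \<gamma> t" for t
    by (simp add: ordered_integrand_def prod.distrib mult_ac)
  then show ?thesis by (simp add: ordered_integral_def)
qed

lemma laguerre_weight_1: "laguerre_weight 1 y = (if y = 0 then 0 else of_real (exp (- y)))"
  by (simp add: laguerre_weight_def abs_powr_exponent_0)

lemma ordered_integral_laguerre_above:
  assumes u_nonneg: "u \<ge> 0"
  shows "ordered_integral {2..Suc k} ({0..} \<inter> {u..}) (\<lambda>y. laguerre_weight 1 y * abs_powr (y - u) (2 * \<gamma>)) \<gamma>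
    = of_real (exp (- u)) ^ k * laguerre_selberg k (1 + 2 * \<gamma>) \<gamma>"
proof -
  have bij: "bij_betw (\<lambda>j. j - 1) {2..Suc k} {1..k}" by (rule bij_betw_byWitness[where f'=Suc]) auto
  have "ordered_integral {2..Suc k} ({0..} \<inter> {u..}) (\<lambda>y. laguerre_weight 1 y * abs_powr (y - u) (2 * \<gamma>)) \<gamma>
      = ordered_integral {1..k} {y. u + 1 * y \<in> {0..} \<inter> {u..}}
        (\<lambda>y. laguerre_weight 1 (u + 1 * y) * abs_powr (u + 1 * y - u) (2 * \<gamma>)) \<gamma>"
    by (rule ordered_integral_affine[OF bij]) auto
  also have "{y. u + 1 * y \<in> {0..} \<inter> {u..}} = {0..}" using u_nonneg by auto
  also have "ordered_integral {1..k} {0..} (\<lambda>y. laguerre_weight 1 (u + 1 * y)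
      * abs_powr (u + 1 * y - u) (2 * \<gamma>)) \<gamma>
      = ordered_integral {1..k} {0..} (\<lambda>y. of_real (exp (- u)) * laguerre_weight (1 + 2 * \<gamma>) y) \<gamma>"
  proof (rule ordered_integral_cong)
    fix y :: real assume "y \<in> {0..}"
    then show "laguerre_weight 1 (u + 1 * y) * abs_powr (u + 1 * y - u) (2 * \<gamma>)
        = of_real (exp (- u)) * laguerre_weight (1 + 2 * \<gamma>) y"
      using u_nonneg by (cases "y = 0")
        (auto simp: laguerre_weight_1 laguerre_weight_def abs_powr_exponent_0 exp_diff exp_minus divide_inverse)
  qed
  finally show ?thesis unfolding ordered_integral_cmult laguerre_selberg_def by simp
qed

lemma laguerre_selberg_Suc_1:
  assumes gamma_pos: "Re \<gamma> > 0"
  shows "laguerre_selberg (Suc k) 1 \<gamma> = laguerre_selberg k (1 + 2 * \<gamma>) \<gamma> / of_nat (Suc k)"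
proof -
  let ?L = "laguerre_selberg k (1 + 2 * \<gamma>) \<gamma>"
  have "{1..Suc k} = insert 1 {2..Suc k}" by auto
  then have "laguerre_selberg (Suc k) 1 \<gamma> = ordered_integral (insert 1 {2..Suc k}) {0..} (laguerre_weight 1) \<gamma>"
    by (simp only: laguerre_selberg_def)
  also have "\<dots> = (LINT u:{0..}|lborel. laguerre_weight 1 u * (of_real (exp (- u)) ^ k * ?L))"
    using gamma_pos by (intro ordered_integral_insert_least ordered_integral_laguerre_above
      integrable_laguerre_integrand) auto
  also have "\<dots> = (LINT u:{0<..}|lborel. of_real (exp (- real (Suc k) * u)) * ?L)"
    unfolding set_lebesgue_integral_def
  proof (rule Bochner_Integration.integral_cong[OF refl])
    fix u :: real
    have "exp (- real (Suc k) * u) = exp (- u) * exp (- u) ^ k"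
      by (simp add: exp_of_nat_mult[symmetric] exp_add[symmetric] algebra_simps)
    then show "indicator {0..} u *\<^sub>R (laguerre_weight 1 u * (of_real (exp (- u)) ^ k * ?L))
        = indicator {0<..} u *\<^sub>R (of_real (exp (- real (Suc k) * u)) * ?L)"
      by (auto simp: laguerre_weight_1 indicator_def)
  qed
  also have "\<dots> = of_real (1 / real (Suc k)) * ?L"
    using set_integral_exp_half_line[of "real (Suc k)"]
    unfolding set_lebesgue_integral_def by (simp flip: mult_scaleR_left del: of_nat_Suc)
  finally show ?thesis by simp
qed

lemma laguerre_selberg_cross_ratio:
  assumes a_pos: "Re a > 0" and gamma_pos: "Re \<gamma> > 0"
  shows "laguerre_selberg n a \<gamma> * (\<Prod>s<n. Gamma (1 + of_nat s * \<gamma>)) = laguerre_selberg n 1 \<gamma>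
      * (\<Prod>s<n. Gamma (a + of_nat s * \<gamma>))"
proof -
  define Q where "Q = (\<Prod>i<n. Gamma (a + 1 + (2 * of_nat n - 2 - of_nat i) * \<gamma>))"
  have "Gamma (a + 1 + (2 * of_nat n - 2 - of_nat i) * \<gamma>) \<noteq> 0" if "i < n" for i
  proof -
    have "2 * of_nat n - 2 - of_nat i = (of_nat (2 * n - 2 - i) :: complex)" using that
      by (simp add: of_nat_diff)
    then have "Re (a + 1 + (2 * of_nat n - 2 - of_nat i) * \<gamma>) = Re a + 1 + real (2 * n - 2 - i) * Re \<gamma>" by simp
    also have "\<dots> > 0" using a_pos gamma_pos by (simp add: add_pos_nonneg)
    finally show ?thesis by (rule Gamma_nonzero_Re_pos)
  qed
  then have "Q \<noteq> 0" by (simp add: Q_def)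
  moreover have "laguerre_selberg n a \<gamma> * ((\<Prod>s<n. Gamma (1 + of_nat s * \<gamma>)) / Q) = selberg n a 1 \<gamma>"
    unfolding Q_def prod_dividef[symmetric] using a_pos gamma_pos
    by (intro selberg_eq_laguerre_selberg[symmetric]) auto
  moreover have "laguerre_selberg n 1 \<gamma> * ((\<Prod>s<n. Gamma (a + of_nat s * \<gamma>)) / Q) = selberg n 1 a \<gamma>"
    unfolding Q_def add.commute[of a 1] prod_dividef[symmetric] using a_pos gamma_pos
    by (intro selberg_eq_laguerre_selberg[symmetric]) auto
  ultimately have "laguerre_selberg n a \<gamma> * (\<Prod>s<n. Gamma (1 + of_nat s * \<gamma>)) / Q
      = laguerre_selberg n 1 \<gamma> * (\<Prod>s<n. Gamma (a + of_nat s * \<gamma>)) / Q"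
    using selberg_commute[of n a 1 \<gamma>] by simp
  then show ?thesis using \<open>Q \<noteq> 0\<close> by (simp only: divide_cancel_right) simp
qed

lemma prod_Gamma_telescope:
  assumes gamma_pos: "Re \<gamma> > 0"
  shows "Gamma \<gamma> * (\<Prod>s<n. Gamma (1 + 2 * \<gamma> + of_nat s * \<gamma>))
    = (\<Prod>s<Suc n. Gamma (1 + of_nat s * \<gamma>)) * (of_nat (Suc n) * Gamma (of_nat (Suc n) * \<gamma>))"
proof -
  have Gamma_plus: "Gamma (1 + of_nat (Suc k) * \<gamma>) = of_nat (Suc k) * \<gamma> * Gamma (of_nat (Suc k) * \<gamma>)" for k
  proof -
    have "Re (of_nat (Suc k) * \<gamma>) > 0" using gamma_pos by (simp del: of_nat_Suc)
    from Gamma_plus1[OF Re_pos_not_nonpos_Ints[OF this]] show ?thesis by (simp only: add.commute)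
  qed
  have "(\<Prod>s<Suc n. Gamma (1 + of_nat s * \<gamma>)) * Gamma (1 + of_nat (Suc n) * \<gamma>)
      = (\<Prod>s<Suc (Suc n). Gamma (1 + of_nat s * \<gamma>))"
    by simp
  also have "\<dots> = Gamma 1 * (Gamma (1 + of_nat (Suc 0) * \<gamma>) * (\<Prod>s<n. Gamma (1 + of_nat (Suc (Suc s)) * \<gamma>)))"
    by (simp only: prod.lessThan_Suc_shift) simp
  also have "(\<Prod>s<n. Gamma (1 + of_nat (Suc (Suc s)) * \<gamma>)) = (\<Prod>s<n. Gamma (1 + 2 * \<gamma> + of_nat s * \<gamma>))"
    by (intro prod.cong refl arg_cong[of _ _ Gamma]) (simp add: algebra_simps)
  finally have "\<gamma> * (Gamma \<gamma> * (\<Prod>s<n. Gamma (1 + 2 * \<gamma> + of_nat s * \<gamma>)))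
      = \<gamma> * ((\<Prod>s<Suc n. Gamma (1 + of_nat s * \<gamma>)) * (of_nat (Suc n) * Gamma (of_nat (Suc n) * \<gamma>)))"
    using Gamma_plus[of 0] Gamma_plus[of n] by (auto simp add: mult_ac simp del: prod.lessThan_Suc)
  moreover have "\<gamma> \<noteq> 0" using gamma_pos by auto
  ultimately show ?thesis by (simp only: mult_cancel_left) simp
qed

theorem laguerre_selberg_eq:
  assumes gamma_pos: "Re \<gamma> > 0" and a_pos: "Re a > 0"
  shows "laguerre_selberg n a \<gamma> = (\<Prod>s<n. Gamma (a + of_nat s * \<gamma>) * (Gamma (of_nat (s + 1) * \<gamma>) / Gamma \<gamma>))"
  using a_pos
proof (induction n arbitrary: a)
  case 0
  show ?case by (simp add: laguerre_selberg_def ordered_integral_empty)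
next
  case (Suc n)
  define P where "P = (\<Prod>s<Suc n. Gamma (1 + of_nat s * \<gamma>))"
  define R where "R = (\<Prod>s<n. Gamma (of_nat (s + 1) * \<gamma>) / Gamma \<gamma>)"
  define T where "T = (\<Prod>s<n. Gamma (1 + 2 * \<gamma> + of_nat s * \<gamma>))"
  have "Gamma (1 + of_nat s * \<gamma>) \<noteq> 0" for s using gamma_pos by (intro Gamma_nonzero_Re_pos)
    (simp add: add_pos_nonneg)
  then have P_nonzero: "P \<noteq> 0" unfolding P_def by simp
  have Gamma_\<gamma>: "Gamma \<gamma> \<noteq> 0" by (rule Gamma_nonzero_Re_pos[OF gamma_pos])
  have "laguerre_selberg (Suc n) 1 \<gamma> = T * R / of_nat (Suc n)"
    unfolding laguerre_selberg_Suc_1[OF gamma_pos] T_def R_def prod.distrib[symmetric] using gamma_pos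
    by (subst Suc.IH) auto
  also have "T = P * (of_nat (Suc n) * Gamma (of_nat (Suc n) * \<gamma>)) / Gamma \<gamma>"
    using prod_Gamma_telescope[OF gamma_pos, of n] Gamma_\<gamma> unfolding P_def T_def
    by (simp add: nonzero_eq_divide_eq mult.commute)
  also have "\<dots> * R / of_nat (Suc n) = P * (R * (Gamma (of_nat (Suc n) * \<gamma>) / Gamma \<gamma>))"
    by (simp del: of_nat_Suc)
  finally have "P * laguerre_selberg (Suc n) a \<gamma>
      = P * ((\<Prod>s<Suc n. Gamma (a + of_nat s * \<gamma>)) * (R * (Gamma (of_nat (Suc n) * \<gamma>) / Gamma \<gamma>)))"
    using laguerre_selberg_cross_ratio[OF Suc.prems gamma_pos, of "Suc n"] unfolding P_def[symmetric]
    by (simp only: mult_ac)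
  then have "laguerre_selberg (Suc n) a \<gamma> = (\<Prod>s<Suc n. Gamma (a + of_nat s * \<gamma>))
      * (R * (Gamma (of_nat (Suc n) * \<gamma>) / Gamma \<gamma>))"
    using P_nonzero by (simp only: mult_cancel_left) simp
  then show ?case unfolding R_def prod.distrib by simp
qed

section \<open>Phases and constants\<close>

lemma prod_off_diagonal:
  fixes F :: "'a :: linorder \<Rightarrow> 'a \<Rightarrow> 'b :: comm_monoid_mult"
  assumes finite_A: "finite A"
  shows "(\<Prod>s\<in>A. \<Prod>r\<in>A - {s}. F s r) = (\<Prod>(a, b)\<in>less_pairs A. F b a * F a b)"
proof -
  let ?L = "less_pairs A"
  have "(SIGMA s:A. A - {s}) = prod.swap ` ?L \<union> ?L" by (auto simp: less_pairs_def image_iff)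
  moreover have "prod.swap ` ?L \<inter> ?L = {}" by (auto simp: less_pairs_def)
  ultimately have "(\<Prod>x\<in>(SIGMA s:A. A - {s}). case_prod F x) = (\<Prod>x\<in>prod.swap ` ?L. case_prod F x)
      * (\<Prod>x\<in>?L. case_prod F x)"
    using finite_A by (simp add: prod.union_disjoint)
  also have "(\<Prod>x\<in>prod.swap ` ?L. case_prod F x) = (\<Prod>(a, b)\<in>?L. F b a)"
    by (subst prod.reindex) (auto simp: o_def case_prod_unfold intro!: inj_on_subset[OF inj_swap])
  finally show ?thesis using finite_A by (simp add: prod.Sigma case_prod_unfold flip: prod.distrib)
qed

context selberg_data
begin

definition phase :: "nat \<Rightarrow> complex" where
  "phase r = (\<Prod>s=1..p. if r < s then exp (\<i> * pi * \<alpha> s) else 1)"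

lemma chamber_less_iff:
  assumes "l \<in> Zset n (p - 1)" "t \<in> chamber l" "i \<in> {1..n}" "s \<in> {1..p}" "t i \<noteq> z s"
  shows "t i < z s \<longleftrightarrow> block l i < s"
proof -
  have block: "block l i \<in> {1..p-1}" by (rule block_range[OF assms(1,3)])
  have "z s \<le> z (block l i)" if "s \<le> block l i" using that assms(4) block by (intro z_le) auto
  moreover have "z (block l i + 1) \<le> z s" if "block l i < s" using that assms(4) by (intro z_le) auto
  ultimately show ?thesis using chamberD(1,2)[OF assms(2,3)] assms(5) by (cases "block l i < s") auto
qed

lemma Phi_eq_phase_abs_Phi:
  assumes l_Zset: "l \<in> Zset n (p - 1)" and t_chamber: "t \<in> chamber l"
  shows "Phi n p z \<alpha> \<gamma> t = (\<Prod>i=1..n. phase (block l i)) * \<Psi> t"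
proof -
  have "br_pow (of_real (t i - z s)) (\<alpha> s) = (if block l i < s then exp (\<i> * pi * \<alpha> s) else 1)
      * abs_powr (t i - z s) (\<alpha> s)"
    if "i \<in> {1..n}" "s \<in> {1..p}" for i s
    using chamber_less_iff[OF l_Zset t_chamber that] unfolding br_pow_of_real by (cases "t i = z s") simp_all
  then have "(\<Prod>i=1..n. \<Prod>s=1..p. br_pow (of_real (t i - z s)) (\<alpha> s))
      = (\<Prod>i=1..n. \<Prod>s=1..p. (if block l i < s then exp (\<i> * pi * \<alpha> s) else 1) * abs_powr (t i - z s) (\<alpha> s))"
    by (intro prod.cong refl)
  then have points: "(\<Prod>s=1..p. \<Prod>i=1..n. br_pow (of_real (t i - z s)) (\<alpha> s))
      = (\<Prod>i=1..n. phase (block l i)) * (\<Prod>i=1..n. point_weight p z \<alpha> (t i))"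
    unfolding prod.swap[of _ "{1..p}"] phase_def point_weight_def prod.distrib .
  have "br_pow (of_real (t j - t i)) (2 * \<gamma>) = abs_powr (t j - t i) (2 * \<gamma>)" if "i \<in> {1..n}" "j \<in> {i<..n}"
    for i j
    using chamberD(3)[OF t_chamber that(1), of j] that unfolding br_pow_of_real by auto
  then have "(\<Prod>i=1..n. \<Prod>j\<in>{i<..n}. br_pow (of_real (t j - t i)) (2 * \<gamma>)) = vandermonde {1..n} \<gamma> t"
    unfolding vandermonde_def prod_less_pairs_nat(1) by (intro prod.cong refl)
  with points show ?thesis unfolding Phi_def abs_Phi_def by (simp only: mult.assoc)
qed

lemma integral_Phi_omega:
  assumes l_Zset: "l \<in> Zset n (p - 1)"
  shows "(LINT t:Uset n p z l|Rn n. Phi n p z \<alpha> \<gamma> t * omega n p z m t) = (\<Prod>i=1..n. phase (block l i))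
      * matrix_entry l m"
proof -
  have "indicator (chamber l) t *\<^sub>R (Phi n p z \<alpha> \<gamma> t * omega n p z m t)
      = (\<Prod>i=1..n. phase (block l i)) * (indicator (chamber l) t *\<^sub>R (\<Psi> t * omega n p z m t))" for t
    using Phi_eq_phase_abs_Phi[OF l_Zset] by (cases "t \<in> chamber l") simp_all
  then show ?thesis
    unfolding Uset_eq_chamber[OF l_Zset] matrix_entry_def chamber_integral_def set_lebesgue_integral_def
    by (simp only: integral_mult_right_zero)
qed

lemma prod_phase: "(\<Prod>r=1..p-1. phase r) ^ N = exp (\<i> * pi * of_nat N * (\<Sum>s=1..p. of_nat (s - 1) * \<alpha> s))"
proof -
  have "(\<Prod>r=1..p-1. if r < s then exp (\<i> * pi * \<alpha> s) else 1) = exp (of_nat (s - 1) * (\<i> * pi * \<alpha> s))"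
    if "s \<in> {1..p}" for s
  proof -
    have "{r \<in> {1..p-1}. r < s} = {1..<s}" using that by auto
    then have "(\<Prod>r=1..p-1. if r < s then exp (\<i> * pi * \<alpha> s) else 1) = exp (\<i> * pi * \<alpha> s) ^ (s - 1)"
      by (simp flip: prod.inter_filter)
    then show ?thesis by (simp only: exp_of_nat_mult)
  qed
  then have "(\<Prod>r=1..p-1. phase r) = (\<Prod>s=1..p. exp (of_nat (s - 1) * (\<i> * pi * \<alpha> s)))"
    unfolding phase_def by (subst prod.swap) (intro prod.cong refl)
  then show ?thesis
    by (simp add: sum_distrib_left mult_ac flip: exp_sum exp_of_nat_mult)
qed

lemma prod_point_const:
  "(\<Prod>s=1..p-1. point_const s) = (\<Prod>(a, b)\<in>less_pairs {1..p}. abs_powr (z b - z a) (\<alpha> a + \<alpha> b))"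
proof -
  have remove_last: "{1..p} - {p} = {1..p-1}"
    using two_le_p by auto
  have "(\<Prod>s=1..p. f s) = (\<Prod>s=1..p-1. f s) * f p" for f :: "nat \<Rightarrow> complex"
    using range_eq_insert_last by (simp add: mult.commute)
  then have "(\<Prod>s=1..p-1. point_const s) = (\<Prod>s=1..p. \<Prod>r\<in>{1..p}-{s}. abs_powr (z s - z r) (\<alpha> r))"
    unfolding point_const_def dist_last_def prod.distrib by (simp only: remove_last mult.commute)
  also have "\<dots> = (\<Prod>(a, b)\<in>less_pairs {1..p}. abs_powr (z b - z a) (\<alpha> a) * abs_powr (z a - z b) (\<alpha> b))"
    by (rule prod_off_diagonal) simp
  also have "\<dots> = (\<Prod>(a, b)\<in>less_pairs {1..p}. abs_powr (z b - z a) (\<alpha> a + \<alpha> b))"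
    by (intro prod.cong refl) (auto simp: abs_powr_add abs_powr_diff_commute)
  finally show ?thesis .
qed

lemma prod_pair_const:
  "(\<Prod>s=1..p-1. pair_const s s) * (\<Prod>(r, s)\<in>less_pairs {1..p-1}. pair_const r s) = vandermonde {1..p} \<gamma> z"
proof -
  have "vandermonde {1..p} \<gamma> z = (\<Prod>s=1..p-1. abs_powr (z p - z s) (2 * \<gamma>)) * vandermonde {1..p-1} \<gamma> z"
    using range_eq_insert_last by (simp only: vandermonde_insert finite_atLeastAtMost not_False_eq_True)
  also have "vandermonde {1..p-1} \<gamma> z = (\<Prod>(r, s)\<in>less_pairs {1..p-1}. pair_const r s)"
    unfolding vandermonde_def by (intro prod.cong refl) (auto simp: pair_const_def less_pairs_def)
  finally show ?thesis by (simp add: pair_const_def dist_last_def)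
qed

lemma prod_block_const:
  "(\<Prod>l\<in>Zset n (p - 1). block_const l) = (\<Prod>b=1..p. \<Prod>a=1..<b. br_pow (of_real (z b - z a))
     ((\<alpha> a + \<alpha> b) * of_nat point_count + 2 * \<gamma> * of_nat pair_count))"
proof -
  have "abs_powr (z b - z a) (\<alpha> a + \<alpha> b) ^ point_count * abs_powr (z b - z a) (2 * \<gamma>) ^ pair_count
      = br_pow (of_real (z b - z a)) ((\<alpha> a + \<alpha> b) * of_nat point_count + 2 * \<gamma> * of_nat pair_count)"
    if "(a, b) \<in> less_pairs {1..p}" for a b
  proof -
    have less: "z a < z b" using that by (intro z_less) (auto simp: less_pairs_def)
    then have "z b - z a \<noteq> 0" by simp
    then show ?thesis
      unfolding br_pow_of_real abs_powr_power[OF \<open>z b - z a \<noteq> 0\<close>] abs_powr_add[symmetric] using less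
      by (simp add: mult.commute)
  qed
  then have "(\<Prod>(a, b)\<in>less_pairs {1..p}. abs_powr (z b - z a) (\<alpha> a + \<alpha> b)) ^ point_count
      * vandermonde {1..p} \<gamma> z ^ pair_count
      = (\<Prod>(a, b)\<in>less_pairs {1..p}. br_pow (of_real (z b - z a)) ((\<alpha> a + \<alpha> b) * of_nat point_count + 2 * \<gamma>
      * of_nat pair_count))"
    unfolding vandermonde_def prod_power_distrib prod.distrib[symmetric] by (intro prod.cong refl) auto
  then show ?thesis
    unfolding block_const_def prod.distrib prod_Zset_block prod_Zset_block_pairs prod_point_const
      prod_pair_const
    by (simp only: prod_less_pairs_nat(2))
qed

lemma prod_laguerre_selberg:
  "(\<Prod>l\<in>Zset n (p - 1). \<Prod>s=1..p-1. laguerre_selberg (l s) (\<alpha> s) \<gamma>)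
    = (\<Prod>i<n. ((Gamma (of_nat (i + 1) * \<gamma>) ^ (p - 1) / Gamma \<gamma> ^ (p - 1))
    * (\<Prod>j=1..p-1. Gamma (\<alpha> j + of_nat i * \<gamma>)))
        ^ card (Zset (n - 1 - i) (p - 1)))"
proof -
  define R where "R s i = Gamma (\<alpha> s + of_nat i * \<gamma>) * (Gamma (of_nat (i + 1) * \<gamma>) / Gamma \<gamma>)" for s i
  have prod_R: "(\<Prod>s=1..p-1. R s i) = (Gamma (of_nat (i + 1) * \<gamma>) ^ (p - 1) / Gamma \<gamma> ^ (p - 1))
      * (\<Prod>j=1..p-1. Gamma (\<alpha> j + of_nat i * \<gamma>))" for i
    unfolding R_def prod.distrib prod_constant power_divide[symmetric] by (simp add: mult.commute)
  have "laguerre_selberg (l s) (\<alpha> s) \<gamma> = (\<Prod>i<l s. R s i)" if "s \<in> {1..p-1}" for l :: "nat \<Rightarrow> nat" and s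
    unfolding R_def using that two_le_p by (intro laguerre_selberg_eq Re_gamma_pos Re_alpha_pos) auto
  then have "(\<Prod>l\<in>Zset n (p - 1). \<Prod>s=1..p-1. laguerre_selberg (l s) (\<alpha> s) \<gamma>)
      = (\<Prod>s=1..p-1. \<Prod>l\<in>Zset n (p - 1). \<Prod>i<l s. R s i)"
    by (subst prod.swap) (intro prod.cong refl)
  also have "\<dots> = (\<Prod>s=1..p-1. \<Prod>i<n. R s i ^ card (Zset (n - 1 - i) (p - 1)))"
    using prod.Zset_raise[where g="\<lambda>i _. R s i" for s] by (intro prod.cong refl) simp
  also have "\<dots> = (\<Prod>i<n. (\<Prod>s=1..p-1. R s i) ^ card (Zset (n - 1 - i) (p - 1)))"
    unfolding prod_power_distrib by (rule prod.swap)
  finally show ?thesis by (simp only: prod_R)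
qed

theorem det_integral_Phi_omega:
  "det_on (Zset n (p - 1)) (\<lambda>l m. LINT t:Uset n p z l|Rn n. Phi n p z \<alpha> \<gamma> t * omega n p z m t)
    = (\<Prod>i<n. ((Gamma (of_nat (i + 1) * \<gamma>) ^ (p - 1) / Gamma \<gamma> ^ (p - 1))
          * (Gamma (gamma_arg_num i) * (\<Prod>j=1..p-1. Gamma (\<alpha> j + of_nat i * \<gamma>)) / Gamma (gamma_arg_den i)))
        ^ card (Zset (n - 1 - i) (p - 1)))
      * exp (\<i> * pi * of_nat point_count * (\<Sum>s=1..p. of_nat (s - 1) * \<alpha> s))
      * (\<Prod>b=1..p. \<Prod>a=1..<b. br_pow (of_real (z b - z a)) ((\<alpha> a + \<alpha> b) * of_nat point_count + 2 * \<gamma>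
      * of_nat pair_count))"
    (is "?L = ?G * ?E * ?B")
proof -
  let ?Z = "Zset n (p - 1)"
  have "?L = det_on ?Z (\<lambda>l m. (\<Prod>i=1..n. phase (block l i)) * matrix_entry l m * 1)"
    by (rule det_on_cong) (simp only: integral_Phi_omega mult_1_right)
  also have "\<dots> = ?E * det_on ?Z matrix_entry" unfolding det_on_scale prod_Zset_block prod_phase by simp
  also have "det_on ?Z matrix_entry = ?B * ((\<Prod>l\<in>?Z. \<Prod>s=1..p-1. laguerre_selberg (l s) (\<alpha> s) \<gamma>)
      * (\<Prod>i<n. (Gamma (gamma_arg_num i) / Gamma (gamma_arg_den i)) ^ card (Zset (n - 1 - i) (p - 1))))"
    unfolding det_matrix_entry diag_limit_def prod.distrib prod_block_const by (rule mult.assoc)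
  also have "\<dots> = ?B * ?G"
    unfolding prod_laguerre_selberg prod.distrib[symmetric] power_mult_distrib[symmetric] times_divide_eq_right
    by (simp only: mult_ac)
  finally show ?thesis by (simp only: mult_ac)
qed

end

theorem theorem4:
  fixes n p :: nat and z :: "nat \<Rightarrow> real" and \<alpha> :: "nat \<Rightarrow> complex" and \<gamma> :: complex
  assumes "p \<ge> 2"
    and "\<And>s. s \<in> {1..<p} \<Longrightarrow> z s < z (s + 1)"
    and "\<And>s. s \<in> {1..p} \<Longrightarrow> Re (\<alpha> s) > 0"
    and "Re \<gamma> > 0"
  shows "det_on (Zset n (p - 1))
           (\<lambda>l m. set_lebesgue_integral (Rn n) (Uset n p z l)
                    (\<lambda>t. Phi n p z \<alpha> \<gamma> t * omega n p z m t))
    = (\<Prod>s=0..<n.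
         ((Gamma (of_nat (s + 1) * \<gamma>) ^ (p - 1) / Gamma \<gamma> ^ (p - 1)) *
          (Gamma (1 + \<alpha> p + of_nat s * \<gamma>) * (\<Prod>j=1..p-1. Gamma (\<alpha> j + of_nat s * \<gamma>)) /
           Gamma (1 + (\<Sum>j=1..p. \<alpha> j) + (2 * of_nat n - 2 - of_nat s) * \<gamma>)))
         ^ ((p + n - s - 3) choose (p - 2)))
      * exp (\<i> * pi * of_nat ((p + n - 2) choose (p - 1)) * (\<Sum>s=1..p. of_nat (s - 1) * \<alpha> s))
      * (\<Prod>b=1..p. \<Prod>a=1..<b.
           br_pow (complex_of_real (z b - z a))
             ((\<alpha> a + \<alpha> b) * of_nat ((p + n - 2) choose (p - 1))
              + 2 * \<gamma> * of_nat ((p + n - 2) choose p)))"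
proof -
  interpret selberg_data n p z \<alpha> \<gamma>
    using assms by unfold_locales (auto intro: less_trans[of "- 1" 0])
  have counts: "n + (p - 1) - 1 = p + n - 2" "Suc (p - 1) = p" using two_le_p by auto
  have "card (Zset (n - 1 - s) (p - 1)) = (p + n - s - 3) choose (p - 2)" if "s \<in> {0..<n}" for s
    using two_le_p that by (subst card_Zset) (auto intro!: arg_cong2[of _ _ _ _ "(choose)"])
  then show ?thesis
    unfolding det_integral_Phi_omega counts gamma_arg_num_def gamma_arg_den_def lessThan_atLeast0
    by (intro arg_cong2[of _ _ _ _ "(*)"] prod.cong refl) (simp only:)
qed

end
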